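(* Let $\mathcal J$ be an $l\times l$ block Jacobi matrix asymptotic to type $1$ whose Jacobi parameters satisfy one of $(A1)$ $\sum_{n=1}^\infty[\|B_n\|+\|\mathbf 1-A_nA_n^*\|]<\infty$; $(A2)$ $\sum_{n=1}^\infty n[\|B_n\|+\|\mathbf 1-A_nA_n^*\|]<\infty$; $(A3)$ $\|B_n\|+\|\mathbf 1-A_nA_n^*\|\le CR^{-2n}$ for all $n$, for some $C$ and some $R>1$. Let the appropriate region be $\overline{\mathbb D}\setminus\{\pm1\}$ under $(A1)$, $\overline{\mathbb D}$ under $(A2)$, $\mathbb D_R=\{|z|<R\}$ under $(A3)$. Then: (i) In the appropriate region, $u_{n+1}(z;\mathcal J)A_n^*+u_n(z;\mathcal J)\bigl(B_n-(z+z^{-1})\mathbf 1\bigr)+u_{n-1}(z;\mathcal J)A_{n-1}=\mathbf 0$ for $n=1,2,\dots$ (ii) In the appropriate region, $\lim_{n\to\infty}z^{-n}u_n(z;\mathcal J)=\mathbf 1$. (iii) For $z\in\mathbb D$, $u(z;\mathcal J^{(1)})=z^{-1}u(z;\mathcal J)M(z;\mathcal J)A_1$. (iv) The only zeros of $u(z;\mathcal J)$ in $\mathbb D$ are at the real points $z_j$ with $E_j=z_j+z_j^{-1}$ a discrete eigenvalue of $\mathcal J$. Each zero of $u(z;\mathcal J)$ in $\mathbb D$ is simple, and the order of $z_j$ as a zero of $\det u(z;\mathcal J)$ equals the multiplicity of $E_j$ as an eigenvalue of $\mathcal J$. Moreover $\ker u(z_j;\mathcal J)=\operatorname{Ran}w_j=\operatorname{Ran}\widetilde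 w_j$. (v) The only zeros of $u(z;\mathcal J)$ in $\partial\mathbb D$ are possible ones at $\pm1$, in which case they are simple. (vi) $M(z;\mathcal J)$ has a continuation from $\mathbb D$ to $\overline{\mathbb D}\setminus\{\pm1\}$, which is everywhere finite and invertible on $\partial\mathbb D\setminus\{\pm1\}$, and $$\operatorname{Im}M(e^{i\theta})=\sin\theta\,\bigl[u(e^{i\theta};\mathcal J)^*u(e^{i\theta};\mathcal J)\bigr]^{-1}.$$ (vii) $u(z;\mathcal J^{(2)})=z^{-1}u(z;\mathcal J^{(1)})A_1^{-1}\bigl((z+z^{-1})\mathbf 1-B_1\bigr)(A_1^* )^{-1}A_2-z^{-2}u(z;\mathcal J)(A_1^* )^{-1}A_2$. Now assume $(A3)$ holds. Then: (viii) $M$ can be extended meromorphically to $\mathbb D_R$, and $$M(z)=M^\sharp(z)+(z-z^{-1})\bigl[u^\sharp(z;\mathcal J)u(z;\mathcal J)\bigr]^{-1},\qquad R^{-1}<|z|<R.$$ (ix) For each $z_j$ with $R^{-1}<|z_j|<1$, $$\widetilde w_j\,u(1/\bar z_j;\mathcal J)^*=-(z_j-z_j^{-1})\operatorname*{Res}_{z=z_j}u(z;\mathcal J)^{-1},$$ in particular $\ker u(1/\bar z_j;\mathcal J)^*\subseteq\ker\operatorname*{Res}_{z=z_j}u(z;\mathcal J)^{-1}=\operatorname{Ran}u(z_j;\mathcal J)$.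
   Context: Notation: $\mathbb{D}$ is the open unit disk; $\mathbf 1,\mathbf 0$ are the $l\times l$ identity and zero matrices; ${}^*$ is Hermitian conjugation; $\operatorname{Im}T=\frac1{2i}(T-T^* )$; $f^\sharp(z)=f(\bar z^{-1})^*$. The order of a pole of a matrix-valued function $f$ at $z_0$ is the minimal $k>0$ such that $\lim_{z\to z_0}(z-z_0)^kf(z)$ is a finite nonzero matrix. A zero of a matrix-valued function $f$ is a pole of $f^{-1}$; it is simple if that pole is of order $1$. A block Jacobi matrix $\mathcal J$ with parameters $\{A_n,B_n\}_{n\ge1}$ ($A_n$ invertible, $B_n$ Hermitian $l\times l$, bounded; $A_0:=\mathbf 1$) is the semi-infinite block tridiagonal matrix with diagonal blocks $B_n$, superdiagonal blocks $A_n$, subdiagonal blocks $A_n^*$. $\mathcal J^{(k)}$ is the block Jacobi matrix with parameters $\{A_{n+k},B_{n+k}\}_{n\ge1}$. Its spectral measure $\mu$ is the $l\times l$ positive semidefinite matrix-valued measure with $\mathfrak m(E)=\int\frac{d\mu(x)}{x-E}$ equal to the upper-left $l\times l$ block of $(\mathcal J-E)^{-1}$. Put $M(z)=M(z;\mathcal J)=-\mathfrak m(z+z^{-1})$. Two block Jacobi matrices are equivalent if they have the same spectral measure, i.e. $\widetilde A_n=\sigma_n^*A_n\sigma_{n+1}$, $\widetilde B_n=\sigma_n^*B_n\sigma_n$ with unitary $\sigma_n$, $\sigma_1=\mathbf 1$; they are asymptotic if moreover $\lim\sigma_n$ exists. Type $1$ means all $A_n>0$; each equivalence class contains exactly one type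 $1$ matrix, and "asymptotic to type $1$" means asymptotic to that matrix. Jost function: define polynomials $g_n,c_n$ by $g_0=c_0=\mathbf 1$ and $$A_{n+1}c_{n+1}(z)=(z^2\mathbf 1-zB_{n+1})c_n(z)+g_n(z),$$ $$A_{n+1}g_{n+1}(z)=\bigl(z^2(\mathbf 1-A_{n+1}A_{n+1}^* )-zB_{n+1}\bigr)c_n(z)+g_n(z).$$ Under the hypotheses the limit $u(z;\mathcal J):=\lim_{n\to\infty}g_n(z)$ exists uniformly on compacts of the appropriate region (also for every $\mathcal J^{(k)}$), and is continuous there and analytic in the interior; set $u_n(z;\mathcal J):=z^nu(z;\mathcal J^{(n)})A_n^{-1}$, so $u_0=u$ (at $z=0$, $z^{-n}u_n$ means $u(0;\mathcal J^{(n)})A_n^{-1}$). For each discrete eigenvalue $E_j$ of $\mathcal J$ outside $[-2,2]$, $z_j\in\mathbb D\cap\mathbb R$ is the point with $z_j+z_j^{-1}=E_j$, $\widetilde w_j=-\lim_{z\to z_j}(z-z_j)M(z)$ and $w_j=\mu(\{E_j\})=(z_j^{-1}-z_j)z_j^{-1}\widetilde w_j$. Identities involving $M$ or negative powers of $z$ are understood as identities of meromorphic functions at poles and at $z=0$. *)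

theory Defs
  imports "HOL-Complex_Analysis.Complex_Analysis" "HOL-Library.Function_Algebras"
begin

definition smult_mat :: "complex \<Rightarrow> complex^'n^'m \<Rightarrow> complex^'n^'m"  (infixr \<open>*\<^sub>m\<close> 75)
  where "c *\<^sub>m X = (\<chi> i j. c * X $ i $ j)"

definition adj :: "complex^'n^'m \<Rightarrow> complex^'m^'n"
  where "adj X = (\<chi> i j. cnj (X $ j $ i))"

definition cinner :: "complex^'n \<Rightarrow> complex^'n \<Rightarrow> complex"
  where "cinner v w = (\<Sum>i\<in>UNIV. cnj (v $ i) * w $ i)"

definition hermitian :: "complex^'n^'n \<Rightarrow> bool"
  where "hermitian X \<longleftrightarrow> adj X = X"

definition unitary :: "complex^'n^'n \<Rightarrow> bool"
  where "unitary X \<longleftrightarrow> adj X ** X = mat 1 \<and> X ** adj X = mat 1"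

definition psd :: "complex^'n^'n \<Rightarrow> bool"
  where "psd X \<longleftrightarrow> hermitian X \<and> (\<forall>v. 0 \<le> Re (cinner v (X *v v)))"

definition posdef :: "complex^'n^'n \<Rightarrow> bool"
  where "posdef X \<longleftrightarrow> hermitian X \<and> (\<forall>v. v \<noteq> 0 \<longrightarrow> 0 < Re (cinner v (X *v v)))"

definition Im_mat :: "complex^'n^'n \<Rightarrow> complex^'n^'n"
  where "Im_mat X = (1 / (2 * \<i>)) *\<^sub>m (X - adj X)"

definition ker_mat :: "complex^'n^'m \<Rightarrow> (complex^'n) set"
  where "ker_mat X = {v. X *v v = 0}"

definition ran_mat :: "complex^'n^'m \<Rightarrow> (complex^'m) set"
  where "ran_mat X = range (\<lambda>v. X *v v)"

definition sharp :: "(complex \<Rightarrow> complex^'n^'n) \<Rightarrow> complex \<Rightarrow> complex^'n^'n"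
  where "sharp f z = adj (f (inverse (cnj z)))"

definition residue_mat :: "(complex \<Rightarrow> complex^'n^'n) \<Rightarrow> complex \<Rightarrow> complex^'n^'n"
  where "residue_mat f z = (\<chi> i j. residue (\<lambda>w. f w $ i $ j) z)"

text \<open>The set \<open>S\<close> is the domain of \<open>f\<close>; limits are taken inside it, because the Jost function may
  be defined only on the closed disk and has to be examined at boundary points as well.\<close>

definition pole_limit ::
    "complex set \<Rightarrow> (complex \<Rightarrow> complex^'n^'n) \<Rightarrow> complex \<Rightarrow> nat \<Rightarrow> bool"
  where "pole_limit S f z0 k \<longleftrightarrow>
    k > 0 \<and> (\<exists>L. L \<noteq> 0 \<and> ((\<lambda>z. (z - z0) ^ k *\<^sub>m f z) \<longlongrightarrow> L) (at z0 within S))"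

definition pole_of_order ::
    "complex set \<Rightarrow> (complex \<Rightarrow> complex^'n^'n) \<Rightarrow> complex \<Rightarrow> nat \<Rightarrow> bool"
  where "pole_of_order S f z0 k \<longleftrightarrow>
    pole_limit S f z0 k \<and> (\<forall>j<k. \<not> pole_limit S f z0 j)"

definition zero_mat :: "complex set \<Rightarrow> (complex \<Rightarrow> complex^'n^'n) \<Rightarrow> complex \<Rightarrow> bool"
  where "zero_mat S f z0 \<longleftrightarrow> (\<exists>k. pole_of_order S (\<lambda>z. matrix_inv (f z)) z0 k)"

definition simple_zero_mat :: "complex set \<Rightarrow> (complex \<Rightarrow> complex^'n^'n) \<Rightarrow> complex \<Rightarrow> bool"
  where "simple_zero_mat S f z0 \<longleftrightarrow> pole_of_order S (\<lambda>z. matrix_inv (f z)) z0 1"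

text \<open>The parameters are indexed from 1.  The value \<open>Apar J 0\<close> stores the convention
  that the zeroth off-diagonal block is the identity, and \<open>Bpar J 0\<close> is never used.\<close>

record 'l block_jacobi =
  Apar :: "nat \<Rightarrow> complex^'l^'l"
  Bpar :: "nat \<Rightarrow> complex^'l^'l"

definition is_block_jacobi :: "'l::finite block_jacobi \<Rightarrow> bool"
  where "is_block_jacobi J \<longleftrightarrow>
    Apar J 0 = mat 1 \<and>
    (\<forall>n\<ge>1. invertible (Apar J n) \<and> hermitian (Bpar J n)) \<and>
    bounded (Apar J ` {1..}) \<and> bounded (Bpar J ` {1..})"

definition jshift :: "nat \<Rightarrow> 'l::finite block_jacobi \<Rightarrow> 'l block_jacobi"
  where "jshift k J =
    \<lparr>Apar = (\<lambda>n. if n = 0 then mat 1 else Apar J (n + k)), Bpar = (\<lambda>n. Bpar J (n + k))\<rparr>"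

definition type1 :: "'l::finite block_jacobi \<Rightarrow> bool"
  where "type1 J \<longleftrightarrow> (\<forall>n\<ge>1. posdef (Apar J n))"

text \<open>The existence of \<open>\<sigma>\<close> without its convergence says that the two matrices have the same
  spectral measure.\<close>

definition asymptotic :: "'l::finite block_jacobi \<Rightarrow> 'l block_jacobi \<Rightarrow> bool"
  where "asymptotic J J' \<longleftrightarrow>
    (\<exists>\<sigma> :: nat \<Rightarrow> complex^'l^'l. \<sigma> 1 = mat 1 \<and> (\<forall>n\<ge>1. unitary (\<sigma> n)) \<and>
      (\<forall>n\<ge>1. Apar J' n = adj (\<sigma> n) ** Apar J n ** \<sigma> (n + 1) \<and>
              Bpar J' n = adj (\<sigma> n) ** Bpar J n ** \<sigma> n) \<and>
      convergent \<sigma>)"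

definition asymptotic_to_type1 :: "'l::finite block_jacobi \<Rightarrow> bool"
  where "asymptotic_to_type1 J \<longleftrightarrow> (\<exists>J'. is_block_jacobi J' \<and> type1 J' \<and> asymptotic J J')"

text \<open>Sequences of vectors are indexed from 0, so entry \<open>n\<close> belongs to block row \<open>n + 1\<close>.\<close>

definition ell2 :: "(nat \<Rightarrow> complex^'l) set"
  where "ell2 = {\<phi>. summable (\<lambda>n. (norm (\<phi> n))\<^sup>2)}"

definition ell2_norm :: "(nat \<Rightarrow> complex^'l) \<Rightarrow> real"
  where "ell2_norm \<phi> = sqrt (\<Sum>n. (norm (\<phi> n))\<^sup>2)"

definition jacobi_op :: "'l::finite block_jacobi \<Rightarrow> (nat \<Rightarrow> complex^'l) \<Rightarrow> nat \<Rightarrow> complex^'l"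
  where "jacobi_op J \<phi> n =
    (if n = 0 then 0 else adj (Apar J n) *v \<phi> (n - 1))
    + Bpar J (n + 1) *v \<phi> n + Apar J (n + 1) *v \<phi> (n + 1)"

definition jacobi_op_minus ::
    "'l::finite block_jacobi \<Rightarrow> complex \<Rightarrow> (nat \<Rightarrow> complex^'l) \<Rightarrow> nat \<Rightarrow> complex^'l"
  where "jacobi_op_minus J E \<phi> n = jacobi_op J \<phi> n - E *s \<phi> n"

definition spectrum :: "'l::finite block_jacobi \<Rightarrow> complex set"
  where "spectrum J = {E. \<not> (bij_betw (jacobi_op_minus J E) ell2 ell2 \<and>
    (\<exists>C. \<forall>\<phi>\<in>ell2. ell2_norm \<phi> \<le> C * ell2_norm (jacobi_op_minus J E \<phi>)))}"

definition resolvent ::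
    "'l::finite block_jacobi \<Rightarrow> complex \<Rightarrow> (nat \<Rightarrow> complex^'l) \<Rightarrow> nat \<Rightarrow> complex^'l"
  where "resolvent J E = the_inv_into ell2 (jacobi_op_minus J E)"

definition first_block_vec :: "complex^'l \<Rightarrow> nat \<Rightarrow> complex^'l"
  where "first_block_vec v n = (if n = 0 then v else 0)"

text \<open>Column \<open>j\<close> of the upper-left block of the resolvent is the first entry of its value on the
  \<open>j\<close>-th unit vector placed in the first block.\<close>

definition m_fun :: "'l::finite block_jacobi \<Rightarrow> complex \<Rightarrow> complex^'l^'l"
  where "m_fun J E = (\<chi> i j. resolvent J E (first_block_vec (axis j 1)) 0 $ i)"

global_interpretation cseq: vector_space
    "\<lambda>(c::complex) (\<phi> :: nat \<Rightarrow> complex^'l::finite) n. c *s \<phi> n"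
  by unfold_locales
    (auto simp: fun_eq_iff vector_add_ldistrib vector_sadd_rdistrib vector_smult_assoc)

definition eigenspace :: "'l::finite block_jacobi \<Rightarrow> complex \<Rightarrow> (nat \<Rightarrow> complex^'l) set"
  where "eigenspace J E = {\<phi> \<in> ell2. \<forall>n. jacobi_op J \<phi> n = E *s \<phi> n}"

definition eigen_multiplicity :: "'l::finite block_jacobi \<Rightarrow> complex \<Rightarrow> nat"
  where "eigen_multiplicity J E = cseq.dim (eigenspace J E)"

definition discrete_eigenvalue :: "'l::finite block_jacobi \<Rightarrow> complex \<Rightarrow> bool"
  where "discrete_eigenvalue J E \<longleftrightarrow>
    (\<exists>\<phi>\<in>eigenspace J E. \<exists>n. \<phi> n \<noteq> 0) \<and>
    (\<exists>b. finite b \<and> eigenspace J E \<subseteq> cseq.span b) \<and>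
    E isolated_in spectrum J"

definition matrix_measure :: "(real set \<Rightarrow> complex^'l^'l) \<Rightarrow> bool"
  where "matrix_measure \<mu> \<longleftrightarrow>
    (\<forall>X\<in>sets borel. psd (\<mu> X)) \<and>
    (\<forall>X :: nat \<Rightarrow> real set. range X \<subseteq> sets borel \<longrightarrow> disjoint_family X \<longrightarrow>
       (\<lambda>n. \<mu> (X n)) sums \<mu> (\<Union>n. X n))"

definition form_measure :: "(real set \<Rightarrow> complex^'l^'l) \<Rightarrow> complex^'l \<Rightarrow> real measure"
  where "form_measure \<mu> v =
    measure_of UNIV (sets borel) (\<lambda>X. ennreal (Re (cinner v (\<mu> X *v v))))"

text \<open>By polarization a complex matrix is determined by its quadratic form, so the integral of a
  scalar function against a matrix-valued measure is determined by the integrals against the finite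
  scalar measures \<open>form_measure \<mu> v\<close>.\<close>

definition has_matrix_integral ::
    "(real set \<Rightarrow> complex^'l^'l) \<Rightarrow> (real \<Rightarrow> complex) \<Rightarrow> complex^'l^'l \<Rightarrow> bool"
  where "has_matrix_integral \<mu> f N \<longleftrightarrow>
    (\<forall>v. integrable (form_measure \<mu> v) f \<and>
         cinner v (N *v v) = integral\<^sup>L (form_measure \<mu> v) f)"

definition is_spectral_measure ::
    "'l::finite block_jacobi \<Rightarrow> (real set \<Rightarrow> complex^'l^'l) \<Rightarrow> bool"
  where "is_spectral_measure J \<mu> \<longleftrightarrow> matrix_measure \<mu> \<and>
    (\<forall>E. Im E \<noteq> 0 \<longrightarrow> has_matrix_integral \<mu> (\<lambda>x. 1 / (of_real x - E)) (m_fun J E))"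

text \<open>The value at the origin is the removable one: \<open>m_fun J E\<close> vanishes as \<open>E\<close> tends to infinity.\<close>

definition M_fun :: "'l::finite block_jacobi \<Rightarrow> complex \<Rightarrow> complex^'l^'l"
  where "M_fun J z = (if z = 0 then 0 else - m_fun J (z + inverse z))"

text \<open>Off \<open>M_dom J\<close> the resolvent does not exist and \<open>M_fun J\<close> has an unspecified value: these are
  the poles of the meromorphic function on the disk.\<close>

definition M_dom :: "'l::finite block_jacobi \<Rightarrow> complex set"
  where "M_dom J = {z \<in> ball 0 1. z = 0 \<or> z + inverse z \<notin> spectrum J}"

definition w_tilde :: "'l::finite block_jacobi \<Rightarrow> complex \<Rightarrow> complex^'l^'l"
  where "w_tilde J z0 = - Lim (at z0) (\<lambda>z. (z - z0) *\<^sub>m M_fun J z)"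

definition eigen_points :: "'l::finite block_jacobi \<Rightarrow> complex set"
  where "eigen_points J =
    {z \<in> ball 0 1. z \<in> \<real> \<and> z \<noteq> 0 \<and> discrete_eigenvalue J (z + inverse z)}"

fun jost_c :: "'l::finite block_jacobi \<Rightarrow> complex \<Rightarrow> nat \<Rightarrow> complex^'l^'l"
  and jost_g :: "'l::finite block_jacobi \<Rightarrow> complex \<Rightarrow> nat \<Rightarrow> complex^'l^'l"
  where
  "jost_c J z 0 = mat 1"
| "jost_g J z 0 = mat 1"
| "jost_c J z (Suc n) = matrix_inv (Apar J (Suc n)) **
     ((z\<^sup>2 *\<^sub>m mat 1 - z *\<^sub>m Bpar J (Suc n)) ** jost_c J z n + jost_g J z n)"
| "jost_g J z (Suc n) = matrix_inv (Apar J (Suc n)) **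
     ((z\<^sup>2 *\<^sub>m (mat 1 - Apar J (Suc n) ** adj (Apar J (Suc n))) - z *\<^sub>m Bpar J (Suc n))
        ** jost_c J z n + jost_g J z n)"

definition jost :: "'l::finite block_jacobi \<Rightarrow> complex \<Rightarrow> complex^'l^'l"
  where "jost J z = lim (\<lambda>n. jost_g J z n)"

text \<open>\<open>jost_sol_scaled J n z\<close> is \<open>jost_sol J n z\<close> divided by the \<open>n\<close>-th power of \<open>z\<close>, with the
  removable value at the origin.\<close>

definition jost_sol_scaled :: "'l::finite block_jacobi \<Rightarrow> nat \<Rightarrow> complex \<Rightarrow> complex^'l^'l"
  where "jost_sol_scaled J n z = jost (jshift n J) z ** matrix_inv (Apar J n)"

definition jost_sol :: "'l::finite block_jacobi \<Rightarrow> nat \<Rightarrow> complex \<Rightarrow> complex^'l^'l"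
  where "jost_sol J n z = z ^ n *\<^sub>m jost_sol_scaled J n z"

text \<open>The norm is the library norm on matrices (Frobenius); the three decay conditions do not depend on
  the choice of matrix norm.\<close>

definition deviation :: "'l::finite block_jacobi \<Rightarrow> nat \<Rightarrow> real"
  where "deviation J n = norm (Bpar J n) + norm (mat 1 - Apar J n ** adj (Apar J n))"

definition cond_A1 :: "'l::finite block_jacobi \<Rightarrow> bool"
  where "cond_A1 J \<longleftrightarrow> summable (\<lambda>n. deviation J (Suc n))"

definition cond_A2 :: "'l::finite block_jacobi \<Rightarrow> bool"
  where "cond_A2 J \<longleftrightarrow> summable (\<lambda>n. real (Suc n) * deviation J (Suc n))"

definition cond_A3 :: "'l::finite block_jacobi \<Rightarrow> real \<Rightarrow> bool"
  where "cond_A3 J R \<longleftrightarrow> R > 1 \<and> (\<exists>C. \<forall>n\<ge>1. deviation J n \<le> C * R powi (- 2 * int n))"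

definition appropriate_region :: "'l::finite block_jacobi \<Rightarrow> complex set \<Rightarrow> bool"
  where "appropriate_region J S \<longleftrightarrow>
    (cond_A1 J \<and> S = cball 0 1 - {1, -1}) \<or>
    (cond_A2 J \<and> S = cball 0 1) \<or>
    (\<exists>R. cond_A3 J R \<and> S = ball 0 R)"

end

theory Submission
  imports Defs
begin

text \<open>A unitary gauge change reduces the convergence of the Jost polynomials to type 1, where a
  Gronwall estimate applies.  The Jost solution then satisfies the three-term recurrence, and all
  remaining properties come from two identities for it.  Constancy of the Wronskian of \<open>u\<^sub>n(z)\<close> and
  \<open>u\<^sub>n(1 / cnj z)\<^sup>*\<close> gives invertibility of \<open>u\<close> on the circle, the reflection formula for
  \<open>M = u\<^sup>-\<^sup>1 u\<^sub>1\<close> and the residue identity.  Green's formula identifies the kernel of \<open>u(z)\<close> with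
  the eigenspace and shows that the derivative of \<open>u\<close> is nondegenerate on this kernel, so that the
  zeros are simple.  At \<open>\<plusminus>1\<close> a truncated form of Green's formula replaces this argument if the
  first moment is finite; otherwise the Herglotz bound on \<open>M\<close> excludes poles of \<open>u\<^sup>-\<^sup>1\<close> of higher
  order.\<close>

section \<open>Complex matrices\<close>

text \<open>The hypotheses control \<open>1 - A ** adj A\<close>, while the estimates need 1 - A
  itself; for A > 0 the factorization 1 - A^2 = (1 + A)(1 - A) supplies it, which is what type 1 is
  good for. The gauge unitaries must converge because the Jost polynomials carry the unitary of the
  running index on their left. The spectrum is found directly: where u(z) is invertible, Green's
  formula prescribes the only possible initial value of a square summable solution of (J - E) phi =
  eta, and the forward solution with this value is bounded by hand. Eigenvalues are then isolated
  because the zeros of det u are. At the edges there are two obstacles. With a finite first moment u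
  is continuous on the closed disk, but no derivative at an edge is available. With summability
  alone u has no guaranteed value there, and a zero is visible only as a pole of the inverse
  approached from within the region.\<close>

lemma smult_mat_nth [simp]: "(c *\<^sub>m X) $ i $ j = c * X $ i $ j"
  by (simp add: smult_mat_def)

lemma adj_nth [simp]: "adj X $ i $ j = cnj (X $ j $ i)"
  by (simp add: adj_def)

lemma mat_eqI:
  fixes X Y :: "complex^'n^'m"
  shows "(\<And>i j. X $ i $ j = Y $ i $ j) \<Longrightarrow> X = Y"
  by (simp add: vec_eq_iff)

lemma smult_mat_simps [simp]:
  "1 *\<^sub>m X = X" "0 *\<^sub>m X = 0" "c *\<^sub>m 0 = 0" "c *\<^sub>m (d *\<^sub>m X) = (c * d) *\<^sub>m X"
  by (auto intro!: mat_eqI simp: mult.assoc)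

lemma smult_mat_add_right: "c *\<^sub>m (X + Y) = c *\<^sub>m X + c *\<^sub>m Y"
  and smult_mat_add_left: "(c + d) *\<^sub>m X = c *\<^sub>m X + d *\<^sub>m X"
  and smult_mat_diff_right: "c *\<^sub>m (X - Y) = c *\<^sub>m X - c *\<^sub>m Y"
  and smult_mat_diff_left: "(c - d) *\<^sub>m X = c *\<^sub>m X - d *\<^sub>m X"
  and smult_mat_minus_left: "(- c) *\<^sub>m X = - (c *\<^sub>m X)"
  by (auto intro!: mat_eqI simp: algebra_simps)

lemma smult_mat_mult_left [simp]: "(c *\<^sub>m X) ** Y = c *\<^sub>m (X ** Y)"
  by (auto intro!: mat_eqI simp: matrix_matrix_mult_def sum_distrib_left mult.assoc)

lemma smult_mat_mult_right [simp]: "X ** (c *\<^sub>m Y) = c *\<^sub>m (X ** Y)"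
  by (auto intro!: mat_eqI simp: matrix_matrix_mult_def sum_distrib_left mult_ac)

lemma smult_mat_vec [simp]: "(c *\<^sub>m X) *v v = c *s (X *v v)"
  by (auto simp: vec_eq_iff matrix_vector_mult_def sum_distrib_left mult.assoc)

lemma mat_vec_smult [simp]: "X *v (c *s v) = c *s (X *v v)" for X :: "complex^'n^'m"
  by (auto simp: vec_eq_iff matrix_vector_mult_def sum_distrib_left mult_ac)

lemma matrix_add_rdistrib': "(B + C) ** A = B ** A + C ** A"
  by (vector matrix_matrix_mult_def sum.distrib[symmetric] field_simps)

lemma matrix_diff_ldistrib: "A ** (B - C) = A ** B - A ** C" for A :: "complex^'n^'m"
  by (auto intro!: mat_eqI simp: matrix_matrix_mult_def sum_subtractf algebra_simps)

lemma matrix_diff_rdistrib: "(B - C) ** A = B ** A - C ** A" for A :: "complex^'n^'m"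
  by (auto intro!: mat_eqI simp: matrix_matrix_mult_def sum_subtractf algebra_simps)

lemma matrix_minus_left [simp]: "(- B) ** A = - (B ** A)" for A :: "complex^'n^'m"
  by (auto intro!: mat_eqI simp: matrix_matrix_mult_def sum_negf)

lemma matrix_minus_right [simp]: "A ** (- B) = - (A ** B)" for A :: "complex^'n^'m"
  by (auto intro!: mat_eqI simp: matrix_matrix_mult_def sum_negf)

lemma mat_vec_minus_left [simp]: "(- X) *v v = - (X *v v)" for X :: "complex^'n^'m"
  by (auto simp: vec_eq_iff matrix_vector_mult_def sum_negf)

lemmas mat_distrib = matrix_add_ldistrib matrix_add_rdistrib' matrix_diff_ldistrib
  matrix_diff_rdistrib smult_mat_add_right smult_mat_diff_right

lemma adj_simps [simp]:
  "adj (adj X) = X" "adj (X + Y) = adj X + adj Y" "adj (X - Y) = adj X - adj Y" "adj (- X) = - adj X"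
  "adj (c *\<^sub>m X) = cnj c *\<^sub>m adj X" "adj 0 = 0"
  by (auto intro!: mat_eqI)

lemma adj_mat_1 [simp]: "adj (mat 1) = mat 1"
  by (auto intro!: mat_eqI simp: mat_def)

lemma adj_mult [simp]: "adj (X ** Y) = adj Y ** adj X"
  by (auto intro!: mat_eqI simp: matrix_matrix_mult_def mult.commute)

section \<open>The sesquilinear form and the Frobenius norm\<close>

lemma cinner_simps:
  "cinner u (v + w) = cinner u v + cinner u w" "cinner (u + v) w = cinner u w + cinner v w"
  "cinner u (v - w) = cinner u v - cinner u w" "cinner (u - v) w = cinner u w - cinner v w"
  "cinner u (- w) = - cinner u w" "cinner (- u) w = - cinner u w"
  "cinner u (c *s w) = c * cinner u w" "cinner (c *s u) w = cnj c * cinner u w"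
  "cinner u 0 = 0" "cinner 0 w = 0"
  by (auto simp: cinner_def sum.distrib sum_subtractf sum_negf sum_distrib_left algebra_simps)

lemma cinner_commute: "cinner v w = cnj (cinner w v)"
  by (simp add: cinner_def mult.commute)

lemma cinner_mat_right: "cinner v (X *v w) = cinner (adj X *v v) w"
proof -
  have "cinner v (X *v w) = (\<Sum>i\<in>UNIV. \<Sum>j\<in>UNIV. cnj (v $ i) * X $ i $ j * w $ j)"
    by (simp add: cinner_def matrix_vector_mult_def sum_distrib_left mult.assoc)
  also have "\<dots> = (\<Sum>j\<in>UNIV. \<Sum>i\<in>UNIV. cnj (v $ i) * X $ i $ j * w $ j)"
    by (rule sum.swap)
  also have "\<dots> = cinner (adj X *v v) w"
    by (simp add: cinner_def matrix_vector_mult_def sum_distrib_left sum_distrib_right mult_ac)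
  finally show ?thesis .
qed

lemma norm_vec_sq: "(norm (v :: complex^'n))\<^sup>2 = (\<Sum>i\<in>UNIV. (cmod (v $ i))\<^sup>2)"
  by (simp add: norm_vec_def L2_set_def sum_nonneg)

lemma cinner_self: "cinner v v = of_real ((norm v)\<^sup>2)"
  by (simp add: cinner_def norm_vec_sq complex_norm_square mult.commute del: of_real_power)

lemma cinner_self_eq_0_iff [simp]: "cinner v v = 0 \<longleftrightarrow> v = 0"
  by (simp add: cinner_self)

lemma norm_cinner_le: "cmod (cinner v w) \<le> norm v * norm w"
proof -
  have "cmod (cinner v w) \<le> (\<Sum>i\<in>UNIV. cmod (v $ i) * cmod (w $ i))"
    unfolding cinner_def by (rule order_trans[OF norm_sum]) (simp add: norm_mult)
  also have "\<dots> = (\<Sum>i\<in>UNIV. \<bar>cmod (v $ i)\<bar> * \<bar>cmod (w $ i)\<bar>)" by simp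
  also have "\<dots> \<le> L2_set (\<lambda>i. cmod (v $ i)) UNIV * L2_set (\<lambda>i. cmod (w $ i)) UNIV"
    by (rule L2_set_mult_ineq)
  finally show ?thesis by (simp add: norm_vec_def)
qed

lemma norm_smult_vec [simp]: "norm (c *s v) = cmod c * norm (v :: complex^'n)"
proof -
  have "(norm (c *s v))\<^sup>2 = (cmod c * norm v)\<^sup>2"
    by (simp add: norm_vec_sq norm_mult power_mult_distrib sum_distrib_left)
  thus ?thesis by (simp add: power2_eq_iff_nonneg)
qed

lemma norm_mat_sq: "(norm (X :: complex^'n^'m))\<^sup>2 = (\<Sum>i\<in>UNIV. \<Sum>j\<in>UNIV. (cmod (X $ i $ j))\<^sup>2)"
proof -
  have "(norm X)\<^sup>2 = (\<Sum>i\<in>UNIV. (norm (X $ i))\<^sup>2)"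
    by (simp add: norm_vec_def[of X] L2_set_def sum_nonneg)
  thus ?thesis by (simp add: norm_vec_sq)
qed

lemma norm_smult_mat [simp]: "norm (c *\<^sub>m X) = cmod c * norm (X :: complex^'n^'m)"
proof -
  have "(norm (c *\<^sub>m X))\<^sup>2 = (cmod c * norm X)\<^sup>2"
    by (simp add: norm_mat_sq norm_mult power_mult_distrib sum_distrib_left)
  thus ?thesis by (simp add: power2_eq_iff_nonneg)
qed

lemma norm_adj [simp]: "norm (adj X) = norm (X :: complex^'n^'m)"
proof -
  have "(norm (adj X))\<^sup>2 = (\<Sum>i\<in>UNIV. \<Sum>j\<in>UNIV. (cmod (X $ j $ i))\<^sup>2)"
    by (simp add: norm_mat_sq)
  also have "\<dots> = (norm X)\<^sup>2" unfolding norm_mat_sq by (rule sum.swap)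
  finally show ?thesis by (simp add: power2_eq_iff_nonneg)
qed

lemma mat_vec_axis: "X *v axis j 1 = column j X" for X :: "complex^'n^'m"
  by (simp add: vec_eq_iff matrix_vector_mult_def column_def axis_def if_distrib cong: if_cong)

text \<open>Lets inequalities for vectors be lifted to the Frobenius norm column by column.\<close>

lemma norm_mat_sq_columns: "(norm (X :: complex^'n^'m))\<^sup>2 = (\<Sum>j\<in>UNIV. (norm (X *v axis j 1))\<^sup>2)"
proof -
  have "(\<Sum>j\<in>UNIV. (norm (X *v axis j 1))\<^sup>2) = (\<Sum>j\<in>UNIV. \<Sum>i\<in>UNIV. (cmod (X $ i $ j))\<^sup>2)"
    by (simp add: norm_vec_sq column_def mat_vec_axis)
  also have "\<dots> = (norm X)\<^sup>2" unfolding norm_mat_sq by (rule sum.swap)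
  finally show ?thesis by simp
qed

lemma norm_mat_vec_le: "norm (X *v v) \<le> norm X * norm (v :: complex^'n)"
proof -
  have "cmod ((X *v v) $ i) \<le> norm (X $ i) * norm v" for i
  proof -
    have "(X *v v) $ i = cinner (\<chi> j. cnj (X $ i $ j)) v"
      by (simp add: matrix_vector_mult_def cinner_def)
    moreover have "norm (\<chi> j. cnj (X $ i $ j)) = norm (X $ i)"
      by (simp add: norm_vec_def)
    ultimately show ?thesis using norm_cinner_le by metis
  qed
  hence "(norm (X *v v))\<^sup>2 \<le> (\<Sum>i\<in>UNIV. (norm (X $ i) * norm v)\<^sup>2)"
    unfolding norm_vec_sq[of "X *v v"] by (intro sum_mono power_mono) auto
  also have "\<dots> = (norm X * norm v)\<^sup>2"
    by (simp add: power_mult_distrib norm_vec_def[of X] L2_set_def sum_nonneg sum_distrib_right)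
  finally show ?thesis by (simp add: power2_le_iff_abs_le)
qed

lemma norm_mat_mult_le: "norm (X ** Y) \<le> norm X * norm (Y :: complex^'p^'n)"
proof -
  have "(norm (X ** Y))\<^sup>2 = (\<Sum>j\<in>UNIV. (norm (X *v (Y *v axis j 1)))\<^sup>2)"
    by (simp add: norm_mat_sq_columns matrix_vector_mul_assoc)
  also have "\<dots> \<le> (\<Sum>j\<in>UNIV. (norm X * norm (Y *v axis j 1))\<^sup>2)"
    by (intro sum_mono power_mono norm_mat_vec_le) auto
  also have "\<dots> = (norm X * norm Y)\<^sup>2"
    by (simp add: power_mult_distrib norm_mat_sq_columns[of Y] sum_distrib_left)
  finally show ?thesis by (simp add: power2_le_iff_abs_le)
qed

lemma bounded_bilinear_mat_mult:
  "bounded_bilinear ((**) :: complex^'n^'m \<Rightarrow> complex^'p^'n \<Rightarrow> _)"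
proof
  show "\<exists>K. \<forall>a b. norm (a ** b) \<le> norm (a :: complex^'n^'m) * norm (b :: complex^'p^'n) * K"
    by (rule exI[of _ 1]) (simp add: norm_mat_mult_le)
qed (simp_all add: mat_distrib scalar_matrix_assoc matrix_scalar_ac)

lemma bounded_bilinear_mat_vec:
  "bounded_bilinear ((*v) :: complex^'n^'m \<Rightarrow> complex^'n \<Rightarrow> _)"
proof
  show "\<exists>K. \<forall>a b. norm (a *v b) \<le> norm (a :: complex^'n^'m) * norm (b :: complex^'n) * K"
    by (rule exI[of _ 1]) (simp add: norm_mat_vec_le)
qed (auto simp: algebra_simps vec_eq_iff matrix_vector_mult_def scaleR_sum_right sum.distrib)

lemma bounded_bilinear_smult_mat:
  "bounded_bilinear (smult_mat :: complex \<Rightarrow> complex^'n^'m \<Rightarrow> _)"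
proof
  show "\<exists>K. \<forall>a b. norm (a *\<^sub>m b) \<le> norm a * norm (b :: complex^'n^'m) * K"
    by (rule exI[of _ 1]) simp
qed (auto intro!: mat_eqI simp: algebra_simps)

lemma bounded_bilinear_smult_vec:
  "bounded_bilinear ((*s) :: complex \<Rightarrow> complex^'n \<Rightarrow> _)"
proof
  show "\<exists>K. \<forall>a b. norm (a *s b) \<le> norm a * norm (b :: complex^'n) * K"
    by (rule exI[of _ 1]) simp
qed (auto simp: vec_eq_iff algebra_simps)

lemma bounded_bilinear_cinner: "bounded_bilinear (cinner :: complex^'n \<Rightarrow> _)"
proof
  show "\<exists>K. \<forall>a b. norm (cinner a b) \<le> norm a * norm (b :: complex^'n) * K"
    by (rule exI[of _ 1]) (simp add: norm_cinner_le)
qed (auto simp: cinner_def sum.distrib algebra_simps scaleR_sum_right)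

lemma bounded_linear_adj: "bounded_linear (adj :: complex^'n^'m \<Rightarrow> _)"
  by (rule bounded_linear_intro[where K = 1]) (auto intro!: mat_eqI)

lemmas mat_tendsto_intros [tendsto_intros] =
  bounded_bilinear.tendsto[OF bounded_bilinear_mat_mult]
  bounded_bilinear.tendsto[OF bounded_bilinear_mat_vec]
  bounded_bilinear.tendsto[OF bounded_bilinear_smult_mat]
  bounded_bilinear.tendsto[OF bounded_bilinear_smult_vec]
  bounded_bilinear.tendsto[OF bounded_bilinear_cinner]
  bounded_linear.tendsto[OF bounded_linear_adj]

lemmas mat_continuous_intros [continuous_intros] =
  bounded_bilinear.continuous_on[OF bounded_bilinear_mat_mult]
  bounded_bilinear.continuous_on[OF bounded_bilinear_mat_vec]
  bounded_bilinear.continuous_on[OF bounded_bilinear_smult_mat]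
  bounded_bilinear.continuous_on[OF bounded_bilinear_cinner]
  bounded_linear.continuous_on[OF bounded_linear_adj]

subsection \<open>Inverses\<close>

lemma matrix_inv_mult:
  assumes "invertible (A :: complex^'n^'n)"
  shows "A ** matrix_inv A = mat 1" "matrix_inv A ** A = mat 1"
  using assms unfolding invertible_def matrix_inv_def by (metis (mono_tags, lifting) someI_ex)+

lemma matrix_inv_unique:
  assumes "A ** B = mat 1"
  shows "invertible (A :: complex^'n^'n)" "matrix_inv A = B"
proof -
  have BA: "B ** A = mat 1" using assms matrix_left_right_inverse by blast
  thus inv: "invertible A" using assms invertible_def by blast
  have "matrix_inv A = matrix_inv A ** (A ** B)" by (simp add: assms)
  also have "\<dots> = B" by (simp add: matrix_mul_assoc matrix_inv_mult[OF inv])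
  finally show "matrix_inv A = B" .
qed

lemma matrix_inv_cancel [simp]:
  assumes "invertible (A :: complex^'n^'n)"
  shows "X ** A ** matrix_inv A = X" "X ** matrix_inv A ** A = X"
    "A *v (matrix_inv A *v v) = v" "matrix_inv A *v (A *v v) = v"
  using assms by (simp_all add: matrix_mul_assoc[symmetric] matrix_inv_mult matrix_vector_mul_assoc)

lemma invertible_matrix_inv: "invertible (A :: complex^'n^'n) \<Longrightarrow> invertible (matrix_inv A)"
  using matrix_inv_mult invertible_def by blast

lemma adj_matrix_inv:
  assumes "invertible (A :: complex^'n^'n)"
  shows "invertible (adj A)" "matrix_inv (adj A) = adj (matrix_inv A)"
proof -
  have "adj A ** adj (matrix_inv A) = mat 1"
    by (metis adj_mat_1 adj_mult matrix_inv_mult(2)[OF assms])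
  thus "invertible (adj A)" "matrix_inv (adj A) = adj (matrix_inv A)"
    using matrix_inv_unique by blast+
qed

lemma invertible_adj_iff [simp]: "invertible (adj A) \<longleftrightarrow> invertible (A :: complex^'n^'n)"
  using adj_matrix_inv(1)[of A] adj_matrix_inv(1)[of "adj A"] by auto

lemma invertible_mat_mult_iff:
  "invertible (A ** B) \<longleftrightarrow> invertible (A :: complex^'n^'n) \<and> invertible (B :: complex^'n^'n)"
  by (simp add: invertible_det_nz det_mul)

lemma matrix_inv_mat_mult:
  assumes "invertible (A :: complex^'n^'n)" "invertible (B :: complex^'n^'n)"
  shows "matrix_inv (A ** B) = matrix_inv B ** matrix_inv A"
  by (rule matrix_inv_unique) (simp add: matrix_mul_assoc assms matrix_inv_mult)

lemma not_invertible_kernel: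
  assumes "\<not> invertible (A :: complex^'n^'n)"
  obtains v where "v \<noteq> 0" "A *v v = 0"
  using assms invertible_left_inverse matrix_left_invertible_ker by blast

lemma invertibleI_kernel:
  assumes "\<And>v. A *v v = 0 \<Longrightarrow> v = 0"
  shows "invertible (A :: complex^'n^'n)"
  using assms not_invertible_kernel by blast

lemma invertible_kernel: "invertible (A :: complex^'n^'n) \<Longrightarrow> A *v v = 0 \<Longrightarrow> v = 0"
  by (metis matrix_inv_cancel(4) matrix_vector_mult_0_right)

text \<open>Cramer's rule. It reduces limits, holomorphy and meromorphy of an inverse to those of
  determinants.\<close>

lemma matrix_inv_nth:
  assumes "invertible (A :: complex^'n^'n)"
  shows "matrix_inv A $ k $ j =
    det (\<chi> i m. if m = k then (axis j 1 :: complex^'n) $ i else A $ i $ m) / det A"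
proof -
  have "A *v (matrix_inv A *v axis j 1) = axis j 1"
    using assms by simp
  hence "matrix_inv A *v axis j 1 =
      (\<chi> k. det (\<chi> i m. if m = k then (axis j 1 :: complex^'n) $ i else A $ i $ m) / det A)"
    using cramer[of A] assms invertible_det_nz by blast
  moreover have "(matrix_inv A *v axis j 1) $ k = matrix_inv A $ k $ j"
    by (simp add: mat_vec_axis column_def)
  ultimately show ?thesis by simp
qed

section \<open>Limits of determinants and inverses\<close>

lemma mat_tendstoI:
  fixes F :: "_ \<Rightarrow> complex^'n^'m"
  assumes "\<And>i j. ((\<lambda>x. F x $ i $ j) \<longlongrightarrow> L $ i $ j) G"
  shows "(F \<longlongrightarrow> L) G"
  using assms by (intro vec_tendstoI)

lemma mat_tendstoD:
  fixes F :: "_ \<Rightarrow> complex^'n^'m"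
  shows "(F \<longlongrightarrow> L) G \<Longrightarrow> ((\<lambda>x. F x $ i $ j) \<longlongrightarrow> L $ i $ j) G"
  by (intro tendsto_vec_nth)

lemma tendsto_det:
  assumes "(F \<longlongrightarrow> L) G"
  shows "((\<lambda>x. det (F x :: complex^'n^'n)) \<longlongrightarrow> det L) G"
  unfolding det_def by (intro tendsto_intros mat_tendstoD assms)

lemma eventually_invertible:
  assumes "(F \<longlongrightarrow> L) G" "invertible (L :: complex^'n^'n)"
  shows "\<forall>\<^sub>F x in G. invertible (F x)"
  using tendsto_imp_eventually_ne[OF tendsto_det[OF assms(1)], of 0] assms(2)
  by (simp add: invertible_det_nz)

lemma tendsto_matrix_inv [tendsto_intros]:
  assumes "(F \<longlongrightarrow> L) G" "invertible (L :: complex^'n^'n)"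
  shows "((\<lambda>x. matrix_inv (F x)) \<longlongrightarrow> matrix_inv L) G"
proof (rule mat_tendstoI)
  fix i j
  have "((\<lambda>x. det (\<chi> a m. if m = i then (axis j 1 :: complex^'n) $ a else F x $ a $ m) / det (F x))
      \<longlongrightarrow> det (\<chi> a m. if m = i then (axis j 1 :: complex^'n) $ a else L $ a $ m) / det L) G"
  proof (intro tendsto_divide tendsto_det assms(1) mat_tendstoI)
    show "((\<lambda>x. (\<chi> a m. if m = i then (axis j 1 :: complex^'n) $ a else F x $ a $ m) $ b $ c)
        \<longlongrightarrow> (\<chi> a m. if m = i then (axis j 1 :: complex^'n) $ a else L $ a $ m) $ b $ c) G" for b c
      using mat_tendstoD[OF assms(1)] by simp
    show "det L \<noteq> 0" using assms(2) by (simp add: invertible_det_nz)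
  qed
  moreover have "\<forall>\<^sub>F x in G. matrix_inv (F x) $ i $ j =
      det (\<chi> a m. if m = i then (axis j 1 :: complex^'n) $ a else F x $ a $ m) / det (F x)"
    using eventually_invertible[OF assms] by eventually_elim (rule matrix_inv_nth)
  ultimately show "((\<lambda>x. matrix_inv (F x) $ i $ j) \<longlongrightarrow> matrix_inv L $ i $ j) G"
    unfolding matrix_inv_nth[OF assms(2)] using tendsto_cong by force
qed

lemma continuous_on_matrix_inv [continuous_intros]:
  assumes "continuous_on S F" "\<And>x. x \<in> S \<Longrightarrow> invertible (F x :: complex^'n^'n)"
  shows "continuous_on S (\<lambda>x. matrix_inv (F x))"
  using assms by (auto simp: continuous_on_def intro!: tendsto_matrix_inv)

subsection \<open>Entrywise holomorphy\<close>

definition mat_holo :: "(complex \<Rightarrow> complex^'n^'m) \<Rightarrow> complex set \<Rightarrow> bool"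
  where "mat_holo F S \<longleftrightarrow> (\<forall>i j. (\<lambda>z. F z $ i $ j) holomorphic_on S)"

lemma mat_holo_subset: "mat_holo F S \<Longrightarrow> T \<subseteq> S \<Longrightarrow> mat_holo F T"
  unfolding mat_holo_def using holomorphic_on_subset by blast

lemma mat_holo_const: "mat_holo (\<lambda>z. A) S"
  by (simp add: mat_holo_def)

lemma mat_holo_add: "mat_holo F S \<Longrightarrow> mat_holo G S \<Longrightarrow> mat_holo (\<lambda>z. F z + G z) S"
  by (auto simp: mat_holo_def intro!: holomorphic_intros)

lemma mat_holo_diff: "mat_holo F S \<Longrightarrow> mat_holo G S \<Longrightarrow> mat_holo (\<lambda>z. F z - G z) S"
  by (auto simp: mat_holo_def intro!: holomorphic_intros)

lemma mat_holo_smult: "f holomorphic_on S \<Longrightarrow> mat_holo F S \<Longrightarrow> mat_holo (\<lambda>z. f z *\<^sub>m F z) S"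
  by (auto simp: mat_holo_def intro!: holomorphic_intros)

lemma mat_holo_mult: "mat_holo F S \<Longrightarrow> mat_holo G S \<Longrightarrow> mat_holo (\<lambda>z. F z ** G z) S"
  by (auto simp: mat_holo_def matrix_matrix_mult_def intro!: holomorphic_intros)

lemmas mat_holo_intros = mat_holo_const mat_holo_add mat_holo_diff mat_holo_smult mat_holo_mult

lemma mat_holo_det: "mat_holo F S \<Longrightarrow> (\<lambda>z. det (F z :: complex^'n^'n)) holomorphic_on S"
  unfolding det_def by (intro holomorphic_intros) (auto simp: mat_holo_def)

lemma mat_holo_matrix_inv:
  assumes "mat_holo F S" "\<And>z. z \<in> S \<Longrightarrow> invertible (F z :: complex^'n^'n)"
  shows "mat_holo (\<lambda>z. matrix_inv (F z)) S"
  unfolding mat_holo_def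
proof (intro allI)
  fix i j
  have "(\<lambda>z. det (\<chi> a m. if m = i then (axis j 1 :: complex^'n) $ a else F z $ a $ m) / det (F z))
      holomorphic_on S"
  proof (intro holomorphic_intros mat_holo_det assms(1))
    show "mat_holo (\<lambda>z. \<chi> a m. if m = i then (axis j 1 :: complex^'n) $ a else F z $ a $ m) S"
      unfolding mat_holo_def
    proof (intro allI)
      fix a m
      show "(\<lambda>z. (\<chi> a m. if m = i then (axis j 1 :: complex^'n) $ a else F z $ a $ m) $ a $ m)
          holomorphic_on S"
        using assms(1) by (cases "m = i") (auto simp: mat_holo_def)
    qed
  qed (use assms(2) invertible_det_nz in auto)
  thus "(\<lambda>z. matrix_inv (F z) $ i $ j) holomorphic_on S"
    by (rule holomorphic_transform) (simp add: matrix_inv_nth assms(2))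
qed

lemma mat_holo_continuous: "mat_holo F S \<Longrightarrow> continuous_on S F"
  unfolding continuous_on_def mat_holo_def
  by (intro ballI mat_tendstoI) (metis continuous_on_def holomorphic_on_imp_continuous_on)

section \<open>Convergence of the Jost function\<close>

text \<open>Pairing (1 + A) v with v gives at least the squared norm of v; Cauchy-Schwarz then
  removes one factor.\<close>

lemma norm_le_norm_one_plus_posdef:
  assumes "posdef A"
  shows "norm v \<le> norm ((mat 1 + A) *v v)"
proof (cases "v = 0")
  case False
  have "(norm v)\<^sup>2 \<le> (norm v)\<^sup>2 + Re (cinner v (A *v v))"
    using assms False unfolding posdef_def by (simp add: less_imp_le)
  also have "\<dots> = Re (cinner v ((mat 1 + A) *v v))"
    by (simp add: matrix_vector_mult_add_rdistrib cinner_simps cinner_self)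
  also have "\<dots> \<le> norm v * norm ((mat 1 + A) *v v)"
    using complex_Re_le_cmod norm_cinner_le order_trans by blast
  finally show ?thesis using False by (simp add: power2_eq_square)
qed simp

text \<open>The only place where positivity of the blocks is used: 1 + A does not shrink vectors, so
  each column of 1 - A is dominated by the same column of 1 - A^2.\<close>

lemma norm_one_minus_posdef_le:
  assumes "posdef (A :: complex^'n^'n)"
  shows "norm (mat 1 - A) \<le> norm (mat 1 - A ** adj A)"
proof -
  have A: "adj A = A" using assms by (simp add: posdef_def hermitian_def)
  have eq: "mat 1 - A ** adj A = (mat 1 + A) ** (mat 1 - A)"
    by (simp add: A mat_distrib)
  have "(norm (mat 1 - A))\<^sup>2 \<le> (norm (mat 1 - A ** adj A))\<^sup>2"
    unfolding norm_mat_sq_columns eq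
    by (intro sum_mono power_mono)
       (auto simp: matrix_vector_mul_assoc[symmetric] intro!: norm_le_norm_one_plus_posdef assms)
  thus ?thesis by (simp add: power2_le_iff_abs_le)
qed

lemma norm_unitary_mult:
  assumes "unitary (U :: complex^'n^'n)"
  shows "norm (U ** X) = norm X" "norm (adj U ** X) = norm X" "norm (X ** U) = norm X"
    "norm (X ** adj U) = norm (X :: complex^'n^'n)"
proof -
  have v: "norm (V *v v) = norm v" if "adj V ** V = mat 1" for V :: "complex^'n^'n" and v
  proof -
    have "of_real ((norm (V *v v))\<^sup>2) = (of_real ((norm v)\<^sup>2) :: complex)"
      using that by (simp only: cinner_self[symmetric])
        (simp add: cinner_mat_right matrix_vector_mul_assoc)
    thus ?thesis by (simp only: of_real_eq_iff) (simp add: power2_eq_iff_nonneg)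
  qed
  have l: "norm (V ** Y) = norm Y" if "adj V ** V = mat 1" for V Y :: "complex^'n^'n"
  proof -
    have "(norm (V ** Y))\<^sup>2 = (norm Y)\<^sup>2"
      unfolding norm_mat_sq_columns by (simp add: matrix_vector_mul_assoc[symmetric] v[OF that])
    thus ?thesis by (simp add: power2_eq_iff_nonneg)
  qed
  show "norm (U ** X) = norm X" "norm (adj U ** X) = norm X"
    using assms l by (auto simp: unitary_def)
  have "norm (adj (X ** U)) = norm (adj X)" "norm (adj (X ** adj U)) = norm (adj X)"
    using assms l by (auto simp: unitary_def)
  thus "norm (X ** U) = norm X" "norm (X ** adj U) = norm X" by (simp_all only: norm_adj)
qed

lemma Apar_jshift [simp]: "Apar (jshift k J) n = (if n = 0 then mat 1 else Apar J (n + k))"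
  and Bpar_jshift [simp]: "Bpar (jshift k J) n = Bpar J (n + k)"
  by (simp_all add: jshift_def)

lemma jshift_jshift: "jshift m (jshift k J) = jshift (m + k) J"
  by (auto simp: jshift_def add.assoc)

lemma jshift_0: "is_block_jacobi J \<Longrightarrow> jshift 0 J = J"
  by (cases J) (auto simp: jshift_def is_block_jacobi_def)

text \<open>The second component may grow like the weight \<open>W\<close>.\<close>

lemma weighted_gronwall:
  fixes g y :: "nat \<Rightarrow> 'a::real_normed_vector"
  assumes g: "\<And>n. norm (g (Suc n) - g n) \<le> \<alpha> n * (norm (g n) + norm (y n))"
    and y: "\<And>n. norm (y (Suc n)) \<le> q * norm (y n) + \<kappa> * norm (g n) + \<alpha> n * (norm (g n) + norm (y n))"
    and W: "\<And>n. W n \<ge> 1" "\<And>n. W (Suc n) \<ge> q * W n + \<kappa>"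
    and nonneg: "q \<ge> 0" "\<kappa> \<ge> 0" "\<And>n. \<alpha> n \<ge> 0"
    and init: "norm (g 0) \<le> N" "norm (y 0) \<le> N * W 0"
    and T: "\<And>n. (\<Sum>i<n. \<alpha> i * W i) \<le> T"
  shows "norm (g (Suc n) - g n) \<le> 2 * \<alpha> n * W n * (N * exp (2 * T))"
proof -
  \<comment> \<open>\<open>P n\<close> majorizes N times the product of the factors 1 + 2 * \<alpha>
    i * W i over i < n, each of which lies below an exponential.\<close>
  define P where "P n = N * exp (2 * (\<Sum>i<n. \<alpha> i * W i))" for n
  have N: "N \<ge> 0" using init(1) norm_ge_zero order_trans by blast
  have P0: "P n \<ge> 0" for n using N by (simp add: P_def)
  have bd: "norm (g n) \<le> P n \<and> norm (y n) \<le> P n * W n" for n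
  proof (induction n)
    case 0
    show ?case using init by (simp add: P_def)
  next
    case (Suc n)
    have s: "norm (g n) + norm (y n) \<le> 2 * W n * P n"
    proof -
      have "norm (g n) \<le> P n * W n"
        using Suc W(1)[of n] P0[of n] by (meson mult_left_le order_trans mult_le_cancel_left1 not_less)
      hence "norm (g n) + norm (y n) \<le> 2 * (P n * W n)" using Suc by simp
      thus ?thesis by (simp add: mult_ac)
    qed
    have PS: "P n * (1 + 2 * \<alpha> n * W n) \<le> P (Suc n)"
    proof -
      have "P (Suc n) = P n * exp (2 * \<alpha> n * W n)"
        by (simp add: P_def exp_add algebra_simps)
      thus ?thesis using exp_ge_add_one_self[of "2 * \<alpha> n * W n"] P0[of n] by (simp add: mult_left_mono)
    qed
    have a: "\<alpha> n * (norm (g n) + norm (y n)) \<le> 2 * \<alpha> n * W n * P n"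
      using mult_left_mono[OF s nonneg(3)[of n]] by (simp add: mult_ac)
    have "norm (g (Suc n)) \<le> norm (g n) + norm (g (Suc n) - g n)"
      by (metis add.commute diff_add_cancel norm_triangle_ineq)
    hence "norm (g (Suc n)) \<le> P n + 2 * \<alpha> n * W n * P n"
      using Suc g[of n] a by linarith
    also have "\<dots> = P n * (1 + 2 * \<alpha> n * W n)" by (simp add: algebra_simps)
    finally have 1: "norm (g (Suc n)) \<le> P (Suc n)" using PS by linarith
    have "norm (y (Suc n)) \<le> q * (P n * W n) + \<kappa> * P n + 2 * \<alpha> n * W n * P n"
      using y[of n] a Suc mult_left_mono[OF conjunct2[OF Suc] nonneg(1)]
        mult_left_mono[OF conjunct1[OF Suc] nonneg(2)] by linarith
    also have "\<dots> = P n * (q * W n + \<kappa>) + 2 * \<alpha> n * W n * P n" by (simp add: algebra_simps)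
    also have "\<dots> \<le> P n * W (Suc n) + 2 * \<alpha> n * W n * P n * W (Suc n)"
    proof (rule add_mono)
      show "P n * (q * W n + \<kappa>) \<le> P n * W (Suc n)" using W(2) P0 by (rule mult_left_mono)
      have "0 \<le> 2 * \<alpha> n * W n * P n"
        using nonneg(3)[of n] W(1)[of n] P0[of n] by (intro mult_nonneg_nonneg) auto
      thus "2 * \<alpha> n * W n * P n \<le> 2 * \<alpha> n * W n * P n * W (Suc n)"
        using W(1)[of "Suc n"] by (metis mult.right_neutral mult_left_mono)
    qed
    also have "\<dots> = P n * (1 + 2 * \<alpha> n * W n) * W (Suc n)" by (simp add: algebra_simps)
    also have "\<dots> \<le> P (Suc n) * W (Suc n)"
      using PS W(1)[of "Suc n"] by (intro mult_right_mono) auto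
    finally show ?case using 1 by simp
  qed
  have "P n \<le> N * exp (2 * T)" unfolding P_def using T[of n] N by (intro mult_left_mono) auto
  moreover have "norm (g n) + norm (y n) \<le> 2 * W n * P n"
  proof -
    have "norm (g n) \<le> P n * W n"
      using bd[of n] W(1)[of n] P0[of n] by (meson mult_left_le order_trans mult_le_cancel_left1 not_less)
    hence "norm (g n) + norm (y n) \<le> 2 * (P n * W n)" using bd[of n] by simp
    thus ?thesis by (simp add: mult_ac)
  qed
  ultimately have "norm (g n) + norm (y n) \<le> 2 * W n * (N * exp (2 * T))"
    using W(1)[of n] by (smt (verit) mult_left_mono)
  thus ?thesis using g[of n] mult_left_mono[OF _ nonneg(3)[of n]] by (fastforce simp: mult_ac)
qed

section \<open>Summable bounds on the steps of the Jost polynomials\<close>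

locale type1_jacobi =
  fixes J :: "'l::finite block_jacobi"
  assumes jacobi: "is_block_jacobi J" and type1: "type1 J" and A1: "cond_A1 J"
begin

abbreviation e :: "nat \<Rightarrow> real" where "e n \<equiv> deviation J (Suc n)"

lemma e_nonneg [simp]: "e n \<ge> 0"
  by (simp add: deviation_def)

lemma summable_e: "summable e"
  using A1 by (simp add: cond_A1_def)

lemma norm_one_minus_A_le: "norm (mat 1 - Apar J (Suc n)) \<le> e n"
  using norm_one_minus_posdef_le[of "Apar J (Suc n)"] type1
  by (auto simp: type1_def deviation_def intro: order_trans[OF _ norm_ge_zero[THEN add_increasing[OF _ order_refl]]])

lemma norm_B_le: "norm (Bpar J (Suc n)) \<le> e n"
  and norm_one_minus_AA_le: "norm (mat 1 - Apar J (Suc n) ** adj (Apar J (Suc n))) \<le> e n"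
  by (auto simp: deviation_def)

lemma invertible_A: "invertible (Apar J (Suc n))"
  using jacobi by (simp add: is_block_jacobi_def)

lemma Apar_tendsto: "Apar J \<longlonglongrightarrow> mat 1"
proof -
  have "(\<lambda>n. mat 1 - Apar J (Suc n)) \<longlonglongrightarrow> 0"
    by (rule Lim_null_comparison[OF _ summable_LIMSEQ_zero[OF summable_e]])
       (simp add: norm_one_minus_A_le)
  hence "(\<lambda>n. mat 1 - (mat 1 - Apar J (Suc n))) \<longlonglongrightarrow> mat 1 - 0" by (intro tendsto_intros)
  thus ?thesis by (simp add: LIMSEQ_imp_Suc)
qed

text \<open>Convergence to the identity bounds the inverses, and A^-1 - 1 = A^-1 (1 - A) makes their
  distance to 1 linear in the deviation.\<close>

lemma inverse_bound:
  obtains K where "K \<ge> 1" "\<And>n. norm (matrix_inv (Apar J (Suc n))) \<le> K"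
    "\<And>n. norm (matrix_inv (Apar J (Suc n)) - mat 1) \<le> K * e n"
proof -
  have "(\<lambda>n. matrix_inv (Apar J n)) \<longlonglongrightarrow> matrix_inv (mat 1)"
    by (intro tendsto_intros Apar_tendsto) (simp add: invertible_det_nz)
  hence "bounded (range (\<lambda>n. matrix_inv (Apar J n)))"
    by (intro convergent_imp_bounded convergentI)
  then obtain K0 where K0: "\<And>n. norm (matrix_inv (Apar J n)) \<le> K0"
    by (auto simp: bounded_iff)
  define K where "K = max 1 K0"
  have K: "norm (matrix_inv (Apar J (Suc n))) \<le> K" for n using K0[of "Suc n"] by (simp add: K_def)
  have "norm (matrix_inv (Apar J (Suc n)) - mat 1) \<le> K * e n" for n
  proof -
    have "matrix_inv (Apar J (Suc n)) - mat 1 = matrix_inv (Apar J (Suc n)) ** (mat 1 - Apar J (Suc n))"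
      by (simp add: mat_distrib matrix_inv_mult invertible_A)
    also have "norm \<dots> \<le> norm (matrix_inv (Apar J (Suc n))) * norm (mat 1 - Apar J (Suc n))"
      by (rule norm_mat_mult_le)
    also have "\<dots> \<le> K * e n"
      using K[of n] norm_one_minus_A_le[of n] by (intro mult_mono) (auto simp: K_def)
    finally show ?thesis .
  qed
  with K show ?thesis by (intro that[of K]) (auto simp: K_def)
qed

text \<open>Comparison with the free recursion (A = 1, B = 0), in which g is constant and c becomes
  z^2 c + g. The constant does not depend on k, so one majorant serves all shifted matrices.\<close>

lemma jost_step_bounds:
  assumes \<rho>: "\<rho> \<ge> 1"
  obtains K where "K \<ge> 1"
    "\<And>z k n. cmod z \<le> \<rho> \<Longrightarrow> norm (jost_g (jshift k J) z (Suc n) - jost_g (jshift k J) z n)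
       \<le> K * e (n + k) * (norm (jost_g (jshift k J) z n) + norm (jost_c (jshift k J) z n))"
    "\<And>z k n. cmod z \<le> \<rho> \<Longrightarrow> norm (jost_c (jshift k J) z (Suc n)
         - (z\<^sup>2 *\<^sub>m jost_c (jshift k J) z n + jost_g (jshift k J) z n))
       \<le> K * e (n + k) * (norm (jost_g (jshift k J) z n) + norm (jost_c (jshift k J) z n))"
proof -
  obtain K where K: "K \<ge> 1" "\<And>n. norm (matrix_inv (Apar J (Suc n))) \<le> K"
    "\<And>n. norm (matrix_inv (Apar J (Suc n)) - mat 1) \<le> K * e n" using inverse_bound by blast
  have \<rho>1: "1 \<le> \<rho>\<^sup>2" "\<rho> \<le> \<rho>\<^sup>2" using \<rho> by (auto simp: one_le_power self_le_power)
  have z2: "cmod (z\<^sup>2) \<le> \<rho>\<^sup>2" if "cmod z \<le> \<rho>" for z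
    using that by (simp add: norm_power power_mono)
  {
    fix z k n assume z: "cmod z \<le> \<rho>"
    define g c where "g = jost_g (jshift k J) z n" and "c = jost_c (jshift k J) z n"
    define A B where "A = Apar J (Suc (n + k))" and "B = Bpar J (Suc (n + k))"
    define \<epsilon> where "\<epsilon> = e (n + k)"
    have \<epsilon>: "\<epsilon> \<ge> 0" by (simp add: \<epsilon>_def)
    have Ai: "norm (matrix_inv A) \<le> K" "norm (matrix_inv A - mat 1) \<le> K * \<epsilon>"
      using K by (auto simp: A_def \<epsilon>_def)
    have B: "norm B \<le> \<epsilon>" "norm (mat 1 - A ** adj A) \<le> \<epsilon>"
      "norm (B) + norm (mat 1 - A ** adj A) = \<epsilon>"
      using norm_B_le norm_one_minus_AA_le by (auto simp: A_def B_def \<epsilon>_def deviation_def)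
    have t0: "norm (X ** Y) \<le> x * y" if "norm X \<le> x" "norm Y \<le> y"
      for X Y :: "complex^'l^'l" and x y
      using norm_mat_mult_le[of X Y] mult_mono[OF that] that(1) norm_ge_zero[of X] norm_ge_zero[of Y]
      by linarith
    have "jost_g (jshift k J) z (Suc n) - g = (matrix_inv A - mat 1) ** g
        + matrix_inv A ** ((z\<^sup>2 *\<^sub>m (mat 1 - A ** adj A) - z *\<^sub>m B) ** c)"
      by (simp add: g_def c_def A_def B_def mat_distrib)
    also have "norm \<dots> \<le> K * \<epsilon> * norm g + K * (\<rho>\<^sup>2 * \<epsilon> * norm c)"
    proof (intro norm_triangle_mono t0 Ai order_refl)
      have "norm (z\<^sup>2 *\<^sub>m (mat 1 - A ** adj A) - z *\<^sub>m B)
          \<le> cmod (z\<^sup>2) * norm (mat 1 - A ** adj A) + cmod z * norm B"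
        using norm_triangle_ineq4[of "z\<^sup>2 *\<^sub>m (mat 1 - A ** adj A)" "z *\<^sub>m B"]
        by (simp del: norm_power)
      also have "\<dots> \<le> \<rho>\<^sup>2 * norm (mat 1 - A ** adj A) + \<rho>\<^sup>2 * norm B"
        using z2[OF z] z \<rho>1 by (intro add_mono mult_right_mono) auto
      also have "\<dots> = \<rho>\<^sup>2 * \<epsilon>" using B(3) by (simp add: algebra_simps flip: B(3))
      finally show "norm (z\<^sup>2 *\<^sub>m (mat 1 - A ** adj A) - z *\<^sub>m B) \<le> \<rho>\<^sup>2 * \<epsilon>" .
    qed
    also have "\<dots> \<le> 2 * K * \<rho>\<^sup>2 * \<epsilon> * (norm g + norm c)"
    proof -
      have "K * \<epsilon> * norm g \<le> K * \<epsilon> * norm g * \<rho>\<^sup>2"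
        using K(1) \<epsilon> \<rho>1 by (metis mult_left_mono mult.right_neutral mult_nonneg_nonneg norm_ge_zero order_trans zero_le_one)
      moreover have "0 \<le> K * \<epsilon> * norm g * \<rho>\<^sup>2" "0 \<le> K * \<epsilon> * norm c * \<rho>\<^sup>2"
        using K(1) \<epsilon> \<rho>1 by auto
      ultimately show ?thesis by (simp add: algebra_simps)
    qed
    finally have 1: "norm (jost_g (jshift k J) z (Suc n) - g) \<le> 2 * K * \<rho>\<^sup>2 * \<epsilon> * (norm g + norm c)" .
    have "jost_c (jshift k J) z (Suc n) - (z\<^sup>2 *\<^sub>m c + g)
        = (matrix_inv A - mat 1) ** (z\<^sup>2 *\<^sub>m c + g) - matrix_inv A ** ((z *\<^sub>m B) ** c)"
      by (simp add: g_def c_def A_def B_def mat_distrib)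
    also have "norm \<dots> \<le> K * \<epsilon> * (\<rho>\<^sup>2 * norm c + norm g) + K * (\<rho>\<^sup>2 * \<epsilon> * norm c)"
    proof (rule order_trans[OF norm_triangle_ineq4], intro add_mono t0 Ai order_refl norm_triangle_mono)
      show "norm (z\<^sup>2 *\<^sub>m c) \<le> \<rho>\<^sup>2 * norm c" using z2[OF z] by (simp add: mult_right_mono)
      have "cmod z * norm B \<le> \<rho>\<^sup>2 * \<epsilon>" using z \<rho>1 B(1) by (intro mult_mono) auto
      thus "norm (z *\<^sub>m B) \<le> \<rho>\<^sup>2 * \<epsilon>" by simp
    qed
    also have "\<dots> \<le> 2 * K * \<rho>\<^sup>2 * \<epsilon> * (norm g + norm c)"
    proof -
      have "K * \<epsilon> * norm g \<le> K * \<epsilon> * norm g * \<rho>\<^sup>2"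
        using K(1) \<epsilon> \<rho>1 by (metis mult_left_mono mult.right_neutral mult_nonneg_nonneg norm_ge_zero order_trans zero_le_one)
      moreover have "0 \<le> K * \<epsilon> * norm g * \<rho>\<^sup>2" "0 \<le> K * \<epsilon> * norm c * \<rho>\<^sup>2"
        using K(1) \<epsilon> \<rho>1 by auto
      ultimately show ?thesis by (simp add: algebra_simps)
    qed
    finally have 2: "norm (jost_c (jshift k J) z (Suc n) - (z\<^sup>2 *\<^sub>m c + g))
      \<le> 2 * K * \<rho>\<^sup>2 * \<epsilon> * (norm g + norm c)" .
    note 1[unfolded g_def c_def \<epsilon>_def] 2[unfolded g_def c_def \<epsilon>_def]
  }
  \<comment> \<open>K comes from the inverses, the square of \<rho> dominates 1, the modulus of z
    and its square, and the 2 accounts for the two summands of each error.\<close>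
  thus ?thesis using K(1) \<rho>1 by (intro that[of "2 * K * \<rho>\<^sup>2"]) (auto simp: mult_ge1_I intro: mult_ge1_I)
qed

text \<open>The majorant for the k-th shift is a shift of one summable sequence. Summing over n
  gives convergence of g; the vanishing of the tails gives convergence of the shifted Jost functions
  to 1 as k grows.\<close>

definition jost_uniform :: "complex set \<Rightarrow> bool"
  where "jost_uniform X \<longleftrightarrow> (\<exists>\<beta>. summable \<beta> \<and> (\<forall>z\<in>X. \<forall>k n.
    norm (jost_g (jshift k J) z (Suc n) - jost_g (jshift k J) z n) \<le> \<beta> (n + k)))"

text \<open>In the free recursion g stays bounded while c may grow like the solution of W' = r^2 W +
  1. Only g has to converge, so it suffices that the deviations are summable against this
  growth.\<close>

lemma jost_uniform_disk_weighted:
  assumes r: "r \<ge> 1" and W: "\<And>n. W n \<ge> 1" "\<And>n. W (Suc n) \<ge> r\<^sup>2 * W n + 1"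
    and sm: "summable (\<lambda>n. e n * W n)"
  shows "jost_uniform (cball 0 r)"
proof -
  obtain K where K: "K \<ge> 1"
    "\<And>z k n. cmod z \<le> r \<Longrightarrow> norm (jost_g (jshift k J) z (Suc n) - jost_g (jshift k J) z n)
       \<le> K * e (n + k) * (norm (jost_g (jshift k J) z n) + norm (jost_c (jshift k J) z n))"
    "\<And>z k n. cmod z \<le> r \<Longrightarrow> norm (jost_c (jshift k J) z (Suc n)
         - (z\<^sup>2 *\<^sub>m jost_c (jshift k J) z n + jost_g (jshift k J) z n))
       \<le> K * e (n + k) * (norm (jost_g (jshift k J) z n) + norm (jost_c (jshift k J) z n))"
    using jost_step_bounds[OF r] by blast
  have "W n \<le> W (Suc n)" for n
  proof -
    have "W n \<le> r\<^sup>2 * W n" using r W(1)[of n] by (simp add: mult_le_cancel_right1 power_le_one_iff one_le_power)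
    thus ?thesis using W(2)[of n] by linarith
  qed
  hence mono: "W m \<le> W n" if "m \<le> n" for m n using that lift_Suc_mono_le[of W] by blast
  define T where "T = K * (\<Sum>n. e n * W n)"
  define N where "N = norm (mat 1 :: complex^'l^'l)"
  define \<beta> where "\<beta> n = 2 * (K * (e n * W n)) * (N * exp (2 * T))" for n
  have "summable \<beta>" unfolding \<beta>_def by (intro summable_mult summable_mult2 sm)
  moreover have "norm (jost_g (jshift k J) z (Suc n) - jost_g (jshift k J) z n) \<le> \<beta> (n + k)"
    if z: "z \<in> cball 0 r" for z k n
  proof -
    have z': "cmod z \<le> r" using z by simp
    have "norm (jost_g (jshift k J) z (Suc n) - jost_g (jshift k J) z n)
        \<le> 2 * (K * e (n + k)) * W n * (N * exp (2 * T))"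
    proof (rule weighted_gronwall[where q = "r\<^sup>2" and \<kappa> = 1 and y = "jost_c (jshift k J) z" and \<alpha> = "\<lambda>n. K * e (n + k)"])
      show "norm (jost_c (jshift k J) z (Suc m)) \<le> r\<^sup>2 * norm (jost_c (jshift k J) z m)
          + 1 * norm (jost_g (jshift k J) z m)
          + K * e (m + k) * (norm (jost_g (jshift k J) z m) + norm (jost_c (jshift k J) z m))" for m
      proof -
        have "norm (jost_c (jshift k J) z (Suc m)) \<le>
           norm (z\<^sup>2 *\<^sub>m jost_c (jshift k J) z m + jost_g (jshift k J) z m) +
           norm (jost_c (jshift k J) z (Suc m) - (z\<^sup>2 *\<^sub>m jost_c (jshift k J) z m + jost_g (jshift k J) z m))"
          by (metis add_diff_cancel_left' diff_add_cancel norm_triangle_ineq add.commute)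
        moreover have "norm (z\<^sup>2 *\<^sub>m jost_c (jshift k J) z m + jost_g (jshift k J) z m)
            \<le> r\<^sup>2 * norm (jost_c (jshift k J) z m) + norm (jost_g (jshift k J) z m)"
          using z' by (intro norm_triangle_mono) (auto simp: norm_power intro!: mult_right_mono power_mono)
        ultimately show ?thesis using K(3)[OF z', of k m] by simp
      qed
      \<comment> \<open>Since W increases, W i may be replaced by W (i + k); the sum is then part of
        the full series, uniformly in k.\<close>
      show "(\<Sum>i<m. K * e (i + k) * W i) \<le> T" for m
      proof -
        have nn: "0 \<le> e i * W i" for i using W(1)[of i] by simp
        have "(\<Sum>i<m. K * e (i + k) * W i) \<le> K * (\<Sum>i<m. e (i + k) * W (i + k))"
          unfolding sum_distrib_left using K(1) mono
          by (intro sum_mono) (auto simp: mult.assoc intro!: mult_left_mono)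
        also have "(\<Sum>i<m. e (i + k) * W (i + k)) = (\<Sum>i\<in>(\<lambda>i. i + k) ` {..<m}. e i * W i)"
          by (subst sum.reindex) (auto simp: inj_on_def)
        also have "\<dots> \<le> (\<Sum>n. e n * W n)" by (intro sum_le_suminf sm) (auto simp: nn)
        finally show ?thesis using K(1) by (simp add: T_def mult_left_mono)
      qed
      show "norm (jost_c (jshift k J) z 0) \<le> N * W 0"
        using W(1)[of 0] by (simp add: N_def mult_le_cancel_left1)
    qed (use K z' W r in \<open>auto simp: N_def\<close>)
    also have "\<dots> \<le> 2 * (K * e (n + k)) * W (n + k) * (N * exp (2 * T))"
      using K(1) mono[of n "n + k"] by (intro mult_right_mono mult_left_mono) (auto simp: N_def)
    finally show ?thesis by (simp add: \<beta>_def mult_ac)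
  qed
  ultimately show ?thesis unfolding jost_uniform_def by blast
qed

text \<open>Away from \<open>\<plusminus>1\<close> the unperturbed recursion is diagonalizable: \<open>c - g / (1 - z\<^sup>2)\<close> is
  multiplied by \<open>z\<^sup>2\<close>, so no weight is needed.\<close>

lemma jost_uniform_away:
  assumes d: "d > 0"
  shows "jost_uniform {z. cmod z \<le> 1 \<and> d \<le> cmod (1 - z\<^sup>2)}"
proof -
  obtain K where K: "K \<ge> 1"
    "\<And>z k n. cmod z \<le> 1 \<Longrightarrow> norm (jost_g (jshift k J) z (Suc n) - jost_g (jshift k J) z n)
       \<le> K * e (n + k) * (norm (jost_g (jshift k J) z n) + norm (jost_c (jshift k J) z n))"
    "\<And>z k n. cmod z \<le> 1 \<Longrightarrow> norm (jost_c (jshift k J) z (Suc n)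
         - (z\<^sup>2 *\<^sub>m jost_c (jshift k J) z n + jost_g (jshift k J) z n))
       \<le> K * e (n + k) * (norm (jost_g (jshift k J) z n) + norm (jost_c (jshift k J) z n))"
    using jost_step_bounds[of 1] by auto
  \<comment> \<open>D converts between the pairs (g, c) and (g, y), as \<open>s\<close> below is at
    most 1 / d. It enters \<open>K'\<close> twice: once for the conversion and once because the
    error of y combines those of c and of s g.\<close>
  define D where "D = 1 + 1 / d"
  have D: "D \<ge> 1" using d by (simp add: D_def)
  define K' where "K' = K * D * D"
  have K': "K' \<ge> 1" "K * D \<le> K'" using K(1) D mult_mono[of 1 "K * D" 1 D] by (auto simp: K'_def mult_ge1_I)
  define T where "T = K' * (\<Sum>n. e n)"
  define N where "N = D * norm (mat 1 :: complex^'l^'l)"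
  define \<beta> where "\<beta> n = 2 * (K' * e n) * (N * exp (2 * T))" for n
  have "summable \<beta>" unfolding \<beta>_def by (intro summable_mult summable_mult2 summable_e)
  moreover have "norm (jost_g (jshift k J) z (Suc n) - jost_g (jshift k J) z n) \<le> \<beta> (n + k)"
    if z: "cmod z \<le> 1" "d \<le> cmod (1 - z\<^sup>2)" for z k n
  proof -
    define s where "s = inverse (1 - z\<^sup>2)"
    have nz: "1 - z\<^sup>2 \<noteq> 0" using z(2) d by auto
    have s: "cmod s \<le> 1 / d" using z(2) d nz by (simp add: s_def norm_inverse norm_divide divide_simps)
    \<comment> \<open>\<open>s\<close> is the fixed point of x -> z^2 x + 1, so the pair (g, s g) is
      stationary under the free recursion and y = c - s g is its other, nonexpanding mode.\<close>
    have s1: "s = z\<^sup>2 * s + 1" using nz by (simp add: s_def field_simps)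
    define g c where "g = jost_g (jshift k J) z" and "c = jost_c (jshift k J) z"
    define y where "y m = c m - s *\<^sub>m g m" for m
    have cb: "norm (g m) + norm (c m) \<le> D * (norm (g m) + norm (y m))" for m
    proof -
      have "norm (c m) \<le> norm (y m) + cmod s * norm (g m)"
        using norm_triangle_ineq[of "y m" "s *\<^sub>m g m"] by (simp add: y_def)
      also have "cmod s * norm (g m) \<le> 1 / d * norm (g m)" using s by (intro mult_right_mono) auto
      finally have "norm (g m) + norm (c m) \<le> D * norm (g m) + norm (y m)" by (simp add: D_def algebra_simps)
      moreover have "norm (y m) \<le> D * norm (y m)" using D by (simp add: mult_le_cancel_right1)
      ultimately show ?thesis by (simp add: algebra_simps)
    qed
    have b: "K * e (m + k) * (norm (g m) + norm (c m)) \<le> K * D * e (m + k) * (norm (g m) + norm (y m))" for m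
      using mult_left_mono[OF cb[of m], of "K * e (m + k)"] K(1) by (simp add: mult_ac)
    have e1: "norm (g (Suc m) - g m) \<le> K * D * e (m + k) * (norm (g m) + norm (y m))" for m
      using K(2)[OF z(1), of k m] b[of m] by (simp add: g_def c_def)
    have e2: "norm (c (Suc m) - (z\<^sup>2 *\<^sub>m c m + g m)) \<le> K * D * e (m + k) * (norm (g m) + norm (y m))" for m
      using K(3)[OF z(1), of k m] b[of m] by (simp add: g_def c_def)
    have "norm (g (Suc n) - g n) \<le> 2 * (K' * e (n + k)) * 1 * (N * exp (2 * T))"
    proof (rule weighted_gronwall[where q = 1 and \<kappa> = 0 and y = y and \<alpha> = "\<lambda>n. K' * e (n + k)" and W = "\<lambda>_. 1"])
      show "norm (g (Suc m) - g m) \<le> K' * e (m + k) * (norm (g m) + norm (y m))" for m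
        using e1[of m] mult_right_mono[OF K'(2), of "e (m + k) * (norm (g m) + norm (y m))"]
        by (simp add: mult.assoc)
      show "norm (y (Suc m)) \<le> 1 * norm (y m) + 0 * norm (g m) + K' * e (m + k) * (norm (g m) + norm (y m))" for m
      proof -
        define q where "q = K * D * e (m + k) * (norm (g m) + norm (y m))"
        have q: "q \<ge> 0" using K(1) D by (auto simp: q_def)
        have "z\<^sup>2 * s = s - 1" using s1 by (simp add: algebra_simps)
        hence "(z\<^sup>2 * s) *\<^sub>m g m = s *\<^sub>m g m - g m" by (simp add: smult_mat_diff_left)
        hence "y (Suc m) = z\<^sup>2 *\<^sub>m y m + ((c (Suc m) - (z\<^sup>2 *\<^sub>m c m + g m)) - s *\<^sub>m (g (Suc m) - g m))"
          by (simp add: y_def smult_mat_diff_right)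
        hence "norm (y (Suc m)) \<le> norm (z\<^sup>2 *\<^sub>m y m) +
            (norm (c (Suc m) - (z\<^sup>2 *\<^sub>m c m + g m)) + norm (s *\<^sub>m (g (Suc m) - g m)))"
          by (simp only:) (rule norm_triangle_mono[OF order_refl norm_triangle_ineq4])
        also have "norm (z\<^sup>2 *\<^sub>m y m) \<le> norm (y m)"
          using z(1) by (simp add: norm_power mult_left_le_one_le power_le_one)
        also have "norm (s *\<^sub>m (g (Suc m) - g m)) \<le> 1 / d * q"
          unfolding norm_smult_mat q_def using s e1[of m] d by (intro mult_mono) auto
        finally have "norm (y (Suc m)) \<le> norm (y m) + D * q"
          using e2[of m, folded q_def] by (simp add: D_def distrib_right)
        thus ?thesis by (simp add: q_def K'_def mult_ac)
      qed
      show "(\<Sum>i<m. K' * e (i + k) * 1) \<le> T" for m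
      proof -
        have "(\<Sum>i<m. K' * e (i + k) * 1) = K' * (\<Sum>i<m. e (i + k))" by (simp add: sum_distrib_left)
        also have "(\<Sum>i<m. e (i + k)) = (\<Sum>i\<in>(\<lambda>i. i + k) ` {..<m}. e i)"
          by (subst sum.reindex) (auto simp: inj_on_def)
        also have "\<dots> \<le> (\<Sum>n. e n)" by (intro sum_le_suminf summable_e) auto
        finally show ?thesis using K' by (simp add: T_def mult_left_mono)
      qed
      have "norm (y 0) \<le> norm (mat 1 :: complex^'l^'l) + cmod s * norm (mat 1 :: complex^'l^'l)"
        using norm_triangle_ineq4[of "mat 1 :: complex^'l^'l" "s *\<^sub>m mat 1"] by (simp add: y_def g_def c_def)
      also have "cmod s * norm (mat 1 :: complex^'l^'l) \<le> 1 / d * norm (mat 1 :: complex^'l^'l)"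
        using s by (intro mult_right_mono) auto
      finally show "norm (y 0) \<le> N * 1" by (simp add: N_def D_def algebra_simps)
      show "norm (g 0) \<le> N" using D by (simp add: g_def N_def mult_le_cancel_right1)
    qed (use K' in auto)
    thus ?thesis by (simp add: \<beta>_def g_def mult_ac)
  qed
  ultimately show ?thesis unfolding jost_uniform_def by blast
qed

text \<open>At z = 1 and z = -1 the free c grows linearly; with this weight the required summability
  is the first moment condition.\<close>

lemma jost_uniform_closed_disk:
  assumes "cond_A2 J"
  shows "jost_uniform (cball 0 1)"
proof (rule jost_uniform_disk_weighted[where W = "\<lambda>n. real (Suc n)"])
  show "summable (\<lambda>n. e n * real (Suc n))"
    using assms by (simp add: cond_A2_def mult.commute)
qed auto

text \<open>The weight D * \<rho>^(2n), with \<rho> strictly between r' and R, outgrows the free c,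
  and the deviations still beat it by the ratio (\<rho> / R)^2. D is large enough for the gap
  \<rho>^2 - r'^2 to absorb the inhomogeneous 1.\<close>

lemma jost_uniform_large_disk:
  assumes A3: "cond_A3 J R" and r: "r < R"
  shows "jost_uniform (cball 0 r)"
proof -
  define r' where "r' = max 1 r"
  define \<rho> where "\<rho> = (r' + R) / 2"
  have R: "R > 1" using A3 by (simp add: cond_A3_def)
  have r': "r' \<ge> 1" "r \<le> r'" "r' < \<rho>" "\<rho> < R" using R r by (auto simp: r'_def \<rho>_def)
  obtain C where C: "\<And>n. n \<ge> 1 \<Longrightarrow> deviation J n \<le> C * R powi (- 2 * int n)"
    using A3 by (auto simp: cond_A3_def)
  define D where "D = max 1 (1 / (\<rho>\<^sup>2 - r'\<^sup>2))"
  have pos: "\<rho>\<^sup>2 - r'\<^sup>2 > 0" using r' by (simp add: power_strict_mono)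
  have D: "D \<ge> 1" "D * (\<rho>\<^sup>2 - r'\<^sup>2) \<ge> 1"
    using pos by (auto simp: D_def max_def divide_simps)
  have "jost_uniform (cball 0 r')"
  proof (rule jost_uniform_disk_weighted[where W = "\<lambda>n. D * (\<rho>\<^sup>2) ^ n"])
    have p1: "(\<rho>\<^sup>2) ^ n \<ge> 1" for n using r' by (simp add: one_le_power)
    show "1 \<le> D * (\<rho>\<^sup>2) ^ n" for n using D(1) p1[of n] by (rule mult_ge1_I)
    show "r'\<^sup>2 * (D * (\<rho>\<^sup>2) ^ n) + 1 \<le> D * (\<rho>\<^sup>2) ^ Suc n" for n
    proof -
      have "1 \<le> (D * (\<rho>\<^sup>2 - r'\<^sup>2)) * (\<rho>\<^sup>2) ^ n" using D(2) p1[of n] by (rule mult_ge1_I)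
      thus ?thesis by (simp add: algebra_simps)
    qed
    have "summable (\<lambda>n. C * D / R\<^sup>2 * ((\<rho> / R)\<^sup>2) ^ n)"
      using r' R by (intro summable_mult summable_geometric) (simp add: power_less_one_iff abs_square_less_1)
    moreover have "norm (e n * (D * (\<rho>\<^sup>2) ^ n)) \<le> C * D / R\<^sup>2 * ((\<rho> / R)\<^sup>2) ^ n" for n
    proof -
      have "R powi (- 2 * int (Suc n)) = 1 / (R\<^sup>2 * (R\<^sup>2) ^ n)"
        using R by (simp add: power_int_def nat_mult_distrib power_mult[symmetric] inverse_eq_divide)
           (simp add: power_add[symmetric] nat_add_distrib nat_mult_distrib algebra_simps power_one_over power2_eq_square)
      hence "e n \<le> C / (R\<^sup>2 * (R\<^sup>2) ^ n)" using C[of "Suc n"] by simp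
      hence "e n * (D * (\<rho>\<^sup>2) ^ n) \<le> C / (R\<^sup>2 * (R\<^sup>2) ^ n) * (D * (\<rho>\<^sup>2) ^ n)"
        using D(1) by (intro mult_right_mono) auto
      also have "\<dots> = C * D / R\<^sup>2 * ((\<rho> / R)\<^sup>2) ^ n" by (simp add: power_divide power_mult_distrib)
      finally show ?thesis using D(1) by simp
    qed
    ultimately show "summable (\<lambda>n. e n * (D * (\<rho>\<^sup>2) ^ n))"
      by (rule summable_comparison_test'[where N = 0])
  qed (use r' in auto)
  thus ?thesis unfolding jost_uniform_def using r'(2) by fastforce
qed

end

section \<open>Continuity and holomorphy of the limits\<close>

declare jost_c.simps(2) [simp del] jost_g.simps(2) [simp del]

lemma mat_holo_jost_polynomials:
  "mat_holo (\<lambda>z. jost_c J z n) UNIV \<and> mat_holo (\<lambda>z. jost_g J z n) UNIV"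
  by (induction n) (auto simp: jost_c.simps jost_g.simps intro!: mat_holo_intros holomorphic_intros)

text \<open>All shifts are included because the n-th Jost solution is built from the n-th shifted
  matrix. Holomorphy is stated on open subsets since X itself may be closed.\<close>

definition jost_good :: "'l::finite block_jacobi \<Rightarrow> complex set \<Rightarrow> bool"
  where "jost_good J X \<longleftrightarrow>
    (\<forall>k. \<forall>z\<in>X. jost_g (jshift k J) z \<longlonglongrightarrow> jost (jshift k J) z) \<and>
    (\<forall>k. continuous_on X (jost (jshift k J))) \<and>
    (\<forall>k V. open V \<longrightarrow> V \<subseteq> X \<longrightarrow> mat_holo (jost (jshift k J)) V) \<and>
    uniform_limit X (\<lambda>k. jost (jshift k J)) (\<lambda>_. mat 1) sequentially"

text \<open>The Weierstrass test applies to the telescoped polynomials; the tails of the majorant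
  give the uniform limit in k.\<close>

lemma (in type1_jacobi) jost_good_if_uniform:
  assumes "jost_uniform X"
  shows "jost_good J X"
proof -
  obtain \<beta> where \<beta>: "summable \<beta>" and bd: "\<And>z k n. z \<in> X \<Longrightarrow>
      norm (jost_g (jshift k J) z (Suc n) - jost_g (jshift k J) z n) \<le> \<beta> (n + k)"
    using assms by (auto simp: jost_uniform_def)
  define f where "f k i z = jost_g (jshift k J) z (Suc i) - jost_g (jshift k J) z i" for k i z
  have tel: "jost_g (jshift k J) z n = mat 1 + (\<Sum>i<n. f k i z)" for k n z
    by (simp add: f_def sum_lessThan_telescope)
  have \<beta>k: "summable (\<lambda>n. \<beta> (n + k))" for k
    using \<beta> by (simp add: summable_iff_shift)
  have ul0: "uniform_limit X (\<lambda>n z. \<Sum>i<n. f k i z) (\<lambda>z. \<Sum>i. f k i z) sequentially" for k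
    by (rule Weierstrass_m_test[OF _ \<beta>k[of k]]) (simp add: f_def bd)
  have ul1: "uniform_limit X (\<lambda>n z. mat 1 + (\<Sum>i<n. f k i z)) (\<lambda>z. mat 1 + (\<Sum>i. f k i z)) sequentially" for k
    by (intro uniform_limit_intros ul0)
  have lim: "jost_g (jshift k J) z \<longlonglongrightarrow> mat 1 + (\<Sum>i. f k i z)" if "z \<in> X" for k z
    using tendsto_uniform_limitI[OF ul1[of k] that] tel[of k z] by presburger
  have jost: "jost (jshift k J) z = mat 1 + (\<Sum>i. f k i z)" if "z \<in> X" for k z
    using limI[OF lim[OF that]] by (simp add: jost_def)
  have ul: "uniform_limit X (\<lambda>n z. jost_g (jshift k J) z n) (jost (jshift k J)) sequentially" for k
    using ul1[of k] by (rule uniform_limit_cong[THEN iffD1, rotated -1]) (auto simp: tel jost)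
  have holo: "mat_holo (\<lambda>z. jost_g (jshift k J) z n) UNIV" for k n
    using mat_holo_jost_polynomials by blast
  have "continuous_on X (jost (jshift k J))" for k
    by (rule uniform_limit_theorem[OF _ ul])
       (auto intro!: always_eventually continuous_on_subset[OF mat_holo_continuous[OF holo]])
  moreover have "mat_holo (jost (jshift k J)) V" if V: "open V" "V \<subseteq> X" for k V
    unfolding mat_holo_def
  proof (intro allI, rule holomorphic_uniform_sequence[OF V(1)])
    fix i j
    show "(\<lambda>z. jost_g (jshift k J) z n $ i $ j) holomorphic_on V" for n
      using mat_holo_subset[OF holo[of k n] subset_UNIV, of V] by (simp add: mat_holo_def)
    fix x assume "x \<in> V"
    then obtain d where d: "d > 0" "cball x d \<subseteq> V" using V(1) open_contains_cball by blast
    have "uniform_limit (cball x d) (\<lambda>n z. jost_g (jshift k J) z n $ i $ j) (\<lambda>z. jost (jshift k J) z $ i $ j) sequentially"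
      by (intro bounded_linear.uniform_limit[OF bounded_linear_vec_nth] uniform_limit_on_subset[OF ul]) (use d V in auto)
    with d show "\<exists>d>0. cball x d \<subseteq> V \<and> uniform_limit (cball x d)
        (\<lambda>n z. jost_g (jshift k J) z n $ i $ j) (\<lambda>z. jost (jshift k J) z $ i $ j) sequentially" by blast
  qed
  moreover have "uniform_limit X (\<lambda>k. jost (jshift k J)) (\<lambda>_. mat 1) sequentially"
  proof (rule uniform_limitI)
    fix \<epsilon> :: real assume "\<epsilon> > 0"
    have "(\<lambda>k. suminf \<beta> - (\<Sum>i<k. \<beta> i)) \<longlonglongrightarrow> suminf \<beta> - suminf \<beta>"
      by (intro tendsto_intros summable_LIMSEQ \<beta>)
    hence "(\<lambda>k. \<Sum>n. \<beta> (n + k)) \<longlonglongrightarrow> 0"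
      by (simp add: suminf_minus_initial_segment[OF \<beta>])
    hence "\<forall>\<^sub>F k in sequentially. (\<Sum>n. \<beta> (n + k)) < \<epsilon>" using \<open>\<epsilon> > 0\<close> by (rule order_tendstoD)
    thus "\<forall>\<^sub>F k in sequentially. \<forall>z\<in>X. dist (jost (jshift k J) z) (mat 1) < \<epsilon>"
    proof eventually_elim
      case (elim k)
      have "norm (\<Sum>i. f k i z) \<le> (\<Sum>n. \<beta> (n + k))" if "z \<in> X" for z
        by (rule norm_suminf_le[OF _ \<beta>k]) (simp add: f_def bd that)
      thus ?case using elim by (force simp: dist_norm jost)
    qed
  qed
  ultimately show ?thesis using lim jost unfolding jost_good_def by simp
qed

section \<open>Transfer from type 1 by a unitary gauge\<close>

lemma unitary_cancel:
  assumes "unitary U"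
  shows "U ** adj U = mat 1" "adj U ** U = mat 1" "X ** U ** adj U = X" "X ** adj U ** U = X"
  using assms by (auto simp: unitary_def matrix_mul_assoc[symmetric])

text \<open>The left factor has the running index, so it must converge for the Jost function to
  exist; the right factor stays at the starting index of the shifted matrix.\<close>

lemma jost_gauge:
  fixes J J' :: "'l::finite block_jacobi"
  assumes \<sigma>: "\<And>n. n \<ge> 1 \<Longrightarrow> unitary (\<sigma> n)"
    and inv: "\<And>n. n \<ge> 1 \<Longrightarrow> invertible (Apar J n)"
    and A': "\<And>n. n \<ge> 1 \<Longrightarrow> Apar J' n = adj (\<sigma> n) ** Apar J n ** \<sigma> (n + 1)"
    and B': "\<And>n. n \<ge> 1 \<Longrightarrow> Bpar J' n = adj (\<sigma> n) ** Bpar J n ** \<sigma> n"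
  shows "jost_c (jshift k J) z n = \<sigma> (n + k + 1) ** jost_c (jshift k J') z n ** adj (\<sigma> (k + 1)) \<and>
    jost_g (jshift k J) z n = \<sigma> (n + k + 1) ** jost_g (jshift k J') z n ** adj (\<sigma> (k + 1))"
proof (induction n)
  case 0
  show ?case using unitary_cancel(1)[OF \<sigma>[of "Suc k"]] by simp
next
  case (Suc n)
  define S S' \<tau> where "S = \<sigma> (Suc (n + k))" and "S' = \<sigma> (Suc (Suc (n + k)))" and "\<tau> = adj (\<sigma> (Suc k))"
  define A B where "A = Apar J (Suc (n + k))" and "B = Bpar J (Suc (n + k))"
  define c g where "c = jost_c (jshift k J') z n" and "g = jost_g (jshift k J') z n"
  have U: "unitary S" "unitary S'" using \<sigma> by (auto simp: S_def S'_def)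
  have invA: "invertible A" using inv by (simp add: A_def)
  have A1: "Apar J' (Suc (n + k)) = adj S ** A ** S'" and B1: "Bpar J' (Suc (n + k)) = adj S ** B ** S"
    using A'[of "Suc (n + k)"] B'[of "Suc (n + k)"] by (auto simp: S_def S'_def A_def B_def)
  have Ai: "matrix_inv (adj S ** A ** S') = adj S' ** matrix_inv A ** S"
    by (rule matrix_inv_unique) (simp add: matrix_mul_assoc unitary_cancel[OF U(1)] unitary_cancel[OF U(2)] invA)
  have IH: "jost_c (jshift k J) z n = S ** c ** \<tau>" "jost_g (jshift k J) z n = S ** g ** \<tau>"
    using Suc by (simp_all add: S_def c_def g_def \<tau>_def)
  show ?case
    unfolding jost_c.simps jost_g.simps IH
    by (simp add: A1 B1 Ai A_def[symmetric] B_def[symmetric] S'_def[symmetric] c_def[symmetric]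
        g_def[symmetric] \<tau>_def[symmetric] mat_distrib matrix_mul_assoc unitary_cancel[OF U(1)] unitary_cancel[OF U(2)])
qed

locale jacobi_asymptotic =
  fixes J :: "'l::finite block_jacobi"
  assumes jacobi: "is_block_jacobi J" and asymp: "asymptotic_to_type1 J" and A1: "cond_A1 J"
begin

text \<open>L is the limit of the unitaries. The deviations agree exactly since the Frobenius norm
  is unitarily invariant, so each decay condition passes to the type 1 representative.\<close>

definition gauge_to :: "'l block_jacobi \<Rightarrow> (nat \<Rightarrow> complex^'l^'l) \<Rightarrow> complex^'l^'l \<Rightarrow> bool"
  where "gauge_to J' \<sigma> L \<longleftrightarrow> type1_jacobi J' \<and> unitary L \<and> \<sigma> \<longlonglongrightarrow> L \<and>
    (\<forall>n\<ge>1. unitary (\<sigma> n) \<and> Apar J n = \<sigma> n ** Apar J' n ** adj (\<sigma> (n + 1)) \<and>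
      deviation J' n = deviation J n) \<and>
    (\<forall>X. jost_good J' X \<longrightarrow> jost_good J X \<and>
      (\<forall>k. \<forall>z\<in>X. jost (jshift k J) z = L ** jost (jshift k J') z ** adj (\<sigma> (k + 1))))"

lemma gauge:
  obtains J' \<sigma> L where "gauge_to J' \<sigma> L"
proof -
  obtain J' \<sigma> where J': "is_block_jacobi J'" "type1 J'" and u: "\<And>n. n \<ge> 1 \<Longrightarrow> unitary (\<sigma> n)"
    and A': "\<And>n. n \<ge> 1 \<Longrightarrow> Apar J' n = adj (\<sigma> n) ** Apar J n ** \<sigma> (n + 1)"
    and B': "\<And>n. n \<ge> 1 \<Longrightarrow> Bpar J' n = adj (\<sigma> n) ** Bpar J n ** \<sigma> n"
    and conv: "convergent \<sigma>"
    using asymp unfolding asymptotic_to_type1_def asymptotic_def by metis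
  obtain L where L: "\<sigma> \<longlonglongrightarrow> L" using conv by (auto simp: convergent_def)
  have inv: "invertible (Apar J n)" if "n \<ge> 1" for n
    using jacobi that by (simp add: is_block_jacobi_def)
  have uL: "unitary L"
  proof -
    have ev: "\<forall>\<^sub>F n in sequentially. unitary (\<sigma> n)"
      using u eventually_at_top_linorder by blast
    have "(\<lambda>n. \<sigma> n ** adj (\<sigma> n)) \<longlonglongrightarrow> L ** adj L" "(\<lambda>n. adj (\<sigma> n) ** \<sigma> n) \<longlonglongrightarrow> adj L ** L"
      by (intro tendsto_intros L)+
    moreover have "(\<lambda>n. \<sigma> n ** adj (\<sigma> n)) \<longlonglongrightarrow> mat 1" "(\<lambda>n. adj (\<sigma> n) ** \<sigma> n) \<longlonglongrightarrow> mat 1"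
      using ev by (auto intro!: tendsto_eventually elim!: eventually_mono simp: unitary_def)
    ultimately have "L ** adj L = mat 1" "adj L ** L = mat 1" by (auto intro: LIMSEQ_unique)
    thus ?thesis by (simp add: unitary_def)
  qed
  have A: "Apar J n = \<sigma> n ** Apar J' n ** adj (\<sigma> (n + 1))" if "n \<ge> 1" for n
    using that u[of n] u[of "n + 1"] by (simp add: A' matrix_mul_assoc unitary_cancel)
  have dev: "deviation J' n = deviation J n" if n: "n \<ge> 1" for n
  proof -
    have "norm (Bpar J' n) = norm (Bpar J n)"
      using u[OF n] by (simp add: B'[OF n] norm_unitary_mult)
    moreover have "mat 1 - Apar J' n ** adj (Apar J' n) = adj (\<sigma> n) ** (mat 1 - Apar J n ** adj (Apar J n)) ** \<sigma> n"
      using u[OF n] u[of "n + 1"] by (simp add: A'[OF n] mat_distrib matrix_mul_assoc unitary_cancel)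
    ultimately show ?thesis using u[OF n] by (simp add: deviation_def norm_unitary_mult)
  qed
  have "cond_A1 J'" using A1 by (simp add: cond_A1_def dev)
  with J' interpret T: type1_jacobi J' by unfold_locales
  have gg: "jost_g (jshift k J) z n = \<sigma> (n + k + 1) ** jost_g (jshift k J') z n ** adj (\<sigma> (k + 1))" for k z n
    using jost_gauge[of \<sigma> J J', OF u inv A' B'] by blast
  have lim: "jost_g (jshift k J) z \<longlonglongrightarrow> L ** jost (jshift k J') z ** adj (\<sigma> (k + 1))"
    if "jost_good J' X" "z \<in> X" for X k z
  proof -
    have "(\<lambda>n. \<sigma> (n + (k + 1))) \<longlonglongrightarrow> L" using L by (rule LIMSEQ_ignore_initial_segment)
    moreover have "jost_g (jshift k J') z \<longlonglongrightarrow> jost (jshift k J') z"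
      using that by (simp add: jost_good_def)
    ultimately have "(\<lambda>n. \<sigma> (n + (k + 1)) ** jost_g (jshift k J') z n ** adj (\<sigma> (k + 1)))
        \<longlonglongrightarrow> L ** jost (jshift k J') z ** adj (\<sigma> (k + 1))" by (intro tendsto_intros)
    thus ?thesis by (simp add: gg fun_eq_iff[THEN iffD2, OF allI[OF gg]] add.assoc)
  qed
  have jj: "jost (jshift k J) z = L ** jost (jshift k J') z ** adj (\<sigma> (k + 1))"
    if "jost_good J' X" "z \<in> X" for X k z
    using limI[OF lim[OF that]] by (simp add: jost_def)
  have good: "jost_good J X" if g: "jost_good J' X" for X
    unfolding jost_good_def
  proof (intro conjI allI ballI impI)
    fix k z assume "z \<in> X"
    thus "jost_g (jshift k J) z \<longlonglongrightarrow> jost (jshift k J) z" using lim[OF g] jj[OF g] by simp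
  next
    fix k
    have "continuous_on X (\<lambda>z. L ** jost (jshift k J') z ** adj (\<sigma> (k + 1)))"
      using g by (intro continuous_intros) (auto simp: jost_good_def)
    thus "continuous_on X (jost (jshift k J))" using jj[OF g] by simp
  next
    fix k V assume V: "open V" "V \<subseteq> X"
    have "mat_holo (\<lambda>z. L ** jost (jshift k J') z ** adj (\<sigma> (k + 1))) V"
      using g V by (intro mat_holo_intros) (auto simp: jost_good_def)
    thus "mat_holo (jost (jshift k J)) V"
      unfolding mat_holo_def
    proof (intro allI)
      fix i j
      have "(\<lambda>z. (L ** jost (jshift k J') z ** adj (\<sigma> (k + 1))) $ i $ j) holomorphic_on V"
        using \<open>mat_holo _ V\<close> by (simp add: mat_holo_def)
      thus "(\<lambda>z. jost (jshift k J) z $ i $ j) holomorphic_on V"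
        by (rule holomorphic_transform) (use jj[OF g] V in auto)
    qed
  next
    show "uniform_limit X (\<lambda>k. jost (jshift k J)) (\<lambda>_. mat 1) sequentially"
    proof (rule uniform_limitI)
      fix \<epsilon> :: real assume \<epsilon>: "\<epsilon> > 0"
      \<comment> \<open>The left and right gauge factors of the k-th shifted Jost function cancel
        only in the limit; this replaces the limit 1 by L times its adjoint.\<close>
      have "(\<lambda>k. L ** adj (\<sigma> (k + 1))) \<longlonglongrightarrow> L ** adj L"
        using LIMSEQ_ignore_initial_segment[OF L, of 1] by (intro tendsto_intros)
      hence 1: "\<forall>\<^sub>F k in sequentially. dist (L ** adj (\<sigma> (k + 1))) (mat 1) < \<epsilon> / 2"
        using \<epsilon> uL by (intro tendstoD) (auto simp: unitary_def)
      have 2: "\<forall>\<^sub>F k in sequentially. \<forall>z\<in>X. dist (jost (jshift k J') z) (mat 1) < \<epsilon> / 2"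
        using g \<epsilon> by (auto simp: jost_good_def dest!: uniform_limitD[where e = "\<epsilon> / 2"])
      from 1 2 show "\<forall>\<^sub>F k in sequentially. \<forall>z\<in>X. dist (jost (jshift k J) z) (mat 1) < \<epsilon>"
      proof eventually_elim
        case (elim k)
        show ?case
        proof
          fix z assume z: "z \<in> X"
          have "jost (jshift k J) z - mat 1 = L ** (jost (jshift k J') z - mat 1) ** adj (\<sigma> (k + 1)) + (L ** adj (\<sigma> (k + 1)) - mat 1)"
            by (simp add: jj[OF g z] mat_distrib)
          hence "norm (jost (jshift k J) z - mat 1) \<le> norm (L ** (jost (jshift k J') z - mat 1) ** adj (\<sigma> (k + 1)))
              + norm (L ** adj (\<sigma> (k + 1)) - mat 1)" by (simp only: norm_triangle_ineq)
          also have "norm (L ** (jost (jshift k J') z - mat 1) ** adj (\<sigma> (k + 1))) = norm (jost (jshift k J') z - mat 1)"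
            using uL u[of "k + 1"] by (simp add: norm_unitary_mult)
          finally show "dist (jost (jshift k J) z) (mat 1) < \<epsilon>"
            using elim z by (force simp: dist_norm)
        qed
      qed
    qed
  qed
  have "gauge_to J' \<sigma> L"
    unfolding gauge_to_def using T.type1_jacobi_axioms uL L u A dev jj good by blast
  thus ?thesis by (rule that)
qed

lemma invertible_A: "n \<ge> 1 \<Longrightarrow> invertible (Apar J n)"
  and adj_B: "n \<ge> 1 \<Longrightarrow> adj (Bpar J n) = Bpar J n"
  and Apar_0 [simp]: "Apar J 0 = mat 1"
  using jacobi by (auto simp: is_block_jacobi_def hermitian_def)

lemma invertible_A' [simp]: "invertible (Apar J n)"
  using invertible_A[of n] by (cases n) (auto simp: invertible_det_nz)

lemma Apar_tendsto: "Apar J \<longlonglongrightarrow> mat 1"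
proof -
  obtain J' \<sigma> L where "gauge_to J' \<sigma> L" by (rule gauge)
  hence g: "type1_jacobi J'" "unitary L" "\<sigma> \<longlonglongrightarrow> L"
    "\<And>n. n \<ge> 1 \<Longrightarrow> Apar J n = \<sigma> n ** Apar J' n ** adj (\<sigma> (n + 1))"
    by (auto simp: gauge_to_def)
  have "(\<lambda>n. \<sigma> n ** Apar J' n ** adj (\<sigma> (n + 1))) \<longlonglongrightarrow> L ** mat 1 ** adj L"
    using LIMSEQ_ignore_initial_segment[OF g(3), of 1] g(1,3) type1_jacobi.Apar_tendsto
    by (intro tendsto_intros)
  hence "(\<lambda>n. \<sigma> n ** Apar J' n ** adj (\<sigma> (n + 1))) \<longlonglongrightarrow> mat 1"
    using g(2) by (simp add: unitary_def)
  thus ?thesis by (rule Lim_transform_eventually) (auto simp: eventually_at_top_linorder g(4) intro!: exI[of _ 1])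
qed

lemma good_away:
  assumes "d > 0"
  shows "jost_good J {z. cmod z \<le> 1 \<and> d \<le> cmod (1 - z\<^sup>2)}"
proof -
  obtain J' \<sigma> L where g: "gauge_to J' \<sigma> L" by (rule gauge)
  hence "type1_jacobi J'" by (simp add: gauge_to_def)
  thus ?thesis using g assms type1_jacobi.jost_uniform_away type1_jacobi.jost_good_if_uniform
    unfolding gauge_to_def by blast
qed

lemma good_closed_disk:
  assumes "cond_A2 J"
  shows "jost_good J (cball 0 1)"
proof -
  obtain J' \<sigma> L where g: "gauge_to J' \<sigma> L" by (rule gauge)
  hence t: "type1_jacobi J'" by (simp add: gauge_to_def)
  have "cond_A2 J'" using assms g by (simp add: cond_A2_def gauge_to_def)
  thus ?thesis using g t type1_jacobi.jost_uniform_closed_disk type1_jacobi.jost_good_if_uniform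
    unfolding gauge_to_def by blast
qed

lemma good_large_disk:
  assumes "cond_A3 J R" "r < R"
  shows "jost_good J (cball 0 r)"
proof -
  obtain J' \<sigma> L where g: "gauge_to J' \<sigma> L" by (rule gauge)
  hence t: "type1_jacobi J'" by (simp add: gauge_to_def)
  have "cond_A3 J' R" using assms g by (auto simp: cond_A3_def gauge_to_def)
  thus ?thesis using g t assms type1_jacobi.jost_uniform_large_disk type1_jacobi.jost_good_if_uniform
    unfolding gauge_to_def by blast
qed

end

section \<open>The recurrence, Green's formula and Wronskians\<close>

text \<open>All three families obey the same recursion with coefficients multiplied from the left,
  so a relation with constant right factors P and Q only has to be checked at the start. Its limit
  in n is the recurrence for the Jost solution.\<close>

lemma jost_polynomials_shift:
  fixes J :: "'l::finite block_jacobi" and z :: complex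
  assumes A: "invertible (Apar J 1)" "invertible (Apar J 2)"
  defines "P \<equiv> matrix_inv (Apar J 1) ** ((1 + z\<^sup>2) *\<^sub>m mat 1 - z *\<^sub>m Bpar J 1)"
    and "Q \<equiv> matrix_inv (Apar J 2) ** adj (Apar J 1)"
  shows "jost_c J z (Suc (Suc n)) = jost_c (jshift 1 J) z (Suc n) ** P - z\<^sup>2 *\<^sub>m (jost_c (jshift 2 J) z n ** Q) \<and>
    jost_g J z (Suc (Suc n)) = jost_g (jshift 1 J) z (Suc n) ** P - z\<^sup>2 *\<^sub>m (jost_g (jshift 2 J) z n ** Q)"
proof (induction n)
  case 0
  have c1: "jost_c J z (Suc 0) = P"
    by (simp add: P_def jost_c.simps mat_distrib smult_mat_add_left)
  have g1: "jost_g J z (Suc 0) = P - z\<^sup>2 *\<^sub>m adj (Apar J 1)"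
    using A by (simp add: P_def jost_g.simps mat_distrib smult_mat_add_left matrix_mul_assoc matrix_inv_mult)
  have 2: "Suc (Suc 0) = 2" by simp
  show ?case
    unfolding jost_c.simps(2)[of J z "Suc 0"] jost_g.simps(2)[of J z "Suc 0"] c1 g1
    unfolding jost_c.simps jost_g.simps 2
    by (simp add: Q_def mat_distrib matrix_mul_assoc 2)
next
  case (Suc n)
  have i: "Suc (Suc (Suc n)) = Suc (Suc n) + 1" "Suc (Suc n) + 1 = Suc n + 2" "Suc n + 2 = Suc (Suc (Suc n))" by auto
  show ?case
    unfolding jost_c.simps(2)[of J z "Suc (Suc n)"] jost_g.simps(2)[of J z "Suc (Suc n)"]
      jost_c.simps(2)[of "jshift 1 J" z "Suc n"] jost_g.simps(2)[of "jshift 1 J" z "Suc n"]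
      jost_c.simps(2)[of "jshift 2 J" z n] jost_g.simps(2)[of "jshift 2 J" z n]
      Suc.IH[THEN conjunct1] Suc.IH[THEN conjunct2]
    by (simp add: mat_distrib matrix_mul_assoc mult.commute)
qed

text \<open>Because the cross terms cancel, (X + iY) times its adjoint is X X^* + Y Y^*, which is
  positive definite. The second claim says that the vectors (adj X l, adj Y l) form a Lagrangian
  subspace: (0, v) is in it when v is orthogonal to it in the symplectic sense.\<close>

lemma selfadjoint_pair:
  fixes X Y :: "complex^'n^'n"
  assumes eq: "X ** adj Y = Y ** adj X"
    and ker: "\<And>l. adj X *v l = 0 \<Longrightarrow> adj Y *v l = 0 \<Longrightarrow> l = 0"
  shows "invertible (X + \<i> *\<^sub>m Y)"
    and "X *v v = 0 \<Longrightarrow> \<exists>l. adj X *v l = 0 \<and> adj Y *v l = v"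
proof -
  have inv: "invertible (adj (X + c *\<^sub>m Y))" if c: "c = \<i> \<or> c = - \<i>" for c
  proof (rule invertibleI_kernel)
    fix l assume 0: "adj (X + c *\<^sub>m Y) *v l = 0"
    have "(X + c *\<^sub>m Y) ** adj (X + c *\<^sub>m Y) = X ** adj X + Y ** adj Y"
      using c by (auto simp: mat_distrib smult_mat_minus_left eq)
    hence "(X ** adj X + Y ** adj Y) *v l = 0"
      using 0 by (metis matrix_vector_mul_assoc matrix_vector_mult_0_right)
    hence "cinner l (X *v (adj X *v l)) + cinner l (Y *v (adj Y *v l)) = 0"
      by (metis cinner_simps(1,9) matrix_vector_mul_assoc matrix_vector_mult_add_rdistrib)
    hence "of_real ((norm (adj X *v l))\<^sup>2 + (norm (adj Y *v l))\<^sup>2) = (0 :: complex)"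
      by (simp only: cinner_mat_right[of l] cinner_self of_real_add)
    hence "(norm (adj X *v l))\<^sup>2 + (norm (adj Y *v l))\<^sup>2 = 0" by (simp only: of_real_eq_0_iff)
    hence "adj X *v l = 0" "adj Y *v l = 0" by (auto simp: add_nonneg_eq_0_iff)
    thus "l = 0" by (rule ker)
  qed
  show "invertible (X + \<i> *\<^sub>m Y)" using inv[of \<i>] by (simp del: adj_simps(2))
  assume v: "X *v v = 0"
  define Z where "Z = X + \<i> *\<^sub>m Y"
  have Z: "invertible (adj Z)" "adj Z = adj X - \<i> *\<^sub>m adj Y"
    using inv[of \<i>] by (auto simp: Z_def smult_mat_minus_left)
  define l where "l = matrix_inv (adj Z) *v ((- \<i>) *s v)"
  have l: "adj Z *v l = (- \<i>) *s v" unfolding l_def using Z(1) by (simp only: matrix_inv_cancel)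
  \<comment> \<open>Together with adj Z l = -i v and X v = 0 this identity puts adj X l into the
    kernel of the invertible X - iY.\<close>
  have "(X - \<i> *\<^sub>m Y) ** adj X = X ** adj Z"
    by (simp add: Z(2) mat_distrib eq)
  hence "(X - \<i> *\<^sub>m Y) *v (adj X *v l) = X *v (adj Z *v l)"
    by (simp only: matrix_vector_mul_assoc)
  also have "\<dots> = 0" by (simp only: l mat_vec_smult v) simp
  finally have "(X + (- \<i>) *\<^sub>m Y) *v (adj X *v l) = 0" by (simp add: smult_mat_minus_left)
  moreover have "invertible (X + (- \<i>) *\<^sub>m Y)"
    using inv[of "- \<i>"] by (simp only: invertible_adj_iff) simp
  ultimately have 1: "adj X *v l = 0" using invertible_kernel by blast
  moreover have "adj Y *v l = v"
  proof -
    have "(- \<i>) *s (adj Y *v l) = (- \<i>) *s v"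
      using l 1 by (simp add: Z(2) matrix_vector_mult_diff_rdistrib)
    thus ?thesis by (simp add: vec_eq_iff)
  qed
  ultimately show "\<exists>l. adj X *v l = 0 \<and> adj Y *v l = v" by blast
qed

lemma continuous_on_locally:
  fixes f :: "'a::t2_space \<Rightarrow> 'b::topological_space"
  assumes "\<And>z. z \<in> S \<Longrightarrow> \<exists>X U. open U \<and> z \<in> U \<and> S \<inter> U \<subseteq> X \<and> continuous_on X f"
  shows "continuous_on S f"
proof (subst continuous_on_eq_continuous_within, intro ballI)
  fix z assume z: "z \<in> S"
  then obtain X U where XU: "open U" "z \<in> U" "S \<inter> U \<subseteq> X" "continuous_on X f"
    using assms[OF z] by blast
  have "continuous_on (S \<inter> U) f" using XU continuous_on_subset by blast
  hence "continuous (at z within S \<inter> U) f"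
    using z XU by (simp add: continuous_on_eq_continuous_within)
  moreover have "at z within S \<inter> U = at z within S"
    by (rule at_within_nhd[of z U]) (use XU in auto)
  ultimately show "continuous (at z within S) f" by (simp add: continuous_def)
qed

lemma mat_holo_locally:
  assumes "\<And>z. z \<in> S \<Longrightarrow> \<exists>U. open U \<and> z \<in> U \<and> mat_holo f U"
  shows "mat_holo f S"
  unfolding mat_holo_def
proof (intro allI)
  fix i j
  have "\<exists>U. open U \<and> z \<in> U \<and> (\<lambda>z. f z $ i $ j) holomorphic_on U" if "z \<in> S" for z
    using assms[OF that] by (auto simp: mat_holo_def)
  thus "(\<lambda>z. f z $ i $ j) holomorphic_on S"
    unfolding holomorphic_on_def using field_differentiable_at_within at_within_open by metis
qed

context jacobi_asymptotic
begin

section \<open>Regions of convergence and the Jost solution\<close>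

abbreviation u :: "nat \<Rightarrow> complex \<Rightarrow> complex^'l^'l" where "u \<equiv> jost_sol J"
abbreviation w :: "nat \<Rightarrow> complex \<Rightarrow> complex^'l^'l" where "w \<equiv> jost_sol_scaled J"

text \<open>The pointwise part of \<open>jost_good\<close>, which is all that algebraic identities
  at a single z require.\<close>

definition regular :: "complex \<Rightarrow> bool"
  where "regular z \<longleftrightarrow> (\<forall>k. jost_g (jshift k J) z \<longlonglongrightarrow> jost (jshift k J) z) \<and>
    (\<lambda>k. jost (jshift k J) z) \<longlonglongrightarrow> mat 1"

lemma jost_good_regular:
  assumes "jost_good J X" "z \<in> X"
  shows "regular z"
proof -
  have "uniform_limit X (\<lambda>k. jost (jshift k J)) (\<lambda>_. mat 1) sequentially"
    using assms(1) by (simp add: jost_good_def)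
  from tendsto_uniform_limitI[OF this assms(2)] show ?thesis
    using assms by (simp add: jost_good_def regular_def)
qed

text \<open>Uniform convergence is available only away from the edges, respectively on smaller
  disks. Every point of the region still has a relative neighbourhood inside one such set, so
  continuity and holomorphy can be checked locally.\<close>

lemma region_good:
  assumes "appropriate_region J S" "z \<in> S"
  obtains X U where "open U" "z \<in> U" "S \<inter> U \<subseteq> X" "z \<in> X" "jost_good J X"
proof -
  consider "S = cball 0 1 - {1, -1}" | "cond_A2 J" "S = cball 0 1" | R where "cond_A3 J R" "S = ball 0 R"
    using assms(1) by (auto simp: appropriate_region_def)
  thus thesis
  proof cases
    case 1
    define d where "d = cmod (1 - z\<^sup>2) / 2"
    have "1 - z\<^sup>2 = (1 - z) * (1 + z)" by (simp add: power2_eq_square algebra_simps)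
    hence "1 - z\<^sup>2 \<noteq> 0" using assms(2) 1 by (auto simp: add_eq_0_iff)
    hence d: "d > 0" "d < cmod (1 - z\<^sup>2)" by (auto simp: d_def)
    have o: "open {z. d < cmod (1 - z\<^sup>2)}" by (intro open_Collect_less continuous_intros)
    show thesis by (rule that[OF o _ _ _ good_away[OF d(1)]]) (use d 1 assms in auto)
  next
    case 2
    show thesis by (rule that[OF open_UNIV _ _ _ good_closed_disk]) (use 2 assms in auto)
  next
    case 3
    define r where "r = (cmod z + R) / 2"
    have r: "cmod z < r" "r < R" using assms 3 by (auto simp: r_def)
    show thesis
      by (rule that[OF open_ball[of 0 r] _ _ _ good_large_disk[OF 3(1) r(2)]]) (use r in auto)
  qed
qed

lemma region_regular: "appropriate_region J S \<Longrightarrow> z \<in> S \<Longrightarrow> regular z"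
  by (erule (1) region_good) (rule jost_good_regular)

lemma region_continuous:
  assumes "appropriate_region J S"
  shows "continuous_on S (jost (jshift k J))"
proof (rule continuous_on_locally)
  fix z assume "z \<in> S"
  then obtain X U where XU: "open U" "z \<in> U" "S \<inter> U \<subseteq> X" "z \<in> X" "jost_good J X"
    by (rule region_good[OF assms])
  thus "\<exists>X U. open U \<and> z \<in> U \<and> S \<inter> U \<subseteq> X \<and> continuous_on X (jost (jshift k J))"
    unfolding jost_good_def by blast
qed

lemma region_holo:
  assumes S: "appropriate_region J S" and V: "open V" "V \<subseteq> S"
  shows "mat_holo (jost (jshift k J)) V"
proof (rule mat_holo_locally)
  fix z assume z: "z \<in> V"
  hence "z \<in> S" using V by blast
  then obtain X U where XU: "open U" "z \<in> U" "S \<inter> U \<subseteq> X" "z \<in> X" "jost_good J X"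
    by (rule region_good[OF S])
  have "open (V \<inter> U)" "V \<inter> U \<subseteq> X" using V XU by auto
  moreover from this have "mat_holo (jost (jshift k J)) (V \<inter> U)"
    using XU(5) unfolding jost_good_def by metis
  ultimately show "\<exists>U. open U \<and> z \<in> U \<and> mat_holo (jost (jshift k J)) U"
    using z XU(2) by (intro exI[of _ "V \<inter> U"]) simp
qed

lemma region_A1: "appropriate_region J (cball 0 1 - {1, -1})"
  using A1 by (simp add: appropriate_region_def)

lemma region_contains:
  assumes "appropriate_region J S"
  shows "cball 0 1 - {1, -1} \<subseteq> S"
  using assms by (auto simp: appropriate_region_def cond_A3_def)

lemma regular_cball: "cmod z \<le> 1 \<Longrightarrow> z \<noteq> 1 \<Longrightarrow> z \<noteq> -1 \<Longrightarrow> regular z"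
  using region_regular[OF region_A1] by auto

lemma regular_ball: "cmod z < 1 \<Longrightarrow> regular z"
  by (rule regular_cball) auto

lemma w_0: "w 0 z = jost J z"
proof -
  have "matrix_inv (mat 1) = (mat 1 :: complex^'l^'l)" by (rule matrix_inv_unique) simp
  thus ?thesis by (simp add: jost_sol_scaled_def jshift_0[OF jacobi])
qed

lemma u_0 [simp]: "u 0 z = jost J z"
  by (simp add: jost_sol_def w_0)

lemma w_tendsto: "regular z \<Longrightarrow> (\<lambda>n. w n z) \<longlonglongrightarrow> mat 1"
proof -
  assume "regular z"
  hence "(\<lambda>n. jost (jshift n J) z ** matrix_inv (Apar J n)) \<longlonglongrightarrow> mat 1 ** matrix_inv (mat 1)"
    by (intro tendsto_intros Apar_tendsto) (auto simp: regular_def invertible_det_nz)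
  moreover have "matrix_inv (mat 1) = (mat 1 :: complex^'l^'l)" by (rule matrix_inv_unique) simp
  ultimately show ?thesis by (simp add: jost_sol_scaled_def)
qed

lemma w_mult_A: "w n z ** Apar J n = jost (jshift n J) z"
  by (simp add: jost_sol_scaled_def)

text \<open>Limit of the relation between the shifted polynomials. Stated for the scaled solution it
  includes z = 0, where it says that consecutive values differ by invertible factors.\<close>

lemma w_recurrence:
  assumes "regular z"
  shows "w n z ** Apar J n = w (Suc n) z ** ((1 + z\<^sup>2) *\<^sub>m mat 1 - z *\<^sub>m Bpar J (Suc n))
    - z\<^sup>2 *\<^sub>m (w (Suc (Suc n)) z ** adj (Apar J (Suc n)))"
proof -
  let ?K = "jshift n J"
  have lim: "jost_g (jshift k J) z \<longlonglongrightarrow> jost (jshift k J) z" for k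
    using assms by (simp add: regular_def)
  define P where "P = matrix_inv (Apar J (Suc n)) ** ((1 + z\<^sup>2) *\<^sub>m mat 1 - z *\<^sub>m Bpar J (Suc n))"
  define Q where "Q = matrix_inv (Apar J (Suc (Suc n))) ** adj (Apar J (Suc n))"
  have "jost_g ?K z (Suc (Suc m)) = jost_g (jshift (Suc n) J) z (Suc m) ** P
      - z\<^sup>2 *\<^sub>m (jost_g (jshift (Suc (Suc n)) J) z m ** Q)" for m
    using jost_polynomials_shift[of ?K z m] by (simp add: jshift_jshift P_def Q_def)
  moreover have "(\<lambda>m. jost_g (jshift (Suc n) J) z (Suc m) ** P - z\<^sup>2 *\<^sub>m (jost_g (jshift (Suc (Suc n)) J) z m ** Q))
      \<longlonglongrightarrow> jost (jshift (Suc n) J) z ** P - z\<^sup>2 *\<^sub>m (jost (jshift (Suc (Suc n)) J) z ** Q)"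
    by (intro tendsto_intros lim LIMSEQ_Suc)
  moreover have "(\<lambda>m. jost_g ?K z (Suc (Suc m))) \<longlonglongrightarrow> jost ?K z"
    using lim[of n] by (intro LIMSEQ_Suc)
  ultimately have "jost ?K z = jost (jshift (Suc n) J) z ** P - z\<^sup>2 *\<^sub>m (jost (jshift (Suc (Suc n)) J) z ** Q)"
    using LIMSEQ_unique by simp
  thus ?thesis unfolding w_mult_A by (simp add: P_def Q_def jost_sol_scaled_def matrix_mul_assoc)
qed

lemma u_recurrence:
  assumes "regular z" "z \<noteq> 0"
  shows "u (Suc (Suc n)) z ** adj (Apar J (Suc n))
    + u (Suc n) z ** (Bpar J (Suc n) - (z + inverse z) *\<^sub>m mat 1) + u n z ** Apar J n = 0"
proof -
  have "u n z ** Apar J n = z ^ n *\<^sub>m (w (Suc n) z ** ((1 + z\<^sup>2) *\<^sub>m mat 1 - z *\<^sub>m Bpar J (Suc n)))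
    - z ^ (n + 2) *\<^sub>m (w (Suc (Suc n)) z ** adj (Apar J (Suc n)))"
    by (simp add: jost_sol_def w_recurrence[OF assms(1)] smult_mat_diff_right power2_eq_square mult_ac)
  moreover have "z * (z * z ^ n) + z * z ^ n * inverse z = z ^ n + z * (z * z ^ n)"
    using assms(2) by (simp add: field_simps)
  ultimately show ?thesis
    using assms(2) by (simp add: jost_sol_def mat_distrib algebra_simps power2_eq_square)
      (simp add: smult_mat_add_left[symmetric] field_simps)
qed

lemma u_recurrence_adj:
  assumes "regular z" "z \<noteq> 0"
  shows "Apar J (Suc n) ** adj (u (Suc (Suc n)) z)
    + (Bpar J (Suc n) - cnj (z + inverse z) *\<^sub>m mat 1) ** adj (u (Suc n) z)
    + adj (Apar J n) ** adj (u n z) = 0"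
proof -
  have "adj (u (Suc (Suc n)) z ** adj (Apar J (Suc n))
    + u (Suc n) z ** (Bpar J (Suc n) - (z + inverse z) *\<^sub>m mat 1) + u n z ** Apar J n) = 0"
    by (simp only: u_recurrence[OF assms] adj_simps)
  thus ?thesis by (simp add: adj_B)
qed

text \<open>Two consecutive zeros propagate through the recurrence to all n, which contradicts the
  limit 1 of the scaled solution.\<close>

lemma u_joint_kernel:
  assumes "regular z" "z \<noteq> 0" "adj (u 0 z) *v l = 0" "adj (u 1 z) *v l = 0"
  shows "l = 0"
proof -
  have "adj (u n z) *v l = 0 \<and> adj (u (Suc n) z) *v l = 0" for n
  proof (induction n)
    case (Suc n)
    have "(Apar J (Suc n) ** adj (u (Suc (Suc n)) z)
      + (Bpar J (Suc n) - cnj (z + inverse z) *\<^sub>m mat 1) ** adj (u (Suc n) z)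
      + adj (Apar J n) ** adj (u n z)) *v l = 0"
      by (simp only: u_recurrence_adj[OF assms(1,2)] matrix_vector_mult_0)
    hence "Apar J (Suc n) *v (adj (u (Suc (Suc n)) z) *v l) = 0"
      using Suc by (simp add: matrix_vector_mult_add_rdistrib matrix_vector_mul_assoc[symmetric])
    thus ?case using Suc invertible_kernel[OF invertible_A'] by blast
  qed (use assms in auto)
  hence 0: "adj (w n z) *v l = 0" for n
    using assms(2) by (auto simp: jost_sol_def vec_eq_iff)
  have "(\<lambda>n. adj (w n z) *v l) \<longlonglongrightarrow> adj (mat 1) *v l"
    by (intro tendsto_intros w_tendsto assms)
  thus ?thesis using 0 LIMSEQ_unique[OF _ tendsto_const] by fastforce
qed

text \<open>Two points are allowed because the adjoint of u_n at z' solves the equation at z as soon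
  as the conjugate of z' + 1/z' equals z + 1/z.\<close>

definition wron :: "complex \<Rightarrow> complex \<Rightarrow> nat \<Rightarrow> complex^'l^'l"
  where "wron z z' n = u n z ** Apar J n ** adj (u (Suc n) z') - u (Suc n) z ** adj (Apar J n) ** adj (u n z')"

lemma wron_const:
  assumes "regular z" "z \<noteq> 0" "regular z'" "z' \<noteq> 0" "cnj (z' + inverse z') = z + inverse z"
  shows "wron z z' n = wron z z' 0"
proof (induction n)
  case (Suc n)
  define X where "X = Bpar J (Suc n) - (z + inverse z) *\<^sub>m mat 1"
  have 1: "u n z ** Apar J n = - (u (Suc (Suc n)) z ** adj (Apar J (Suc n))) - u (Suc n) z ** X"
    using u_recurrence[OF assms(1,2), of n] by (simp add: X_def algebra_simps eq_neg_iff_add_eq_0)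
  have 2: "adj (Apar J n) ** adj (u n z') = - (Apar J (Suc n) ** adj (u (Suc (Suc n)) z')) - X ** adj (u (Suc n) z')"
    using u_recurrence_adj[OF assms(3,4), of n] unfolding assms(5) X_def[symmetric]
    by (simp add: algebra_simps eq_neg_iff_add_eq_0)
  have "wron z z' n = wron z z' (Suc n)"
    unfolding wron_def 1 matrix_mul_assoc[symmetric, of _ "adj (Apar J n)" "adj (u n z')"] 2
    by (simp add: mat_distrib matrix_mul_assoc)
  thus ?case using Suc by simp
qed simp

lemma wron_0: "wron z z' 0 = jost J z ** adj (u 1 z') - u 1 z ** adj (jost J z')"
  by (simp add: wron_def)

text \<open>At the reflected point the powers of z cancel, so the constant Wronskian can be
  evaluated at infinity, where all scaled factors are 1.\<close>

lemma wronskian_reflected: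
  assumes "regular z" "z \<noteq> 0" "regular (inverse (cnj z))"
  shows "jost J z ** adj (u 1 (inverse (cnj z))) - u 1 z ** adj (jost J (inverse (cnj z)))
    = (inverse z - z) *\<^sub>m mat 1"
proof -
  define z' where "z' = inverse (cnj z)"
  have z': "z' \<noteq> 0" "regular z'" "cnj z' = inverse z" using assms by (auto simp: z'_def)
  have eq: "wron z z' n = inverse z *\<^sub>m (w n z ** Apar J n ** adj (w (Suc n) z'))
      - z *\<^sub>m (w (Suc n) z ** adj (Apar J n) ** adj (w n z'))" for n
  proof -
    have "inverse z ^ Suc n * z ^ n = inverse z" "inverse z ^ n * z ^ Suc n = z"
      using assms(2) by (simp_all add: field_simps)
    thus ?thesis unfolding wron_def jost_sol_def by (simp add: z'(3) del: power_Suc power_inverse)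
  qed
  have "(\<lambda>n. wron z z' n) \<longlonglongrightarrow> inverse z *\<^sub>m (mat 1 ** mat 1 ** adj (mat 1)) - z *\<^sub>m (mat 1 ** adj (mat 1) ** adj (mat 1))"
    unfolding eq using assms z' by (intro tendsto_intros w_tendsto Apar_tendsto LIMSEQ_Suc)
  hence "(\<lambda>n. wron z z' n) \<longlonglongrightarrow> (inverse z - z) *\<^sub>m mat 1" by (simp add: smult_mat_diff_left)
  moreover have "wron z z' n = wron z z' 0" for n
    by (rule wron_const) (use assms z' in auto)
  ultimately have "wron z z' 0 = (inverse z - z) *\<^sub>m mat 1"
    using LIMSEQ_unique tendsto_const by (metis (no_types, lifting) ext)
  thus ?thesis by (simp add: wron_0 z'_def)
qed

text \<open>Here z' = z and the Wronskian is an odd power of z times \<open>X n\<close>, where X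
  tends to 0. Hence it vanishes also at 1 and -1, where the power does not decay.\<close>

lemma wronskian_real:
  assumes "regular z" "z \<noteq> 0" "z \<in> \<real>" "cmod z \<le> 1"
  shows "jost J z ** adj (u 1 z) = u 1 z ** adj (jost J z)"
proof -
  have c: "cnj z = z" using assms(3) by (simp add: Reals_cnj_iff)
  define X where "X n = w n z ** Apar J n ** adj (w (Suc n) z) - w (Suc n) z ** adj (Apar J n) ** adj (w n z)" for n
  have eq: "wron z z n = z ^ Suc (n + n) *\<^sub>m X n" for n
    unfolding wron_def jost_sol_def X_def
    by (simp add: c smult_mat_diff_right power_add mult_2 mult_ac)
  have "X \<longlonglongrightarrow> mat 1 ** mat 1 ** adj (mat 1) - mat 1 ** adj (mat 1) ** adj (mat 1)"
    unfolding X_def using assms by (intro tendsto_intros w_tendsto Apar_tendsto LIMSEQ_Suc)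
  hence X: "X \<longlonglongrightarrow> 0" by simp
  have "(\<lambda>n. wron z z n) \<longlonglongrightarrow> 0"
  proof (rule Lim_null_comparison)
    show "(\<lambda>n. norm (X n)) \<longlonglongrightarrow> 0" using X by (rule tendsto_norm_zero)
    show "\<forall>\<^sub>F n in sequentially. norm (wron z z n) \<le> norm (X n)"
      using assms(4) by (intro always_eventually allI) (simp add: eq norm_power mult_left_le_one_le power_le_one del: power_Suc)
  qed
  moreover have "wron z z n = wron z z 0" for n
    by (rule wron_const) (use assms c in auto)
  ultimately have "wron z z 0 = 0"
    using LIMSEQ_unique tendsto_const by (metis (no_types, lifting) ext)
  thus ?thesis by (simp add: wron_0)
qed

text \<open>The boundary term of summation by parts. At N = 0 the entry of \<phi> before the first
  one counts as 0, and since the zeroth block is 1 only u applied to \<phi> 0 remains.\<close>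

definition bdry :: "complex \<Rightarrow> (nat \<Rightarrow> complex^'l) \<Rightarrow> nat \<Rightarrow> complex^'l"
  where "bdry z \<phi> N = u N z *v (Apar J N *v \<phi> N)
    - (if N = 0 then 0 else u (Suc N) z *v (adj (Apar J N) *v \<phi> (N - 1)))"

text \<open>No decay of \<phi> is assumed: each summand is the increment of the boundary term, by
  the recurrence for u.\<close>

lemma green:
  assumes "regular z" "z \<noteq> 0"
  shows "(\<Sum>n<N. u (Suc n) z *v jacobi_op_minus J (z + inverse z) \<phi> n) = bdry z \<phi> N - jost J z *v \<phi> 0"
proof (induction N)
  case 0
  show ?case by (simp add: bdry_def)
next
  case (Suc N)
  define X where "X = Bpar J (Suc N) - (z + inverse z) *\<^sub>m mat 1"
  have 1: "u N z ** Apar J N = - (u (Suc (Suc N)) z ** adj (Apar J (Suc N))) - u (Suc N) z ** X"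
    using u_recurrence[OF assms, of N] by (simp add: X_def algebra_simps eq_neg_iff_add_eq_0)
  have 2: "jacobi_op_minus J (z + inverse z) \<phi> N =
      (if N = 0 then 0 else adj (Apar J N) *v \<phi> (N - 1)) + X *v \<phi> N + Apar J (Suc N) *v \<phi> (Suc N)"
    by (simp add: jacobi_op_minus_def jacobi_op_def X_def matrix_vector_mult_diff_rdistrib)
  have "bdry z \<phi> N + u (Suc N) z *v jacobi_op_minus J (z + inverse z) \<phi> N = bdry z \<phi> (Suc N)"
    unfolding bdry_def 2
    by (simp add: matrix_vector_mul_assoc 1 matrix_vector_right_distrib matrix_vector_mult_diff_rdistrib
        matrix_vector_mult_add_rdistrib)
  thus ?case by (simp only: sum.lessThan_Suc Suc.IH diff_add_eq)
qed

text \<open>The first row of the operator lacks the term with u_0; that missing term is the defect.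
  For l in the kernel of the adjoint of u(z) the columns therefore solve the homogeneous
  equation.\<close>

lemma column_solution:
  assumes "regular z" "z \<noteq> 0"
  shows "jacobi_op_minus J (cnj (z + inverse z)) (\<lambda>n. adj (u (Suc n) z) *v l) n
    = (if n = 0 then - (adj (jost J z) *v l) else 0)"
proof -
  define E where "E = cnj (z + inverse z)"
  have "Apar J (Suc n) *v (adj (u (Suc (Suc n)) z) *v l)
    + (Bpar J (Suc n) *v (adj (u (Suc n) z) *v l) - E *s (adj (u (Suc n) z) *v l))
    + adj (Apar J n) *v (adj (u n z) *v l) = (Apar J (Suc n) ** adj (u (Suc (Suc n)) z)
    + (Bpar J (Suc n) - E *\<^sub>m mat 1) ** adj (u (Suc n) z) + adj (Apar J n) ** adj (u n z)) *v l"
    by (simp add: matrix_vector_mult_add_rdistrib matrix_vector_mult_diff_rdistrib matrix_vector_mul_assoc mat_distrib)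
  also have "\<dots> = 0" unfolding E_def u_recurrence_adj[OF assms] by simp
  finally have *: "Apar J (Suc n) *v (adj (u (Suc (Suc n)) z) *v l)
    + (Bpar J (Suc n) *v (adj (u (Suc n) z) *v l) - E *s (adj (u (Suc n) z) *v l))
    + adj (Apar J n) *v (adj (u n z) *v l) = 0" .
  show ?thesis
    unfolding jacobi_op_minus_def jacobi_op_def E_def[symmetric]
    using * by (cases n) (auto simp: algebra_simps eq_neg_iff_add_eq_0)
qed

text \<open>Turns a kernel vector v of u(z) into a column solution without defect whose first entry
  is v.\<close>

lemma real_kernel_vector:
  assumes "regular z" "z \<noteq> 0" "z \<in> \<real>" "cmod z \<le> 1"
  shows "invertible (jost J z + \<i> *\<^sub>m u 1 z)"
    and "jost J z *v v = 0 \<Longrightarrow> \<exists>l. adj (jost J z) *v l = 0 \<and> adj (u 1 z) *v l = v"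
  using selfadjoint_pair[OF wronskian_real[OF assms]] u_joint_kernel[OF assms(1,2)] by auto

end

section \<open>The spectrum outside \<open>[-2, 2]\<close>\<close>

lemma ell2_D: "\<phi> \<in> ell2 \<Longrightarrow> summable (\<lambda>n. (norm (\<phi> n))\<^sup>2)"
  by (simp add: ell2_def)

lemma ell2_norm_sq: "\<phi> \<in> ell2 \<Longrightarrow> (ell2_norm \<phi>)\<^sup>2 = (\<Sum>n. (norm (\<phi> n))\<^sup>2)"
  by (simp add: ell2_norm_def suminf_nonneg ell2_D)

lemma ell2_norm_nonneg: "\<phi> \<in> ell2 \<Longrightarrow> 0 \<le> ell2_norm \<phi>"
  by (simp add: ell2_norm_def suminf_nonneg ell2_D)

lemma ell2_partial_le: "\<phi> \<in> ell2 \<Longrightarrow> (\<Sum>n<N. (norm (\<phi> n))\<^sup>2) \<le> (ell2_norm \<phi>)\<^sup>2"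
  unfolding ell2_norm_sq by (rule sum_le_suminf[OF ell2_D]) auto

lemma ell2I:
  assumes "\<And>N. (\<Sum>n<N. (norm (\<phi> n))\<^sup>2) \<le> C\<^sup>2" "C \<ge> 0"
  shows "\<phi> \<in> ell2" "ell2_norm \<phi> \<le> C"
proof -
  have s: "summable (\<lambda>n. (norm (\<phi> n))\<^sup>2)"
    by (rule summableI_nonneg_bounded[of _ "C\<^sup>2"]) (use assms in auto)
  thus "\<phi> \<in> ell2" by (simp add: ell2_def)
  have "(\<Sum>n. (norm (\<phi> n))\<^sup>2) \<le> C\<^sup>2" by (rule suminf_le_const[OF s assms(1)])
  thus "ell2_norm \<phi> \<le> C" unfolding ell2_norm_def using assms(2) by (simp add: real_le_lsqrt)
qed

lemma ell2_norm_nth_le: "\<phi> \<in> ell2 \<Longrightarrow> norm (\<phi> n) \<le> ell2_norm \<phi>"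
proof -
  assume \<phi>: "\<phi> \<in> ell2"
  have "(norm (\<phi> n))\<^sup>2 \<le> (\<Sum>i<Suc n. (norm (\<phi> i))\<^sup>2)" by (simp add: sum_nonneg)
  also have "\<dots> \<le> (ell2_norm \<phi>)\<^sup>2" by (rule ell2_partial_le[OF \<phi>])
  finally show ?thesis using ell2_norm_nonneg[OF \<phi>] by (simp add: power2_le_iff_abs_le)
qed

lemma ell2_tendsto_0: "\<phi> \<in> ell2 \<Longrightarrow> \<phi> \<longlonglongrightarrow> 0"
  using summable_LIMSEQ_zero[OF ell2_D] by (simp add: tendsto_norm_zero_iff)

lemma ell2_comparison:
  assumes "\<phi> \<in> ell2" "\<And>n. norm (\<psi> n) \<le> C * norm (\<phi> n)"
  shows "\<psi> \<in> ell2"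
proof -
  have "(norm (\<psi> n))\<^sup>2 \<le> C\<^sup>2 * (norm (\<phi> n))\<^sup>2" for n
    using power_mono[OF assms(2), of n 2] by (simp add: power_mult_distrib)
  thus ?thesis unfolding ell2_def
    by (intro CollectI summable_comparison_test'[where N = 0, OF summable_mult[OF ell2_D[OF assms(1)]]]) auto
qed

lemma ell2_add:
  assumes "\<phi> \<in> ell2" "\<psi> \<in> ell2"
  shows "(\<lambda>n. \<phi> n + \<psi> n) \<in> ell2"
proof -
  have "(norm (\<phi> n + \<psi> n))\<^sup>2 \<le> 2 * (norm (\<phi> n))\<^sup>2 + 2 * (norm (\<psi> n))\<^sup>2" for n
  proof -
    have "(norm (\<phi> n + \<psi> n))\<^sup>2 \<le> (norm (\<phi> n) + norm (\<psi> n))\<^sup>2"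
      by (intro power_mono norm_triangle_ineq) auto
    also have "\<dots> \<le> 2 * (norm (\<phi> n))\<^sup>2 + 2 * (norm (\<psi> n))\<^sup>2"
      using zero_le_power2[of "norm (\<phi> n) - norm (\<psi> n)"] by (simp add: power2_eq_square algebra_simps)
    finally show ?thesis .
  qed
  thus ?thesis unfolding ell2_def
    by (intro CollectI summable_comparison_test'[where N = 0,
        OF summable_add[OF summable_mult[OF ell2_D[OF assms(1)]] summable_mult[OF ell2_D[OF assms(2)]]]]) auto
qed

lemma ell2_uminus: "\<phi> \<in> ell2 \<Longrightarrow> (\<lambda>n. - \<phi> n) \<in> ell2"
  by (simp add: ell2_def)

lemma ell2_diff: "\<phi> \<in> ell2 \<Longrightarrow> \<psi> \<in> ell2 \<Longrightarrow> (\<lambda>n. \<phi> n - \<psi> n) \<in> ell2"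
  using ell2_add[OF _ ell2_uminus] by fastforce

lemma ell2_Suc: "\<phi> \<in> ell2 \<Longrightarrow> (\<lambda>n. \<phi> (Suc n)) \<in> ell2"
  unfolding ell2_def using summable_Suc_iff[of "\<lambda>n. (norm (\<phi> n))\<^sup>2"] by simp

lemma ell2_pred: "\<phi> \<in> ell2 \<Longrightarrow> (\<lambda>n. if n = 0 then 0 else \<phi> (n - 1)) \<in> ell2"
proof -
  assume "\<phi> \<in> ell2"
  hence "summable (\<lambda>n. (norm ((\<lambda>n. if n = 0 then 0 else \<phi> (n - 1)) (Suc n)))\<^sup>2)"
    by (simp add: ell2_def)
  thus ?thesis unfolding ell2_def by (subst (asm) summable_Suc_iff) simp
qed

lemma ell2_first_block: "first_block_vec v \<in> ell2"
proof (rule ell2I(1)[where C = "norm v"])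
  have "(norm (first_block_vec v n))\<^sup>2 = (if n = 0 then (norm v)\<^sup>2 else 0)" for n
    by (simp add: first_block_vec_def)
  thus "(\<Sum>n<N. (norm (first_block_vec v n))\<^sup>2) \<le> (norm v)\<^sup>2" for N by simp
qed simp

text \<open>Convexity of the square, applied to x and y / (1 - q) with weights q and 1 - q.\<close>

lemma convex_square: 
  assumes "0 \<le> q" "q < (1::real)"
  shows "(q * x + y)\<^sup>2 \<le> q * x\<^sup>2 + y\<^sup>2 / (1 - q)"
proof -
  have "0 \<le> q * ((1 - q) * x - y)\<^sup>2 / (1 - q)" using assms by simp
  also have "\<dots> = q * x\<^sup>2 + y\<^sup>2 / (1 - q) - (q * x + y)\<^sup>2"
    using assms by (simp add: field_simps power2_eq_square)
  finally show ?thesis by simp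
qed

lemma geometric_ell2_forward:
  fixes a c :: "nat \<Rightarrow> real"
  assumes q: "0 \<le> q" "q < 1" and a: "\<And>n. 0 \<le> a n" and step: "\<And>n. a (Suc n) \<le> q * a n + c n"
    and c: "\<And>N. (\<Sum>n<N. (c n)\<^sup>2) \<le> X"
  shows "(1 - q) * (\<Sum>n<N. (a n)\<^sup>2) \<le> (a 0)\<^sup>2 + X / (1 - q)"
proof -
  have s: "(a (Suc n))\<^sup>2 \<le> q * (a n)\<^sup>2 + (c n)\<^sup>2 / (1 - q)" for n
    using power_mono[OF step a, of n 2] convex_square[OF q] order_trans by blast
  have "(\<Sum>n<N. (a n)\<^sup>2) + (a N)\<^sup>2 = (a 0)\<^sup>2 + (\<Sum>n<N. (a (Suc n))\<^sup>2)"
    using sum.lessThan_Suc_shift[of "\<lambda>n. (a n)\<^sup>2" N] by simp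
  also have "(\<Sum>n<N. (a (Suc n))\<^sup>2) \<le> (\<Sum>n<N. q * (a n)\<^sup>2 + (c n)\<^sup>2 / (1 - q))"
    by (intro sum_mono s)
  also have "\<dots> = q * (\<Sum>n<N. (a n)\<^sup>2) + (\<Sum>n<N. (c n)\<^sup>2) / (1 - q)"
    by (simp add: sum.distrib sum_distrib_left sum_divide_distrib)
  also have "\<dots> \<le> q * (\<Sum>n<N. (a n)\<^sup>2) + X / (1 - q)"
    using c[of N] q by (simp add: divide_right_mono)
  finally show ?thesis using zero_le_power2[of "a N"] unfolding left_diff_distrib by linarith
qed

text \<open>A backward recursion has no initial value to start from; the uniform bound Y on b takes
  its place at the far end.\<close>

lemma geometric_ell2_backward:
  fixes b c :: "nat \<Rightarrow> real"
  assumes q: "0 \<le> q" "q < 1" and b: "\<And>n. 0 \<le> b n" and step: "\<And>n. b n \<le> q * b (Suc n) + c n"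
    and bX: "\<And>n. (b n)\<^sup>2 \<le> Y" and c: "\<And>N. (\<Sum>n<N. (c n)\<^sup>2) \<le> X"
  shows "(1 - q) * (\<Sum>n<N. (b n)\<^sup>2) \<le> Y + X / (1 - q)"
proof -
  have s: "(b n)\<^sup>2 \<le> q * (b (Suc n))\<^sup>2 + (c n)\<^sup>2 / (1 - q)" for n
    using power_mono[OF step b, of n 2] convex_square[OF q] order_trans by blast
  have "(\<Sum>n<N. (b n)\<^sup>2) \<le> (\<Sum>n<N. q * (b (Suc n))\<^sup>2 + (c n)\<^sup>2 / (1 - q))"
    by (intro sum_mono s)
  also have "\<dots> = q * (\<Sum>n<N. (b (Suc n))\<^sup>2) + (\<Sum>n<N. (c n)\<^sup>2) / (1 - q)"
    by (simp add: sum.distrib sum_distrib_left sum_divide_distrib)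
  also have "\<dots> \<le> q * ((\<Sum>n<N. (b n)\<^sup>2) + Y) + X / (1 - q)"
  proof (intro add_mono mult_left_mono q divide_right_mono c)
    have "(\<Sum>n<N. (b (Suc n))\<^sup>2) \<le> (b 0)\<^sup>2 + (\<Sum>n<N. (b (Suc n))\<^sup>2)" by simp
    also have "\<dots> = (\<Sum>n<N. (b n)\<^sup>2) + (b N)\<^sup>2"
      using sum.lessThan_Suc_shift[of "\<lambda>n. (b n)\<^sup>2" N] by simp
    finally show "(\<Sum>n<N. (b (Suc n))\<^sup>2) \<le> (\<Sum>n<N. (b n)\<^sup>2) + Y" using bX[of N] by simp
  qed (use q in auto)
  also have "\<dots> \<le> q * (\<Sum>n<N. (b n)\<^sup>2) + Y + X / (1 - q)"
  proof -
    have "Y \<ge> 0" using bX[of 0] zero_le_power2 order_trans by blast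
    hence "q * Y \<le> Y" using q by (simp add: mult_left_le_one_le)
    thus ?thesis by (simp add: algebra_simps)
  qed
  finally show ?thesis by (simp add: algebra_simps)
qed

section \<open>Formal solutions and the resolvent estimate\<close>

context jacobi_asymptotic
begin

lemma jacobi_op_minus_add:
  "jacobi_op_minus J E (\<lambda>n. \<phi> n + \<psi> n) n = jacobi_op_minus J E \<phi> n + jacobi_op_minus J E \<psi> n"
  by (simp add: jacobi_op_minus_def jacobi_op_def algebra_simps vector_add_ldistrib)

lemma jacobi_op_minus_smult:
  "jacobi_op_minus J E (\<lambda>n. c *s \<phi> n) n = c *s jacobi_op_minus J E \<phi> n"
  by (simp add: jacobi_op_minus_def jacobi_op_def vector_add_ldistrib vector_ssub_ldistrib vector_smult_assoc mult.commute)

lemma jacobi_op_minus_diff: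
  "jacobi_op_minus J E (\<lambda>n. \<phi> n - \<psi> n) n = jacobi_op_minus J E \<phi> n - jacobi_op_minus J E \<psi> n"
  by (simp add: jacobi_op_minus_def jacobi_op_def algebra_simps vector_ssub_ldistrib)

lemma jacobi_op_minus_ell2:
  assumes "\<phi> \<in> ell2"
  shows "jacobi_op_minus J E \<phi> \<in> ell2"
proof -
  have "bounded (Apar J ` {1..})" "bounded (Bpar J ` {1..})" using jacobi by (auto simp: is_block_jacobi_def)
  then obtain a b where a: "\<And>n. norm (Apar J (Suc n)) \<le> a" and b: "\<And>n. norm (Bpar J (Suc n)) \<le> b"
    by (auto simp: bounded_iff)
  define a' where "a' = max a (norm (Apar J 0))"
  have a': "norm (Apar J n) \<le> a'" for n using a by (cases n) (auto simp: a'_def intro: max.coboundedI1)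
  have m: "norm (X *v v) \<le> x * norm v" if "norm X \<le> x" for X :: "complex^'l^'l" and v x
    using norm_mat_vec_le[of X v] mult_right_mono[OF that, of "norm v"] by simp
  have "(\<lambda>n. adj (Apar J n) *v (if n = 0 then 0 else \<phi> (n - 1))) \<in> ell2"
    by (rule ell2_comparison[OF ell2_pred[OF assms], of _ a']) (rule m, simp add: a' del: Apar_0)
  moreover have "(\<lambda>n. Bpar J (n + 1) *v \<phi> n) \<in> ell2"
    by (rule ell2_comparison[OF assms, of _ b]) (rule m, simp add: b)
  moreover have "(\<lambda>n. Apar J (n + 1) *v \<phi> (Suc n)) \<in> ell2"
    by (rule ell2_comparison[OF ell2_Suc[OF assms], of _ a]) (rule m, simp add: a)
  moreover have "(\<lambda>n. E *s \<phi> n) \<in> ell2"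
    by (rule ell2_comparison[OF assms, of _ "cmod E"]) simp
  ultimately have "(\<lambda>n. adj (Apar J n) *v (if n = 0 then 0 else \<phi> (n - 1)) + Bpar J (n + 1) *v \<phi> n
      + Apar J (n + 1) *v \<phi> (Suc n) - E *s \<phi> n) \<in> ell2"
    by (intro ell2_diff ell2_add)
  also have "(\<lambda>n. adj (Apar J n) *v (if n = 0 then 0 else \<phi> (n - 1)) + Bpar J (n + 1) *v \<phi> n
      + Apar J (n + 1) *v \<phi> (Suc n) - E *s \<phi> n) = jacobi_op_minus J E \<phi>"
    by (auto simp: fun_eq_iff jacobi_op_minus_def jacobi_op_def)
  finally show ?thesis .
qed

text \<open>Since the blocks \<open>A\<^sub>n\<close> are invertible, a formal solution is determined by its first entry.\<close>

fun forward :: "complex \<Rightarrow> (nat \<Rightarrow> complex^'l) \<Rightarrow> complex^'l \<Rightarrow> nat \<Rightarrow> (complex^'l) \<times> (complex^'l)"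
  where
  "forward E \<eta> v 0 = (0, v)"
| "forward E \<eta> v (Suc n) = (snd (forward E \<eta> v n), matrix_inv (Apar J (Suc n)) *v
    (\<eta> n - Bpar J (Suc n) *v snd (forward E \<eta> v n) + E *s snd (forward E \<eta> v n)
      - adj (Apar J n) *v fst (forward E \<eta> v n)))"

lemma forward_solution:
  "snd (forward E \<eta> v 0) = v" "jacobi_op_minus J E (\<lambda>n. snd (forward E \<eta> v n)) n = \<eta> n"
proof -
  have "fst (forward E \<eta> v n) = (if n = 0 then 0 else snd (forward E \<eta> v (n - 1)))"
    by (cases n) auto
  thus "jacobi_op_minus J E (\<lambda>n. snd (forward E \<eta> v n)) n = \<eta> n"
    by (simp add: jacobi_op_minus_def jacobi_op_def)
qed simp

lemma solution_step:
  assumes "jacobi_op_minus J E \<phi> n = \<eta> n"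
  shows "\<phi> (Suc n) = matrix_inv (Apar J (Suc n)) *v (\<eta> n - Bpar J (Suc n) *v \<phi> n + E *s \<phi> n
    - (if n = 0 then 0 else adj (Apar J n) *v \<phi> (n - 1)))"
proof -
  have "Apar J (Suc n) *v \<phi> (Suc n) = \<eta> n - Bpar J (Suc n) *v \<phi> n + E *s \<phi> n
    - (if n = 0 then 0 else adj (Apar J n) *v \<phi> (n - 1))"
    using assms by (auto simp: jacobi_op_minus_def jacobi_op_def algebra_simps)
  thus ?thesis by (metis matrix_inv_cancel(4) invertible_A')
qed

lemma solution_unique:
  assumes "\<And>n. jacobi_op_minus J E \<phi> n = \<eta> n" "\<And>n. jacobi_op_minus J E \<psi> n = \<eta> n" "\<phi> 0 = \<psi> 0"
  shows "\<phi> = \<psi>"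
proof
  fix n
  have "\<phi> n = \<psi> n \<and> \<phi> (Suc n) = \<psi> (Suc n)"
  proof (induction n)
    case 0
    show ?case using solution_step[of E \<phi> 0 \<eta>] solution_step[of E \<psi> 0 \<eta>] assms by simp
  next
    case (Suc n)
    thus ?case using solution_step[of E \<phi> "Suc n" \<eta>] solution_step[of E \<psi> "Suc n" \<eta>] assms by simp
  qed
  thus "\<phi> n = \<psi> n" by simp
qed

lemma w_bounded: "regular z \<Longrightarrow> \<exists>C>0. \<forall>n. norm (w n z) \<le> C"
proof -
  assume "regular z"
  from convergent_imp_bounded[OF w_tendsto[OF this]] have "bounded (range (\<lambda>n. w n z))" .
  thus ?thesis by (auto simp: bounded_pos)
qed

lemma u_tendsto_0:
  assumes "cmod z < 1"
  shows "(\<lambda>n. u n z) \<longlonglongrightarrow> 0"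
proof -
  have "(\<lambda>n. z ^ n *\<^sub>m w n z) \<longlonglongrightarrow> 0 *\<^sub>m mat 1"
    using assms by (intro tendsto_intros w_tendsto regular_ball LIMSEQ_power_zero) auto
  thus ?thesis by (simp add: jost_sol_def)
qed

lemma bdry_tendsto_0:
  assumes "cmod z < 1" "\<phi> \<in> ell2"
  shows "bdry z \<phi> \<longlonglongrightarrow> 0"
proof -
  note lims = u_tendsto_0[OF assms(1)] ell2_tendsto_0[OF assms(2)] Apar_tendsto
  have 1: "(\<lambda>N. u N z *v (Apar J N *v \<phi> N)) \<longlonglongrightarrow> (0 :: complex^'l^'l) *v ((mat 1 :: complex^'l^'l) *v 0)"
    by (intro tendsto_intros lims)
  have 2: "(\<lambda>N. u (Suc (Suc N)) z *v (adj (Apar J (Suc N)) *v \<phi> N)) \<longlonglongrightarrow> (0 :: complex^'l^'l) *v (adj (mat 1 :: complex^'l^'l) *v 0)"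
    by (intro mat_tendsto_intros lims(2) LIMSEQ_Suc[OF lims(3)] LIMSEQ_Suc[OF LIMSEQ_Suc[OF lims(1)]])
  from tendsto_diff[OF LIMSEQ_Suc[OF 1] 2]
  have "(\<lambda>N. bdry z \<phi> (Suc N)) \<longlonglongrightarrow> 0" by (simp add: bdry_def)
  thus ?thesis by (rule LIMSEQ_imp_Suc)
qed

text \<open>Inside the disk u decays and \<phi> tends to 0, so the boundary term disappears. This
  links the solvability of (J - E) \<phi> = \<eta> to u(z) acting on the first entry.\<close>

lemma green_sums:
  assumes "cmod z < 1" "z \<noteq> 0" "\<phi> \<in> ell2"
  shows "(\<lambda>n. u (Suc n) z *v jacobi_op_minus J (z + inverse z) \<phi> n) sums (- (jost J z *v \<phi> 0))"
proof -
  have "(\<lambda>N. bdry z \<phi> N - jost J z *v \<phi> 0) \<longlonglongrightarrow> 0 - jost J z *v \<phi> 0"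
    by (intro tendsto_intros bdry_tendsto_0 assms)
  thus ?thesis using green[OF regular_ball[OF assms(1)] assms(2)] by (simp add: sums_def)
qed

lemma eigenvector_kernel:
  assumes "cmod z < 1" "z \<noteq> 0" "\<phi> \<in> eigenspace J (z + inverse z)"
  shows "jost J z *v \<phi> 0 = 0"
proof -
  have "\<phi> \<in> ell2" "\<And>n. jacobi_op_minus J (z + inverse z) \<phi> n = 0"
    using assms(3) by (auto simp: eigenspace_def jacobi_op_minus_def)
  thus ?thesis using green_sums[OF assms(1,2), of \<phi>] sums_unique2[OF _ sums_zero] by fastforce
qed

text \<open>With the right initial value the inhomogeneous solution satisfies a first order recursion
  whose coefficient is close to \<open>z\<close>.\<close>

lemma resolvent_bound:
  assumes z: "cmod z < 1" "z \<noteq> 0" and inv: "invertible (jost J z)"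
  shows "\<exists>C\<ge>0. \<forall>\<phi> \<eta>. \<eta> \<in> ell2 \<longrightarrow> (\<forall>n. jacobi_op_minus J (z + inverse z) \<phi> n = \<eta> n) \<longrightarrow>
    (\<lambda>n. u (Suc n) z *v \<eta> n) sums (- (jost J z *v \<phi> 0)) \<longrightarrow> \<phi> \<in> ell2 \<and> ell2_norm \<phi> \<le> C * ell2_norm \<eta>"
proof -
  define r where "r = cmod z"
  have r: "0 < r" "r < 1" using z by (auto simp: r_def)
  have reg: "regular z" by (rule regular_ball[OF z(1)])
  obtain C2 where C2: "C2 > 0" "\<And>n. norm (w n z) \<le> C2" using w_bounded[OF reg] by blast
  \<comment> \<open>The slack allowed in the step factor: r * (1 + \<delta>) is q, the midpoint of r
    and 1.\<close>
  define \<delta> where "\<delta> = (1 - r) / (2 * r)"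
  have \<delta>: "\<delta> > 0" using r by (simp add: \<delta>_def)
  define q where "q = (1 + r) / 2"
  have q: "0 \<le> q" "q < 1" "r * (1 + \<delta>) = q" using r by (auto simp: q_def \<delta>_def field_simps)
  have WA: "(\<lambda>n. w n z ** Apar J n) \<longlonglongrightarrow> mat 1 ** mat 1"
    by (intro tendsto_intros w_tendsto Apar_tendsto reg)
  hence ev1: "\<forall>\<^sub>F n in sequentially. invertible (w n z ** Apar J n)"
    by (rule eventually_invertible) (simp add: invertible_det_nz)
  have inv1: "matrix_inv (mat 1) = (mat 1 :: complex^'l^'l)" by (rule matrix_inv_unique) simp
  have iWA: "(\<lambda>n. matrix_inv (w n z ** Apar J n)) \<longlonglongrightarrow> mat 1"
    using tendsto_matrix_inv[OF WA] by (simp add: invertible_det_nz inv1)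
  obtain C1 where C1: "C1 > 0" "\<And>n. norm (matrix_inv (w n z ** Apar J n)) \<le> C1"
    using convergent_imp_bounded[OF iWA] by (auto simp: bounded_pos)
  \<comment> \<open>The boundary term at n is z^n times w_n A_n \<phi>_n minus z w_(n+1) adj(A_n)
    \<phi>_(n-1). Solving for \<phi>_n leaves the factor z * M n, and M n tends to 1.\<close>
  define M where "M n = matrix_inv (w n z ** Apar J n) ** (w (Suc n) z ** adj (Apar J n))" for n
  have "M \<longlonglongrightarrow> mat 1 ** (mat 1 ** adj (mat 1))"
    unfolding M_def by (intro tendsto_intros iWA LIMSEQ_Suc w_tendsto Apar_tendsto reg)
  hence "\<forall>\<^sub>F n in sequentially. dist (M n) (mat 1) < \<delta>" using \<delta> by (auto dest: tendstoD)
  with ev1 obtain m where m: "\<And>n. n \<ge> m \<Longrightarrow> invertible (w n z ** Apar J n)" "\<And>n. n \<ge> m \<Longrightarrow> dist (M n) (mat 1) < \<delta>"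
    unfolding eventually_at_top_linorder by (metis nle_le order_trans)
  have Mn: "norm (M n *v x) \<le> (1 + \<delta>) * norm x" if "n \<ge> m" for n x
  proof -
    have "M n *v x = x + (M n - mat 1) *v x" by (simp add: matrix_vector_mult_diff_rdistrib)
    hence "norm (M n *v x) \<le> norm x + norm ((M n - mat 1) *v x)" by (metis norm_triangle_ineq)
    also have "norm ((M n - mat 1) *v x) \<le> \<delta> * norm x"
      using norm_mat_vec_le[of "M n - mat 1" x] m(2)[OF that]
      by (smt (verit) dist_norm mult_right_mono norm_ge_zero)
    finally show ?thesis by (simp add: algebra_simps)
  qed
  define adm where "adm \<phi> \<eta> \<longleftrightarrow> \<eta> \<in> ell2 \<and> (\<forall>n. jacobi_op_minus J (z + inverse z) \<phi> n = \<eta> n) \<and>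
    (\<lambda>n. u (Suc n) z *v \<eta> n) sums (- (jost J z *v \<phi> 0))" for \<phi> \<eta>
  \<comment> \<open>A geometric average of the tail of \<eta>: up to the constant C2, r^N * b \<eta>
    N dominates the tail of Green's series from N on, and b obeys a backward recursion with factor
    r.\<close>
  define b where "b \<eta> N = (\<Sum>n. r ^ n * norm (\<eta> (n + N)))" for \<eta> :: "nat \<Rightarrow> complex^'l" and N
  have bs: "summable (\<lambda>n. r ^ n * norm (\<eta> (n + N)))" if "\<eta> \<in> ell2" for \<eta> :: "nat \<Rightarrow> complex^'l" and N
  proof (rule summable_comparison_test'[where N = 0])
    show "summable (\<lambda>n. r ^ n * ell2_norm \<eta>)" using r by (intro summable_mult2 summable_geometric) auto
    show "norm (r ^ n * norm (\<eta> (n + N))) \<le> r ^ n * ell2_norm \<eta>" for n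
      using r ell2_norm_nth_le[OF that] by (simp add: mult_left_mono)
  qed
  have b0: "b \<eta> N \<ge> 0" if "\<eta> \<in> ell2" for \<eta> N
    unfolding b_def using r by (intro suminf_nonneg bs that) auto
  have bY: "b \<eta> N \<le> ell2_norm \<eta> / (1 - r)" if "\<eta> \<in> ell2" for \<eta> N
  proof -
    have "b \<eta> N \<le> (\<Sum>n. r ^ n * ell2_norm \<eta>)" unfolding b_def
      using r ell2_norm_nth_le[OF that] by (intro suminf_le bs that summable_mult2 summable_geometric) (auto intro: mult_left_mono)
    also have "\<dots> = ell2_norm \<eta> / (1 - r)"
      using r by (simp add: suminf_mult2[symmetric] suminf_geometric)
    finally show ?thesis .
  qed
  have bstep: "b \<eta> N \<le> r * b \<eta> (Suc N) + norm (\<eta> N)" if "\<eta> \<in> ell2" for \<eta> N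
  proof -
    have "b \<eta> N = norm (\<eta> N) + (\<Sum>n. r ^ Suc n * norm (\<eta> (Suc n + N)))"
      unfolding b_def using suminf_split_head[OF bs[OF that, of N]] by simp
    also have "(\<Sum>n. r ^ Suc n * norm (\<eta> (Suc n + N))) = r * b \<eta> (Suc N)"
      unfolding b_def using suminf_mult[OF bs[OF that, of "Suc N"], of r] by (simp add: mult.assoc)
    finally show ?thesis by simp
  qed
  \<comment> \<open>The constant of \<open>geometric_ell2_backward\<close> with Y = (norm / (1 -
    r))^2 and X = norm^2, divided by 1 - r.\<close>
  define K where "K = (1 / (1 - r)\<^sup>2 + 1 / (1 - r)) / (1 - r)"
  have bK: "(\<Sum>n<N. (b \<eta> n)\<^sup>2) \<le> K * (ell2_norm \<eta>)\<^sup>2" if "\<eta> \<in> ell2" for \<eta> N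
  proof -
    have "(1 - r) * (\<Sum>n<N. (b \<eta> n)\<^sup>2) \<le> (ell2_norm \<eta> / (1 - r))\<^sup>2 + (ell2_norm \<eta>)\<^sup>2 / (1 - r)"
      using r b0[OF that] bstep[OF that] bY[OF that] ell2_partial_le[OF that]
      by (intro geometric_ell2_backward[where c = "\<lambda>n. norm (\<eta> n)"] power_mono) auto
    also have "\<dots> = (1 - r) * K * (ell2_norm \<eta>)\<^sup>2"
    proof -
      have "(1 - r) * K = 1 / (1 - r)\<^sup>2 + 1 / (1 - r)" using r by (simp add: K_def)
      thus ?thesis by (simp add: power_divide distrib_right)
    qed
    finally show ?thesis using r by (simp add: mult.assoc)
  qed
  have S: "norm (\<Sum>n. u (Suc (n + N)) z *v \<eta> (n + N)) \<le> C2 * (r ^ N * b \<eta> N) \<and>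
      summable (\<lambda>n. u (Suc (n + N)) z *v \<eta> (n + N))" if "\<eta> \<in> ell2" for \<eta> N
  proof -
    have *: "norm (u (Suc (n + N)) z *v \<eta> (n + N)) \<le> C2 * (r ^ N * (r ^ n * norm (\<eta> (n + N))))" for n
    proof -
      have "norm (u (Suc (n + N)) z *v \<eta> (n + N)) \<le> norm (u (Suc (n + N)) z) * norm (\<eta> (n + N))"
        by (rule norm_mat_vec_le)
      also have "norm (u (Suc (n + N)) z) \<le> r ^ (n + N) * C2"
      proof -
        have "norm (u (Suc (n + N)) z) = r ^ Suc (n + N) * norm (w (Suc (n + N)) z)"
          by (simp add: jost_sol_def norm_power norm_mult r_def)
        also have "\<dots> \<le> r ^ (n + N) * C2"
          using r C2 by (intro mult_mono) (auto simp: mult_left_le_one_le)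
        finally show ?thesis .
      qed
      finally show ?thesis by (simp add: power_add mult_ac mult_right_mono)
    qed
    have "norm (\<Sum>n. u (Suc (n + N)) z *v \<eta> (n + N)) \<le> (\<Sum>n. C2 * (r ^ N * (r ^ n * norm (\<eta> (n + N)))))"
      by (rule norm_suminf_le[OF *]) (intro summable_mult bs that)
    also have "\<dots> = C2 * (r ^ N * b \<eta> N)"
      unfolding b_def using bs[OF that, of N] by (simp add: suminf_mult summable_mult)
    finally have 1: "norm (\<Sum>n. u (Suc (n + N)) z *v \<eta> (n + N)) \<le> C2 * (r ^ N * b \<eta> N)" .
    have "summable (\<lambda>n. u (Suc (n + N)) z *v \<eta> (n + N))"
      by (rule summable_comparison_test'[where N = 0, OF _ *]) (intro summable_mult bs that)
    with 1 show ?thesis by blast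
  qed
  \<comment> \<open>The full series equals minus u(z) \<phi>_0 by assumption, so the truncated Green
    formula turns the boundary term into minus the tail.\<close>
  have bd: "norm (bdry z \<phi> N) \<le> C2 * (r ^ N * b \<eta> N)" if adm: "adm \<phi> \<eta>" for \<phi> \<eta> N
  proof -
    have \<eta>: "\<eta> \<in> ell2" using adm by (simp add: adm_def)
    have s: "(\<lambda>n. u (Suc n) z *v \<eta> n) sums (- (jost J z *v \<phi> 0))" using adm by (simp add: adm_def)
    have "bdry z \<phi> N = (\<Sum>n<N. u (Suc n) z *v \<eta> n) + jost J z *v \<phi> 0"
      using green[OF reg z(2), of \<phi> N] adm by (simp add: adm_def algebra_simps)
    also have "\<dots> = (\<Sum>n<N. u (Suc n) z *v \<eta> n) - (\<Sum>n. u (Suc n) z *v \<eta> n)"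
      using arg_cong[OF sums_unique[OF s], of uminus] by simp
    also have "\<dots> = - (\<Sum>n. u (Suc (n + N)) z *v \<eta> (n + N))"
      using suminf_minus_initial_segment[OF sums_summable[OF s], of N] by simp
    finally show ?thesis using S[OF \<eta>, of N] by simp
  qed
  have step: "norm (\<phi> (Suc N)) \<le> q * norm (\<phi> N) + C1 * C2 * b \<eta> (Suc N)"
    if adm: "adm \<phi> \<eta>" and N: "Suc N \<ge> m" for \<phi> \<eta> N
  proof -
    define n where "n = Suc N"
    have n: "n \<ge> m" using N by (simp add: n_def)
    have "bdry z \<phi> n = z ^ n *s ((w n z ** Apar J n) *v \<phi> n - z *s ((w (Suc n) z ** adj (Apar J n)) *v \<phi> N))"
      by (simp add: bdry_def n_def jost_sol_def vector_ssub_ldistrib vector_smult_assoc matrix_vector_mul_assoc mult_ac)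
    hence "norm (bdry z \<phi> n) = r ^ n * norm ((w n z ** Apar J n) *v \<phi> n - z *s ((w (Suc n) z ** adj (Apar J n)) *v \<phi> N))"
      by (simp only: norm_smult_vec norm_power r_def)
    with bd[OF adm, of n] r have *: "norm ((w n z ** Apar J n) *v \<phi> n - z *s ((w (Suc n) z ** adj (Apar J n)) *v \<phi> N)) \<le> C2 * b \<eta> n"
      by (simp add: mult.left_commute[of C2])
    have "matrix_inv (w n z ** Apar J n) *v ((w n z ** Apar J n) *v \<phi> n - z *s ((w (Suc n) z ** adj (Apar J n)) *v \<phi> N))
        = \<phi> n - z *s (M n *v \<phi> N)"
      using m(1)[OF n] by (simp add: matrix_vector_mult_diff_distrib M_def matrix_vector_mul_assoc[of _ _ "\<phi> N", symmetric] del: matrix_vector_mul_assoc)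
    hence "norm (\<phi> n - z *s (M n *v \<phi> N)) \<le> C1 * (C2 * b \<eta> n)"
      using norm_mat_vec_le C1 * by (smt (verit, best) mult_mono norm_ge_zero)
    moreover have "norm (\<phi> n) \<le> norm (z *s (M n *v \<phi> N)) + norm (\<phi> n - z *s (M n *v \<phi> N))"
      by (metis add.commute diff_add_cancel norm_triangle_ineq)
    moreover have "norm (z *s (M n *v \<phi> N)) \<le> q * norm (\<phi> N)"
      using mult_left_mono[OF Mn[OF n, of "\<phi> N"], of r] r q(3) by (simp add: r_def mult.assoc[symmetric])
    ultimately show ?thesis by (simp add: n_def mult.assoc)
  qed
  \<comment> \<open>Below m the factor M n is not controlled. The entries there are bounded one at a
    time by the three-term recursion, starting from \<phi>_0, where invertibility of u(z)
    enters.\<close>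
  have init: "\<exists>C\<ge>0. \<forall>\<phi> \<eta>. adm \<phi> \<eta> \<longrightarrow> norm (\<phi> n) \<le> C * ell2_norm \<eta> \<and> norm (\<phi> (Suc n)) \<le> C * ell2_norm \<eta>" for n
  proof (induction n)
    case 0
    define c0 where "c0 = norm (matrix_inv (jost J z)) * (C2 * (1 / (1 - r)))"
    have 0: "norm (\<phi> 0) \<le> c0 * ell2_norm \<eta>" if adm: "adm \<phi> \<eta>" for \<phi> \<eta>
    proof -
      have \<eta>: "\<eta> \<in> ell2" using adm by (simp add: adm_def)
      have "norm (jost J z *v \<phi> 0) \<le> C2 * b \<eta> 0"
        using bd[OF adm, of 0] by (simp add: bdry_def)
      also have "\<dots> \<le> C2 * (ell2_norm \<eta> / (1 - r))" using bY[OF \<eta>] C2 by (intro mult_left_mono) auto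
      finally have *: "norm (jost J z *v \<phi> 0) \<le> C2 * (ell2_norm \<eta> / (1 - r))" .
      have "norm (\<phi> 0) = norm (matrix_inv (jost J z) *v (jost J z *v \<phi> 0))" by (simp add: inv)
      also have "\<dots> \<le> norm (matrix_inv (jost J z)) * norm (jost J z *v \<phi> 0)" by (rule norm_mat_vec_le)
      also have "\<dots> \<le> norm (matrix_inv (jost J z)) * (C2 * (ell2_norm \<eta> / (1 - r)))"
        using * by (rule mult_left_mono) simp
      finally show ?thesis by (simp add: c0_def)
    qed
    define c1 where "c1 = norm (matrix_inv (Apar J 1)) * (1 + norm (Bpar J 1) * c0 + cmod (z + inverse z) * c0)"
    have c0: "c0 \<ge> 0" using C2 r by (simp add: c0_def)
    hence c1: "c1 \<ge> 0" by (simp add: c1_def)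
    have 1: "norm (\<phi> (Suc 0)) \<le> c1 * ell2_norm \<eta>" if adm: "adm \<phi> \<eta>" for \<phi> \<eta>
    proof -
      have \<eta>: "\<eta> \<in> ell2" using adm by (simp add: adm_def)
      have "\<phi> (Suc 0) = matrix_inv (Apar J 1) *v (\<eta> 0 - Bpar J 1 *v \<phi> 0 + (z + inverse z) *s \<phi> 0)"
        using solution_step[of "z + inverse z" \<phi> 0 \<eta>] adm by (simp add: adm_def)
      hence "norm (\<phi> (Suc 0)) \<le> norm (matrix_inv (Apar J 1)) * norm (\<eta> 0 - Bpar J 1 *v \<phi> 0 + (z + inverse z) *s \<phi> 0)"
        using norm_mat_vec_le by metis
      also have "\<dots> \<le> norm (matrix_inv (Apar J 1)) * (ell2_norm \<eta> + norm (Bpar J 1) * (c0 * ell2_norm \<eta>)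
          + cmod (z + inverse z) * (c0 * ell2_norm \<eta>))"
      proof (rule mult_left_mono[OF _ norm_ge_zero], intro norm_triangle_mono order_trans[OF norm_triangle_ineq4] add_mono)
        show "norm (Bpar J 1 *v \<phi> 0) \<le> norm (Bpar J 1) * (c0 * ell2_norm \<eta>)"
          by (rule order_trans[OF norm_mat_vec_le mult_left_mono[OF 0[OF adm]]]) simp
        show "norm ((z + inverse z) *s \<phi> 0) \<le> cmod (z + inverse z) * (c0 * ell2_norm \<eta>)"
          unfolding norm_smult_vec by (rule mult_left_mono[OF 0[OF adm]]) simp
      qed (rule ell2_norm_nth_le[OF \<eta>])
      finally show ?thesis by (simp add: c1_def algebra_simps)
    qed
    show ?case
    proof (intro exI[of _ "max c0 c1"] conjI allI impI)
      fix \<phi> \<eta> assume adm: "adm \<phi> \<eta>"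
      hence "ell2_norm \<eta> \<ge> 0" by (auto simp: adm_def intro: ell2_norm_nonneg)
      hence "c0 * ell2_norm \<eta> \<le> max c0 c1 * ell2_norm \<eta>" "c1 * ell2_norm \<eta> \<le> max c0 c1 * ell2_norm \<eta>"
        by (auto intro!: mult_right_mono)
      thus "norm (\<phi> 0) \<le> max c0 c1 * ell2_norm \<eta>" "norm (\<phi> (Suc 0)) \<le> max c0 c1 * ell2_norm \<eta>"
        using 0[OF adm] 1[OF adm] by linarith+
    qed (use c0 in auto)
  next
    case (Suc n)
    then obtain c where c: "c \<ge> 0" "\<And>\<phi> \<eta>. adm \<phi> \<eta> \<Longrightarrow> norm (\<phi> n) \<le> c * ell2_norm \<eta>"
      "\<And>\<phi> \<eta>. adm \<phi> \<eta> \<Longrightarrow> norm (\<phi> (Suc n)) \<le> c * ell2_norm \<eta>" by blast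
    define d where "d = norm (matrix_inv (Apar J (Suc (Suc n)))) *
      (1 + norm (Bpar J (Suc (Suc n))) * c + cmod (z + inverse z) * c + norm (adj (Apar J (Suc n))) * c)"
    have d: "d \<ge> 0" using c by (simp add: d_def)
    have 2: "norm (\<phi> (Suc (Suc n))) \<le> d * ell2_norm \<eta>" if adm: "adm \<phi> \<eta>" for \<phi> \<eta>
    proof -
      have \<eta>: "\<eta> \<in> ell2" using adm by (simp add: adm_def)
      have "\<phi> (Suc (Suc n)) = matrix_inv (Apar J (Suc (Suc n))) *v (\<eta> (Suc n) - Bpar J (Suc (Suc n)) *v \<phi> (Suc n)
          + (z + inverse z) *s \<phi> (Suc n) - adj (Apar J (Suc n)) *v \<phi> n)"
        using solution_step[of "z + inverse z" \<phi> "Suc n" \<eta>] adm by (simp add: adm_def)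
      hence "norm (\<phi> (Suc (Suc n))) \<le> norm (matrix_inv (Apar J (Suc (Suc n)))) * norm (\<eta> (Suc n)
          - Bpar J (Suc (Suc n)) *v \<phi> (Suc n) + (z + inverse z) *s \<phi> (Suc n) - adj (Apar J (Suc n)) *v \<phi> n)"
        using norm_mat_vec_le by metis
      also have "\<dots> \<le> norm (matrix_inv (Apar J (Suc (Suc n)))) * (ell2_norm \<eta>
          + norm (Bpar J (Suc (Suc n))) * (c * ell2_norm \<eta>) + cmod (z + inverse z) * (c * ell2_norm \<eta>)
          + norm (adj (Apar J (Suc n))) * (c * ell2_norm \<eta>))"
      proof (rule mult_left_mono[OF _ norm_ge_zero], intro order_trans[OF norm_triangle_ineq4] add_mono order_trans[OF norm_triangle_ineq])
        show "norm (Bpar J (Suc (Suc n)) *v \<phi> (Suc n)) \<le> norm (Bpar J (Suc (Suc n))) * (c * ell2_norm \<eta>)"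
          by (rule order_trans[OF norm_mat_vec_le mult_left_mono[OF c(3)[OF adm]]]) simp
        show "norm (adj (Apar J (Suc n)) *v \<phi> n) \<le> norm (adj (Apar J (Suc n))) * (c * ell2_norm \<eta>)"
          by (rule order_trans[OF norm_mat_vec_le mult_left_mono[OF c(2)[OF adm]]]) simp
        show "norm ((z + inverse z) *s \<phi> (Suc n)) \<le> cmod (z + inverse z) * (c * ell2_norm \<eta>)"
          unfolding norm_smult_vec by (rule mult_left_mono[OF c(3)[OF adm]]) simp
      qed (rule ell2_norm_nth_le[OF \<eta>])
      finally show ?thesis by (simp add: d_def algebra_simps)
    qed
    show ?case
    proof (intro exI[of _ "max c d"] conjI allI impI)
      fix \<phi> \<eta> assume adm: "adm \<phi> \<eta>"
      hence "ell2_norm \<eta> \<ge> 0" by (auto simp: adm_def intro: ell2_norm_nonneg)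
      hence "c * ell2_norm \<eta> \<le> max c d * ell2_norm \<eta>" "d * ell2_norm \<eta> \<le> max c d * ell2_norm \<eta>"
        by (auto intro!: mult_right_mono)
      thus "norm (\<phi> (Suc n)) \<le> max c d * ell2_norm \<eta>" "norm (\<phi> (Suc (Suc n))) \<le> max c d * ell2_norm \<eta>"
        using c(3)[OF adm] 2[OF adm] by linarith+
    qed (use d in auto)
  qed
  obtain cs where cs: "\<And>n. cs n \<ge> 0" "\<And>n \<phi> \<eta>. adm \<phi> \<eta> \<Longrightarrow> norm (\<phi> n) \<le> cs n * ell2_norm \<eta>"
    using init by metis
  define T where "T = (\<Sum>n<m. (cs n)\<^sup>2) + ((cs m)\<^sup>2 + (C1 * C2)\<^sup>2 * K / (1 - q)) / (1 - q)"
  have K0: "K \<ge> 0" using r by (simp add: K_def)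
  have T0: "T \<ge> 0" using q K0 by (auto simp: T_def intro!: add_nonneg_nonneg sum_nonneg divide_nonneg_nonneg)
  have main: "(\<Sum>n<N. (norm (\<phi> n))\<^sup>2) \<le> (sqrt T * ell2_norm \<eta>)\<^sup>2" if adm: "adm \<phi> \<eta>" for \<phi> \<eta> N
  proof -
    have \<eta>: "\<eta> \<in> ell2" using adm by (simp add: adm_def)
    have "(\<Sum>n<N. (norm (\<phi> n))\<^sup>2) \<le> (\<Sum>n<m + N. (norm (\<phi> n))\<^sup>2)"
      by (intro sum_mono2) auto
    also have "\<dots> = (\<Sum>n<m. (norm (\<phi> n))\<^sup>2) + (\<Sum>n<N. (norm (\<phi> (n + m)))\<^sup>2)"
    proof -
      have "(\<Sum>n<m + N. (norm (\<phi> n))\<^sup>2) = (\<Sum>n<m. (norm (\<phi> n))\<^sup>2) + (\<Sum>n=m..<m+N. (norm (\<phi> n))\<^sup>2)"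
        by (simp add: lessThan_atLeast0 sum.atLeastLessThan_concat)
      also have "(\<Sum>n=m..<m+N. (norm (\<phi> n))\<^sup>2) = (\<Sum>n<N. (norm (\<phi> (n + m)))\<^sup>2)"
        using sum.shift_bounds_nat_ivl[of "\<lambda>n. (norm (\<phi> n))\<^sup>2" 0 m N] by (simp add: lessThan_atLeast0 add.commute)
      finally show ?thesis .
    qed
    also have "(\<Sum>n<m. (norm (\<phi> n))\<^sup>2) \<le> (\<Sum>n<m. (cs n)\<^sup>2) * (ell2_norm \<eta>)\<^sup>2"
    proof -
      have "(norm (\<phi> n))\<^sup>2 \<le> (cs n)\<^sup>2 * (ell2_norm \<eta>)\<^sup>2" for n
        using power_mono[OF cs(2)[OF adm, of n], of 2] by (simp add: power_mult_distrib)
      thus ?thesis unfolding sum_distrib_right by (intro sum_mono)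
    qed
    also have "(\<Sum>n<N. (norm (\<phi> (n + m)))\<^sup>2) \<le> ((cs m)\<^sup>2 + (C1 * C2)\<^sup>2 * K / (1 - q)) / (1 - q) * (ell2_norm \<eta>)\<^sup>2"
    proof -
      have "(1 - q) * (\<Sum>n<N. (norm (\<phi> (n + m)))\<^sup>2) \<le> (norm (\<phi> (0 + m)))\<^sup>2 + ((C1 * C2)\<^sup>2 * (K * (ell2_norm \<eta>)\<^sup>2)) / (1 - q)"
      proof (rule geometric_ell2_forward[where c = "\<lambda>n. C1 * C2 * b \<eta> (Suc (n + m))"])
        show "norm (\<phi> (Suc n + m)) \<le> q * norm (\<phi> (n + m)) + C1 * C2 * b \<eta> (Suc (n + m))" for n
          using step[OF adm, of "n + m"] by simp
        show "(\<Sum>n<M. (C1 * C2 * b \<eta> (Suc (n + m)))\<^sup>2) \<le> (C1 * C2)\<^sup>2 * (K * (ell2_norm \<eta>)\<^sup>2)" for M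
        proof -
          have "(\<Sum>n<M. (b \<eta> (Suc (n + m)))\<^sup>2) = (\<Sum>n\<in>(\<lambda>n. Suc (n + m)) ` {..<M}. (b \<eta> n)\<^sup>2)"
            by (subst sum.reindex) (auto simp: inj_on_def)
          also have "\<dots> \<le> (\<Sum>n<Suc (M + m). (b \<eta> n)\<^sup>2)" by (intro sum_mono2) auto
          also have "\<dots> \<le> K * (ell2_norm \<eta>)\<^sup>2" by (rule bK[OF \<eta>])
          finally show ?thesis
            by (simp add: power_mult_distrib sum_distrib_left[symmetric] mult_left_mono)
        qed
      qed (use q in auto)
      also have "(norm (\<phi> (0 + m)))\<^sup>2 \<le> (cs m)\<^sup>2 * (ell2_norm \<eta>)\<^sup>2"
        using power_mono[OF cs(2)[OF adm, of m], of 2] by (simp add: power_mult_distrib)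
      finally have "(1 - q) * (\<Sum>n<N. (norm (\<phi> (n + m)))\<^sup>2)
          \<le> (cs m)\<^sup>2 * (ell2_norm \<eta>)\<^sup>2 + ((C1 * C2)\<^sup>2 * (K * (ell2_norm \<eta>)\<^sup>2)) / (1 - q)" by simp
      hence "(1 - q) * (\<Sum>n<N. (norm (\<phi> (n + m)))\<^sup>2)
          \<le> ((cs m)\<^sup>2 + (C1 * C2)\<^sup>2 * K / (1 - q)) * (ell2_norm \<eta>)\<^sup>2"
        by (simp add: distrib_right mult.assoc)
      thus ?thesis using q(2) by (simp add: pos_le_divide_eq mult.commute)
    qed
    finally show ?thesis using T0 by (simp add: T_def power_mult_distrib algebra_simps)
  qed
  show ?thesis
  proof (intro exI[of _ "sqrt T"] conjI[of "0 \<le> sqrt T"] allI impI)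
    show "0 \<le> sqrt T" using T0 by simp
    fix \<phi> \<eta> assume "\<eta> \<in> ell2" "\<forall>n. jacobi_op_minus J (z + inverse z) \<phi> n = \<eta> n"
      "(\<lambda>n. u (Suc n) z *v \<eta> n) sums (- (jost J z *v \<phi> 0))"
    hence adm: "adm \<phi> \<eta>" and \<eta>: "\<eta> \<in> ell2" by (auto simp: adm_def)
    show "\<phi> \<in> ell2 \<and> ell2_norm \<phi> \<le> sqrt T * ell2_norm \<eta>"
      using ell2I[OF main[OF adm]] T0 ell2_norm_nonneg[OF \<eta>] by simp
  qed
qed

end

section \<open>The Joukowsky map and the singular points of the Jost function\<close>

lemma Im_joukowsky: "Im (z + inverse z) = Im z * (1 - 1 / (cmod z)\<^sup>2)"
  by (simp add: cmod_power2 right_diff_distrib)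

lemma Im_joukowsky_eq_0_iff:
  assumes "cmod z < 1" "z \<noteq> 0"
  shows "Im (z + inverse z) = 0 \<longleftrightarrow> z \<in> \<real>"
proof -
  have "(cmod z)\<^sup>2 < 1" using assms(1) by (simp add: power_less_one_iff abs_square_less_1)
  thus ?thesis unfolding Im_joukowsky using assms(2) by (auto simp: complex_is_Real_iff)
qed

lemma joukowsky_inj_on: "inj_on (\<lambda>z. z + inverse z) (ball 0 1 - {0 :: complex})"
proof (rule inj_onI)
  fix z w :: complex assume zw: "z \<in> ball 0 1 - {0}" "w \<in> ball 0 1 - {0}" and eq: "z + inverse z = w + inverse w"
  have "(z - w) * (z * w - 1) = (z * w) * ((z + inverse z) - (w + inverse w))"
    using zw by (simp add: field_simps)
  hence "z = w \<or> z * w = 1" using eq by simp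
  moreover have "cmod (z * w) < 1"
    using zw mult_strict_mono[of "cmod z" 1 "cmod w" 1] by (simp add: norm_mult)
  ultimately show "z = w" by auto
qed

context jacobi_asymptotic
begin

lemma summable_u_ell2:
  assumes z: "cmod z < 1" and \<eta>: "\<eta> \<in> ell2"
  shows "summable (\<lambda>n. u (Suc n) z *v \<eta> n)"
proof -
  obtain C where C: "C > 0" "\<And>n. norm (w n z) \<le> C" using w_bounded[OF regular_ball[OF z]] by blast
  show ?thesis
  proof (rule summable_comparison_test'[where N = 0])
    show "summable (\<lambda>n. cmod z ^ n * (C * ell2_norm \<eta>))" using z by (intro summable_mult2 summable_geometric) auto
    fix n
    have "norm (u (Suc n) z) \<le> cmod z ^ n * C"
    proof -
      have "norm (u (Suc n) z) = cmod z ^ Suc n * norm (w (Suc n) z)"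
        by (simp add: jost_sol_def norm_power norm_mult)
      also have "\<dots> \<le> cmod z ^ n * C"
        using z C by (intro mult_mono) (auto simp: mult_left_le_one_le)
      finally show ?thesis .
    qed
    hence "norm (u (Suc n) z) * norm (\<eta> n) \<le> (cmod z ^ n * C) * ell2_norm \<eta>"
      using C by (intro mult_mono ell2_norm_nth_le \<eta>) auto
    thus "norm (u (Suc n) z *v \<eta> n) \<le> cmod z ^ n * (C * ell2_norm \<eta>)"
      using norm_mat_vec_le[of "u (Suc n) z" "\<eta> n"] by (simp add: mult.assoc)
  qed
qed

lemma column_ell2:
  assumes z: "cmod z < 1"
  shows "(\<lambda>n. adj (u (Suc n) z) *v l) \<in> ell2"
proof -
  obtain C where C: "C > 0" "\<And>n. norm (w n z) \<le> C" using w_bounded[OF regular_ball[OF z]] by blast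
  show ?thesis unfolding ell2_def
  proof (rule CollectI, rule summable_comparison_test'[where N = 0])
    show "summable (\<lambda>n. ((cmod z)\<^sup>2) ^ n * (C * norm l)\<^sup>2)"
      using z by (intro summable_mult2 summable_geometric) (simp add: power_less_one_iff abs_square_less_1)
    fix n
    have "norm (u (Suc n) z) \<le> cmod z ^ n * C"
    proof -
      have "norm (u (Suc n) z) = cmod z ^ Suc n * norm (w (Suc n) z)"
        by (simp add: jost_sol_def norm_power norm_mult)
      also have "\<dots> \<le> cmod z ^ n * C"
        using z C by (intro mult_mono) (auto simp: mult_left_le_one_le)
      finally show ?thesis .
    qed
    hence "norm (adj (u (Suc n) z)) * norm l \<le> cmod z ^ n * C * norm l" by (intro mult_right_mono) auto
    hence "norm (adj (u (Suc n) z) *v l) \<le> cmod z ^ n * (C * norm l)"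
      using norm_mat_vec_le[of "adj (u (Suc n) z)" l] by (simp add: mult.assoc)
    from power_mono[OF this, of 2]
    show "norm ((norm (adj (u (Suc n) z) *v l))\<^sup>2) \<le> ((cmod z)\<^sup>2) ^ n * (C * norm l)\<^sup>2"
      by (simp add: power_mult_distrib power_mult[symmetric] mult.commute)
  qed
qed

text \<open>Symmetry of the operator: the imaginary part of the form telescopes to a boundary term,
  which tends to 0 along a square summable sequence.\<close>

lemma selfadjoint_nonreal:
  assumes \<phi>: "\<phi> \<in> ell2" and eq: "\<And>n. jacobi_op_minus J E \<phi> n = 0" and E: "Im E \<noteq> 0"
  shows "\<phi> n = 0"
proof -
  define b where "b N = (if N = 0 then 0 else cinner (\<phi> (N - 1)) (Apar J N *v \<phi> N))" for N
  have id: "Im E * (\<Sum>n<N. (norm (\<phi> n))\<^sup>2) = Im (b N)" for N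
  proof (induction N)
    case (Suc N)
    have "cinner (\<phi> N) (jacobi_op J \<phi> N) = E * cinner (\<phi> N) (\<phi> N)"
      using eq[of N] by (simp add: jacobi_op_minus_def cinner_simps)
    moreover have "cinner (\<phi> N) (jacobi_op J \<phi> N) = cnj (b N) + cinner (\<phi> N) (Bpar J (Suc N) *v \<phi> N) + b (Suc N)"
      by (simp add: jacobi_op_def b_def cinner_simps cinner_mat_right[of "\<phi> N" "adj (Apar J N)"]
          cinner_commute[of "\<phi> (N - Suc 0)" "Apar J N *v \<phi> N"])
    moreover have "Im (cinner (\<phi> N) (Bpar J (Suc N) *v \<phi> N)) = 0"
    proof -
      have "cinner (\<phi> N) (Bpar J (Suc N) *v \<phi> N) = cnj (cinner (\<phi> N) (Bpar J (Suc N) *v \<phi> N))"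
        by (subst cinner_commute, subst cinner_mat_right) (simp add: adj_B)
      thus ?thesis by (metis cnj.simps(2) neg_equal_zero)
    qed
    ultimately have "E * of_real ((norm (\<phi> N))\<^sup>2) = cnj (b N) + cinner (\<phi> N) (Bpar J (Suc N) *v \<phi> N) + b (Suc N)"
      (is "?l = ?r") and B0: "Im (cinner (\<phi> N) (Bpar J (Suc N) *v \<phi> N)) = 0" by (simp_all add: cinner_self)
    hence "Im ?l = Im ?r" by (simp only:)
    hence "Im E * (norm (\<phi> N))\<^sup>2 = Im (b (Suc N)) - Im (b N)" using B0 by (simp del: of_real_power)
    thus ?case using Suc by (simp add: algebra_simps)
  qed (simp add: b_def)
  have "(\<lambda>N. cinner (\<phi> N) (Apar J (Suc N) *v \<phi> (Suc N))) \<longlonglongrightarrow> cinner 0 ((mat 1 :: complex^'l^'l) *v 0)"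
    using ell2_tendsto_0[OF \<phi>] Apar_tendsto by (intro mat_tendsto_intros LIMSEQ_Suc[OF Apar_tendsto] LIMSEQ_Suc[OF ell2_tendsto_0[OF \<phi>]])
  hence "(\<lambda>N. b (Suc N)) \<longlonglongrightarrow> 0" by (simp add: b_def cinner_simps)
  hence "b \<longlonglongrightarrow> 0" by (rule LIMSEQ_imp_Suc)
  hence "(\<lambda>N. Im (b N)) \<longlonglongrightarrow> Im 0" by (rule tendsto_Im)
  hence "(\<lambda>N. Im E * (\<Sum>n<N. (norm (\<phi> n))\<^sup>2)) \<longlonglongrightarrow> 0" by (simp add: id)
  moreover have "(\<lambda>N. Im E * (\<Sum>n<N. (norm (\<phi> n))\<^sup>2)) \<longlonglongrightarrow> Im E * (ell2_norm \<phi>)\<^sup>2"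
    unfolding ell2_norm_sq[OF \<phi>] by (intro tendsto_intros summable_LIMSEQ ell2_D \<phi>)
  ultimately have "Im E * (ell2_norm \<phi>)\<^sup>2 = 0" by (rule LIMSEQ_unique[symmetric])
  thus ?thesis using E ell2_norm_nth_le[OF \<phi>, of n] by simp
qed

text \<open>At z = 0 the scaled recurrence passes invertibility down from a large index, where the
  value is close to 1. At nonreal z a kernel vector of the adjoint would give a square summable
  solution with nonreal energy.\<close>

lemma singular_imp_real:
  assumes z: "cmod z < 1" and s: "\<not> invertible (jost J z)"
  shows "z \<in> \<real>" "z \<noteq> 0"
proof -
  show nz: "z \<noteq> 0"
  proof
    assume z0: "z = 0"
    have "\<forall>\<^sub>F n in sequentially. invertible (w n z)"
      by (rule eventually_invertible[OF w_tendsto[OF regular_ball[OF z]]]) (simp add: invertible_det_nz)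
    then obtain N where "invertible (w N z)" by (auto simp: eventually_at_top_linorder)
    moreover have "invertible (w (Suc n) z) \<longleftrightarrow> invertible (w n z)" for n
      using w_recurrence[OF regular_ball[OF z], of n] invertible_mat_mult_iff[of "w n z" "Apar J n"] z0 by simp
    hence "invertible (w n z) \<longleftrightarrow> invertible (w 0 z)" for n by (induction n) auto
    ultimately show False using s w_0 by metis
  qed
  obtain l where l: "l \<noteq> 0" "adj (jost J z) *v l = 0"
    using s not_invertible_kernel[of "adj (jost J z)"] by auto
  show "z \<in> \<real>"
  proof (rule ccontr)
    assume "z \<notin> \<real>"
    hence "Im (cnj (z + inverse z)) \<noteq> 0" using Im_joukowsky_eq_0_iff[OF z nz] by simp
    moreover have "jacobi_op_minus J (cnj (z + inverse z)) (\<lambda>n. adj (u (Suc n) z) *v l) n = 0" for n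
      using column_solution[OF regular_ball[OF z] nz, of l n] l by simp
    ultimately have "adj (u (Suc 0) z) *v l = 0"
      using selfadjoint_nonreal[OF column_ell2[OF z]] by blast
    thus False using u_joint_kernel[OF regular_ball[OF z] nz, of l] l by simp
  qed
qed

text \<open>Converse of \<open>eigenvector_kernel\<close>: at a singular, hence real, point every
  kernel vector v is the first entry of an eigenvector, which is moreover a column solution.\<close>

lemma kernel_eigenvector:
  assumes z: "cmod z < 1" and v: "jost J z *v v = 0" and nz: "v \<noteq> 0"
  obtains l where "adj (jost J z) *v l = 0" "(\<lambda>n. adj (u (Suc n) z) *v l) \<in> eigenspace J (z + inverse z)"
    "adj (u 1 z) *v l = v"
proof -
  have "\<not> invertible (jost J z)" using v nz invertible_kernel by blast
  note r = singular_imp_real[OF z this]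
  obtain l where l: "adj (jost J z) *v l = 0" "adj (u 1 z) *v l = v"
    using real_kernel_vector(2)[OF regular_ball[OF z] r(2,1) less_imp_le[OF z] v] by blast
  have c: "cnj (z + inverse z) = z + inverse z" using r by (simp add: Reals_cnj_iff)
  have "jacobi_op_minus J (z + inverse z) (\<lambda>n. adj (u (Suc n) z) *v l) n = 0" for n
    using column_solution[OF regular_ball[OF z] r(2), of l n] l c by simp
  hence "(\<lambda>n. adj (u (Suc n) z) *v l) \<in> eigenspace J (z + inverse z)"
    using column_ell2[OF z] by (simp add: eigenspace_def jacobi_op_minus_def)
  with l show thesis using that by blast
qed

lemma invertible_not_spectrum:
  assumes z: "cmod z < 1" "z \<noteq> 0" and inv: "invertible (jost J z)"
  shows "z + inverse z \<notin> spectrum J"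
proof -
  let ?T = "jacobi_op_minus J (z + inverse z)"
  obtain C where "\<forall>\<phi> \<eta>. \<eta> \<in> ell2 \<longrightarrow> (\<forall>n. ?T \<phi> n = \<eta> n) \<longrightarrow>
    (\<lambda>n. u (Suc n) z *v \<eta> n) sums (- (jost J z *v \<phi> 0)) \<longrightarrow> \<phi> \<in> ell2 \<and> ell2_norm \<phi> \<le> C * ell2_norm \<eta>"
    using resolvent_bound[OF z inv] by blast
  hence C: "\<phi> \<in> ell2 \<and> ell2_norm \<phi> \<le> C * ell2_norm \<eta>" if "\<eta> \<in> ell2" "\<And>n. ?T \<phi> n = \<eta> n"
    "(\<lambda>n. u (Suc n) z *v \<eta> n) sums (- (jost J z *v \<phi> 0))" for \<phi> \<eta> using that by blast
  have bound: "ell2_norm \<phi> \<le> C * ell2_norm (?T \<phi>)" if "\<phi> \<in> ell2" for \<phi>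
    using C[OF jacobi_op_minus_ell2[OF that] refl green_sums[OF z that]] by blast
  have "inj_on ?T ell2"
  proof (rule inj_onI)
    fix \<phi> \<psi> assume m: "\<phi> \<in> ell2" "\<psi> \<in> ell2" and eq: "?T \<phi> = ?T \<psi>"
    let ?d = "\<lambda>n. \<phi> n - \<psi> n"
    have d: "?d \<in> ell2" using m by (rule ell2_diff)
    have "?T ?d = (\<lambda>_. 0)" using eq by (simp add: fun_eq_iff jacobi_op_minus_diff)
    hence "ell2_norm ?d \<le> 0" using bound[OF d] by (simp add: ell2_norm_def)
    hence "norm (?d n) \<le> 0" for n using ell2_norm_nth_le[OF d, of n] by linarith
    thus "\<phi> = \<psi>" by (auto simp: fun_eq_iff)
  qed
  moreover have "?T ` ell2 = ell2"
  proof
    show "?T ` ell2 \<subseteq> ell2" using jacobi_op_minus_ell2 by blast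
    show "ell2 \<subseteq> ?T ` ell2"
    proof
      fix \<eta> :: "nat \<Rightarrow> complex^'l" assume \<eta>: "\<eta> \<in> ell2"
      \<comment> \<open>The initial value is forced by Green's formula; any other choice would
        violate it for a square summable solution.\<close>
      define v where "v = matrix_inv (jost J z) *v (- (\<Sum>n. u (Suc n) z *v \<eta> n))"
      define \<phi> where "\<phi> n = snd (forward (z + inverse z) \<eta> v n)" for n
      have T: "?T \<phi> n = \<eta> n" for n using forward_solution(2) by (simp add: \<phi>_def[abs_def])
      have "jost J z *v \<phi> 0 = - (\<Sum>n. u (Suc n) z *v \<eta> n)"
        using inv by (simp add: \<phi>_def v_def)
      hence "(\<lambda>n. u (Suc n) z *v \<eta> n) sums (- (jost J z *v \<phi> 0))"
        using summable_sums[OF summable_u_ell2[OF z(1) \<eta>]] by simp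
      hence "\<phi> \<in> ell2" using C[OF \<eta> T] by blast
      moreover have "\<eta> = ?T \<phi>" using T by auto
      ultimately show "\<eta> \<in> ?T ` ell2" by blast
    qed
  qed
  ultimately have "bij_betw ?T ell2 ell2" by (simp add: bij_betw_def)
  thus ?thesis using bound by (auto simp: spectrum_def)
qed

section \<open>Eigenspaces, the spectrum and the M-function\<close>

lemma eigenspace_zero: "(\<lambda>n. 0) \<in> eigenspace J E"
  by (simp add: eigenspace_def ell2_def jacobi_op_def)

lemma eigenspace_D: "\<phi> \<in> eigenspace J E \<Longrightarrow> \<phi> \<in> ell2" "\<phi> \<in> eigenspace J E \<Longrightarrow> jacobi_op_minus J E \<phi> n = 0"
  by (auto simp: eigenspace_def jacobi_op_minus_def)

lemma singular_spectrum:
  assumes z: "cmod z < 1" and s: "\<not> invertible (jost J z)"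
  shows "z + inverse z \<in> spectrum J"
proof -
  obtain v where v: "v \<noteq> 0" "jost J z *v v = 0" using s not_invertible_kernel by blast
  obtain l where l: "(\<lambda>n. adj (u (Suc n) z) *v l) \<in> eigenspace J (z + inverse z)" "adj (u 1 z) *v l = v"
    using kernel_eigenvector[OF z v(2,1)] by blast
  let ?\<phi> = "\<lambda>n. adj (u (Suc n) z) *v l"
  have "\<not> inj_on (jacobi_op_minus J (z + inverse z)) ell2"
  proof
    assume "inj_on (jacobi_op_minus J (z + inverse z)) ell2"
    moreover have "jacobi_op_minus J (z + inverse z) ?\<phi> = jacobi_op_minus J (z + inverse z) (\<lambda>n. 0)"
      using eigenspace_D(2)[OF l(1)] eigenspace_D(2)[OF eigenspace_zero, of "z + inverse z"] by auto
    ultimately have "?\<phi> = (\<lambda>n. 0)"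
      using eigenspace_D(1)[OF l(1)] eigenspace_D(1)[OF eigenspace_zero] by (auto dest: inj_onD)
    thus False using l(2) v(1) by (metis One_nat_def)
  qed
  thus ?thesis by (auto simp: spectrum_def bij_betw_def)
qed

text \<open>Both directions of the spectral characterization; the origin lies on both sides because
  u(0) is invertible.\<close>

lemma M_dom_iff: "z \<in> M_dom J \<longleftrightarrow> cmod z < 1 \<and> invertible (jost J z)"
  using invertible_not_spectrum singular_spectrum singular_imp_real(2)[of z]
  unfolding M_dom_def by (cases "z = 0") auto

lemma u_1_at_0: "u (Suc 0) 0 = 0"
  by (simp add: jost_sol_def)

text \<open>Apply Green's formula to a column of the resolvent: its image lives in the first block,
  so a single term of the series survives. At the origin both sides vanish.\<close>

lemma M_fun_eq:
  assumes "cmod z < 1" and inv: "invertible (jost J z)"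
  shows "M_fun J z = matrix_inv (jost J z) ** u 1 z" "jost J z ** M_fun J z = u 1 z"
proof -
  show *: "jost J z ** M_fun J z = u 1 z"
  proof (cases "z = 0")
    case True
    thus ?thesis by (simp add: M_fun_def u_1_at_0)
  next
    case False
    let ?E = "z + inverse z"
    have "bij_betw (jacobi_op_minus J ?E) ell2 ell2"
      using invertible_not_spectrum[OF assms(1) False inv] by (simp add: spectrum_def)
    note b = this
    have "(jost J z ** m_fun J ?E) *v axis j 1 = - (u 1 z *v axis j 1)" for j
    proof -
      define \<phi> where "\<phi> = resolvent J ?E (first_block_vec (axis j 1))"
      have \<phi>: "\<phi> \<in> ell2" "jacobi_op_minus J ?E \<phi> = first_block_vec (axis j 1)"
        unfolding \<phi>_def resolvent_def
        using the_inv_into_into[OF bij_betw_imp_inj_on[OF b], of _ ell2] f_the_inv_into_f_bij_betw[OF b]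
          bij_betw_imp_surj_on[OF b] ell2_first_block[of "axis j 1 :: complex^'l"] by auto
      have "(\<lambda>n. u (Suc n) z *v first_block_vec (axis j 1) n) sums (- (jost J z *v \<phi> 0))"
        using green_sums[OF assms(1) False \<phi>(1)] \<phi>(2) by simp
      moreover have "(\<lambda>n. u (Suc n) z *v first_block_vec (axis j 1) n) sums (u 1 z *v axis j 1)"
        using sums_single[of 0 "\<lambda>n. u (Suc n) z *v axis j 1"]
        by (simp add: first_block_vec_def if_distrib cong: if_cong)
      ultimately have "u 1 z *v axis j 1 = - (jost J z *v \<phi> 0)" by (rule sums_unique2[symmetric])
      moreover have "m_fun J ?E *v axis j 1 = \<phi> 0"
        by (simp add: mat_vec_axis column_def vec_eq_iff m_fun_def \<phi>_def)
      ultimately show ?thesis by (simp add: matrix_vector_mul_assoc[symmetric])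
    qed
    hence "(jost J z ** M_fun J z) *v axis j 1 = u 1 z *v axis j 1" for j
      using False by (simp add: M_fun_def)
    thus ?thesis by (simp add: mat_vec_axis column_def vec_eq_iff)
  qed
  show "M_fun J z = matrix_inv (jost J z) ** u 1 z"
    unfolding *[symmetric] using inv by (simp add: matrix_mul_assoc matrix_inv_mult)
qed

text \<open>The determinant of u is holomorphic and nonzero at the origin, so on a connected domain
  containing it its zeros are isolated.\<close>

lemma eventually_invertible_jost:
  assumes V: "open V" "connected V" "0 \<in> V" "mat_holo (jost J) V" "z \<in> V"
  shows "\<forall>\<^sub>F \<zeta> in at z. invertible (jost J \<zeta>)"
proof (cases "invertible (jost J z)")
  case True
  have "continuous_on V (jost J)" using V(4) by (rule mat_holo_continuous)
  hence "(jost J \<longlongrightarrow> jost J z) (at z)" using V(1,5) by (metis at_within_open continuous_on_def)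
  thus ?thesis using True by (rule eventually_invertible)
next
  case False
  have "invertible (jost J 0)" using singular_imp_real(2)[of 0] by auto
  then obtain r where r: "0 < r" "ball z r \<subseteq> V" "\<And>\<zeta>. \<zeta> \<in> ball z r - {z} \<Longrightarrow> det (jost J \<zeta>) \<noteq> 0"
    using isolated_zeros[OF mat_holo_det[OF V(4)] V(1,2,5) _ V(3)] False
    by (auto simp: invertible_det_nz)
  thus ?thesis
    unfolding eventually_at by (intro exI[of _ r]) (auto simp: invertible_det_nz dist_commute)
qed

lemma jost_holo_ball: "mat_holo (jost J) (ball 0 1)"
proof -
  have "ball 0 1 \<subseteq> cball 0 1 - {1, -1 :: complex}" by auto
  from region_holo[OF region_A1 open_ball this, of 0] show ?thesis by (simp add: jshift_0[OF jacobi])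
qed

lemma eventually_invertible_jost_ball:
  "cmod z < 1 \<Longrightarrow> \<forall>\<^sub>F \<zeta> in at z. invertible (jost J \<zeta>) \<and> cmod \<zeta> < 1"
proof -
  assume z: "cmod z < 1"
  have "\<forall>\<^sub>F \<zeta> in at z. \<zeta> \<in> ball 0 1" using z by (intro eventually_at_in_open') auto
  thus ?thesis using eventually_invertible_jost[of "ball 0 1" z] z jost_holo_ball
    by (auto elim: eventually_elim2)
qed

text \<open>A solution is determined by its first entry, and the admissible first entries are
  exactly the kernel of u(z).\<close>

lemma eigenspace_image:
  assumes z: "cmod z < 1" "z \<noteq> 0"
  shows "eigenspace J (z + inverse z) = (\<lambda>v n. snd (forward (z + inverse z) (\<lambda>_. 0) v n)) ` ker_mat (jost J z)"
proof (intro set_eqI iffI)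
  let ?E = "z + inverse z"
  fix \<phi> assume \<phi>: "\<phi> \<in> eigenspace J ?E"
  have "\<phi> = (\<lambda>n. snd (forward ?E (\<lambda>_. 0) (\<phi> 0) n))"
    by (rule solution_unique[of ?E _ "\<lambda>_. 0"]) (simp_all add: forward_solution eigenspace_D(2)[OF \<phi>])
  moreover have "\<phi> 0 \<in> ker_mat (jost J z)" using eigenvector_kernel[OF z \<phi>] by (simp add: ker_mat_def)
  ultimately show "\<phi> \<in> (\<lambda>v n. snd (forward ?E (\<lambda>_. 0) v n)) ` ker_mat (jost J z)" by blast
next
  let ?E = "z + inverse z"
  fix \<phi> assume "\<phi> \<in> (\<lambda>v n. snd (forward ?E (\<lambda>_. 0) v n)) ` ker_mat (jost J z)"
  then obtain v where v: "jost J z *v v = 0" "\<phi> = (\<lambda>n. snd (forward ?E (\<lambda>_. 0) v n))" by (auto simp: ker_mat_def)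
  show "\<phi> \<in> eigenspace J ?E"
  proof (cases "v = 0")
    case True
    have "\<phi> = (\<lambda>n. 0)" unfolding v(2)
      by (rule solution_unique[of ?E _ "\<lambda>_. 0"]) (simp_all add: forward_solution eigenspace_D(2)[OF eigenspace_zero] True)
    thus ?thesis using eigenspace_zero by simp
  next
    case False
    then obtain l where l: "(\<lambda>n. adj (u (Suc n) z) *v l) \<in> eigenspace J ?E" "adj (u 1 z) *v l = v"
      using kernel_eigenvector[OF z(1) v(1)] by blast
    have "\<phi> = (\<lambda>n. adj (u (Suc n) z) *v l)" unfolding v(2)
      by (rule solution_unique[of ?E _ "\<lambda>_. 0"]) (use l(2) in \<open>simp_all add: forward_solution eigenspace_D(2)[OF l(1)]\<close>)
    thus ?thesis using l(1) by simp
  qed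
qed

text \<open>The first entry determines the solution linearly and injectively, so the dimension of
  the kernel is the multiplicity.\<close>

lemma eigenspace_dim:
  assumes z: "cmod z < 1" "z \<noteq> 0"
  shows "eigen_multiplicity J (z + inverse z) = vec.dim (ker_mat (jost J z))"
    and "\<exists>b. finite b \<and> eigenspace J (z + inverse z) \<subseteq> cseq.span b"
proof -
  let ?E = "z + inverse z"
  define f where "f v = (\<lambda>n. snd (forward ?E (\<lambda>_. 0) v n))" for v
  have f: "jacobi_op_minus J ?E (f v) n = 0" "f v 0 = v" for v n by (simp_all add: f_def forward_solution)
  interpret P: finite_dimensional_vector_space_pair_1 "(*s) :: complex \<Rightarrow> complex^'l \<Rightarrow> _" cart_basis
    "\<lambda>(c::complex) (\<phi> :: nat \<Rightarrow> complex^'l) n. c *s \<phi> n"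
    by unfold_locales
  have lin: "Vector_Spaces.linear (*s) (\<lambda>(c::complex) (\<phi> :: nat \<Rightarrow> complex^'l) n. c *s \<phi> n) f"
    unfolding Vector_Spaces.linear_iff
  proof (intro conjI allI)
    fix x y :: "complex^'l" and c :: complex
    show "f (x + y) = f x + f y"
      by (rule solution_unique[of ?E _ "\<lambda>_. 0"]) (simp_all add: f plus_fun_def jacobi_op_minus_add)
    show "f (c *s x) = (\<lambda>n. c *s f x n)"
      by (rule solution_unique[of ?E _ "\<lambda>_. 0"]) (simp_all add: f jacobi_op_minus_smult)
  qed unfold_locales
  have inj: "inj f" by (rule injI) (metis f(2))
  have im: "eigenspace J ?E = f ` ker_mat (jost J z)" using eigenspace_image[OF z] by (simp add: f_def[abs_def])
  show "eigen_multiplicity J (z + inverse z) = vec.dim (ker_mat (jost J z))"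
    unfolding eigen_multiplicity_def im by (rule P.dim_image_eq[OF lin]) (use inj inj_on_subset in blast)
  obtain B :: "(complex^'l) set" where B: "B \<subseteq> ker_mat (jost J z)" "vec.independent B" "ker_mat (jost J z) \<subseteq> vec.span B"
    "card B = vec.dim (ker_mat (jost J z))" by (rule vec.basis_exists)
  have "finite B" using vec.finiteI_independent B(2) by blast
  moreover have "eigenspace J ?E \<subseteq> cseq.span (f ` B)"
  proof -
    interpret L: Vector_Spaces.linear "(*s)" "\<lambda>(c::complex) (\<phi> :: nat \<Rightarrow> complex^'l) n. c *s \<phi> n" f by (rule lin)
    show ?thesis unfolding im using L.spans_image[OF B(3)] .
  qed
  ultimately show "\<exists>b. finite b \<and> eigenspace J ?E \<subseteq> cseq.span b" by blast
qed

text \<open>The eigenvalue condition matches the kernel of u(z); what remains is to show that such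
  an energy is isolated in the spectrum.\<close>

lemma eigen_points_eq: "eigen_points J = {z \<in> ball 0 1. \<not> invertible (jost J z)}"
proof (intro set_eqI iffI)
  fix z assume z: "z \<in> eigen_points J"
  hence z1: "cmod z < 1" "z \<noteq> 0" and "discrete_eigenvalue J (z + inverse z)" by (auto simp: eigen_points_def)
  then obtain \<phi> n where \<phi>: "\<phi> \<in> eigenspace J (z + inverse z)" "\<phi> n \<noteq> 0" by (auto simp: discrete_eigenvalue_def)
  have "\<phi> 0 \<noteq> 0"
  proof
    assume "\<phi> 0 = 0"
    hence "\<phi> = (\<lambda>n. 0)"
      using eigenspace_D(2)[OF \<phi>(1)] eigenspace_D(2)[OF eigenspace_zero]
      by (intro solution_unique[of "z + inverse z" _ "\<lambda>_. 0"]) auto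
    thus False using \<phi>(2) by simp
  qed
  thus "z \<in> {z \<in> ball 0 1. \<not> invertible (jost J z)}"
    using eigenvector_kernel[OF z1 \<phi>(1)] invertible_kernel z1 by auto
next
  fix z assume "z \<in> {z \<in> ball 0 1. \<not> invertible (jost J z)}"
  hence z: "cmod z < 1" and s: "\<not> invertible (jost J z)" by auto
  note r = singular_imp_real[OF z s]
  let ?E = "z + inverse z"
  obtain v where v: "v \<noteq> 0" "jost J z *v v = 0" using s not_invertible_kernel by blast
  obtain l where l: "(\<lambda>n. adj (u (Suc n) z) *v l) \<in> eigenspace J ?E" "adj (u 1 z) *v l = v"
    using kernel_eigenvector[OF z v(2,1)] by blast
  have 1: "\<exists>\<phi>\<in>eigenspace J ?E. \<exists>n. \<phi> n \<noteq> 0"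
    using l v(1) by (intro bexI[OF _ l(1)] exI[of _ 0]) auto
  have "\<forall>\<^sub>F \<zeta> in at z. invertible (jost J \<zeta>) \<and> \<zeta> \<in> ball 0 1 - {0}"
    using eventually_invertible_jost_ball[OF z] eventually_at_in_open'[of "- {0}" z] r(2)
    by (auto elim: eventually_elim2 simp: open_Compl)
  then obtain d where d: "d > 0" "\<And>\<zeta>. \<zeta> \<noteq> z \<Longrightarrow> dist \<zeta> z < d \<Longrightarrow> invertible (jost J \<zeta>) \<and> \<zeta> \<in> ball 0 1 - {0}"
    unfolding eventually_at by auto
  have sub: "ball z d \<subseteq> ball 0 1 - {0}" using d(2) z r(2) by (force simp: dist_commute)
  \<comment> \<open>The Joukowsky map is injective and open near z, so isolation of the zero of det
    u becomes isolation of the energy.\<close>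
  have "open ((\<lambda>z. z + inverse z) ` ball z d)"
  proof (rule open_mapping_thm3)
    show "(\<lambda>z. z + inverse z) holomorphic_on ball z d" using sub by (intro holomorphic_intros) blast
    show "inj_on (\<lambda>z. z + inverse z) (ball z d)" using joukowsky_inj_on sub by (rule inj_on_subset)
  qed auto
  moreover have "(\<lambda>z. z + inverse z) ` ball z d \<inter> spectrum J = {?E}"
  proof (intro equalityI subsetI)
    fix E assume "E \<in> (\<lambda>z. z + inverse z) ` ball z d \<inter> spectrum J"
    then obtain \<zeta> where \<zeta>: "\<zeta> \<in> ball z d" "E = \<zeta> + inverse \<zeta>" "E \<in> spectrum J" by blast
    have "\<zeta> = z"
    proof (rule ccontr)
      assume "\<zeta> \<noteq> z"
      hence "invertible (jost J \<zeta>) \<and> \<zeta> \<in> ball 0 1 - {0}" using d(2) \<zeta>(1) by (simp add: dist_commute)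
      thus False using invertible_not_spectrum[of \<zeta>] \<zeta> by simp
    qed
    thus "E \<in> {?E}" using \<zeta> by simp
  qed (use d(1) singular_spectrum[OF z s] in auto)
  ultimately have "?E isolated_in spectrum J"
    using singular_spectrum[OF z s] by (auto simp: isolated_in_def)
  thus "z \<in> eigen_points J"
    using 1 eigenspace_dim(2)[OF z r(2)] r z by (auto simp: eigen_points_def discrete_eigenvalue_def)
qed

end

section \<open>Simple zeros of matrix-valued functions\<close>

definition diag_mat :: "('n \<Rightarrow> complex) \<Rightarrow> complex^'n^'n"
  where "diag_mat f = (\<chi> i j. if i = j then f i else 0)"

lemma mult_diag_mat_nth: "(X ** diag_mat f) $ i $ j = X $ i $ j * f j"
  by (simp add: matrix_matrix_mult_def diag_mat_def if_distrib cong: if_cong)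

lemma smult_diag_mat: "c *\<^sub>m diag_mat f = diag_mat (\<lambda>i. c * f i)"
  by (rule mat_eqI) (simp add: diag_mat_def)

lemma diag_mat_vec_nth: "(diag_mat f *v x) $ i = f i * x $ i"
  by (simp add: matrix_vector_mult_def diag_mat_def if_distrib if_distribR cong: if_cong)

lemma det_diag_mat: "det (diag_mat f) = (\<Prod>i\<in>UNIV. f i)"
  by (subst det_diagonal) (auto simp: diag_mat_def)

lemma tendsto_diag_mat [tendsto_intros]:
  assumes "\<And>i. ((\<lambda>x. f x i) \<longlongrightarrow> l i) G"
  shows "((\<lambda>x. diag_mat (f x)) \<longlongrightarrow> diag_mat l) G"
  using assms by (intro mat_tendstoI) (simp add: diag_mat_def)

text \<open>Coordinates in which K is spanned by the axes in D, so that dividing the columns in D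
  touches the kernel directions only.\<close>

lemma adapted_basis:
  fixes K :: "(complex^'n) set"
  assumes K: "vec.subspace K"
  obtains Q :: "complex^'n^'n" and D :: "'n set" where "invertible Q" "card D = vec.dim K"
    "K = {Q *v x | x. \<forall>i. i \<notin> D \<longrightarrow> x $ i = 0}"
proof -
  obtain B where B: "B \<subseteq> K" "vec.independent B" "K \<subseteq> vec.span B" "card B = vec.dim K"
    by (rule vec.basis_exists)
  define B' where "B' = vec.extend_basis B"
  have B': "vec.independent B'" "vec.span B' = UNIV" "B \<subseteq> B'"
    using vec.independent_extend_basis[OF B(2)] vec.span_extend_basis[OF B(2)] vec.extend_basis_superset[OF B(2)]
    by (auto simp: B'_def)
  have fin: "finite B'" using vec.finiteI_independent[OF B'(1)] .
  have "card B' = CARD('n)" using vec.dim_eq_card[of B' UNIV] B' vec_dim_card[where 'a = complex and 'n = 'n] by simp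
  then obtain b where b: "bij_betw b (UNIV :: 'n set) B'"
    using finite_same_card_bij[OF _ fin, of "UNIV :: 'n set"] by auto
  define Q :: "complex^'n^'n" where "Q = (\<chi> i j. b j $ i)"
  define D where "D = b -` B"
  have col: "column j Q = b j" for j by (simp add: column_def Q_def vec_eq_iff)
  have "columns Q = B'"
    using b by (auto simp: columns_def col bij_betw_def)
  hence "\<exists>X. Q ** X = mat 1" using B'(2) by (simp add: matrix_right_invertible_span_columns)
  hence inv: "invertible Q" using matrix_inv_unique(1) by blast
  have bD: "bij_betw b D B"
    using b B'(3) unfolding D_def bij_betw_def by (auto intro: inj_on_subset)
  have cD: "card D = vec.dim K" using bij_betw_same_card[OF bD] B(4) by simp
  have span: "vec.span B = K"
    using B vec.span_minimal[OF B(1) K] by auto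
  have "K = {Q *v x | x. \<forall>i. i \<notin> D \<longrightarrow> x $ i = 0}"
  proof (intro set_eqI iffI)
    fix v assume "v \<in> K"
    hence "v \<in> vec.span B" using span by simp
    then obtain c where c: "v = (\<Sum>a\<in>B. c a *s a)"
      using vec.span_finite[OF finite_subset[OF B'(3) fin]] by auto
    define x :: "complex^'n" where "x = (\<chi> i. if i \<in> D then c (b i) else 0)"
    have "Q *v x = (\<Sum>i\<in>UNIV. x $ i *s b i)" by (simp add: matrix_mult_sum col)
    also have "\<dots> = (\<Sum>i\<in>D. c (b i) *s b i)"
      by (rule sum.mono_neutral_cong_right) (auto simp: x_def)
    also have "\<dots> = v" unfolding c by (rule sum.reindex_bij_betw[OF bD])
    finally show "v \<in> {Q *v x | x. \<forall>i. i \<notin> D \<longrightarrow> x $ i = 0}" by (force simp: x_def)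
  next
    fix v assume "v \<in> {Q *v x | x. \<forall>i. i \<notin> D \<longrightarrow> x $ i = 0}"
    then obtain x where x: "v = Q *v x" "\<And>i. i \<notin> D \<Longrightarrow> x $ i = 0" by blast
    have "v = (\<Sum>i\<in>UNIV. x $ i *s b i)" unfolding x by (simp add: matrix_mult_sum col)
    also have "\<dots> \<in> K"
    proof (rule vec.subspace_sum[OF K])
      fix i show "x $ i *s b i \<in> K"
        using x(2)[of i] B(1) K by (cases "i \<in> D") (auto simp: D_def vec.subspace_scale vec.subspace_0)
    qed
    finally show "v \<in> K" .
  qed
  with inv cD show thesis by (rule that)
qed

text \<open>\<open>F\<close> has a simple zero at \<open>z0\<close> as soon as the first-order behaviour \<open>k\<close> of \<open>F\<close> on its kernel
  is nondegenerate modulo the range of \<open>F z0\<close>: dividing the columns that span the kernel by \<open>z - z0\<close>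
  leaves a function \<open>T\<close> that is invertible at \<open>z0\<close>.\<close>

locale simple_zero =
  fixes F :: "complex \<Rightarrow> complex^'n^'n" and S :: "complex set" and z0 :: complex
    and k :: "complex^'n \<Rightarrow> complex^'n"
  assumes nonbot: "at z0 within S \<noteq> bot"
    and cont: "(F \<longlongrightarrow> F z0) (at z0 within S)"
    and lim: "\<And>v. F z0 *v v = 0 \<Longrightarrow> ((\<lambda>z. inverse (z - z0) *s (F z *v v)) \<longlongrightarrow> k v) (at z0 within S)"
    and nondeg: "\<And>v. F z0 *v v = 0 \<Longrightarrow> v \<noteq> 0 \<Longrightarrow> \<exists>l. adj (F z0) *v l = 0 \<and> cinner l (k v) \<noteq> 0"
begin

lemma factorization:
  obtains Q :: "complex^'n^'n" and D :: "'n set" and T0 where "invertible Q" "invertible T0" "card D = vec.dim (ker_mat (F z0))"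
    "ker_mat (F z0) = {Q *v x | x. \<forall>i. i \<notin> D \<longrightarrow> x $ i = 0}"
    "\<forall>x. (\<forall>i\<in>D. x $ i = 0) \<longrightarrow> T0 *v x = F z0 *v (Q *v x)"
    "((\<lambda>z. F z ** Q ** diag_mat (\<lambda>i. if i \<in> D then inverse (z - z0) else 1)) \<longlongrightarrow> T0) (at z0 within S)"
proof -
  have sub: "vec.subspace (ker_mat (F z0))"
    by (auto simp: vec.subspace_def ker_mat_def matrix_vector_right_distrib)
  obtain Q :: "complex^'n^'n" and D :: "'n set" where Q: "invertible Q" "card D = vec.dim (ker_mat (F z0))"
    "ker_mat (F z0) = {Q *v x | x. \<forall>i. i \<notin> D \<longrightarrow> x $ i = 0}" by (rule adapted_basis[OF sub])
  define T where "T z = F z ** Q ** diag_mat (\<lambda>i. if i \<in> D then inverse (z - z0) else 1)" for z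
  \<comment> \<open>The expected limit: rescaled columns tend to the first-order terms
    \<open>k\<close>, the others to the columns of F z0 ** Q.\<close>
  define T0 :: "complex^'n^'n" where "T0 = (\<chi> i j. if j \<in> D then k (column j Q) $ i else (F z0 ** Q) $ i $ j)"
  have Qj: "F z0 *v column j Q = 0" if "j \<in> D" for j
  proof -
    have "Q *v axis j 1 \<in> ker_mat (F z0)" unfolding Q(3) using that by (auto intro!: exI[of _ "axis j 1"] simp: axis_def)
    thus ?thesis by (simp add: ker_mat_def mat_vec_axis)
  qed
  have T: "(T \<longlongrightarrow> T0) (at z0 within S)"
  proof (rule mat_tendstoI)
    fix i j
    have c: "(F z ** Q) $ i $ j = (F z *v column j Q) $ i" for z
      by (simp add: matrix_matrix_mult_def matrix_vector_mult_def column_def)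
    show "((\<lambda>z. T z $ i $ j) \<longlongrightarrow> T0 $ i $ j) (at z0 within S)"
    proof (cases "j \<in> D")
      case True
      have "((\<lambda>z. (inverse (z - z0) *s (F z *v column j Q)) $ i) \<longlongrightarrow> k (column j Q) $ i) (at z0 within S)"
        by (intro tendsto_vec_nth lim Qj True)
      thus ?thesis using True by (simp add: T_def T0_def mult_diag_mat_nth c mult.commute)
    next
      case False
      have "((\<lambda>z. (F z ** Q) $ i $ j) \<longlongrightarrow> (F z0 ** Q) $ i $ j) (at z0 within S)"
        by (intro mat_tendstoD tendsto_intros cont)
      thus ?thesis using False by (simp add: T_def T0_def mult_diag_mat_nth)
    qed
  qed
  have T0_off: "T0 *v x = F z0 *v (Q *v x)" if "\<And>i. i \<in> D \<Longrightarrow> x $ i = 0" for x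
  proof -
    have "T0 *v x = (F z0 ** Q) *v x"
      unfolding vec_eq_iff matrix_vector_mult_def using that by (auto simp: T0_def intro!: sum.cong)
    thus ?thesis by (simp add: matrix_vector_mul_assoc)
  qed
  \<comment> \<open>Uniqueness of limits makes \<open>k\<close> linear on the kernel, although only
    pointwise limits are assumed.\<close>
  have T0_on: "T0 *v x = k (Q *v x)" if x: "\<And>i. i \<notin> D \<Longrightarrow> x $ i = 0" for x
  proof (rule tendsto_unique[OF nonbot])
    show "((\<lambda>z. T z *v x) \<longlongrightarrow> T0 *v x) (at z0 within S)" by (intro tendsto_intros T)
    have "T z *v x = inverse (z - z0) *s (F z *v (Q *v x))" for z
    proof -
      have "diag_mat (\<lambda>i. if i \<in> D then inverse (z - z0) else 1) *v x = inverse (z - z0) *s x"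
        using x by (auto simp: vec_eq_iff diag_mat_vec_nth)
      thus ?thesis by (simp add: T_def matrix_vector_mul_assoc[symmetric])
    qed
    moreover have "F z0 *v (Q *v x) = 0" using x Q(3) unfolding ker_mat_def by blast
    ultimately show "((\<lambda>z. T z *v x) \<longlongrightarrow> k (Q *v x)) (at z0 within S)" using lim by simp
  qed
  \<comment> \<open>Split a kernel vector along D. Pairing with vectors l that annihilate the range
    of F z0 removes the part outside D, so nondegeneracy kills the part in D; the rest lies in the
    kernel of F z0 and outside D at once.\<close>
  have "invertible T0"
  proof (rule invertibleI_kernel)
    fix x assume 0: "T0 *v x = 0"
    define x1 x2 :: "complex^'n" where "x1 = (\<chi> i. if i \<in> D then x $ i else 0)"
      and "x2 = (\<chi> i. if i \<in> D then 0 else x $ i)"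
    have xx: "x = x1 + x2" by (simp add: x1_def x2_def vec_eq_iff)
    have 1: "k (Q *v x1) + F z0 *v (Q *v x2) = 0"
      using 0 T0_on[of x1] T0_off[of x2] by (simp add: xx matrix_vector_right_distrib x1_def x2_def)
    have "Q *v x1 \<in> ker_mat (F z0)" unfolding Q(3) by (auto simp: x1_def)
    hence ker1: "F z0 *v (Q *v x1) = 0" by (simp add: ker_mat_def)
    have "Q *v x1 = 0"
    proof (rule ccontr)
      assume "Q *v x1 \<noteq> 0"
      then obtain l where l: "adj (F z0) *v l = 0" "cinner l (k (Q *v x1)) \<noteq> 0" using nondeg ker1 by blast
      have "cinner l (k (Q *v x1)) = cinner l (k (Q *v x1) + F z0 *v (Q *v x2))"
        by (simp add: cinner_simps cinner_mat_right l(1))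
      thus False using l(2) 1 by (simp add: cinner_simps)
    qed
    hence x1: "x1 = 0" using invertible_kernel[OF Q(1)] by blast
    have "k 0 = 0"
    proof (rule tendsto_unique[OF nonbot])
      show "((\<lambda>z. 0) \<longlongrightarrow> k 0) (at z0 within S)" using lim[of 0] by simp
    qed simp
    hence "F z0 *v (Q *v x2) = 0" using 1 x1 by simp
    then obtain y where y: "Q *v x2 = Q *v y" "\<forall>i. i \<notin> D \<longrightarrow> y $ i = 0" using Q(3) unfolding ker_mat_def by blast
    hence "x2 = y" using inj_matrix_vector_mult[OF Q(1)] by (auto dest: injD)
    hence "x2 $ i = 0" for i using y(2) by (cases "i \<in> D") (auto simp: x2_def)
    hence "x2 = 0" by (simp add: vec_eq_iff)
    thus "x = 0" using xx x1 by simp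
  qed
  moreover have "\<forall>x. (\<forall>i\<in>D. x $ i = 0) \<longrightarrow> T0 *v x = F z0 *v (Q *v x)" using T0_off by blast
  ultimately show thesis using that[OF Q(1) _ Q(2,3) _ T[unfolded T_def[abs_def]]] by blast
qed

text \<open>By the factorization, (z - z0) times the inverse of F is Q diag(1 on D, z - z0 off D)
  T^-1. Its limit is Q, the projection onto D and the inverse of T0, from which range and kernel can
  be read off.\<close>

lemma inverse_limit:
  obtains L where "((\<lambda>z. (z - z0) *\<^sub>m matrix_inv (F z)) \<longlongrightarrow> L) (at z0 within S)"
    "ran_mat L = ker_mat (F z0)" "ker_mat L = ran_mat (F z0)"
    "\<forall>\<^sub>F z in at z0 within S. invertible (F z)"
proof -
  obtain Q :: "complex^'n^'n" and D :: "'n set" and T0 where f: "invertible Q" "invertible T0" "card D = vec.dim (ker_mat (F z0))"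
    "ker_mat (F z0) = {Q *v x | x. \<forall>i. i \<notin> D \<longrightarrow> x $ i = 0}"
    "\<forall>x. (\<forall>i\<in>D. x $ i = 0) \<longrightarrow> T0 *v x = F z0 *v (Q *v x)"
    "((\<lambda>z. F z ** Q ** diag_mat (\<lambda>i. if i \<in> D then inverse (z - z0) else 1)) \<longlongrightarrow> T0) (at z0 within S)"
    by (rule factorization)
  define T where "T z = F z ** Q ** diag_mat (\<lambda>i. if i \<in> D then inverse (z - z0) else 1)" for z
  have T: "(T \<longlongrightarrow> T0) (at z0 within S)" using f(6) by (simp add: T_def[abs_def])
  define P where "P = diag_mat (\<lambda>i. if i \<in> D then 1 else 0)"
  define L where "L = Q ** P ** matrix_inv T0"
  have ev: "\<forall>\<^sub>F z in at z0 within S. invertible (T z) \<and> z \<noteq> z0"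
    using eventually_invertible[OF T f(2)] by (auto simp: eventually_at_filter elim: eventually_mono)
  have inv: "invertible (F z) \<and> (z - z0) *\<^sub>m matrix_inv (F z)
      = Q ** diag_mat (\<lambda>i. if i \<in> D then 1 else z - z0) ** matrix_inv (T z)"
    if z: "invertible (T z)" "z \<noteq> z0" for z
  proof -
    have iF: "invertible (F z)" using z(1) by (simp add: T_def invertible_mat_mult_iff)
    have "F z ** (Q ** diag_mat (\<lambda>i. if i \<in> D then inverse (z - z0) else 1) ** matrix_inv (T z)) = mat 1"
      using z(1) by (simp add: matrix_mul_assoc T_def[symmetric] matrix_inv_mult)
    hence "matrix_inv (F z) = Q ** diag_mat (\<lambda>i. if i \<in> D then inverse (z - z0) else 1) ** matrix_inv (T z)"
      by (rule matrix_inv_unique)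
    hence "(z - z0) *\<^sub>m matrix_inv (F z)
        = Q ** ((z - z0) *\<^sub>m diag_mat (\<lambda>i. if i \<in> D then inverse (z - z0) else 1)) ** matrix_inv (T z)"
      by (simp only: smult_mat_mult_left smult_mat_mult_right)
    moreover have "(z - z0) *\<^sub>m diag_mat (\<lambda>i. if i \<in> D then inverse (z - z0) else 1)
        = diag_mat (\<lambda>i. if i \<in> D then 1 else z - z0)"
      using z(2) by (auto simp: smult_diag_mat intro!: arg_cong[of _ _ diag_mat])
    ultimately show ?thesis using iF by (simp only:)
  qed
  have "((\<lambda>z. Q ** diag_mat (\<lambda>i. if i \<in> D then 1 else z - z0) ** matrix_inv (T z)) \<longlongrightarrow> L) (at z0 within S)"
    unfolding L_def P_def
  proof (intro tendsto_intros T f(2))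
    fix i show "((\<lambda>x. if i \<in> D then 1 else x - z0) \<longlongrightarrow> (if i \<in> D then 1 else 0)) (at z0 within S)"
      by (auto intro!: tendsto_eq_intros)
  qed
  hence lim: "((\<lambda>z. (z - z0) *\<^sub>m matrix_inv (F z)) \<longlongrightarrow> L) (at z0 within S)"
    by (rule Lim_transform_eventually) (use ev inv in \<open>auto elim!: eventually_mono\<close>)
  have evF: "\<forall>\<^sub>F z in at z0 within S. invertible (F z)"
    using ev inv by (auto elim!: eventually_mono)
  have Pv: "P *v x = (\<chi> i. if i \<in> D then x $ i else 0)" for x
    by (simp add: P_def vec_eq_iff diag_mat_vec_nth)
  have Lv: "L *v y = Q *v (P *v (matrix_inv T0 *v y))" for y
    by (simp add: L_def matrix_vector_mul_assoc matrix_mul_assoc)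
  have ran: "ran_mat L = ker_mat (F z0)"
  proof (intro set_eqI iffI)
    fix v assume "v \<in> ran_mat L"
    then obtain y where "v = Q *v (P *v (matrix_inv T0 *v y))"
      by (auto simp: ran_mat_def Lv)
    thus "v \<in> ker_mat (F z0)" unfolding f(4) Pv by auto
  next
    fix v assume "v \<in> ker_mat (F z0)"
    then obtain x where x: "v = Q *v x" "\<forall>i. i \<notin> D \<longrightarrow> x $ i = 0" using f(4) by auto
    have "L *v (T0 *v x) = Q *v (P *v (matrix_inv T0 *v (T0 *v x)))"
      by (rule Lv)
    also have "\<dots> = Q *v (P *v x)" using f(2) by simp
    also have "P *v x = x" using x(2) by (auto simp: Pv vec_eq_iff)
    finally show "v \<in> ran_mat L" unfolding ran_mat_def x(1) by (metis rangeI)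
  qed
  have ker: "ker_mat L = ran_mat (F z0)"
  proof (intro set_eqI iffI)
    fix v assume "v \<in> ker_mat L"
    hence "Q *v (P *v (matrix_inv T0 *v v)) = 0" by (simp add: ker_mat_def Lv)
    hence "P *v (matrix_inv T0 *v v) = 0" using invertible_kernel[OF f(1)] by blast
    hence "(matrix_inv T0 *v v) $ i = 0" if "i \<in> D" for i using that by (auto simp: Pv vec_eq_iff split: if_splits)
    hence "T0 *v (matrix_inv T0 *v v) = F z0 *v (Q *v (matrix_inv T0 *v v))" using f(5) by blast
    thus "v \<in> ran_mat (F z0)" using f(2) by (auto simp: ran_mat_def)
  next
    fix v assume "v \<in> ran_mat (F z0)"
    then obtain y where y: "v = F z0 *v y" by (auto simp: ran_mat_def)
    define x where "x = matrix_inv Q *v y"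
    define x2 :: "complex^'n" where "x2 = (\<chi> i. if i \<in> D then 0 else x $ i)"
    have "F z0 *v (Q *v (x - x2)) = 0"
    proof -
      have "Q *v (x - x2) \<in> ker_mat (F z0)" unfolding f(4) by (auto simp: x2_def)
      thus ?thesis by (simp add: ker_mat_def)
    qed
    hence "v = F z0 *v (Q *v x2)"
      using f(1) by (simp add: y x_def matrix_vector_mult_diff_distrib)
    also have "\<dots> = T0 *v x2" using f(5) by (simp add: x2_def)
    finally have "L *v v = Q *v (P *v x2)"
      using f(2) by (simp add: Lv)
    also have "P *v x2 = 0" by (simp add: Pv x2_def vec_eq_iff)
    finally show "v \<in> ker_mat L" by (simp add: ker_mat_def)
  qed
  show thesis by (rule that[OF lim ran ker evF])
qed

lemma pole_of_order_1:
  assumes "\<not> invertible (F z0)"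
  shows "pole_of_order S (\<lambda>z. matrix_inv (F z)) z0 1"
proof -
  obtain L where L: "((\<lambda>z. (z - z0) *\<^sub>m matrix_inv (F z)) \<longlongrightarrow> L) (at z0 within S)" "ran_mat L = ker_mat (F z0)"
    by (rule inverse_limit) auto
  obtain v where "v \<noteq> 0" "F z0 *v v = 0" using assms not_invertible_kernel by blast
  hence "L \<noteq> 0" using L(2) by (auto simp: ran_mat_def ker_mat_def)
  thus ?thesis using L(1) by (auto simp: pole_of_order_def pole_limit_def)
qed

text \<open>Each of the card D divided columns contributes one factor z - z0 to det F; the remaining
  factor is det T / det Q, whose singularity at z0 is removable with nonzero value.\<close>

lemma zorder_det:
  assumes S: "open S" "z0 \<in> S" "mat_holo F S"
  shows "zorder (\<lambda>z. det (F z)) z0 = int (vec.dim (ker_mat (F z0)))"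
proof -
  obtain Q :: "complex^'n^'n" and D :: "'n set" and T0 where f: "invertible Q" "invertible T0" "card D = vec.dim (ker_mat (F z0))"
    "ker_mat (F z0) = {Q *v x | x. \<forall>i. i \<notin> D \<longrightarrow> x $ i = 0}"
    "\<forall>x. (\<forall>i\<in>D. x $ i = 0) \<longrightarrow> T0 *v x = F z0 *v (Q *v x)"
    "((\<lambda>z. F z ** Q ** diag_mat (\<lambda>i. if i \<in> D then inverse (z - z0) else 1)) \<longlongrightarrow> T0) (at z0 within S)"
    by (rule factorization)
  define T where "T z = F z ** Q ** diag_mat (\<lambda>i. if i \<in> D then inverse (z - z0) else 1)" for z
  have T: "((\<lambda>z. det (T z)) \<longlongrightarrow> det T0) (at z0)"
    using tendsto_det[OF f(6)] unfolding T_def[symmetric] at_within_open[OF S(2,1)] .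
  define g where "g z = (if z = z0 then det T0 else det (T z)) / det Q" for z
  have dQ: "det Q \<noteq> 0" "det T0 \<noteq> 0" using f(1,2) by (auto simp: invertible_det_nz)
  have prod: "(\<Prod>i\<in>UNIV. if i \<in> D then c else 1) = c ^ card D" for c :: complex
    by (simp add: prod.If_cases)
  have dT: "det (T z) = det (F z) * det Q * inverse (z - z0) ^ card D" for z
    by (simp add: T_def det_mul det_diag_mat prod)
  have hg: "(\<lambda>z. det (F z) * inverse (z - z0) ^ card D) holomorphic_on S - {z0}"
    using mat_holo_det[OF mat_holo_subset[OF S(3), of "S - {z0}"]] by (intro holomorphic_intros) auto
  hence hg': "g holomorphic_on S - {z0}"
    by (rule holomorphic_transform) (use dQ in \<open>auto simp: g_def dT\<close>)
  have "g holomorphic_on S"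
  proof (rule no_isolated_singularity[OF _ hg' S(1)])
    have "(g \<longlongrightarrow> g z0) (at z0)"
    proof (rule Lim_transform_eventually)
      show "((\<lambda>z. det (T z) / det Q) \<longlongrightarrow> g z0) (at z0)"
        unfolding g_def using T dQ by (auto intro!: tendsto_intros)
      show "\<forall>\<^sub>F z in at z0. det (T z) / det Q = g z"
        by (simp add: g_def eventually_at_filter)
    qed
    moreover have "isCont g z" if "z \<in> S" "z \<noteq> z0" for z
      using holomorphic_on_imp_continuous_on[OF hg'] that S(1)
      by (metis Diff_iff continuous_on_eq_continuous_at open_Diff finite_imp_closed finite.intros singletonD)
    ultimately show "continuous_on S g"
      by (intro continuous_at_imp_continuous_on) (auto simp: isCont_def)
  qed simp
  thus ?thesis
  proof (rule zorder_eqI[OF S(1,2)])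
    show "g z0 \<noteq> 0" using dQ by (simp add: g_def)
    fix z assume "z \<in> S" "z \<noteq> z0"
    thus "det (F z) = g z * (z - z0) powi int (vec.dim (ker_mat (F z0)))"
      using dQ by (simp add: g_def dT f(3)[symmetric] power_inverse)
  qed
qed

end

text \<open>With a continuous inverse, every positive power of z - z0 forces the limit 0.\<close>

lemma not_zero_mat_invertible:
  assumes "at z0 within S \<noteq> bot" "(F \<longlongrightarrow> F z0) (at z0 within S)" "invertible (F z0)"
  shows "\<not> zero_mat S F z0"
proof
  assume "zero_mat S F z0"
  then obtain k L where k: "k > 0" "L \<noteq> 0" "((\<lambda>z. (z - z0) ^ k *\<^sub>m matrix_inv (F z)) \<longlongrightarrow> L) (at z0 within S)"
    by (auto simp: zero_mat_def pole_of_order_def pole_limit_def)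
  have "((\<lambda>z. (z - z0) ^ k *\<^sub>m matrix_inv (F z)) \<longlongrightarrow> (z0 - z0) ^ k *\<^sub>m matrix_inv (F z0)) (at z0 within S)"
    by (intro tendsto_intros assms)
  hence "L = (z0 - z0) ^ k *\<^sub>m matrix_inv (F z0)" using k(3) assms(1) tendsto_unique by blast
  thus False using k by (simp add: power_0_left)
qed

lemma vec_limit_diff_quotient:
  assumes S: "open S" "z0 \<in> S" and F: "mat_holo F S" and v: "F z0 *v v = 0"
  shows "\<exists>d. ((\<lambda>z. inverse (z - z0) *s (F z *v v)) \<longlongrightarrow> d) (at z0)"
proof -
  have "\<exists>d. ((\<lambda>z. inverse (z - z0) * (F z *v v) $ i) \<longlongrightarrow> d) (at z0)" for i
  proof -
    have "(\<lambda>z. (F z *v v) $ i) holomorphic_on S"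
      using F unfolding mat_holo_def matrix_vector_mult_def by (auto intro!: holomorphic_intros)
    then obtain d where "((\<lambda>z. (F z *v v) $ i) has_field_derivative d) (at z0)"
      using S holomorphic_on_open by blast
    hence "((\<lambda>z. ((F z *v v) $ i - (F z0 *v v) $ i) / (z - z0)) \<longlongrightarrow> d) (at z0)"
      by (simp add: has_field_derivative_iff)
    thus ?thesis using v by (auto simp: divide_inverse mult.commute)
  qed
  then obtain d where "((\<lambda>z. inverse (z - z0) * (F z *v v) $ i) \<longlongrightarrow> d i) (at z0)" for i by metis
  hence "((\<lambda>z. inverse (z - z0) *s (F z *v v)) \<longlongrightarrow> (\<chi> i. d i)) (at z0)"
    by (intro vec_tendstoI) simp
  thus ?thesis by blast
qed

section \<open>Uniform bounds and the zeros inside the disk\<close>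

sublocale type1_jacobi \<subseteq> jacobi_asymptotic
proof
  have "asymptotic J J"
    unfolding asymptotic_def
    by (intro exI[of _ "\<lambda>_. mat 1"]) (auto simp: unitary_def convergent_const)
  thus "asymptotic_to_type1 J" using jacobi type1 by (auto simp: asymptotic_to_type1_def)
qed (use jacobi A1 in auto)

context jacobi_asymptotic
begin

text \<open>Uniform convergence to 1 handles all large n, compactness the finitely many
  others.\<close>

lemma w_uniform_bound:
  assumes X: "jost_good J X" "compact X"
  shows "\<exists>C>0. \<forall>n. \<forall>z\<in>X. norm (w n z) \<le> C"
proof -
  have "\<forall>\<^sub>F n in sequentially. \<forall>z\<in>X. dist (jost (jshift n J) z) (mat 1) < 1"
    using X(1) by (auto simp: jost_good_def dest!: uniform_limitD[where e = 1])
  then obtain N where N: "\<And>n z. n \<ge> N \<Longrightarrow> z \<in> X \<Longrightarrow> dist (jost (jshift n J) z) (mat 1) < 1"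
    by (auto simp: eventually_at_top_linorder)
  have "\<exists>c. \<forall>z\<in>X. norm (jost (jshift n J) z) \<le> c" for n
  proof -
    have "continuous_on X (jost (jshift n J))" using X(1) by (simp add: jost_good_def)
    hence "bounded (jost (jshift n J) ` X)" by (intro compact_imp_bounded compact_continuous_image X(2))
    thus ?thesis by (auto simp: bounded_iff)
  qed
  then obtain c where c: "\<And>n z. z \<in> X \<Longrightarrow> norm (jost (jshift n J) z) \<le> c n" by metis
  define m where "m = 1 + norm (mat 1 :: complex^'l^'l) + (\<Sum>n<N. \<bar>c n\<bar>)"
  have U: "norm (jost (jshift n J) z) \<le> m" if z: "z \<in> X" for n z
  proof (cases "n < N")
    case True
    have "norm (jost (jshift n J) z) \<le> \<bar>c n\<bar>" using c[OF z, of n] by simp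
    also have "\<dots> \<le> (\<Sum>n<N. \<bar>c n\<bar>)" using True by (intro member_le_sum) auto
    finally show ?thesis unfolding m_def using norm_ge_zero[of "mat 1 :: complex^'l^'l"] by linarith
  next
    case False
    have "norm (jost (jshift n J) z) \<le> norm (mat 1 :: complex^'l^'l) + dist (jost (jshift n J) z) (mat 1)"
      by (metis dist_norm norm_triangle_sub)
    also have "\<dots> \<le> m" using N[of n z] False z by (simp add: m_def sum_nonneg add_increasing2)
    finally show ?thesis .
  qed
  have "(\<lambda>n. matrix_inv (Apar J n)) \<longlonglongrightarrow> matrix_inv (mat 1)"
    by (intro tendsto_intros Apar_tendsto) (simp add: invertible_det_nz)
  from convergent_imp_bounded[OF this] obtain a where a: "a > 0" "\<And>n. norm (matrix_inv (Apar J n)) \<le> a"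
    by (auto simp: bounded_pos)
  have m: "m > 0" unfolding m_def by (intro add_pos_nonneg sum_nonneg) auto
  show ?thesis
  proof (intro exI[of _ "m * a"] conjI allI ballI)
    show "m * a > 0" using m a by simp
    fix n z assume "z \<in> X"
    have "norm (w n z) \<le> norm (jost (jshift n J) z) * norm (matrix_inv (Apar J n))"
      unfolding jost_sol_scaled_def by (rule norm_mat_mult_le)
    also have "\<dots> \<le> m * a" using U[OF \<open>z \<in> X\<close>] a(2) m by (intro mult_mono) auto
    finally show "norm (w n z) \<le> m * a" .
  qed
qed

lemma jost_tendsto:
  assumes "appropriate_region J S" "z \<in> S"
  shows "(jost J \<longlongrightarrow> jost J z) (at z within S)"
  using region_continuous[OF assms(1), of 0] assms(2) by (simp add: jshift_0[OF jacobi] continuous_on_def)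

lemma scaled_continuous: "appropriate_region J S \<Longrightarrow> continuous_on S (w n)"
  unfolding jost_sol_scaled_def by (intro continuous_intros region_continuous)

lemma u_continuous: "appropriate_region J S \<Longrightarrow> continuous_on S (u n)"
  unfolding jost_sol_def by (intro continuous_intros scaled_continuous)

text \<open>Green's formula between the eigenvector at \<open>z0\<close> and the Jost solution at \<open>z\<close> computes the
  derivative of the Jost function on its kernel; it is nondegenerate because the eigenvector has
  nonzero norm.\<close>

lemma simple_zero_interior:
  assumes z0: "cmod z0 < 1" and sing: "\<not> invertible (jost J z0)"
  shows "\<exists>k. simple_zero (jost J) (ball 0 1) z0 k"
proof -
  note r = singular_imp_real[OF z0 sing]
  let ?E = "z0 + inverse z0"
  define f where "f v n = snd (forward ?E (\<lambda>_. 0) v n)" for v n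
  have f: "f v \<in> eigenspace J ?E" "f v 0 = v" if "jost J z0 *v v = 0" for v
    using that eigenspace_image[OF z0 r(2)] by (auto simp: f_def[abs_def] ker_mat_def)
  \<comment> \<open>The difference of the energies at z0 and z is -(z - z0)(1 - 1/(z z0)); dividing
    Green's formula by z - z0 leaves this factor in the limit.\<close>
  define k where "k v = (1 - inverse (z0 * z0)) *s (\<Sum>n. u (Suc n) z0 *v f v n)" for v
  \<comment> \<open>On the closed disk of this intermediate radius Green's series is dominated by a
    geometric one, which makes its sum continuous at z0.\<close>
  define \<rho> where "\<rho> = (1 + cmod z0) / 2"
  have \<rho>: "cmod z0 < \<rho>" "\<rho> < 1" "0 < \<rho>" using z0 by (auto simp: \<rho>_def intro: add_pos_nonneg)
  define d where "d = 1 - \<rho>\<^sup>2"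
  have d: "d > 0" using \<rho> by (simp add: d_def power_less_one_iff abs_square_less_1)
  define X where "X = {z :: complex. cmod z \<le> 1 \<and> d \<le> cmod (1 - z\<^sup>2)}"
  have X: "jost_good J X" using good_away[OF d] by (simp add: X_def)
  have "X = cball 0 1 \<inter> {z. d \<le> cmod (1 - z\<^sup>2)}" by (auto simp: X_def)
  moreover have "closed {z :: complex. d \<le> cmod (1 - z\<^sup>2)}" by (intro closed_Collect_le continuous_intros)
  ultimately have cX: "compact X" by (simp add: compact_Int_closed)
  have sub: "cball 0 \<rho> \<subseteq> X"
  proof
    fix z :: complex assume z: "z \<in> cball 0 \<rho>"
    have "cmod (z\<^sup>2) \<le> \<rho>\<^sup>2" using z by (simp add: norm_power power_mono)
    moreover have "1 - cmod (z\<^sup>2) \<le> cmod (1 - z\<^sup>2)" using norm_triangle_ineq2[of 1 "z\<^sup>2"] by simp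
    ultimately show "z \<in> X" using z \<rho> by (simp add: X_def d_def)
  qed
  obtain C where C: "C > 0" "\<And>n z. z \<in> X \<Longrightarrow> norm (w n z) \<le> C" using w_uniform_bound[OF X cX] by blast
  have ub: "norm (u (Suc n) z) \<le> C * \<rho> ^ n" if "z \<in> cball 0 \<rho>" for n and z :: complex
  proof -
    have "norm (u (Suc n) z) = cmod z ^ Suc n * norm (w (Suc n) z)"
      by (simp add: jost_sol_def norm_power norm_mult)
    also have "\<dots> \<le> \<rho> ^ Suc n * C" using that sub C \<rho> by (intro mult_mono power_mono) auto
    also have "\<dots> \<le> C * \<rho> ^ n" using C \<rho> by (simp add: mult_left_le_one_le mult.left_commute)
    finally show ?thesis .
  qed
  have cont: "continuous_on (cball 0 \<rho>) (\<lambda>z :: complex. \<Sum>n. u (Suc n) z *v f v n)" if v: "jost J z0 *v v = 0" for v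
  proof (rule uniform_limit_theorem[of _ "\<lambda>N (z :: complex). \<Sum>n<N. u (Suc n) z *v f v n"])
    have \<phi>: "f v \<in> ell2" using f(1)[OF v] by (rule eigenspace_D)
    show "uniform_limit (cball 0 \<rho>) (\<lambda>N z. \<Sum>n<N. u (Suc n) z *v f v n) (\<lambda>z. \<Sum>n. u (Suc n) z *v f v n) sequentially"
    proof (rule Weierstrass_m_test)
      fix n and z :: complex assume z: "z \<in> cball 0 \<rho>"
      have "norm (u (Suc n) z *v f v n) \<le> norm (u (Suc n) z) * norm (f v n)" by (rule norm_mat_vec_le)
      also have "\<dots> \<le> (C * \<rho> ^ n) * ell2_norm (f v)"
        using ub[OF z] ell2_norm_nth_le[OF \<phi>] C \<rho> by (intro mult_mono) auto
      finally show "norm (u (Suc n) z *v f v n) \<le> (C * \<rho> ^ n) * ell2_norm (f v)" .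
    next
      show "summable (\<lambda>n. (C * \<rho> ^ n) * ell2_norm (f v))"
        using \<rho> by (intro summable_mult2 summable_mult summable_geometric) auto
    qed
    have "cball 0 \<rho> \<subseteq> cball 0 1 - {1, -1 :: complex}" using \<rho> by auto
    thus "\<forall>\<^sub>F N in sequentially. continuous_on (cball 0 \<rho>) (\<lambda>z. \<Sum>n<N. u (Suc n) z *v f v n)"
      by (intro always_eventually allI continuous_intros continuous_on_subset[OF u_continuous[OF region_A1]])
  qed simp
  have lim: "((\<lambda>z. inverse (z - z0) *s (jost J z *v v)) \<longlongrightarrow> k v) (at z0)" if v: "jost J z0 *v v = 0" for v
  proof -
    have c: "continuous_on (ball 0 \<rho>) (\<lambda>z. \<Sum>n. u (Suc n) z *v f v n)"
      using cont[OF v] by (rule continuous_on_subset) auto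
    have "z0 \<in> ball 0 \<rho>" using \<rho> by simp
    from bspec[OF c[unfolded continuous_on_def] this]
    have "((\<lambda>z. \<Sum>n. u (Suc n) z *v f v n) \<longlongrightarrow> (\<Sum>n. u (Suc n) z0 *v f v n)) (at z0 within ball 0 \<rho>)" .
    moreover have "at z0 within ball 0 \<rho> = at z0" by (rule at_within_open) (use \<rho> in auto)
    ultimately have S: "((\<lambda>z. \<Sum>n. u (Suc n) z *v f v n) \<longlongrightarrow> (\<Sum>n. u (Suc n) z0 *v f v n)) (at z0)"
      by (simp only:)
    have "((\<lambda>z. (1 - inverse (z * z0)) *s (\<Sum>n. u (Suc n) z *v f v n)) \<longlongrightarrow> k v) (at z0)"
      unfolding k_def using r(2) by (intro tendsto_intros S) auto
    moreover have "\<forall>\<^sub>F z in at z0. z \<in> ball 0 1 - {0} \<and> z \<noteq> z0"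
      using eventually_at_in_open'[of "ball 0 1 - {0}" z0] z0 r(2)
      by (auto simp: open_delete eventually_at_filter elim: eventually_mono)
    ultimately show ?thesis
    proof (rule Lim_transform_eventually[OF _ eventually_mono])
      fix z assume z: "z \<in> ball 0 1 - {0} \<and> z \<noteq> z0"
      define c where "c = ?E - (z + inverse z)"
      have op: "jacobi_op_minus J (z + inverse z) (f v) n = c *s f v n" for n
      proof -
        have "jacobi_op J (f v) n = ?E *s f v n" using f(1)[OF v] by (simp add: eigenspace_def)
        thus ?thesis by (simp add: jacobi_op_minus_def vec_eq_iff left_diff_distrib c_def)
      qed
      have "(\<lambda>n. u (Suc n) z *v (c *s f v n)) sums (- (jost J z *v v))"
        using green_sums[of z "f v"] z eigenspace_D(1)[OF f(1)[OF v]] f(2)[OF v] by (simp add: op)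
      hence "(\<Sum>n. c *s (u (Suc n) z *v f v n)) = - (jost J z *v v)"
        by (simp add: sums_unique[symmetric])
      moreover have "(\<Sum>n. c *s (u (Suc n) z *v f v n))
          = c *s (\<Sum>n. u (Suc n) z *v f v n)"
        using z by (intro bounded_linear.suminf[OF bounded_bilinear.bounded_linear_right[OF bounded_bilinear_smult_vec], symmetric]
            summable_u_ell2 eigenspace_D(1)[OF f(1)[OF v]]) auto
      ultimately have "jost J z *v v = (- c) *s (\<Sum>n. u (Suc n) z *v f v n)"
        by (metis minus_equation_iff vec.scale_minus_left)
      moreover have "inverse (z - z0) * (- c) = 1 - inverse (z * z0)"
        using z r(2) by (simp add: c_def field_simps)
      ultimately show "(1 - inverse (z * z0)) *s (\<Sum>n. u (Suc n) z *v f v n) = inverse (z - z0) *s (jost J z *v v)"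
        by (simp only: vector_smult_assoc)
    qed
  qed
  have nondeg: "\<exists>l. adj (jost J z0) *v l = 0 \<and> cinner l (k v) \<noteq> 0" if v: "jost J z0 *v v = 0" "v \<noteq> 0" for v
  proof -
    obtain l where l: "adj (jost J z0) *v l = 0" "(\<lambda>n. adj (u (Suc n) z0) *v l) \<in> eigenspace J ?E"
      "adj (u 1 z0) *v l = v" by (rule kernel_eigenvector[OF z0 v])
    \<comment> \<open>The eigenvector coincides with the column solution of l, so pairing Green's
      sum with l produces its squared norm.\<close>
    have eq: "f v = (\<lambda>n. adj (u (Suc n) z0) *v l)"
      by (rule solution_unique[of ?E _ "\<lambda>_. 0"])
         (use l(3) f(2)[OF v(1)] in \<open>simp_all add: eigenspace_D(2)[OF l(2)] eigenspace_D(2)[OF f(1)[OF v(1)]]\<close>)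
    have \<phi>: "f v \<in> ell2" using f(1)[OF v(1)] by (rule eigenspace_D)
    have "cinner l (\<Sum>n. u (Suc n) z0 *v f v n) = (\<Sum>n. cinner l (u (Suc n) z0 *v f v n))"
      by (intro bounded_linear.suminf[OF bounded_bilinear.bounded_linear_right[OF bounded_bilinear_cinner]]
          summable_u_ell2 z0 \<phi>)
    also have "\<dots> = (\<Sum>n. of_real ((norm (f v n))\<^sup>2))"
      by (simp only: cinner_mat_right eq cinner_self)
    also have "\<dots> = of_real ((ell2_norm (f v))\<^sup>2)"
      unfolding ell2_norm_sq[OF \<phi>] by (rule suminf_of_real[symmetric, OF ell2_D[OF \<phi>]])
    finally have *: "cinner l (\<Sum>n. u (Suc n) z0 *v f v n) = of_real ((ell2_norm (f v))\<^sup>2)" .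
    have "ell2_norm (f v) \<noteq> 0"
      using ell2_norm_nth_le[OF \<phi>, of 0] f(2)[OF v(1)] v(2) by auto
    moreover have "1 - inverse (z0 * z0) \<noteq> 0"
    proof -
      have "cmod (z0 * z0) < 1" using z0 mult_strict_mono[of "cmod z0" 1 "cmod z0" 1] by (simp add: norm_mult)
      thus ?thesis using r(2) by (auto simp: field_simps)
    qed
    ultimately have "cinner l (k v) \<noteq> 0" unfolding k_def by (simp add: cinner_simps *)
    with l(1) show ?thesis by blast
  qed
  have w: "at z0 within ball 0 1 = at z0" by (rule at_within_open) (use z0 in auto)
  have "simple_zero (jost J) (ball 0 1) z0 k"
  proof
    show "(jost J \<longlongrightarrow> jost J z0) (at z0 within ball 0 1)"
      using mat_holo_continuous[OF jost_holo_ball] z0 by (simp add: continuous_on_def)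
  qed (use lim nondeg in \<open>simp_all add: w\<close>)
  thus ?thesis by blast
qed

end

section \<open>The edges \<open>\<plusminus>1\<close> under a first moment condition\<close>

lemma norm_mat_mult_mono:
  fixes X :: "complex^'n^'m" and Y :: "complex^'p^'n"
  assumes "norm X \<le> x" "norm Y \<le> y"
  shows "norm (X ** Y) \<le> x * y"
  using norm_mat_mult_le[of X Y] mult_mono[OF assms] order_trans[OF norm_ge_zero assms(1)] norm_ge_zero[of Y]
  by linarith

lemma cond_A3_imp_A2:
  assumes "cond_A3 J R"
  shows "cond_A2 J"
proof -
  obtain C where C: "\<And>n. n \<ge> 1 \<Longrightarrow> deviation J n \<le> C * R powi (- 2 * int n)" and R: "R > 1"
    using assms by (auto simp: cond_A3_def)
  define x where "x = inverse (R\<^sup>2)"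
  have x: "0 < x" "x < 1" using R by (auto simp: x_def one_less_power inverse_less_1_iff)
  have "R powi (- 2 * int (Suc n)) = x * x ^ n" for n
  proof -
    have "R powi (- 2 * int (Suc n)) = (R powi (-2)) powi int (Suc n)" by (simp only: power_int_mult)
    also have "R powi (-2) = x" by (simp add: x_def power_int_minus)
    finally show ?thesis by (simp add: power_int_of_nat del: of_nat_Suc)
  qed
  hence bd: "deviation J (Suc n) \<le> C * (x * x ^ n)" for n using C[of "Suc n"] by simp
  have "summable (\<lambda>n. real (Suc n) * x ^ n)"
    using geometric_deriv_sums[of x] x by (auto simp: sums_iff)
  hence s: "summable (\<lambda>n. (C * x) * (real (Suc n) * x ^ n))" by (rule summable_mult)
  show ?thesis unfolding cond_A2_def
  proof (rule summable_comparison_test'[OF s, of 0])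
    fix n
    have "deviation J (Suc n) \<ge> 0" by (simp add: deviation_def)
    hence "norm (real (Suc n) * deviation J (Suc n)) = real (Suc n) * deviation J (Suc n)" by simp
    also have "\<dots> \<le> real (Suc n) * (C * (x * x ^ n))" by (intro mult_left_mono bd) auto
    finally show "norm (real (Suc n) * deviation J (Suc n)) \<le> (C * x) * (real (Suc n) * x ^ n)"
      by (simp add: mult_ac)
  qed
qed

lemma cond_A2_imp_A1:
  assumes "cond_A2 J"
  shows "cond_A1 J"
  unfolding cond_A1_def
proof (rule summable_comparison_test'[OF assms[unfolded cond_A2_def], of 0])
  fix n
  have "deviation J (Suc n) \<ge> 0" by (simp add: deviation_def)
  thus "norm (deviation J (Suc n)) \<le> real (Suc n) * deviation J (Suc n)"
    by (simp add: mult_le_cancel_right1)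
qed

context type1_jacobi
begin

text \<open>The differences satisfy d_n = z^2 d_(n+1) + O(\<epsilon>_n) and vanish at infinity.
  Summing backwards, the factor n + 1 is absorbed into the tail of the first moment series,
  uniformly on the closed disk.\<close>

lemma scaled_differences:
  assumes A2: "cond_A2 J"
  shows "\<exists>C \<theta>. C > 0 \<and> \<theta> \<longlonglongrightarrow> 0 \<and> (\<forall>n. \<forall>z\<in>cball 0 1. norm (w n z) \<le> C \<and>
    real (Suc n) * norm (w n z - w (Suc n) z) \<le> \<theta> n)"
proof -
  have good: "jost_good J (cball 0 1)" by (rule good_closed_disk[OF A2])
  obtain C where C: "C > 0" "\<And>n z. z \<in> cball 0 1 \<Longrightarrow> norm (w n z) \<le> C"
    using w_uniform_bound[OF good compact_cball] by blast
  \<comment> \<open>w_n meets 1 - A_n, which is 0 for n = 0 and is bounded by e (n - 1) otherwise;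
    the two copies of e n come from B_(n+1) and A_(n+1).\<close>
  define \<epsilon> where "\<epsilon> n = C * (2 * e n + (if n = 0 then 0 else e (n - 1)))" for n
  have "deviation J n \<ge> 0" for n by (simp add: deviation_def)
  hence \<epsilon>0: "\<epsilon> n \<ge> 0" for n using C by (auto simp: \<epsilon>_def)
  have s1: "summable (\<lambda>n. real (Suc n) * e n)" using A2 by (simp add: cond_A2_def)
  have s2: "summable (\<lambda>n. real (Suc n) * (if n = 0 then 0 else e (n - 1)))"
  proof -
    have "summable (\<lambda>n. real (Suc n) * e n + e n)" by (intro summable_add s1 summable_e)
    hence "summable (\<lambda>n. real (Suc (Suc n)) * (if Suc n = 0 then 0 else e (Suc n - 1)))"
      by (simp add: algebra_simps)
    thus ?thesis by (subst (asm) summable_Suc_iff)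
  qed
  have "summable (\<lambda>n. C * (2 * (real (Suc n) * e n) + real (Suc n) * (if n = 0 then 0 else e (n - 1))))"
    by (intro summable_mult summable_add s1 s2)
  moreover have "C * (2 * (real (Suc n) * e n) + real (Suc n) * (if n = 0 then 0 else e (n - 1))) = real (Suc n) * \<epsilon> n" for n
    by (simp add: \<epsilon>_def algebra_simps)
  ultimately have s: "summable (\<lambda>n. real (Suc n) * \<epsilon> n)" by (simp only:)
  define \<theta> where "\<theta> n = (\<Sum>m. real (Suc (m + n)) * \<epsilon> (m + n))" for n
  have "(\<lambda>k. (\<Sum>n. real (Suc n) * \<epsilon> n) - (\<Sum>i<k. real (Suc i) * \<epsilon> i)) \<longlonglongrightarrow> (\<Sum>n. real (Suc n) * \<epsilon> n) - (\<Sum>n. real (Suc n) * \<epsilon> n)"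
    by (intro tendsto_intros summable_LIMSEQ s)
  hence \<theta>: "\<theta> \<longlonglongrightarrow> 0"
    unfolding \<theta>_def[abs_def] suminf_minus_initial_segment[OF s] by simp
  have main: "real (Suc n) * norm (w n z - w (Suc n) z) \<le> \<theta> n" if z: "z \<in> cball 0 1" for n z
  proof -
    have reg: "regular z" by (rule jost_good_regular[OF good z])
    define d where "d n = w n z - w (Suc n) z" for n
    have step: "norm (d n) \<le> \<epsilon> n + norm (d (Suc n))" for n
    proof -
      have "d n - z\<^sup>2 *\<^sub>m d (Suc n) = (w n z ** (mat 1 - Apar J n) - z *\<^sub>m (w (Suc n) z ** Bpar J (Suc n)))
          + z\<^sup>2 *\<^sub>m (w (Suc (Suc n)) z ** adj (mat 1 - Apar J (Suc n)))"
        using w_recurrence[OF reg, of n]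
        by (simp add: d_def mat_distrib smult_mat_add_left algebra_simps)
      hence "d n = z\<^sup>2 *\<^sub>m d (Suc n) + ((w n z ** (mat 1 - Apar J n) - z *\<^sub>m (w (Suc n) z ** Bpar J (Suc n)))
          + z\<^sup>2 *\<^sub>m (w (Suc (Suc n)) z ** adj (mat 1 - Apar J (Suc n))))"
        by (metis add.commute diff_add_cancel)
      hence "norm (d n) \<le> norm (z\<^sup>2 *\<^sub>m d (Suc n)) + ((norm (w n z ** (mat 1 - Apar J n)) + norm (z *\<^sub>m (w (Suc n) z ** Bpar J (Suc n))))
          + norm (z\<^sup>2 *\<^sub>m (w (Suc (Suc n)) z ** adj (mat 1 - Apar J (Suc n)))))"
        by (smt (verit, best) norm_triangle_ineq norm_triangle_ineq4)
      also have "\<dots> \<le> norm (d (Suc n)) + ((C * (if n = 0 then 0 else e (n - 1)) + C * e n) + C * e n)"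
      proof (intro add_mono)
        have z1: "cmod z \<le> 1" "cmod (z\<^sup>2) \<le> 1" using z by (auto simp: norm_power power_le_one)
        show "norm (z\<^sup>2 *\<^sub>m d (Suc n)) \<le> norm (d (Suc n))" using z1 by (simp add: mult_left_le_one_le)
        show "norm (w n z ** (mat 1 - Apar J n)) \<le> C * (if n = 0 then 0 else e (n - 1))"
          using norm_one_minus_A_le[of "n - 1"] by (intro norm_mat_mult_mono C z) auto
        have "norm (w (Suc n) z ** Bpar J (Suc n)) \<le> C * e n"
          using norm_B_le by (intro norm_mat_mult_mono C z)
        thus "norm (z *\<^sub>m (w (Suc n) z ** Bpar J (Suc n))) \<le> C * e n"
          using z1 by (simp add: mult_left_le_one_le order_trans[OF mult_left_le_one_le])
        have "norm (w (Suc (Suc n)) z ** adj (mat 1 - Apar J (Suc n))) \<le> C * e n"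
          by (intro norm_mat_mult_mono C z) (simp only: norm_adj norm_one_minus_A_le)
        thus "norm (z\<^sup>2 *\<^sub>m (w (Suc (Suc n)) z ** adj (mat 1 - Apar J (Suc n)))) \<le> C * e n"
          unfolding norm_smult_mat using z1 by (meson mult_left_le_one_le norm_ge_zero order_trans)
      qed
      finally show ?thesis by (simp add: \<epsilon>_def algebra_simps)
    qed
    have it: "norm (d n) \<le> (\<Sum>m<M. \<epsilon> (m + n)) + norm (d (n + M))" for M
    proof (induction M)
      case (Suc M)
      thus ?case using step[of "n + M"] by (simp add: add.commute)
    qed simp
    have bdM: "real (Suc n) * norm (d n) \<le> \<theta> n + real (Suc n) * norm (d (n + M))" for M
    proof -
      have "real (Suc n) * (\<Sum>m<M. \<epsilon> (m + n)) \<le> (\<Sum>m<M. real (Suc (m + n)) * \<epsilon> (m + n))"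
        unfolding sum_distrib_left by (intro sum_mono mult_right_mono \<epsilon>0) auto
      also have "\<dots> \<le> \<theta> n"
        unfolding \<theta>_def using summable_ignore_initial_segment[OF s, of n] \<epsilon>0 by (intro sum_le_suminf) auto
      finally show ?thesis using mult_left_mono[OF it[of M], of "real (Suc n)"] by (simp add: distrib_left)
    qed
    have "d \<longlonglongrightarrow> mat 1 - mat 1" unfolding d_def by (intro tendsto_intros w_tendsto reg LIMSEQ_Suc)
    hence "(\<lambda>M. d (M + n)) \<longlonglongrightarrow> 0" using LIMSEQ_ignore_initial_segment by fastforce
    hence "(\<lambda>M. \<theta> n + real (Suc n) * norm (d (n + M))) \<longlonglongrightarrow> \<theta> n + real (Suc n) * norm (0 :: complex^'l^'l)"
      by (intro tendsto_intros) (simp add: add.commute)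
    hence "real (Suc n) * norm (d n) \<le> \<theta> n + real (Suc n) * norm (0 :: complex^'l^'l)"
      by (rule LIMSEQ_le_const) (use bdM in blast)
    thus ?thesis by (simp add: d_def)
  qed
  show ?thesis using C \<theta> main by blast
qed

lemma scaled_tendsto_uniform:
  assumes A2: "cond_A2 J" and \<epsilon>: "\<epsilon> > 0"
  shows "\<exists>M. \<forall>n\<ge>M. \<forall>z\<in>cball 0 1. norm (w n z - mat 1) < \<epsilon>"
proof -
  have good: "jost_good J (cball 0 1)" by (rule good_closed_disk[OF A2])
  have i1: "matrix_inv (mat 1) = (mat 1 :: complex^'l^'l)" by (rule matrix_inv_unique) simp
  have lim: "(\<lambda>n. matrix_inv (Apar J n)) \<longlonglongrightarrow> mat 1"
    using tendsto_matrix_inv[OF Apar_tendsto] by (simp add: invertible_det_nz i1)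
  obtain a where a: "a > 0" "\<And>n. norm (matrix_inv (Apar J n)) \<le> a"
    using convergent_imp_bounded[OF lim] by (auto simp: bounded_pos)
  have "\<forall>\<^sub>F n in sequentially. \<forall>z\<in>cball 0 1. dist (jost (jshift n J) z) (mat 1) < \<epsilon> / (2 * a)"
    using good \<epsilon> a by (auto simp: jost_good_def dest!: uniform_limitD[where e = "\<epsilon> / (2 * a)"])
  moreover have "\<forall>\<^sub>F n in sequentially. dist (matrix_inv (Apar J n)) (mat 1) < \<epsilon> / 2"
    using lim \<epsilon> by (intro tendstoD) auto
  ultimately have "\<forall>\<^sub>F n in sequentially. \<forall>z\<in>cball 0 1. norm (w n z - mat 1) < \<epsilon>"
  proof eventually_elim
    case (elim n)
    show ?case
    proof
      fix z :: complex assume z: "z \<in> cball 0 1"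
      have "w n z - mat 1 = (jost (jshift n J) z - mat 1) ** matrix_inv (Apar J n) + (matrix_inv (Apar J n) - mat 1)"
        by (simp add: jost_sol_scaled_def mat_distrib)
      hence "norm (w n z - mat 1) \<le> norm ((jost (jshift n J) z - mat 1) ** matrix_inv (Apar J n)) + norm (matrix_inv (Apar J n) - mat 1)"
        by (simp only: norm_triangle_ineq)
      also have "norm ((jost (jshift n J) z - mat 1) ** matrix_inv (Apar J n)) \<le> \<epsilon> / (2 * a) * a"
        using elim z a by (intro norm_mat_mult_mono) (auto simp: dist_norm intro: less_imp_le)
      finally show "norm (w n z - mat 1) < \<epsilon>" using elim a by (simp add: dist_norm)
    qed
  qed
  thus ?thesis by (auto simp: eventually_at_top_linorder)
qed

text \<open>Same Green's formula as in the interior, but now truncated at \<open>N\<close>, with \<open>N\<close> of the order of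
  \<open>1 / cmod (z - z0)\<close>: the sum is then negligible and the boundary term gives the limit.\<close>

lemma edge_quotient_limit:
  assumes A2: "cond_A2 J" and z0: "z0 = 1 \<or> z0 = -1" and l: "adj (jost J z0) *v l = 0"
  shows "((\<lambda>z. inverse (z - z0) *s (jost J z *v (adj (u 1 z0) *v l))) \<longlongrightarrow> - l) (at z0 within cball 0 1)"
proof -
  have good: "jost_good J (cball 0 1)" by (rule good_closed_disk[OF A2])
  have reg: "regular z" if "z \<in> cball 0 1" for z using jost_good_regular[OF good that] .
  obtain C \<theta> where C: "C > 0" and \<theta>: "\<theta> \<longlonglongrightarrow> 0" and wC: "\<And>n z. z \<in> cball 0 1 \<Longrightarrow> norm (w n z) \<le> C"
    and dw: "\<And>n z. z \<in> cball 0 1 \<Longrightarrow> real (Suc n) * norm (w n z - w (Suc n) z) \<le> \<theta> n"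
    using scaled_differences[OF A2] by blast
  obtain a where a: "a > 0" "\<And>n. norm (Apar J n) \<le> a"
    using convergent_imp_bounded[OF Apar_tendsto] by (auto simp: bounded_pos)
  have z0p: "cmod z0 = 1" "z0 \<in> cball 0 1" "z0 * z0 = 1" "cnj z0 = z0" "z0 \<noteq> 0" "z0 \<in> \<real>" using z0 by auto
  define om where "om n = adj (w n z0)" for n
  have om: "norm (om n) \<le> C" for n using wC[OF z0p(2)] by (simp add: om_def)
  define \<phi> where "\<phi> n = adj (u (Suc n) z0) *v l" for n
  have \<phi>: "\<phi> n = z0 ^ Suc n *s (om (Suc n) *v l)" for n
    by (simp add: \<phi>_def jost_sol_def om_def z0p del: power_Suc)
  let ?E = "z0 + inverse z0"
  have op0: "jacobi_op J \<phi> n = ?E *s \<phi> n" for n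
  proof -
    have "jacobi_op_minus J ?E \<phi> n = 0"
      using column_solution[OF reg[OF z0p(2)] z0p(5), of l n] l z0p by (simp add: \<phi>_def[abs_def])
    thus ?thesis by (simp add: jacobi_op_minus_def)
  qed
  \<comment> \<open>Up to powers of z and z0, G is the coefficient of the first half of the boundary
    term and H the difference of the two halves. G tends to 1, while N times H tends to 0 by the
    first moment condition.\<close>
  define G where "G z N = w N z ** Apar J N ** om (Suc N)" for z N
  define H where "H z N = w N z ** Apar J N ** om (Suc N) - w (Suc N) z ** adj (Apar J N) ** om N" for z N
  define B where "B = C * a * C"
  have B: "B \<ge> 0" using C a by (simp add: B_def)
  have G: "norm (G z N) \<le> B" if "z \<in> cball 0 1" for z N
    unfolding G_def B_def by (intro norm_mat_mult_mono wC that a om)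
  define \<rho> where "\<rho> N = 2 * C * (C * (real N * e (N - 1)) + \<theta> N)" for N
  have \<rho>: "\<rho> \<longlonglongrightarrow> 0"
  proof -
    have "(\<lambda>n. real (Suc n) * e n) \<longlonglongrightarrow> 0"
      using A2 by (intro summable_LIMSEQ_zero) (simp add: cond_A2_def)
    hence "(\<lambda>n. real (Suc n) * e (Suc n - 1)) \<longlonglongrightarrow> 0" by simp
    hence "(\<lambda>n. real n * e (n - 1)) \<longlonglongrightarrow> 0" by (rule LIMSEQ_imp_Suc)
    hence "(\<lambda>N. 2 * C * (C * (real N * e (N - 1)) + \<theta> N)) \<longlonglongrightarrow> 2 * C * (C * 0 + 0)"
      using \<theta> by (intro tendsto_intros)
    thus ?thesis by (simp add: \<rho>_def[abs_def])
  qed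
  have H: "real N * norm (H z N) \<le> \<rho> N" if z: "z \<in> cball 0 1" and N: "N \<ge> 1" for z N
  proof -
    have eN: "norm (mat 1 - Apar J N) \<le> e (N - 1)" using norm_one_minus_A_le[of "N - 1"] N by simp
    have "H z N = ((w N z - w (Suc N) z) ** om (Suc N) - w (Suc N) z ** adj (w N z0 - w (Suc N) z0))
        + (w (Suc N) z ** adj (mat 1 - Apar J N) ** om N - w N z ** (mat 1 - Apar J N) ** om (Suc N))"
      by (simp add: H_def om_def mat_distrib)
    hence "norm (H z N) \<le> (norm ((w N z - w (Suc N) z) ** om (Suc N)) + norm (w (Suc N) z ** adj (w N z0 - w (Suc N) z0)))
        + (norm (w (Suc N) z ** adj (mat 1 - Apar J N) ** om N) + norm (w N z ** (mat 1 - Apar J N) ** om (Suc N)))"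
      by (smt (verit, best) norm_triangle_ineq norm_triangle_ineq4)
    also have "\<dots> \<le> (norm (w N z - w (Suc N) z) * C + C * norm (w N z0 - w (Suc N) z0))
        + (C * e (N - 1) * C + C * e (N - 1) * C)"
    proof (intro add_mono norm_mat_mult_mono order_refl wC om z)
      show "norm (adj (w N z0 - w (Suc N) z0)) \<le> norm (w N z0 - w (Suc N) z0)" by (simp only: norm_adj)
      show "norm (adj (mat 1 - Apar J N)) \<le> e (N - 1)" using eN by (simp only: norm_adj)
    qed (rule eN)
    finally have "real N * norm (H z N) \<le> real N * ((norm (w N z - w (Suc N) z) * C + C * norm (w N z0 - w (Suc N) z0))
        + (C * e (N - 1) * C + C * e (N - 1) * C))" by (rule mult_left_mono) simp
    also have "\<dots> = C * (real N * norm (w N z - w (Suc N) z)) + C * (real N * norm (w N z0 - w (Suc N) z0))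
        + 2 * C * (C * (real N * e (N - 1)))" by (simp add: algebra_simps)
    also have "\<dots> \<le> C * \<theta> N + C * \<theta> N + 2 * C * (C * (real N * e (N - 1)))"
    proof (intro add_mono mult_left_mono order_refl)
      have *: "real N * x \<le> real (Suc N) * x" if "x \<ge> 0" for x using that by (simp add: mult_right_mono)
      show "real N * norm (w N z - w (Suc N) z) \<le> \<theta> N" using dw[OF z, of N] * norm_ge_zero order_trans by blast
      show "real N * norm (w N z0 - w (Suc N) z0) \<le> \<theta> N" using dw[OF z0p(2), of N] * norm_ge_zero order_trans by blast
    qed (use C in auto)
    finally show ?thesis by (simp add: \<rho>_def algebra_simps)
  qed
  have Glim: "\<exists>M. \<forall>N\<ge>M. \<forall>z\<in>cball 0 1. norm (G z N - mat 1) < \<epsilon>" if \<epsilon>: "\<epsilon> > 0" for \<epsilon>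
  proof -
    have "(\<lambda>N. Apar J N ** om (Suc N)) \<longlonglongrightarrow> mat 1 ** adj (mat 1)"
      unfolding om_def by (intro tendsto_intros Apar_tendsto LIMSEQ_Suc w_tendsto reg z0p)
    hence "\<forall>\<^sub>F N in sequentially. dist (Apar J N ** om (Suc N)) (mat 1) < \<epsilon> / 2"
      using \<epsilon> by (intro tendstoD) auto
    then obtain M1 where M1: "\<And>N. N \<ge> M1 \<Longrightarrow> norm (Apar J N ** om (Suc N) - mat 1) < \<epsilon> / 2"
      by (auto simp: eventually_at_top_linorder dist_norm)
    have aC: "a * C > 0" using a C by simp
    obtain M2 where M2: "\<And>N z. N \<ge> M2 \<Longrightarrow> z \<in> cball 0 1 \<Longrightarrow> norm (w N z - mat 1) < \<epsilon> / (2 * (a * C))"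
      using scaled_tendsto_uniform[OF A2, of "\<epsilon> / (2 * (a * C))"] \<epsilon> aC by (metis divide_pos_pos mult_pos_pos zero_less_numeral)
    show ?thesis
    proof (intro exI[of _ "max M1 M2"] allI impI ballI)
      fix N and z :: complex assume N: "max M1 M2 \<le> N" and z: "z \<in> cball 0 1"
      have "G z N - mat 1 = (w N z - mat 1) ** (Apar J N ** om (Suc N)) + (Apar J N ** om (Suc N) - mat 1)"
        by (simp add: G_def mat_distrib matrix_mul_assoc)
      hence "norm (G z N - mat 1) \<le> norm ((w N z - mat 1) ** (Apar J N ** om (Suc N))) + norm (Apar J N ** om (Suc N) - mat 1)"
        by (simp only: norm_triangle_ineq)
      also have "norm ((w N z - mat 1) ** (Apar J N ** om (Suc N))) \<le> \<epsilon> / (2 * (a * C)) * (a * C)"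
        using M2[of N z] N z by (intro norm_mat_mult_mono a om) auto
      also have "\<epsilon> / (2 * (a * C)) * (a * C) = \<epsilon> / 2" using a(1) C by (simp add: field_simps)
      finally show "norm (G z N - mat 1) < \<epsilon>" using M1[of N] N by simp
    qed
  qed
  define v where "v = adj (u 1 z0) *v l"
  have \<phi>0: "\<phi> 0 = v" by (simp add: \<phi>_def v_def)
  have key: "inverse (z - z0) *s (jost J z *v v) + l = ((l - (z * z0) ^ N *s (G z N *v l))
      + (inverse (z - z0) * z * (z * z0) ^ N) *s (H z N *v l))
      + ((z - z0) * inverse z) *s (\<Sum>n<N. u (Suc n) z *v \<phi> n)"
    if z: "z \<in> cball 0 1" "z \<noteq> 0" "z \<noteq> z0" and N: "N \<ge> 1" for z N
  proof -
    define c where "c = ?E - (z + inverse z)"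
    \<comment> \<open>The energy z + 1/z has critical points at 1 and -1, so the energies differ
      only to second order.\<close>
    have c: "c = - ((z - z0)\<^sup>2 * inverse z)"
      using z(2) z0p(3,5) z0 by (auto simp: c_def power2_eq_square field_simps)
    have "jacobi_op_minus J (z + inverse z) \<phi> n = c *s \<phi> n" for n
      by (simp add: jacobi_op_minus_def op0 c_def vec_eq_iff left_diff_distrib)
    hence "(\<Sum>n<N. c *s (u (Suc n) z *v \<phi> n)) = bdry z \<phi> N - jost J z *v v"
      using green[OF reg[OF z(1)] z(2), of \<phi> N] by (simp add: \<phi>0)
    hence "jost J z *v v = bdry z \<phi> N - c *s (\<Sum>n<N. u (Suc n) z *v \<phi> n)"
      by (simp add: vec.scale_sum_right algebra_simps)
    moreover have "bdry z \<phi> N = (z * z0) ^ N *s ((z0 - z) *s (G z N *v l) + z *s (H z N *v l))"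
    proof -
      obtain m where m: "N = Suc m" using N by (cases N) auto
      have "bdry z \<phi> N = (z ^ N * z0 ^ Suc N) *s (G z N *v l) - (z ^ Suc N * z0 ^ N) *s ((w (Suc N) z ** adj (Apar J N) ** om N) *v l)"
        by (simp add: bdry_def m \<phi> jost_sol_def G_def matrix_vector_mul_assoc matrix_mul_assoc vector_smult_assoc mult_ac del: power_Suc)
      also have "w (Suc N) z ** adj (Apar J N) ** om N = G z N - H z N" by (simp add: G_def H_def)
      finally show ?thesis
        by (simp add: vec_eq_iff matrix_vector_mult_diff_rdistrib power_mult_distrib algebra_simps)
    qed
    ultimately have eq: "jost J z *v v = (z * z0) ^ N *s ((z0 - z) *s (G z N *v l) + z *s (H z N *v l)) - c *s (\<Sum>n<N. u (Suc n) z *v \<phi> n)"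
      by simp
    have nz: "z - z0 \<noteq> 0" using z(3) by simp
    have "inverse d * - (d\<^sup>2 * y) = - (d * y)" if "d \<noteq> 0" for d y :: complex
      using that by (simp add: power2_eq_square)
    hence "inverse (z - z0) * c = - ((z - z0) * inverse z)" unfolding c using nz by blast
    moreover have "inverse (z - z0) * (z0 - z) = -1" using nz by (simp add: field_simps)
    ultimately have i: "inverse (z - z0) * (z0 - z) = -1" "inverse (z - z0) * c = - ((z - z0) * inverse z)" by blast+
    show ?thesis unfolding eq vec_eq_iff
    proof
      fix i
      define g h s where "g = (G z N *v l) $ i" and "h = (H z N *v l) $ i" and "s = (\<Sum>n<N. u (Suc n) z *v \<phi> n) $ i"
      have "inverse (z - z0) * ((z * z0) ^ N * ((z0 - z) * g + z * h) - c * s) + l $ i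
          = (z * z0) ^ N * ((inverse (z - z0) * (z0 - z)) * g + inverse (z - z0) * z * h) - (inverse (z - z0) * c) * s + l $ i"
        by (simp add: algebra_simps)
      also have "\<dots> = l $ i - (z * z0) ^ N * g + inverse (z - z0) * z * (z * z0) ^ N * h + (z - z0) * inverse z * s"
        unfolding i by (simp add: algebra_simps)
      finally show "(inverse (z - z0) *s ((z * z0) ^ N *s ((z0 - z) *s (G z N *v l) + z *s (H z N *v l)) - c *s (\<Sum>n<N. u (Suc n) z *v \<phi> n)) + l) $ i
        = (l - (z * z0) ^ N *s (G z N *v l) + (inverse (z - z0) * z * (z * z0) ^ N) *s (H z N *v l) + ((z - z0) * inverse z) *s (\<Sum>n<N. u (Suc n) z *v \<phi> n)) $ i"
        by (simp only: g_def h_def s_def vector_add_component vector_minus_component vector_smult_component)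
    qed
  qed
  define L where "L = norm l"
  have L: "L \<ge> 0" by (simp add: L_def)
  \<comment> \<open>With t the distance of z to z0, the errors are of order norm (G - 1) + N t,
    \<rho> N / (N t) and N t. Hence N t has to be small, but bounded away from 0.\<close>
  have est: "norm (inverse (z - z0) *s (jost J z *v v) + l) \<le> (norm (G z N - mat 1) * L + real N * cmod (z - z0) * (B * L))
      + \<rho> N * L / (real N * cmod (z - z0)) + 2 * (real N * cmod (z - z0)) * (C * C * L)"
    if z: "z \<in> cball 0 1" "cmod (z - z0) < 1 / 2" "z \<noteq> z0" and N: "N \<ge> 1" for z N
  proof -
    have "cmod z0 \<le> cmod z + cmod (z - z0)" by (metis add.commute norm_minus_commute norm_triangle_sub)
    hence z1: "cmod z \<ge> 1 / 2" using z(2) z0p(1) by simp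
    hence zn: "z \<noteq> 0" by auto
    have z1': "cmod z \<le> 1" using z by simp
    have q: "cmod ((z * z0) ^ N) \<le> 1" using z1' z0p(1) by (simp add: norm_mult norm_power power_le_one)
    have t1: "norm (l - (z * z0) ^ N *s (G z N *v l)) \<le> norm (G z N - mat 1) * L + real N * cmod (z - z0) * (B * L)"
    proof -
      have "l - (z * z0) ^ N *s (G z N *v l) = (1 - (z * z0) ^ N) *s (G z N *v l) - (G z N - mat 1) *v l"
        by (simp add: matrix_vector_mult_diff_rdistrib vec_eq_iff algebra_simps)
      hence "norm (l - (z * z0) ^ N *s (G z N *v l)) \<le> norm ((1 - (z * z0) ^ N) *s (G z N *v l)) + norm ((G z N - mat 1) *v l)"
        by (simp only: norm_triangle_ineq4)
      also have "norm ((1 - (z * z0) ^ N) *s (G z N *v l)) = cmod (1 - (z * z0) ^ N) * norm (G z N *v l)"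
        by (rule norm_smult_vec)
      finally have "norm (l - (z * z0) ^ N *s (G z N *v l)) \<le> cmod (1 - (z * z0) ^ N) * norm (G z N *v l) + norm ((G z N - mat 1) *v l)" .
      also have "\<dots> \<le> (real N * cmod (z - z0)) * (B * L) + norm (G z N - mat 1) * L"
      proof (intro add_mono mult_mono)
        have "cmod (1 ^ N - (z * z0) ^ N) \<le> real N * cmod (1 - z * z0)"
          using z1' z0p(1) by (intro norm_power_diff) (auto simp: norm_mult)
        also have "1 - z * z0 = z0 * (z0 - z)" using z0p(3) by (simp add: algebra_simps)
        finally show "cmod (1 - (z * z0) ^ N) \<le> real N * cmod (z - z0)" using z0p(1) by (simp add: norm_mult norm_minus_commute)
        show "norm (G z N *v l) \<le> B * L"
          unfolding L_def by (rule order_trans[OF norm_mat_vec_le mult_right_mono[OF G[OF z(1)]]]) simp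
        show "norm ((G z N - mat 1) *v l) \<le> norm (G z N - mat 1) * L" unfolding L_def by (rule norm_mat_vec_le)
      qed auto
      finally show ?thesis by simp
    qed
    have t2: "norm ((inverse (z - z0) * z * (z * z0) ^ N) *s (H z N *v l)) \<le> \<rho> N * L / (real N * cmod (z - z0))"
    proof -
      have "norm ((inverse (z - z0) * z * (z * z0) ^ N) *s (H z N *v l))
          = inverse (cmod (z - z0)) * (cmod z * cmod ((z * z0) ^ N)) * norm (H z N *v l)"
        by (simp add: norm_mult norm_inverse mult.assoc)
      also have "\<dots> \<le> inverse (cmod (z - z0)) * 1 * (\<rho> N / real N * L)"
      proof (intro mult_mono)
        show "cmod z * cmod ((z * z0) ^ N) \<le> 1" using z1' q by (intro mult_le_one) auto
        have "norm (H z N *v l) \<le> norm (H z N) * L" unfolding L_def by (rule norm_mat_vec_le)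
        also have "norm (H z N) \<le> \<rho> N / real N" using H[OF z(1) N] N by (simp add: pos_le_divide_eq mult.commute)
        finally show "norm (H z N *v l) \<le> \<rho> N / real N * L" using L by (simp add: mult_right_mono)
      qed auto
      finally show ?thesis by (simp add: divide_inverse mult_ac)
    qed
    have t3: "norm (((z - z0) * inverse z) *s (\<Sum>n<N. u (Suc n) z *v \<phi> n)) \<le> 2 * (real N * cmod (z - z0)) * (C * C * L)"
    proof -
      have "norm (\<Sum>n<N. u (Suc n) z *v \<phi> n) \<le> (\<Sum>n<N. C * (C * L))"
      proof (rule order_trans[OF norm_sum sum_mono])
        fix n
        have "norm (u (Suc n) z) \<le> C"
        proof -
          have "norm (u (Suc n) z) = cmod z ^ Suc n * norm (w (Suc n) z)" by (simp add: jost_sol_def norm_power norm_mult)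
          also have "\<dots> \<le> 1 * C" using z1' C by (intro mult_mono wC z power_le_one) auto
          finally show ?thesis by simp
        qed
        moreover have "norm (\<phi> n) \<le> C * L"
        proof -
          have "norm (\<phi> n) = norm (om (Suc n) *v l)" using z0p(1) by (simp add: \<phi> norm_power norm_mult)
          also have "\<dots> \<le> C * L" unfolding L_def by (rule order_trans[OF norm_mat_vec_le mult_right_mono[OF om]]) simp
          finally show ?thesis .
        qed
        ultimately have "norm (u (Suc n) z) * norm (\<phi> n) \<le> C * (C * L)" using C by (intro mult_mono) auto
        thus "norm (u (Suc n) z *v \<phi> n) \<le> C * (C * L)" using norm_mat_vec_le order_trans by blast
      qed
      hence s: "norm (\<Sum>n<N. u (Suc n) z *v \<phi> n) \<le> real N * (C * C * L)" by (simp add: mult.assoc)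
      have "inverse (cmod z) \<le> inverse (1 / 2)" using z1 by (intro le_imp_inverse_le) auto
      hence "cmod ((z - z0) * inverse z) \<le> cmod (z - z0) * 2"
        unfolding norm_mult norm_inverse by (intro mult_left_mono) auto
      hence "cmod ((z - z0) * inverse z) * norm (\<Sum>n<N. u (Suc n) z *v \<phi> n) \<le> (cmod (z - z0) * 2) * (real N * (C * C * L))"
        using s by (intro mult_mono) auto
      thus ?thesis by (simp add: mult_ac)
    qed
    show ?thesis unfolding key[OF z(1) zn z(3) N]
      using t1 t2 t3 by (intro norm_triangle_mono)
  qed
  show ?thesis unfolding v_def[symmetric]
  proof (rule tendstoI)
    fix \<epsilon> :: real assume \<epsilon>: "\<epsilon> > 0"
    \<comment> \<open>The coefficient of \<delta> that remains once N t is at most 2 * \<delta>; the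
      1 keeps K positive.\<close>
    define K where "K = 2 * (B * L) + 4 * (C * C * L) + 1"
    have K: "K > 0" using B C L by (auto simp: K_def intro!: add_nonneg_pos mult_nonneg_nonneg add_nonneg_nonneg)
    define \<delta> where "\<delta> = \<epsilon> / (3 * K)"
    have \<delta>: "\<delta> > 0" using \<epsilon> K by (simp add: \<delta>_def)
    have \<delta>K: "\<delta> * (2 * (B * L) + 4 * (C * C * L)) < \<epsilon> / 3"
    proof -
      have "\<delta> * (2 * (B * L) + 4 * (C * C * L)) < \<delta> * K" using \<delta> by (simp add: K_def)
      also have "\<dots> = \<epsilon> / 3" using K by (simp add: \<delta>_def)
      finally show ?thesis .
    qed
    obtain M1 where M1: "\<And>N z. N \<ge> M1 \<Longrightarrow> z \<in> cball 0 1 \<Longrightarrow> norm (G z N - mat 1) < \<epsilon> / (3 * (L + 1))"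
      using Glim[of "\<epsilon> / (3 * (L + 1))"] \<epsilon> L by (metis add_nonneg_pos divide_pos_pos mult_pos_pos zero_less_numeral zero_less_one)
    have "\<forall>\<^sub>F N in sequentially. dist (\<rho> N) 0 < \<epsilon> * \<delta> / (3 * (L + 1))"
      using \<rho> \<epsilon> \<delta> L by (intro tendstoD) auto
    then obtain M2 where M2: "\<And>N. N \<ge> M2 \<Longrightarrow> \<rho> N < \<epsilon> * \<delta> / (3 * (L + 1))"
      by (fastforce simp: eventually_at_top_linorder)
    define M where "M = Suc (max M1 M2)"
    define r where "r = min (1 / 2) (min \<delta> (\<delta> / real M))"
    have r: "r > 0" using \<delta> by (simp add: r_def M_def)
    have "dist (inverse (z - z0) *s (jost J z *v v)) (- l) < \<epsilon>"
      if z: "z \<in> cball 0 1" "z \<noteq> z0" "dist z z0 < r" for z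
    proof -
      define t where "t = cmod (z - z0)"
      have t: "0 < t" "t < 1 / 2" "t < \<delta>" "t < \<delta> / real M" using z by (auto simp: t_def r_def dist_norm)
      \<comment> \<open>This places N t between \<delta> and 2 * \<delta>, the upper bound since t <
        \<delta>; t < \<delta> / M makes N exceed M1 and M2.\<close>
      define N where "N = nat \<lceil>\<delta> / t\<rceil>"
      have dt: "\<delta> / t > real M" using t by (simp add: M_def field_simps)
      have Nr: "\<delta> / t \<le> real N" "real N < \<delta> / t + 1"
        using t \<delta> unfolding N_def by (auto simp: of_nat_nat ceiling_less_iff) (smt (verit) ceiling_correct divide_pos_pos of_nat_nat zero_le_ceiling)+
      have NM: "N \<ge> M" using dt Nr(1) by linarith
      hence N1: "N \<ge> 1" "N \<ge> M1" "N \<ge> M2" by (auto simp: M_def)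
      have Nt: "\<delta> \<le> real N * t" "real N * t \<le> 2 * \<delta>"
        using Nr t by (auto simp: field_simps) 
      have "norm (inverse (z - z0) *s (jost J z *v v) + l) \<le> (norm (G z N - mat 1) * L + real N * t * (B * L))
        + \<rho> N * L / (real N * t) + 2 * (real N * t) * (C * C * L)"
        using est[of z N] z t N1 by (simp add: t_def)
      also have "\<dots> \<le> (\<epsilon> / (3 * (L + 1)) * L + 2 * \<delta> * (B * L)) + \<epsilon> / (3 * (L + 1)) * L + 2 * (2 * \<delta>) * (C * C * L)"
      proof (intro add_mono mult_right_mono mult_left_mono)
        show "norm (G z N - mat 1) \<le> \<epsilon> / (3 * (L + 1))" using M1[OF N1(2) z(1)] by simp
        have "\<rho> N * L / (real N * t) \<le> (\<epsilon> * \<delta> / (3 * (L + 1))) * L / (real N * t)"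
          using M2[OF N1(3)] L Nt \<delta> by (intro divide_right_mono mult_right_mono) auto
        also have "\<dots> \<le> (\<epsilon> * \<delta> / (3 * (L + 1))) * L / \<delta>"
          using Nt \<delta> \<epsilon> L N1 t by (intro divide_left_mono mult_nonneg_nonneg mult_pos_pos) auto
        also have "\<dots> = \<epsilon> / (3 * (L + 1)) * L" using \<delta> by simp
        finally show "\<rho> N * L / (real N * t) \<le> \<epsilon> / (3 * (L + 1)) * L" .
      qed (use Nt B L C in auto)
      also have "\<dots> = 2 * (\<epsilon> / (3 * (L + 1)) * L) + \<delta> * (2 * (B * L) + 4 * (C * C * L))" by (simp add: algebra_simps)
      also have "\<dots> < 2 * (\<epsilon> / 3) + \<epsilon> / 3"
      proof (rule add_le_less_mono[OF mult_left_mono \<delta>K])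
        show "\<epsilon> / (3 * (L + 1)) * L \<le> \<epsilon> / 3" using \<epsilon> L by (simp add: field_simps)
      qed simp
      finally show ?thesis by (simp add: dist_norm)
    qed
    thus "\<forall>\<^sub>F z in at z0 within cball 0 1. dist (inverse (z - z0) *s (jost J z *v v)) (- l) < \<epsilon>"
      unfolding eventually_at using r by blast
  qed
qed

lemma at_cball_nonbot: "z0 = 1 \<or> z0 = -1 \<Longrightarrow> at z0 within cball 0 1 \<noteq> (bot :: complex filter)"
proof -
  assume "z0 = 1 \<or> z0 = -1"
  hence "z0 islimpt ball 0 1" by (auto simp: islimpt_ball)
  hence "z0 islimpt cball 0 1" by (rule islimpt_subset) auto
  thus ?thesis by (simp add: trivial_limit_within)
qed

text \<open>The difference quotient tends to -l, where l is also a vector in the kernel of the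
  adjoint, so pairing with l itself gives minus its squared norm.\<close>

lemma edge_nondegenerate:
  assumes A2: "cond_A2 J" and z0: "z0 = 1 \<or> z0 = -1"
  shows "\<exists>k. \<forall>v. jost J z0 *v v = 0 \<longrightarrow>
    ((\<lambda>z. inverse (z - z0) *s (jost J z *v v)) \<longlongrightarrow> k v) (at z0 within cball 0 1) \<and>
    (v \<noteq> 0 \<longrightarrow> (\<exists>l. adj (jost J z0) *v l = 0 \<and> cinner l (k v) \<noteq> 0))"
proof -
  have reg: "regular z0" by (rule jost_good_regular[OF good_closed_disk[OF A2]]) (use z0 in auto)
  have "\<exists>l. adj (jost J z0) *v l = 0 \<and> adj (u 1 z0) *v l = v" if "jost J z0 *v v = 0" for v
    by (rule real_kernel_vector(2)[OF reg _ _ _ that]) (use z0 in auto)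
  then obtain l where l: "\<And>v. jost J z0 *v v = 0 \<Longrightarrow> adj (jost J z0) *v l v = 0 \<and> adj (u 1 z0) *v l v = v"
    by metis
  show ?thesis
  proof (intro exI[of _ "\<lambda>v. - l v"] allI impI conjI)
    fix v assume v: "jost J z0 *v v = 0"
    show "((\<lambda>z. inverse (z - z0) *s (jost J z *v v)) \<longlongrightarrow> - l v) (at z0 within cball 0 1)"
      using edge_quotient_limit[OF A2 z0, of "l v"] l[OF v] by simp
    assume "v \<noteq> 0"
    hence "l v \<noteq> 0" using l[OF v] by force
    thus "\<exists>l'. adj (jost J z0) *v l' = 0 \<and> cinner l' (- l v) \<noteq> 0"
      using l[OF v] by (intro exI[of _ "l v"]) (simp add: cinner_simps)
  qed
qed

lemma simple_zero_edge:
  assumes z0: "z0 = 1 \<or> z0 = -1" and S: "cond_A2 J \<and> S = cball 0 1 \<or> cond_A3 J R \<and> S = ball 0 R"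
  shows "\<exists>k. simple_zero (jost J) S z0 k"
proof -
  have A2: "cond_A2 J" using S cond_A3_imp_A2 by blast
  have reg: "appropriate_region J S" using S by (auto simp: appropriate_region_def)
  have R: "1 < R" if "S = ball 0 R" "cond_A3 J R" using that by (simp add: cond_A3_def)
  have z0S: "z0 \<in> S" using z0 S by (auto simp: cond_A3_def)
  obtain k where "\<forall>v. jost J z0 *v v = 0 \<longrightarrow>
    ((\<lambda>z. inverse (z - z0) *s (jost J z *v v)) \<longlongrightarrow> k v) (at z0 within cball 0 1) \<and>
    (v \<noteq> 0 \<longrightarrow> (\<exists>l. adj (jost J z0) *v l = 0 \<and> cinner l (k v) \<noteq> 0))"
    using edge_nondegenerate[OF A2 z0] by (elim exE)
  hence k: "jost J z0 *v v = 0 \<Longrightarrow> ((\<lambda>z. inverse (z - z0) *s (jost J z *v v)) \<longlongrightarrow> k v) (at z0 within cball 0 1)"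
    "jost J z0 *v v = 0 \<Longrightarrow> v \<noteq> 0 \<Longrightarrow> \<exists>l. adj (jost J z0) *v l = 0 \<and> cinner l (k v) \<noteq> 0" for v by blast+
  have sub: "cball 0 1 \<subseteq> S" using S by (auto simp: cond_A3_def)
  have lim: "((\<lambda>z. inverse (z - z0) *s (jost J z *v v)) \<longlongrightarrow> k v) (at z0 within S)" if v: "jost J z0 *v v = 0" for v
  proof (cases "S = cball 0 1")
    case True
    thus ?thesis using k(1)[OF v] by simp
  next
    case False
    hence o: "open S" using S by auto
    have h: "mat_holo (jost J) S" using region_holo[OF reg o order_refl, of 0] by (simp add: jshift_0[OF jacobi])
    \<comment> \<open>An analytic u has a full difference quotient limit, which must agree with the
      one found within the closed disk.\<close>
    obtain d where d: "((\<lambda>z. inverse (z - z0) *s (jost J z *v v)) \<longlongrightarrow> d) (at z0)"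
      using vec_limit_diff_quotient[OF o z0S h v] by blast
    have "((\<lambda>z. inverse (z - z0) *s (jost J z *v v)) \<longlongrightarrow> d) (at z0 within cball 0 1)"
      using d by (rule Lim_at_imp_Lim_at_within)
    hence "d = k v" using tendsto_unique[OF at_cball_nonbot[OF z0]] k(1)[OF v] by blast
    thus ?thesis using d by (auto intro: Lim_at_imp_Lim_at_within)
  qed
  have "at z0 within S \<noteq> bot"
    using at_cball_nonbot[OF z0] at_le[OF sub, of z0] by (auto simp: bot_unique)
  thus ?thesis using lim k(2) jost_tendsto[OF reg z0S] by (intro exI[of _ k]) (unfold_locales, auto)
qed

end

text \<open>The edge estimate is available for type 1, where the first moment controls 1 - A_n; u
  differs from the type 1 Jost function by constant unitary factors, which leave the pole order
  unchanged.\<close>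

lemma (in jacobi_asymptotic) simple_zero_mat_edge:
  assumes z0: "z0 = 1 \<or> z0 = -1" and S: "cond_A2 J \<and> S = cball 0 1 \<or> cond_A3 J R \<and> S = ball 0 R"
    and sing: "\<not> invertible (jost J z0)"
  shows "simple_zero_mat S (jost J) z0"
proof -
  have reg: "appropriate_region J S" using S by (auto simp: appropriate_region_def)
  have z0S: "z0 \<in> S" using z0 S by (auto simp: cond_A3_def)
  obtain J' \<sigma> L where g: "gauge_to J' \<sigma> L" by (rule gauge)
  hence t: "type1_jacobi J'" and L: "unitary L" and s1: "unitary (\<sigma> 1)" by (simp_all add: gauge_to_def)
  interpret T: type1_jacobi J' by (rule t)
  have dev: "deviation J' (Suc n) = deviation J (Suc n)" for n using g by (simp add: gauge_to_def)
  hence S': "cond_A2 J' \<and> S = cball 0 1 \<or> cond_A3 J' R \<and> S = ball 0 R"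
    using S g by (auto simp: cond_A2_def cond_A3_def gauge_to_def)
  hence reg': "appropriate_region J' S" by (auto simp: appropriate_region_def)
  have eq: "jost J z = L ** jost J' z ** adj (\<sigma> 1)" if zS: "z \<in> S" for z
  proof -
    obtain X U where X: "open U" "z \<in> U" "S \<inter> U \<subseteq> X" "z \<in> X" "jost_good J' X"
      by (rule T.region_good[OF reg' zS])
    have "jost (jshift 0 J) z = L ** jost (jshift 0 J') z ** adj (\<sigma> (0 + 1))"
      using g X(4,5) unfolding gauge_to_def by blast
    thus ?thesis by (simp add: jshift_0[OF jacobi] jshift_0[OF T.jacobi])
  qed
  obtain k where "simple_zero (jost J') S z0 k" using T.simple_zero_edge[OF z0 S'] by blast
  then interpret Z: simple_zero "jost J'" S z0 k .
  obtain M where M: "((\<lambda>z. (z - z0) *\<^sub>m matrix_inv (jost J' z)) \<longlongrightarrow> M) (at z0 within S)" "ran_mat M = ker_mat (jost J' z0)"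
    "ker_mat M = ran_mat (jost J' z0)" "\<forall>\<^sub>F z in at z0 within S. invertible (jost J' z)" by (rule Z.inverse_limit)
  have iL: "invertible L" "invertible (adj (\<sigma> 1))" "matrix_inv L = adj L" "matrix_inv (adj (\<sigma> 1)) = \<sigma> 1"
    using unitary_cancel[OF L] unitary_cancel[OF s1] matrix_inv_unique by blast+
  have "\<not> invertible (jost J' z0)" using sing eq[OF z0S] iL by (simp add: invertible_mat_mult_iff)
  then obtain v where v: "v \<noteq> 0" "jost J' z0 *v v = 0" using not_invertible_kernel by blast
  have M0: "M \<noteq> 0" using v M(2) by (auto simp: ran_mat_def ker_mat_def)
  have lim: "((\<lambda>z. \<sigma> 1 ** ((z - z0) *\<^sub>m matrix_inv (jost J' z)) ** adj L) \<longlongrightarrow> \<sigma> 1 ** M ** adj L) (at z0 within S)"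
    by (intro tendsto_intros M(1))
  have ev: "\<forall>\<^sub>F z in at z0 within S. \<sigma> 1 ** ((z - z0) *\<^sub>m matrix_inv (jost J' z)) ** adj L = (z - z0) ^ 1 *\<^sub>m matrix_inv (jost J z)"
  proof -
    have "\<forall>\<^sub>F z in at z0 within S. z \<in> S" by (auto simp: eventually_at_filter)
    with M(4) show ?thesis
    proof (eventually_elim)
    case (elim z)
    have "z \<in> S \<Longrightarrow> matrix_inv (jost J z) = \<sigma> 1 ** matrix_inv (jost J' z) ** adj L"
      using elim iL by (simp add: eq matrix_inv_mat_mult invertible_mat_mult_iff matrix_mul_assoc)
    thus ?case using elim by simp
    qed
  qed
  have "((\<lambda>z. (z - z0) ^ 1 *\<^sub>m matrix_inv (jost J z)) \<longlongrightarrow> \<sigma> 1 ** M ** adj L) (at z0 within S)"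
    by (rule Lim_transform_eventually[OF lim ev])
  moreover have "\<sigma> 1 ** M ** adj L \<noteq> 0"
  proof
    assume "\<sigma> 1 ** M ** adj L = 0"
    hence "norm (\<sigma> 1 ** M ** adj L) = 0" by simp
    hence "norm M = 0" using L s1 by (simp only: norm_unitary_mult)
    thus False using M0 by simp
  qed
  ultimately show ?thesis unfolding simple_zero_mat_def pole_of_order_def pole_limit_def by auto
qed

section \<open>The spectral measure\<close>

text \<open>Polarization with u + w and u + i w.\<close>

lemma mat_eq_by_quadratic_form:
  fixes X :: "complex^'n^'n"
  assumes "\<And>v. cinner v (X *v v) = 0"
  shows "X = 0"
proof -
  have "cinner u (X *v w) = 0" for u w
  proof -
    have "cinner (u + w) (X *v (u + w)) = 0" "cinner (u + \<i> *s w) (X *v (u + \<i> *s w)) = 0"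
      "cinner u (X *v u) = 0" "cinner w (X *v w) = 0" by (rule assms)+
    hence "cinner u (X *v w) + cinner w (X *v u) = 0" "cinner u (X *v w) - cinner w (X *v u) = 0"
      by (simp_all add: cinner_simps matrix_vector_right_distrib algebra_simps)
    thus ?thesis by simp
  qed
  hence "X *v w = 0" for w using cinner_self_eq_0_iff by blast
  thus ?thesis by (simp add: matrix_eq)
qed

lemma form_measure_facts:
  assumes \<mu>: "matrix_measure \<mu>"
  shows sets_form_measure: "sets (form_measure \<mu> v) = sets borel"
    and space_form_measure: "space (form_measure \<mu> v) = UNIV"
    and emeasure_form_measure: "X \<in> sets borel \<Longrightarrow> emeasure (form_measure \<mu> v) X = ennreal (Re (cinner v (\<mu> X *v v)))"
proof -
  have pow: "sets borel \<subseteq> Pow (UNIV :: real set)" by auto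
  show "sets (form_measure \<mu> v) = sets borel" "space (form_measure \<mu> v) = UNIV"
    unfolding form_measure_def using pow by (simp_all add: sets.sigma_sets_eq[of borel, simplified])
  have nn: "0 \<le> Re (cinner v (\<mu> X *v v))" if "X \<in> sets borel" for X
    using \<mu> that by (simp add: matrix_measure_def psd_def)
  have sums: "(\<lambda>n. \<mu> (X n)) sums \<mu> (\<Union>n. X n)" if "range X \<subseteq> sets borel" "disjoint_family X" for X :: "nat \<Rightarrow> real set"
    using \<mu> that by (simp add: matrix_measure_def)
  have "(\<lambda>n. \<mu> {}) sums \<mu> {}" using sums[of "\<lambda>_. {}"] by (simp add: disjoint_family_on_def)
  hence e0: "\<mu> {} = 0" using summable_const_iff sums_summable by blast
  have "positive (sets borel) (\<lambda>X. ennreal (Re (cinner v (\<mu> X *v v))))"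
    by (simp add: positive_def e0 cinner_simps)
  moreover have "countably_additive (sets borel) (\<lambda>X. ennreal (Re (cinner v (\<mu> X *v v))))"
    unfolding countably_additive_def
  proof (intro allI impI)
    fix X :: "nat \<Rightarrow> real set" assume X: "range X \<subseteq> sets borel" "disjoint_family X"
    have "bounded_linear (\<lambda>N. cinner v (N *v v))"
      by (intro bounded_linear_compose[OF bounded_bilinear.bounded_linear_right[OF bounded_bilinear_cinner]
            bounded_bilinear.bounded_linear_left[OF bounded_bilinear_mat_vec]])
    hence "(\<lambda>n. cinner v (\<mu> (X n) *v v)) sums cinner v (\<mu> (\<Union>n. X n) *v v)"
      using sums[OF X] by (rule bounded_linear.sums)
    hence "(\<lambda>n. Re (cinner v (\<mu> (X n) *v v))) sums Re (cinner v (\<mu> (\<Union>n. X n) *v v))" by (rule sums_Re)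
    thus "(\<Sum>i. ennreal (Re (cinner v (\<mu> (X i) *v v)))) = ennreal (Re (cinner v (\<mu> (\<Union> (range X)) *v v)))"
      using X by (intro suminf_ennreal_eq nn) auto
  qed
  ultimately show "emeasure (form_measure \<mu> v) X = ennreal (Re (cinner v (\<mu> X *v v)))" if "X \<in> sets borel"
    unfolding form_measure_def using that sets.sigma_algebra_axioms[of "borel :: real measure"]
    by (intro emeasure_measure_of_sigma) auto
qed

lemma finite_form_measure: "matrix_measure \<mu> \<Longrightarrow> finite_measure (form_measure \<mu> v)"
  by (intro finite_measureI) (simp add: space_form_measure emeasure_form_measure)

lemma measure_form_measure_point:
  assumes "matrix_measure \<mu>"
  shows "of_real (measure (form_measure \<mu> v) {x}) = cinner v (\<mu> {x} *v v)"
proof -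
  have p: "psd (\<mu> {x})" using assms by (simp add: matrix_measure_def)
  hence "measure (form_measure \<mu> v) {x} = Re (cinner v (\<mu> {x} *v v))"
    using assms by (simp add: measure_def emeasure_form_measure psd_def)
  moreover have "cinner v (\<mu> {x} *v v) = cnj (cinner v (\<mu> {x} *v v))"
    using p by (subst cinner_commute, subst cinner_mat_right) (simp add: psd_def hermitian_def)
  hence "Im (cinner v (\<mu> {x} *v v)) = 0" by (metis cnj.simps(2) neg_equal_zero)
  ultimately show ?thesis by (simp add: complex_eq_iff)
qed

lemma cauchy_kernel_bound:
  fixes x :: real
  assumes "Im E \<noteq> 0"
  shows "cmod (1 / (of_real x - E)) \<le> 1 / \<bar>Im E\<bar>"
proof -
  have "\<bar>Im E\<bar> \<le> cmod (of_real x - E)" using abs_Im_le_cmod[of "of_real x - E"] by simp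
  thus ?thesis using assms by (simp add: norm_divide frac_le)
qed

text \<open>The Herglotz bound; C is the total mass of the scalar measure belonging to v.\<close>

lemma m_fun_form_bound:
  assumes "is_spectral_measure J \<mu>"
  obtains C where "C \<ge> 0" "\<forall>E. Im E \<noteq> 0 \<longrightarrow> cmod (cinner v (m_fun J E *v v)) \<le> C / \<bar>Im E\<bar>"
proof (rule that)
  let ?\<nu> = "form_measure \<mu> v"
  have \<mu>: "matrix_measure \<mu>" using assms by (simp add: is_spectral_measure_def)
  interpret finite_measure ?\<nu> by (rule finite_form_measure[OF \<mu>])
  show "measure ?\<nu> (space ?\<nu>) \<ge> 0" by simp
  show "\<forall>E. Im E \<noteq> 0 \<longrightarrow> cmod (cinner v (m_fun J E *v v)) \<le> measure ?\<nu> (space ?\<nu>) / \<bar>Im E\<bar>"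
  proof (intro allI impI)
    fix E assume E: "Im E \<noteq> 0"
    have h: "integrable ?\<nu> (\<lambda>x. 1 / (of_real x - E))" "cinner v (m_fun J E *v v) = (\<integral>x. 1 / (of_real x - E) \<partial>?\<nu>)"
      using assms E by (auto simp: is_spectral_measure_def has_matrix_integral_def)
    have "cmod (cinner v (m_fun J E *v v)) \<le> (\<integral>x. cmod (1 / (of_real x - E)) \<partial>?\<nu>)"
      unfolding h(2) by (rule integral_norm_bound)
    also have "\<dots> \<le> (\<integral>x. 1 / \<bar>Im E\<bar> \<partial>?\<nu>)"
      by (intro integral_mono integrable_norm h(1) cauchy_kernel_bound E) auto
    also have "\<dots> = measure ?\<nu> (space ?\<nu>) / \<bar>Im E\<bar>" by simp
    finally show "cmod (cinner v (m_fun J E *v v)) \<le> measure ?\<nu> (space ?\<nu>) / \<bar>Im E\<bar>" .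
  qed
qed

text \<open>The point mass is read off the resolvent along the vertical line through the eigenvalue point,
  by dominated convergence in the Cauchy transform.\<close>

lemma point_mass_residue:
  assumes sp: "is_spectral_measure J \<mu>" and z0: "z0 \<in> \<real>" "z0 \<noteq> 0" "cmod z0 < 1"
    and N: "((\<lambda>z. (z - z0) *\<^sub>m M_fun J z) \<longlongrightarrow> N) (at z0)"
  shows "\<mu> {Re (z0 + inverse z0)} = (1 - inverse (z0 * z0)) *\<^sub>m N"
proof -
  have \<mu>: "matrix_measure \<mu>" using sp by (simp add: is_spectral_measure_def)
  define E0 where "E0 = Re (z0 + inverse z0)"
  have "Im z0 = 0" using z0(1) by (simp add: complex_is_Real_iff)
  hence "Im (z0 + inverse z0) = 0" unfolding Im_joukowsky by simp
  hence E0: "z0 + inverse z0 = of_real E0"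
    unfolding E0_def by (intro complex_eqI) (simp_all only: Re_complex_of_real Im_complex_of_real)
  define t where "t n = 1 / (real n + 2 + 2 / (1 - cmod z0))" for n
  have tlim: "t \<longlonglongrightarrow> 0" unfolding t_def by real_asymp
  have z1: "1 - cmod z0 > 0" using z0(3) by simp
  have t0: "0 < t n" for n unfolding t_def using z1 by (intro divide_pos_pos add_nonneg_pos) auto
  define z where "z n = z0 + \<i> * of_real (t n)" for n
  have zz: "z n - z0 = \<i> * of_real (t n)" "z n \<noteq> z0" for n using t0[of n] by (auto simp: z_def)
  have zlim: "z \<longlonglongrightarrow> z0"
  proof -
    have "z \<longlonglongrightarrow> z0 + \<i> * of_real 0" unfolding z_def by (intro tendsto_intros tlim)
    thus ?thesis by simp
  qed
  have zat: "filterlim z (at z0) sequentially"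
    using zlim zz by (simp add: filterlim_at)
  have Imz: "Im (z n) = t n" for n using \<open>Im z0 = 0\<close> by (simp add: z_def)
  hence zn0: "z n \<noteq> 0" for n using t0[of n] by (metis less_irrefl zero_complex.simps(2))
  define E where "E n = z n + inverse (z n)" for n
  have ev: "\<forall>\<^sub>F n in sequentially. cmod (z n) < 1"
    using order_tendstoD(2)[OF tendsto_norm[OF zlim] z0(3)] .
  have EE: "E n - of_real E0 = (z n - z0) * (1 - inverse (z n * z0))" for n
    unfolding E_def E0[symmetric] using zn0[of n] z0(2) by (simp add: field_simps)
  have ImE: "Im (E n) = t n * (1 - 1 / (cmod (z n))\<^sup>2)" for n
    unfolding E_def Im_joukowsky Imz ..
  define c where "c = 1 - inverse (z0 * z0)"
  have r: "(\<lambda>n. 1 - inverse (z n * z0)) \<longlonglongrightarrow> c" unfolding c_def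
    using z0(2) by (intro tendsto_intros zlim) auto
  have z02: "(cmod z0)\<^sup>2 < 1" using z0(3) by (simp add: power_less_one_iff abs_square_less_1)
  have q0: "1 - 1 / (cmod z0)\<^sup>2 \<noteq> 0" using z02 z0(2) by auto
  \<comment> \<open>E n approaches E0 nontangentially: this quotient is the distance to E0 divided
    by the modulus of the imaginary part. Its bound K is the dominating constant below.\<close>
  have q: "(\<lambda>n. cmod (1 - inverse (z n * z0)) / \<bar>1 - 1 / (cmod (z n))\<^sup>2\<bar>) \<longlonglongrightarrow> cmod c / \<bar>1 - 1 / (cmod z0)\<^sup>2\<bar>"
    using z0(2) q0 by (intro tendsto_intros r zlim) auto
  obtain K where K: "\<And>n. cmod (1 - inverse (z n * z0)) / \<bar>1 - 1 / (cmod (z n))\<^sup>2\<bar> \<le> K"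
    using convergent_imp_bounded[OF q] by (auto simp: bounded_iff)
  have form: "cinner v (\<mu> {E0} *v v) = cinner v ((c *\<^sub>m N) *v v)" for v
  proof -
    let ?\<nu> = "form_measure \<mu> v"
    interpret finite_measure ?\<nu> by (rule finite_form_measure[OF \<mu>])
    \<comment> \<open>The rescaled Cauchy kernel tends to -1 at E0 and to 0 elsewhere, so its
      integral tends to minus the mass at E0.\<close>
    define s where "s n x = (E n - of_real E0) / (of_real x - E n)" for n and x :: real
    obtain n0 where n0: "\<And>n. n \<ge> n0 \<Longrightarrow> cmod (z n) < 1" using ev by (auto simp: eventually_at_top_linorder)
    have ImE0: "Im (E n) \<noteq> 0" if "n \<ge> n0" for n
    proof -
      have "0 < (cmod (z n))\<^sup>2" "(cmod (z n))\<^sup>2 < 1"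
        using n0[OF that] zn0[of n] by (auto simp: power_less_one_iff abs_square_less_1)
      thus ?thesis using t0[of n] by (auto simp: ImE)
    qed
    have meas: "f \<in> borel_measurable ?\<nu> \<longleftrightarrow> f \<in> borel_measurable borel" for f :: "real \<Rightarrow> complex"
      by (rule arg_cong[of _ _ "\<lambda>S. f \<in> S"], rule measurable_cong_sets) (simp_all add: sets_form_measure[OF \<mu>])
    have "(\<lambda>n. \<integral>x. s (n + n0) x \<partial>?\<nu>) \<longlonglongrightarrow> (\<integral>x. - indicator {E0} x \<partial>?\<nu>)"
    proof (rule integral_dominated_convergence[where w = "\<lambda>_. K"])
      show "(\<lambda>x. - indicator {E0} x :: complex) \<in> borel_measurable ?\<nu>" unfolding meas by measurable
      show "s (n + n0) \<in> borel_measurable ?\<nu>" for n unfolding meas s_def by measurable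
      show "AE x in ?\<nu>. (\<lambda>n. s (n + n0) x) \<longlonglongrightarrow> - indicator {E0} x"
      proof (rule AE_I2)
        fix x
        have Elim: "(\<lambda>n. E (n + n0)) \<longlonglongrightarrow> of_real E0"
        proof -
          have "E \<longlonglongrightarrow> z0 + inverse z0" unfolding E_def using z0(2) by (intro tendsto_intros zlim)
          thus ?thesis unfolding E0 by (rule LIMSEQ_ignore_initial_segment)
        qed
        show "(\<lambda>n. s (n + n0) x) \<longlonglongrightarrow> - indicator {E0} x"
        proof (cases "x = E0")
          case True
          have "E (n + n0) \<noteq> of_real E0" for n using ImE0[of "n + n0"] by auto
          hence "s (n + n0) x = -1" for n unfolding s_def True
            by (metis divide_minus1 minus_diff_eq minus_divide_right nonzero_eq_divide_eq right_minus_eq divide_self)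
          thus ?thesis using True by simp
        next
          case False
          hence "(\<lambda>n. s (n + n0) x) \<longlonglongrightarrow> (of_real E0 - of_real E0) / (of_real x - of_real E0)"
            unfolding s_def by (intro tendsto_intros Elim) auto
          thus ?thesis using False by simp
        qed
      qed
      show "AE x in ?\<nu>. norm (s (n + n0) x) \<le> K" for n
      proof (rule AE_I2)
        fix x
        have "norm (s (n + n0) x) = cmod (E (n + n0) - of_real E0) * cmod (1 / (of_real x - E (n + n0)))"
          by (simp add: s_def norm_divide)
        also have "\<dots> \<le> cmod (E (n + n0) - of_real E0) * (1 / \<bar>Im (E (n + n0))\<bar>)"
          by (intro mult_left_mono cauchy_kernel_bound ImE0) auto
        also have "\<dots> = cmod (1 - inverse (z (n + n0) * z0)) / \<bar>1 - 1 / (cmod (z (n + n0)))\<^sup>2\<bar>"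
          unfolding EE ImE zz(1) using t0[of "n + n0"] by (simp add: norm_mult abs_mult)
        also have "\<dots> \<le> K" by (rule K)
        finally show "norm (s (n + n0) x) \<le> K" .
      qed
    qed simp
    moreover have "(\<integral>x. - indicator {E0} x \<partial>?\<nu>) = - (cinner v (\<mu> {E0} *v v))"
    proof -
      have "(\<integral>x. (indicator {E0} x :: complex) \<partial>?\<nu>) = of_real (measure ?\<nu> {E0})"
      proof -
        have "(\<integral>x. (indicator {E0} x :: complex) \<partial>?\<nu>) = (\<integral>x. complex_of_real (indicator {E0} x) \<partial>?\<nu>)"
          by (intro Bochner_Integration.integral_cong) (auto simp: indicator_def)
        also have "\<dots> = of_real (\<integral>x. indicator {E0} x \<partial>?\<nu>)" by (rule integral_complex_of_real)
        finally show ?thesis by (simp add: space_form_measure[OF \<mu>])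
      qed
      thus ?thesis by (simp add: measure_form_measure_point[OF \<mu>])
    qed
    moreover have "(\<integral>x. s (n + n0) x \<partial>?\<nu>) = - (1 - inverse (z (n + n0) * z0)) * cinner v (((z (n + n0) - z0) *\<^sub>m M_fun J (z (n + n0))) *v v)" for n
    proof -
      define m where "m = n + n0"
      have "Im (E m) \<noteq> 0" using ImE0[of m] by (simp add: m_def)
      hence h: "cinner v (m_fun J (E m) *v v) = (\<integral>x. 1 / (of_real x - E m) \<partial>?\<nu>)"
        using sp by (auto simp: is_spectral_measure_def has_matrix_integral_def)
      have "(\<integral>x. s m x \<partial>?\<nu>) = (E m - of_real E0) * cinner v (m_fun J (E m) *v v)"
        unfolding h by (subst integral_mult_right_zero[symmetric]) (simp add: s_def[abs_def])
      also have "m_fun J (E m) = - M_fun J (z m)" using zn0[of m] by (simp add: M_fun_def E_def)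
      finally have "(\<integral>x. s m x \<partial>?\<nu>) = - (1 - inverse (z m * z0)) * ((z m - z0) * cinner v (M_fun J (z m) *v v))"
        by (simp only: EE mat_vec_minus_left cinner_simps) (simp only: mult_minus_left mult_minus_right mult_ac)
      thus ?thesis by (simp only: smult_mat_vec cinner_simps m_def)
    qed
    moreover have "(\<lambda>n. - (1 - inverse (z (n + n0) * z0)) * cinner v (((z (n + n0) - z0) *\<^sub>m M_fun J (z (n + n0))) *v v))
        \<longlonglongrightarrow> - c * cinner v (N *v v)"
    proof -
      have "(\<lambda>n. (z n - z0) *\<^sub>m M_fun J (z n)) \<longlonglongrightarrow> N" using filterlim_compose[OF N zat] .
      hence "(\<lambda>n. - (1 - inverse (z n * z0)) * cinner v (((z n - z0) *\<^sub>m M_fun J (z n)) *v v)) \<longlonglongrightarrow> - c * cinner v (N *v v)"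
        by (intro tendsto_intros r)
      thus ?thesis by (rule LIMSEQ_ignore_initial_segment)
    qed
    ultimately have "- (cinner v (\<mu> {E0} *v v)) = - c * cinner v (N *v v)"
      by (metis (no_types, lifting) LIMSEQ_unique ext)
    thus ?thesis by (simp add: cinner_simps)
  qed
  have "\<mu> {E0} - c *\<^sub>m N = 0"
    by (rule mat_eq_by_quadratic_form) (simp only: matrix_vector_mult_diff_rdistrib cinner_simps form diff_self)
  thus ?thesis by (simp add: E0_def c_def)
qed

section \<open>The \<open>M\<close>-function on the unit circle\<close>

text \<open>The derivative of sin is at least 1/2 on [0, 1], since 1 < pi / 3.\<close>

lemma sin_x_ge_half:
  assumes "0 \<le> x" "x \<le> (1 :: real)"
  shows "x / 2 \<le> sin x"
proof -
  have "sin 0 - 0 / 2 \<le> sin x - x / 2"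
  proof (rule DERIV_nonneg_imp_nondecreasing[OF assms(1)])
    fix y assume y: "0 \<le> y" "y \<le> x"
    have "cos (pi / 3) \<le> cos y" using y assms pi_gt3 by (intro cos_monotone_0_pi_le) auto
    hence "cos y - 1 / 2 \<ge> 0" by (simp add: cos_60)
    moreover have "((\<lambda>x. sin x - x / 2) has_real_derivative cos y - 1 / 2) (at y)"
      by (auto intro!: derivative_eq_intros)
    ultimately show "\<exists>d. ((\<lambda>x. sin x - x / 2) has_real_derivative d) (at y) \<and> 0 \<le> d" by blast
  qed
  thus ?thesis by simp
qed

lemma sinh_ge_double:
  assumes "0 \<le> (x :: real)"
  shows "2 * x \<le> exp x - exp (- x)"
proof -
  have "exp 0 - exp (- 0) - 2 * 0 \<le> exp x - exp (- x) - 2 * x"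
  proof (rule DERIV_nonneg_imp_nondecreasing[OF assms])
    fix y :: real
    have "2 \<le> exp y + exp (- y)"
    proof -
      have "0 \<le> (exp (y / 2) - exp (- y / 2))\<^sup>2" by simp
      also have "\<dots> = exp y + exp (- y) - 2"
        by (simp add: power2_eq_square algebra_simps exp_add[symmetric])
      finally show ?thesis by simp
    qed
    moreover have "((\<lambda>x. exp x - exp (- x) - 2 * x) has_real_derivative exp y + exp (- y) - 2) (at y)"
      by (auto intro!: derivative_eq_intros)
    ultimately show "\<exists>d. ((\<lambda>x. exp x - exp (- x) - 2 * x) has_real_derivative d) (at y) \<and> 0 \<le> d"
      by (intro exI[of _ "exp y + exp (- y) - 2"]) auto
  qed
  thus ?thesis by simp
qed

lemma norm_cis_minus_1_le: "cmod (cis x - 1) \<le> \<bar>x\<bar>"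
proof -
  have "(cmod (cis x - 1))\<^sup>2 = 2 - 2 * cos x"
    unfolding cmod_power2 using sin_cos_squared_add[of x] by (simp add: power2_eq_square algebra_simps)
  also have "\<dots> = (2 * \<bar>sin (x / 2)\<bar>)\<^sup>2"
    using cos_double_sin[of "x / 2"] by (simp add: power_mult_distrib)
  also have "\<dots> \<le> \<bar>x\<bar>\<^sup>2"
    using abs_sin_x_le_abs_x[of "x / 2"] by (intro power_mono) auto
  finally show ?thesis by (rule power2_le_imp_le) simp
qed

lemma diff_eq_minus_imp: "a - b = - c \<Longrightarrow> b = a + (c :: 'a::ab_group_add)"
  by (metis add.commute diff_add_cancel diff_minus_eq_add minus_diff_eq)

context jacobi_asymptotic
begin

text \<open>Equals \<open>M_fun J\<close> on \<open>M_dom J\<close>, but is expressed through u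
  alone. It is the continuation of M both to the circle and to the disk of radius R.\<close>

definition Mx :: "complex \<Rightarrow> complex^'l^'l"
  where "Mx z = matrix_inv (jost J z) ** u 1 z"

text \<open>The reflected Wronskian identity, multiplied by the inverse of u on the left and of the
  reflected adjoint on the right.\<close>

lemma Mx_reflected:
  assumes "regular z" "z \<noteq> 0" "regular (inverse (cnj z))"
    and inv: "invertible (jost J z)" "invertible (jost J (inverse (cnj z)))"
  shows "Mx z = adj (Mx (inverse (cnj z)))
    + (z - inverse z) *\<^sub>m matrix_inv (adj (jost J (inverse (cnj z))) ** jost J z)"
proof -
  define X X' Y Y' where "X = jost J z" and "X' = jost J (inverse (cnj z))" and "Y = u 1 z" and "Y' = u 1 (inverse (cnj z))"
  have i: "invertible X" "invertible X'" "invertible (adj X')" using inv by (auto simp: X_def X'_def)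
  have "X ** adj Y' - Y ** adj X' = (inverse z - z) *\<^sub>m mat 1"
    using wronskian_reflected[OF assms(1-3)] by (simp add: X_def X'_def Y_def Y'_def)
  hence "matrix_inv X ** (X ** adj Y' - Y ** adj X') ** matrix_inv (adj X')
      = matrix_inv X ** ((inverse z - z) *\<^sub>m mat 1) ** matrix_inv (adj X')" by (simp only:)
  hence "adj Y' ** matrix_inv (adj X') - matrix_inv X ** Y = (inverse z - z) *\<^sub>m (matrix_inv X ** matrix_inv (adj X'))"
    using i by (simp add: mat_distrib matrix_mul_assoc matrix_inv_mult)
  moreover have "matrix_inv (adj X' ** X) = matrix_inv X ** matrix_inv (adj X')"
    using i by (simp add: matrix_inv_mat_mult)
  moreover have "adj (matrix_inv X' ** Y') = adj Y' ** matrix_inv (adj X')"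
    using i by (simp add: adj_matrix_inv)
  ultimately have "adj (matrix_inv X' ** Y') - matrix_inv X ** Y = - ((z - inverse z) *\<^sub>m matrix_inv (adj X' ** X))"
    by (simp only: smult_mat_minus_left[symmetric] minus_diff_eq)
  thus ?thesis unfolding Mx_def X_def X'_def Y_def Y'_def by (rule diff_eq_minus_imp)
qed

lemma circle_cnj:
  assumes "cmod z = 1"
  shows "inverse (cnj z) = z"
proof -
  have "cnj z * z = 1" using complex_norm_square[of z] assms by (simp add: mult.commute)
  thus ?thesis by (rule inverse_unique)
qed

text \<open>On the circle z is its own reflection and 1/z - z is nonzero off the edges. A kernel
  vector of either adjoint makes the quadratic form of the Wronskian vanish, hence is 0.\<close>

lemma circle_invertible:
  assumes z: "cmod z = 1" "z \<noteq> 1" "z \<noteq> -1"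
  shows "invertible (jost J z)" "invertible (u 1 z)"
proof -
  have reg: "regular z" "z \<noteq> 0" using regular_cball[of z] z by auto
  have eq: "jost J z ** adj (u 1 z) - u 1 z ** adj (jost J z) = (inverse z - z) *\<^sub>m mat 1"
    using wronskian_reflected[of z] reg circle_cnj[OF z(1)] by simp
  have "inverse z \<noteq> z"
  proof
    assume "inverse z = z"
    hence "(z - 1) * (z + 1) = 0" using reg(2) by (simp add: field_simps)
    hence "z = 1 \<or> z + 1 = 0" by simp
    thus False using z by (metis eq_neg_iff_add_eq_0)
  qed
  hence nz: "inverse z - z \<noteq> 0" by simp
  have "l = 0" if "adj (jost J z) *v l = 0 \<or> adj (u 1 z) *v l = 0" for l
  proof -
    have "cinner l ((jost J z ** adj (u 1 z) - u 1 z ** adj (jost J z)) *v l)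
        = cinner (adj (jost J z) *v l) (adj (u 1 z) *v l) - cinner (adj (u 1 z) *v l) (adj (jost J z) *v l)"
      by (simp add: matrix_vector_mult_diff_rdistrib cinner_simps matrix_vector_mul_assoc[symmetric] cinner_mat_right[of l])
    also have "\<dots> = 0" using that by (auto simp: cinner_simps)
    finally have "(inverse z - z) * cinner l l = 0" unfolding eq by (simp only: smult_mat_vec cinner_simps matrix_vector_mul_lid)
    thus ?thesis using nz by simp
  qed
  thus "invertible (jost J z)" "invertible (u 1 z)"
    using invertibleI_kernel invertible_adj_iff by metis+
qed

text \<open>On the circle the reflection formula compares M with its own adjoint, and z - 1/z is 2i
  times Im z.\<close>

lemma circle_Im:
  assumes z: "cmod z = 1" "z \<noteq> 1" "z \<noteq> -1"
  shows "Im_mat (Mx z) = complex_of_real (Im z) *\<^sub>m matrix_inv (adj (jost J z) ** jost J z)"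
proof -
  have reg: "regular z" "z \<noteq> 0" using regular_cball[of z] z by auto
  have "Mx z = adj (Mx z) + (z - inverse z) *\<^sub>m matrix_inv (adj (jost J z) ** jost J z)"
    using Mx_reflected[of z] reg circle_cnj[OF z(1)] circle_invertible[OF z] by simp
  hence "Mx z - adj (Mx z) = (z - inverse z) *\<^sub>m matrix_inv (adj (jost J z) ** jost J z)"
    by (metis add_diff_cancel_left')
  moreover have "inverse z = cnj z" using circle_cnj[OF z(1)] by (metis complex_cnj_cnj complex_cnj_inverse)
  hence "1 / (2 * \<i>) * (z - inverse z) = of_real (Im z)"
    by (simp add: complex_diff_cnj field_simps)
  ultimately show ?thesis unfolding Im_mat_def by (simp only: smult_mat_simps)
qed

lemma Mx_continuous:
  "continuous_on {z \<in> cball 0 1 - {1, -1}. invertible (jost J z)} Mx"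
proof -
  have "continuous_on (cball 0 1 - {1, -1}) (jost J)"
    using region_continuous[OF region_A1, of 0] by (simp add: jshift_0[OF jacobi])
  thus ?thesis unfolding Mx_def
    by (intro continuous_intros continuous_on_subset[OF u_continuous[OF region_A1]]) (auto elim: continuous_on_subset)
qed

lemma Mx_holo: "mat_holo Mx {z \<in> ball 0 1. invertible (jost J z)}"
proof -
  have "ball 0 1 \<subseteq> cball 0 1 - {1, -1 :: complex}" by auto
  hence h: "mat_holo (jost (jshift k J)) (ball 0 1)" for k using region_holo[OF region_A1 open_ball] by blast
  have "mat_holo (jost J) {z \<in> ball 0 1. invertible (jost J z)}"
    "mat_holo (jost (jshift 1 J)) {z \<in> ball 0 1. invertible (jost J z)}"
    by (rule mat_holo_subset[OF jost_holo_ball], force) (rule mat_holo_subset[OF h], force)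
  thus ?thesis unfolding Mx_def jost_sol_def jost_sol_scaled_def
    by (intro mat_holo_intros mat_holo_matrix_inv holomorphic_intros) auto
qed

text \<open>In this coordinate the energy is 2 * z0 * cos \<tau>, so its imaginary part has modulus
  sin(Re \<tau>) * 2 sinh(Im \<tau>). The sector stays off the real axis, where all zeros of u in
  the disk lie.\<close>

lemma upper_sector_invertible:
  assumes z0: "z0 = 1 \<or> z0 = -1" and \<tau>: "0 < Re \<tau>" "Re \<tau> < 1" "0 \<le> Im \<tau>"
  defines "z \<equiv> z0 * exp (\<i> * \<tau>)"
  shows "z \<in> cball 0 1 - {1, -1}" "invertible (jost J z)" "Im \<tau> > 0 \<Longrightarrow> cmod z < 1"
    "\<bar>Im (z + inverse z)\<bar> \<ge> Re \<tau> * Im \<tau>" "Im \<tau> > 0 \<Longrightarrow> z \<notin> \<real>"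
proof -
  have nz: "cmod z = exp (- Im \<tau>)" using z0 by (auto simp: z_def norm_mult)
  have Imz: "\<bar>Im z\<bar> = exp (- Im \<tau>) * sin (Re \<tau>)"
    using z0 \<tau> pi_gt3 sin_gt_zero[of "Re \<tau>"] by (auto simp: z_def Im_exp abs_mult)
  have sp: "sin (Re \<tau>) > 0" using \<tau> pi_gt3 by (intro sin_gt_zero) auto
  have I0: "Im z \<noteq> 0" using Imz sp by auto
  show "z \<notin> \<real>" using I0 by (auto simp: complex_is_Real_iff)
  show c: "z \<in> cball 0 1 - {1, -1}" using nz \<tau>(3) I0 by auto
  show l: "cmod z < 1" if "Im \<tau> > 0" using nz that by simp
  show "invertible (jost J z)"
  proof (cases "Im \<tau> = 0")
    case True
    thus ?thesis using circle_invertible(1)[of z] nz c by auto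
  next
    case False
    thus ?thesis using singular_imp_real(1)[of z] l \<tau>(3) I0 by (auto simp: complex_is_Real_iff)
  qed
  have "z + inverse z = z0 * (2 * cos \<tau>)"
    using z0 by (auto simp: z_def cos_exp_eq exp_minus field_simps)
  hence "\<bar>Im (z + inverse z)\<bar> = \<bar>2 * Im (cos \<tau>)\<bar>" using z0 by auto
  also have "2 * Im (cos \<tau>) = - (sin (Re \<tau>) * (exp (Im \<tau>) - exp (- Im \<tau>)))"
    by (simp add: Im_cos right_diff_distrib)
  also have "\<bar>\<dots>\<bar> = sin (Re \<tau>) * (exp (Im \<tau>) - exp (- Im \<tau>))"
    using sp \<tau>(3) by (simp add: abs_mult)
  also have "\<dots> \<ge> Re \<tau> * Im \<tau>"
  proof -
    have "sin (Re \<tau>) \<ge> Re \<tau> / 2" using \<tau> by (intro sin_x_ge_half) auto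
    moreover have "exp (Im \<tau>) - exp (- Im \<tau>) \<ge> 2 * Im \<tau>" by (rule sinh_ge_double) (rule \<tau>(3))
    ultimately have "(Re \<tau> / 2) * (2 * Im \<tau>) \<le> sin (Re \<tau>) * (exp (Im \<tau>) - exp (- Im \<tau>))"
      using \<tau> by (intro mult_mono) auto
    thus ?thesis by simp
  qed
  finally show "\<bar>Im (z + inverse z)\<bar> \<ge> Re \<tau> * Im \<tau>" .
qed

text \<open>If \<open>(z - z0)\<^sup>k u\<^sup>-\<^sup>1\<close> had a nonzero limit with \<open>k \<ge> 2\<close>, the imaginary part of a quadratic form of
  \<open>M\<close> would be at least of order \<open>x\<^sup>-\<^sup>3\<close> at distance \<open>x\<close> from \<open>z0\<close> on the circle, while the Herglotz bound
  \<open>C / \<bar>Im E\<bar>\<close> limits it in the interior.  Integrating against the weight \<open>(\<tau> - s) (3s - \<tau>)\<close>, which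
  compensates the Herglotz bound at the corners, over the triangle with vertices \<open>s\<close>, \<open>2s + i s\<close>, \<open>3s\<close>
  in the coordinate \<open>z = z0 exp (i \<tau>)\<close> gives a contradiction as \<open>s\<close> tends to 0.\<close>

lemma edge_triangle_estimate:
  fixes F :: "complex \<Rightarrow> complex"
  assumes s: "0 < s" "3 * s < 1" and d: "d > 0" and C: "C \<ge> 0"
    and cont: "continuous_on {\<tau>. 0 < Re \<tau> \<and> Re \<tau> < 1 \<and> 0 \<le> Im \<tau>} F"
    and holo: "F holomorphic_on {\<tau>. 0 < Re \<tau> \<and> Re \<tau> < 1 \<and> 0 < Im \<tau>}"
    and up: "\<And>\<tau>. 0 < Re \<tau> \<Longrightarrow> Re \<tau> < 1 \<Longrightarrow> 0 < Im \<tau> \<Longrightarrow> cmod (F \<tau>) \<le> C / (Re \<tau> * Im \<tau>)"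
    and low: "\<And>x. s \<le> x \<Longrightarrow> x \<le> 3 * s \<Longrightarrow> d / x ^ 3 \<le> Im (F (of_real x))"
  shows "4 * d / 81 \<le> 24 * C * s"
proof -
  define a b p :: complex where "a = of_real s" and "b = of_real (3 * s)" and "p = Complex (2 * s) s"
  define f where "f \<tau> = F \<tau> * ((\<tau> - a) * (b - \<tau>))" for \<tau>
  define H where "H = {\<tau>. s \<le> Re \<tau> \<and> Re \<tau> \<le> 3 * s \<and> 0 \<le> Im \<tau>}"
  have "convex H"
  proof -
    have "H = {\<tau>. Re \<tau> \<ge> s} \<inter> {\<tau>. Re \<tau> \<le> 3 * s} \<inter> {\<tau>. Im \<tau> \<ge> 0}" by (auto simp: H_def)
    thus ?thesis by (simp add: convex_Int convex_halfspace_Re_ge convex_halfspace_Re_le convex_halfspace_Im_ge)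
  qed
  hence hull: "convex hull {a, b, p} \<subseteq> H"
    using s by (intro hull_minimal) (auto simp: H_def a_def b_def p_def)
  have int: "interior (convex hull {a, b, p}) \<subseteq> {\<tau>. 0 < Re \<tau> \<and> Re \<tau> < 1 \<and> 0 < Im \<tau>}"
  proof
    fix \<tau> assume \<tau>: "\<tau> \<in> interior (convex hull {a, b, p})"
    then obtain r where r: "r > 0" "ball \<tau> r \<subseteq> convex hull {a, b, p}" by (auto simp: mem_interior)
    have "\<tau> - \<i> * of_real (r / 2) \<in> ball \<tau> r" using r by (simp add: dist_norm norm_mult)
    hence "\<tau> - \<i> * of_real (r / 2) \<in> H" using r hull by blast
    thus "\<tau> \<in> {\<tau>. 0 < Re \<tau> \<and> Re \<tau> < 1 \<and> 0 < Im \<tau>}" using r s by (auto simp: H_def)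
  qed
  have Hsub: "H \<subseteq> {\<tau>. 0 < Re \<tau> \<and> Re \<tau> < 1 \<and> 0 \<le> Im \<tau>}" using s by (auto simp: H_def)
  have cf: "continuous_on (convex hull {a, b, p}) f"
    unfolding f_def using hull Hsub by (intro continuous_intros continuous_on_subset[OF cont]) auto
  \<comment> \<open>F is holomorphic only above the base, so Cauchy's theorem is used in the form
    that needs mere continuity on the boundary of the triangle.\<close>
  have "(f has_contour_integral 0) (linepath a b +++ linepath b p +++ linepath p a)"
  proof (rule Cauchy_theorem_triangle_interior[OF cf])
    show "f holomorphic_on interior (convex hull {a, b, p})"
      unfolding f_def[abs_def] by (intro holomorphic_intros holomorphic_on_subset[OF holo int])
  qed
  moreover have ci: "f contour_integrable_on linepath a b" "f contour_integrable_on linepath b p"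
    "f contour_integrable_on linepath p a"
  proof -
    have "continuous_on (closed_segment a b) f" "continuous_on (closed_segment b p) f" "continuous_on (closed_segment p a) f"
      using cf continuous_on_subset segments_subset_convex_hull by metis+
    thus "f contour_integrable_on linepath a b" "f contour_integrable_on linepath b p"
      "f contour_integrable_on linepath p a" by (auto intro!: contour_integrable_continuous_linepath)
  qed
  moreover have "(f has_contour_integral (contour_integral (linepath a b) f + (contour_integral (linepath b p) f
      + contour_integral (linepath p a) f))) (linepath a b +++ linepath b p +++ linepath p a)"
    using ci by (intro has_contour_integral_join has_contour_integral_integral) auto
  ultimately have zero: "contour_integral (linepath a b) f + (contour_integral (linepath b p) f
      + contour_integral (linepath p a) f) = 0"
    using has_contour_integral_unique by blast
  \<comment> \<open>On a slanted side Im \<tau> = t s and Re \<tau> is at least s, so F is bounded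
    by C / (t s^2). One factor of the weight vanishes at the corner, which gives (2 t s)(3 s) and 6
    C in total.\<close>
  have side: "cmod (f \<tau>) \<le> 6 * C" if "\<tau> = of_real s + of_real t * Complex s s \<or> \<tau> = of_real (3 * s) + of_real t * Complex (- s) s"
    and t: "0 \<le> t" "t \<le> 1" for \<tau> t
  proof (cases "t = 0")
    case True
    thus ?thesis using that C by (auto simp: f_def a_def b_def)
  next
    case False
    hence t0: "t > 0" using t by simp
    have I: "Im \<tau> = t * s" "s \<le> Re \<tau>" "Re \<tau> \<le> 3 * s"
      using that s mult_left_le_one_le[of s t] by (auto simp: algebra_simps)
    have S: "cmod (Complex s s) \<le> 2 * s" "cmod (Complex (- s) s) \<le> 2 * s"
      using cmod_le[of "Complex s s"] cmod_le[of "Complex (- s) s"] s by auto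
    have "cmod ((\<tau> - a) * (b - \<tau>)) \<le> (t * (2 * s)) * (3 * s)"
    proof -
      have near: "cmod (of_real t * w) \<le> t * (2 * s)" if "cmod w \<le> 2 * s" for w
        using that t by (simp add: norm_mult mult_left_mono)
      have far: "cmod w \<le> 3 * s" if "0 \<le> Re w" "Re w \<le> 2 * s" "\<bar>Im w\<bar> \<le> s" for w
        using cmod_le[of w] that by linarith
      from that(1) show ?thesis
      proof
        assume \<tau>: "\<tau> = of_real s + of_real t * Complex s s"
        have "cmod (\<tau> - a) \<le> t * (2 * s)" using near[OF S(1)] by (simp add: \<tau> a_def)
        moreover have "cmod (b - \<tau>) \<le> 3 * s"
          using I s t mult_left_le_one_le[of s t] by (intro far) (auto simp: b_def)
        ultimately show ?thesis unfolding norm_mult using s t by (intro mult_mono) auto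
      next
        assume \<tau>: "\<tau> = of_real (3 * s) + of_real t * Complex (- s) s"
        have "cmod (b - \<tau>) \<le> t * (2 * s)" using near[OF S(2)] by (simp add: \<tau> b_def norm_minus_commute)
        moreover have "cmod (\<tau> - a) \<le> 3 * s"
          using I s t mult_left_le_one_le[of s t] by (intro far) (auto simp: a_def)
        ultimately have "cmod (\<tau> - a) * cmod (b - \<tau>) \<le> (3 * s) * (t * (2 * s))" using s t by (intro mult_mono) auto
        thus ?thesis by (simp add: norm_mult mult_ac)
      qed
    qed
    moreover have "cmod (F \<tau>) \<le> C / (s * (t * s))"
    proof -
      have "cmod (F \<tau>) \<le> C / (Re \<tau> * Im \<tau>)" using I s t0 by (intro up) auto
      also have "\<dots> \<le> C / (s * (t * s))"
        unfolding I(1) using I s t0 C by (intro divide_left_mono mult_right_mono mult_pos_pos) auto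
      finally show ?thesis .
    qed
    ultimately have "cmod (F \<tau>) * cmod ((\<tau> - a) * (b - \<tau>)) \<le> C / (s * (t * s)) * ((t * (2 * s)) * (3 * s))"
      using C s t0 by (intro mult_mono) auto
    also have "\<dots> = 6 * C" using s t0 by (simp add: field_simps)
    finally show ?thesis by (simp add: f_def norm_mult)
  qed
  have len: "cmod (p - b) \<le> 2 * s" "cmod (a - p) \<le> 2 * s"
    using cmod_le[of "p - b"] cmod_le[of "a - p"] s by (auto simp: p_def a_def b_def)
  have "cmod (contour_integral (linepath b p) f) \<le> 6 * C * cmod (p - b)"
  proof (rule has_contour_integral_bound_linepath[OF has_contour_integral_integral[OF ci(2)]])
    fix x assume "x \<in> closed_segment b p"
    then obtain t where t: "0 \<le> t" "t \<le> 1" "x = (1 - t) *\<^sub>R b + t *\<^sub>R p" by (auto simp: closed_segment_def)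
    have "x = of_real (3 * s) + of_real t * Complex (- s) s"
      by (simp add: t(3) b_def p_def complex_eq_iff algebra_simps)
    thus "cmod (f x) \<le> 6 * C" using side[of x t] t by simp
  qed (use C in simp)
  also have "\<dots> \<le> 6 * C * (2 * s)" using len C by (intro mult_left_mono) auto
  finally have I2: "cmod (contour_integral (linepath b p) f) \<le> 12 * C * s" by simp
  have "cmod (contour_integral (linepath p a) f) \<le> 6 * C * cmod (a - p)"
  proof (rule has_contour_integral_bound_linepath[OF has_contour_integral_integral[OF ci(3)]])
    fix x assume "x \<in> closed_segment p a"
    then obtain t where t: "0 \<le> t" "t \<le> 1" "x = (1 - t) *\<^sub>R p + t *\<^sub>R a" by (auto simp: closed_segment_def)
    have "x = of_real s + of_real (1 - t) * Complex s s"
      by (simp add: t(3) a_def p_def complex_eq_iff algebra_simps)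
    thus "cmod (f x) \<le> 6 * C" using side[of x "1 - t"] t by simp
  qed (use C in simp)
  also have "\<dots> \<le> 6 * C * (2 * s)" using len C by (intro mult_left_mono) auto
  finally have I3: "cmod (contour_integral (linepath p a) f) \<le> 12 * C * s" by simp
  \<comment> \<open>With y = s + 2 s x on the base, weight times length is 8 s^3 (x - x^2), and Im F
    is at least d / (3 s)^3. The integral 1/6 of x - x^2 yields 4 d / 81.\<close>
  have I1: "4 * d / 81 \<le> Im (contour_integral (linepath a b) f)"
  proof (rule has_integral_le)
    have "((\<lambda>x. f (linepath a b x) * (b - a)) has_integral contour_integral (linepath a b) f) {0..1}"
      using has_contour_integral_integral[OF ci(1)] by (simp add: has_contour_integral_linepath)
    from has_integral_linear[OF this bounded_linear_Im]
    show "((\<lambda>x. Im (f (linepath a b x) * (b - a))) has_integral Im (contour_integral (linepath a b) f)) {0..1}"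
      by (simp add: o_def)
    have "((\<lambda>x. 8 * d / 27 * (x - x\<^sup>2)) has_integral (8 * d / 27 * (1\<^sup>2 / 2 - 1 ^ 3 / 3) - 8 * d / 27 * (0\<^sup>2 / 2 - 0 ^ 3 / 3))) {0..1 :: real}"
      by (rule fundamental_theorem_of_calculus)
         (auto intro!: derivative_eq_intros simp: has_real_derivative_iff_has_vector_derivative[symmetric] power2_eq_square)
    thus "((\<lambda>x. 8 * d / 27 * (x - x\<^sup>2)) has_integral 4 * d / 81) {0..1 :: real}" by simp
  next
    fix x :: real assume x: "x \<in> {0..1}"
    define y where "y = s + 2 * s * x"
    have y: "s \<le> y" "y \<le> 3 * s" using x s mult_left_le[of x s] by (auto simp: y_def)
    have lp: "linepath a b x = of_real y"
      by (simp add: linepath_def a_def b_def y_def complex_eq_iff algebra_simps)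
    have "f (linepath a b x) * (b - a) = F (of_real y) * of_real ((y - s) * (3 * s - y) * (2 * s))"
      unfolding f_def lp by (simp add: a_def b_def algebra_simps)
    hence "Im (f (linepath a b x) * (b - a)) = Im (F (of_real y)) * ((y - s) * (3 * s - y) * (2 * s))"
      by (simp only: times_complex.sel Re_complex_of_real Im_complex_of_real)
    also have "(y - s) * (3 * s - y) * (2 * s) = 8 * s ^ 3 * (x - x\<^sup>2)"
      by (simp add: y_def power2_eq_square power3_eq_cube algebra_simps)
    also have "Im (F (of_real y)) * (8 * s ^ 3 * (x - x\<^sup>2)) \<ge> d / (27 * s ^ 3) * (8 * s ^ 3 * (x - x\<^sup>2))"
    proof (rule mult_right_mono)
      have "d / (27 * s ^ 3) = d / (3 * s) ^ 3" by (simp add: power_mult_distrib)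
      also have "\<dots> \<le> d / y ^ 3" using y s d by (intro divide_left_mono power_mono) auto
      also have "\<dots> \<le> Im (F (of_real y))" using y by (rule low)
      finally show "d / (27 * s ^ 3) \<le> Im (F (of_real y))" .
      have "x\<^sup>2 \<le> x" using x by (simp add: power2_eq_square mult_left_le)
      thus "0 \<le> 8 * s ^ 3 * (x - x\<^sup>2)" using s by simp
    qed
    also have "d / (27 * s ^ 3) * (8 * s ^ 3 * (x - x\<^sup>2)) = 8 * d / 27 * (x - x\<^sup>2)" using s by simp
    finally show "8 * d / 27 * (x - x\<^sup>2) \<le> Im (f (linepath a b x) * (b - a))" .
  qed
  have "Im (contour_integral (linepath a b) f) = - (Im (contour_integral (linepath b p) f) + Im (contour_integral (linepath p a) f))"
    using arg_cong[OF zero, of Im] by simp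
  also have "\<dots> \<le> 12 * C * s + 12 * C * s"
    using I2 I3 abs_Im_le_cmod[of "contour_integral (linepath b p) f"] abs_Im_le_cmod[of "contour_integral (linepath p a) f"]
    by linarith
  finally show ?thesis using I1 by simp
qed

lemma edge_pole_order_le_1:
  assumes sp: "is_spectral_measure J \<mu>" and z0: "z0 = 1 \<or> z0 = -1" and L: "L \<noteq> 0"
    and lim: "((\<lambda>z. (z - z0) ^ k *\<^sub>m matrix_inv (jost J z)) \<longlongrightarrow> L) (at z0 within cball 0 1 - {1, -1})"
  shows "k \<le> 1"
proof (rule ccontr)
  assume "\<not> k \<le> 1"
  hence k: "k \<ge> 2" by simp
  have "adj L \<noteq> 0" using L by (metis adj_simps(1,6))
  then obtain v where v: "adj L *v v \<noteq> 0" by (metis matrix_eq matrix_vector_mult_0)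
  define c where "c = norm (adj L *v v) / 2"
  have c: "c > 0" using v by (simp add: c_def)
  have "((\<lambda>z. norm (adj ((z - z0) ^ k *\<^sub>m matrix_inv (jost J z)) *v v)) \<longlongrightarrow> norm (adj L *v v)) (at z0 within cball 0 1 - {1, -1})"
    by (intro tendsto_intros lim)
  moreover have "c < norm (adj L *v v)" using c by (simp add: c_def)
  ultimately have "\<forall>\<^sub>F z in at z0 within cball 0 1 - {1, -1}. c < norm (adj ((z - z0) ^ k *\<^sub>m matrix_inv (jost J z)) *v v)"
    by (rule order_tendstoD)
  then obtain r where r: "r > 0" "\<And>z. z \<in> cball 0 1 - {1, -1} \<Longrightarrow> z \<noteq> z0 \<Longrightarrow> dist z z0 < r \<Longrightarrow>
      c < norm (adj ((z - z0) ^ k *\<^sub>m matrix_inv (jost J z)) *v v)"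
    unfolding eventually_at by blast
  obtain C where C: "C \<ge> 0" "\<forall>E. Im E \<noteq> 0 \<longrightarrow> cmod (cinner v (m_fun J E *v v)) \<le> C / \<bar>Im E\<bar>"
    by (rule m_fun_form_bound[OF sp])
  \<comment> \<open>On the arc Im z = z0 * sin x, so the factor z0 makes Im F nonnegative at both
    edges.\<close>
  define F where "F \<tau> = z0 * cinner v (Mx (z0 * exp (\<i> * \<tau>)) *v v)" for \<tau>
  have cz0: "cmod z0 = 1" "z0 * z0 = 1" "cnj z0 = z0" using z0 by auto
  note sec = upper_sector_invertible[OF z0]
  have cont: "continuous_on {\<tau>. 0 < Re \<tau> \<and> Re \<tau> < 1 \<and> 0 \<le> Im \<tau>} F"
  proof -
    have "continuous_on {\<tau>. 0 < Re \<tau> \<and> Re \<tau> < 1 \<and> 0 \<le> Im \<tau>} (\<lambda>\<tau>. Mx (z0 * exp (\<i> * \<tau>)))"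
      by (rule continuous_on_compose2[OF Mx_continuous]) (use sec(1,2) in \<open>auto intro!: continuous_intros\<close>)
    thus ?thesis unfolding F_def by (intro continuous_intros)
  qed
  have holo: "F holomorphic_on {\<tau>. 0 < Re \<tau> \<and> Re \<tau> < 1 \<and> 0 < Im \<tau>}"
  proof -
    have "(\<lambda>\<tau>. Mx (z0 * exp (\<i> * \<tau>)) $ i $ j) holomorphic_on {\<tau>. 0 < Re \<tau> \<and> Re \<tau> < 1 \<and> 0 < Im \<tau>}" for i j
    proof -
      have "((\<lambda>z. Mx z $ i $ j) \<circ> (\<lambda>\<tau>. z0 * exp (\<i> * \<tau>))) holomorphic_on {\<tau>. 0 < Re \<tau> \<and> Re \<tau> < 1 \<and> 0 < Im \<tau>}"
        using Mx_holo sec(2,3) unfolding mat_holo_def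
        by (intro holomorphic_on_compose_gen[where t = "{z \<in> ball 0 1. invertible (jost J z)}"])
           (auto intro!: holomorphic_intros)
      thus ?thesis by (simp add: o_def)
    qed
    thus ?thesis unfolding F_def cinner_def matrix_vector_mult_def by (simp, intro holomorphic_intros)
  qed
  have up: "cmod (F \<tau>) \<le> C / (Re \<tau> * Im \<tau>)" if \<tau>: "0 < Re \<tau>" "Re \<tau> < 1" "0 < Im \<tau>" for \<tau>
  proof -
    define z where "z = z0 * exp (\<i> * \<tau>)"
    have z: "cmod z < 1" "invertible (jost J z)" "\<bar>Im (z + inverse z)\<bar> \<ge> Re \<tau> * Im \<tau>"
      using sec[OF \<tau>(1,2)] \<tau>(3) unfolding z_def by auto
    have "Re \<tau> * Im \<tau> > 0" using \<tau> by simp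
    hence I: "Im (z + inverse z) \<noteq> 0" using z(3) by auto
    have "z \<noteq> 0" using z0 by (auto simp: z_def)
    hence "Mx z = - m_fun J (z + inverse z)"
      using M_fun_eq(1)[OF z(1,2)] by (simp add: Mx_def M_fun_def)
    hence "cmod (F \<tau>) = cmod (cinner v (m_fun J (z + inverse z) *v v))"
      using cz0 by (simp add: F_def z_def[symmetric] norm_mult cinner_simps)
    also have "\<dots> \<le> C / \<bar>Im (z + inverse z)\<bar>" using C(2) I by blast
    also have "\<dots> \<le> C / (Re \<tau> * Im \<tau>)" 
    proof (rule divide_left_mono[OF z(3) C(1) mult_pos_pos[OF _ \<open>Re \<tau> * Im \<tau> > 0\<close>]])
      show "\<bar>Im (z + inverse z)\<bar> > 0" using I by (simp only: zero_less_abs_iff not_False_eq_True)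
    qed
    finally show ?thesis .
  qed
  \<comment> \<open>As k is at least 2, the adjoint of u^-1 maps v to a vector of norm greater than
    c / x^2. Squaring and multiplying by sin x, which is at least x / 2, gives the order
    x^-3.\<close>
  have low: "c\<^sup>2 / 2 / x ^ 3 \<le> Im (F (of_real x))" if x: "0 < x" "x < 1" "x < r" for x
  proof -
    define z where "z = z0 * exp (\<i> * of_real x)"
    have zz: "z \<in> cball 0 1 - {1, -1}" "invertible (jost J z)"
      using sec[of "of_real x"] x unfolding z_def by auto
    have z1: "cmod z = 1" using z0 by (auto simp: z_def norm_mult)
    have Imz: "z0 * of_real (Im z) = of_real (sin x)" using z0 by (auto simp: z_def Im_exp)
    have dist: "cmod (z - z0) \<le> x"
    proof -
      have "z - z0 = z0 * (exp (\<i> * of_real x) - 1)" by (simp add: z_def algebra_simps)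
      hence "cmod (z - z0) = cmod (cis x - 1)" using cz0 by (simp add: norm_mult cis_conv_exp)
      also have "\<dots> \<le> \<bar>x\<bar>" by (rule norm_cis_minus_1_le)
      finally show ?thesis using x by simp
    qed
    define y where "y = adj (matrix_inv (jost J z)) *v v"
    have zne: "z \<noteq> z0" using zz z0 by auto
    have "c < cmod (z - z0) ^ k * norm y"
      using r(2)[OF zz(1) zne] dist x
      by (simp add: dist_norm y_def norm_mult norm_power del: complex_cnj_diff complex_cnj_power)
    also have "\<dots> \<le> x ^ 2 * norm y"
    proof (rule mult_right_mono)
      have "cmod (z - z0) ^ k \<le> x ^ k" using dist by (intro power_mono) auto
      also have "\<dots> \<le> x ^ 2" using k x by (intro power_decreasing) auto
      finally show "cmod (z - z0) ^ k \<le> x ^ 2" .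
    qed simp
    finally have cy: "c < x ^ 2 * norm y" .
    have "F (of_real x) = z0 * cinner v (Mx z *v v)" by (simp add: F_def z_def)
    moreover have "Im (z0 * cinner v (Mx z *v v)) = sin x * (norm y)\<^sup>2"
    proof -
      define q where "q = cinner v (Mx z *v v)"
      have "cinner v (Im_mat (Mx z) *v v) = 1 / (2 * \<i>) * (q - cnj q)"
      proof -
        have "cinner v (adj (Mx z) *v v) = cnj q"
          unfolding q_def by (subst cinner_mat_right, simp) (rule cinner_commute)
        thus ?thesis
          unfolding Im_mat_def smult_mat_vec matrix_vector_mult_diff_rdistrib cinner_simps q_def[symmetric] by simp
      qed
      also have "\<dots> = of_real (Im q)" by (simp add: complex_diff_cnj field_simps)
      finally have "of_real (Im q) = cinner v (Im_mat (Mx z) *v v)" by simp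
      also have "Im_mat (Mx z) = of_real (Im z) *\<^sub>m matrix_inv (adj (jost J z) ** jost J z)"
        by (rule circle_Im) (use z1 zz in auto)
      also have "matrix_inv (adj (jost J z) ** jost J z) = matrix_inv (jost J z) ** adj (matrix_inv (jost J z))"
        using zz(2) by (simp add: matrix_inv_mat_mult adj_matrix_inv)
      also have "cinner v ((of_real (Im z) *\<^sub>m (matrix_inv (jost J z) ** adj (matrix_inv (jost J z)))) *v v)
          = of_real (Im z) * cinner y y"
        by (simp add: cinner_simps matrix_vector_mul_assoc[symmetric] cinner_mat_right[of v] y_def)
      finally have "of_real (Im q) = of_real (Im z) * cinner y y" .
      hence "z0 * of_real (Im q) = of_real (sin x) * cinner y y"
        by (simp only: Imz[symmetric] mult.assoc)
      hence "z0 * of_real (Im q) = of_real (sin x * (norm y)\<^sup>2)" by (simp add: cinner_self)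
      hence "Re (z0 * of_real (Im q)) = sin x * (norm y)\<^sup>2" by (simp only: Re_complex_of_real)
      moreover have "Im (z0 * q) = Re (z0 * of_real (Im q))" using z0 by auto
      ultimately show ?thesis by (simp add: q_def)
    qed
    moreover have "c\<^sup>2 / 2 / x ^ 3 \<le> sin x * (norm y)\<^sup>2"
    proof -
      have "c\<^sup>2 \<le> (x ^ 2 * norm y)\<^sup>2" using cy c by (intro power_mono) auto
      hence "c\<^sup>2 / 2 / x ^ 3 \<le> (x ^ 2 * norm y)\<^sup>2 / 2 / x ^ 3" using x by (intro divide_right_mono) auto
      also have "\<dots> = x / 2 * (norm y)\<^sup>2"
        using x by (simp add: power_mult_distrib power2_eq_square power3_eq_cube field_simps)
      also have "\<dots> \<le> sin x * (norm y)\<^sup>2" using sin_x_ge_half[of x] x by (intro mult_right_mono) auto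
      finally show ?thesis .
    qed
    ultimately show ?thesis by simp
  qed
  define d where "d = c\<^sup>2 / 2"
  have d: "d > 0" using c by (simp add: d_def)
  \<comment> \<open>The first two bounds keep the base [s, 3 s] inside the sector and within r; the
    third makes 24 * C * s at most d / 81, against the lower bound 4 * d / 81.\<close>
  define s where "s = min (1 / 6) (min (r / 6) (d / (81 * (24 * C + 1))))"
  have C1: "24 * C + 1 > 0" using C(1) by simp
  have "0 < s" using r(1) d C1 by (simp add: s_def)
  moreover have "s \<le> 1 / 6" "s \<le> r / 6" and s_le: "s \<le> d / (81 * (24 * C + 1))"
    unfolding s_def by (blast intro: min.cobounded1 min.cobounded2 min.coboundedI2)+
  ultimately have s: "0 < s" "3 * s < 1" "3 * s < r" "s \<le> d / (81 * (24 * C + 1))"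
    using r(1) by linarith+
  have "4 * d / 81 \<le> 24 * C * s"
  proof (rule edge_triangle_estimate[OF s(1,2) d C(1) cont holo up])
    fix x assume "s \<le> x" "x \<le> 3 * s"
    thus "d / x ^ 3 \<le> Im (F (of_real x))" unfolding d_def using s by (intro low) auto
  qed
  also have "\<dots> \<le> (24 * C + 1) * s" using s by simp
  also have "\<dots> \<le> (24 * C + 1) * (d / (81 * (24 * C + 1)))" using s(4) C1 by (intro mult_left_mono) auto
  also have "\<dots> = d / 81" using C1 by (simp add: field_simps)
  finally show False using d by simp
qed

end

section \<open>Zeros of the Jost function and the reflection identity\<close>

lemma ran_mat_smult:
  assumes "c \<noteq> 0"
  shows "ran_mat (c *\<^sub>m X) = ran_mat (X :: complex^'n^'m)"
proof -
  have "c *s (X *v v) = X *v (c *s v)" "X *v v = c *s (X *v (inverse c *s v))" for v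
    using assms by (simp_all add: vector_smult_assoc)
  thus ?thesis unfolding ran_mat_def smult_mat_vec by (metis (mono_tags, lifting) image_cong image_iff rangeI subsetI subset_antisym)
qed

lemma square_neq_1_in_disk:
  assumes "cmod z < 1"
  shows "z * z \<noteq> 1"
proof
  assume "z * z = 1"
  hence "cmod z * cmod z = 1" by (metis norm_mult norm_one)
  thus False using assms abs_square_less_1[of "cmod z"] by (simp add: power2_eq_square)
qed

lemma meromorphic_on_matrix_inv_nth:
  fixes F :: "complex \<Rightarrow> complex^'n^'n"
  assumes F: "mat_holo F V" and V: "open V"
    and inv: "\<And>z. z \<in> V \<Longrightarrow> \<forall>\<^sub>F \<zeta> in at z. invertible (F \<zeta>)"
  shows "(\<lambda>z. matrix_inv (F z) $ i $ j) meromorphic_on V"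
proof -
  define G where "G z = (\<chi> a m. if m = i then (axis j 1 :: complex^'n) $ a else F z $ a $ m)" for z
  have "mat_holo G V"
    unfolding mat_holo_def
  proof (intro allI)
    fix a m
    show "(\<lambda>z. G z $ a $ m) holomorphic_on V"
      using F by (cases "m = i") (auto simp: G_def mat_holo_def)
  qed
  hence "(\<lambda>z. det (G z)) analytic_on V" "(\<lambda>z. det (F z)) analytic_on V"
    using F V by (simp_all add: analytic_on_open mat_holo_det)
  hence "(\<lambda>z. det (G z) / det (F z)) meromorphic_on V"
    by (intro meromorphic_on_divide analytic_on_imp_meromorphic_on)
  moreover have "\<forall>\<^sub>F \<zeta> in at z. matrix_inv (F \<zeta>) $ i $ j = det (G \<zeta>) / det (F \<zeta>)" if "z \<in> V" for z
    using inv[OF that] by eventually_elim (simp add: matrix_inv_nth G_def)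
  hence "(\<lambda>z. matrix_inv (F z) $ i $ j) meromorphic_on V \<longleftrightarrow> (\<lambda>z. det (G z) / det (F z)) meromorphic_on V"
    by (intro meromorphic_on_cong) auto
  ultimately show ?thesis by simp
qed

lemma tendsto_reflection:
  assumes "z \<noteq> 0"
  shows "((\<lambda>\<zeta>. inverse (cnj \<zeta>)) \<longlongrightarrow> inverse (cnj z)) (at z)"
  by (intro tendsto_intros) (use assms in auto)

text \<open>Reflection respects punctured neighbourhoods, so what holds near the reflected point can
  be used near z.\<close>

lemma filterlim_reflection:
  assumes "z \<noteq> 0"
  shows "filterlim (\<lambda>\<zeta>. inverse (cnj \<zeta>)) (at (inverse (cnj z))) (at z)"
proof (rule filterlim_atI[OF tendsto_reflection[OF assms]])
  have "\<forall>\<^sub>F \<zeta> in at z. \<zeta> \<noteq> z" by (rule eventually_neq_at_within)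
  thus "\<forall>\<^sub>F \<zeta> in at z. inverse (cnj \<zeta>) \<noteq> inverse (cnj z)"
    by eventually_elim simp
qed

section \<open>Local behaviour at zeros, residues and reflection\<close>

context jacobi_asymptotic
begin

lemma ball_subset_region: "appropriate_region J S \<Longrightarrow> ball 0 1 \<subseteq> S"
  using region_contains by force

lemma at_within_region:
  assumes "appropriate_region J S" "cmod z < 1"
  shows "at z within S = at z"
  using ball_subset_region[OF assms(1)] assms(2)
  by (metis at_within_open_subset centre_in_ball dist_0_norm mem_ball open_ball)

lemma at_within_region_nonbot:
  assumes "appropriate_region J S" "cmod z \<le> 1"
  shows "at z within S \<noteq> bot"
proof -
  have "z islimpt ball 0 1" using assms(2) by (simp add: islimpt_ball)
  hence "z islimpt S" using ball_subset_region[OF assms(1)] islimpt_subset by blast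
  thus ?thesis by (simp add: trivial_limit_within)
qed

lemma eventually_punctured_disk:
  assumes "cmod z < 1"
  shows "\<forall>\<^sub>F \<zeta> in at z. invertible (jost J \<zeta>) \<and> cmod \<zeta> < 1 \<and> \<zeta> \<noteq> 0"
  using eventually_invertible_jost_ball[OF assms] eventually_neq_at_within[of 0 z UNIV]
  by eventually_elim simp

lemma eventually_near_0: "\<forall>\<^sub>F \<zeta> :: complex in at 0. cmod \<zeta> < 1 \<and> \<zeta> \<noteq> 0"
  using eventually_punctured_disk[of 0] by (auto elim: eventually_mono)

lemma jost_tendsto_ball:
  assumes "cmod z < 1"
  shows "(jost (jshift k J) \<longlongrightarrow> jost (jshift k J) z) (at z)"
proof -
  have "continuous_on (ball 0 1) (jost (jshift k J))"
    using region_continuous[OF region_A1] by (rule continuous_on_subset) auto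
  thus ?thesis using assms by (simp add: continuous_on_eq_continuous_at isCont_def)
qed

lemma recurrence_limit:
  assumes "appropriate_region J S" "n \<ge> 1"
  defines "E \<equiv> \<lambda>z. u (n + 1) z ** adj (Apar J n) + u n z ** (Bpar J n - (z + inverse z) *\<^sub>m mat 1)
      + u (n - 1) z ** Apar J (n - 1)"
  shows "(\<forall>z\<in>S - {0}. E z = 0) \<and> (E \<longlongrightarrow> 0) (at 0)"
proof -
  obtain m where n: "n = Suc m" using assms(2) by (cases n) auto
  have E: "E z = 0" if "regular z" "z \<noteq> 0" for z
    using u_recurrence[OF that, of m] unfolding E_def n by simp
  have "\<forall>\<^sub>F z in at 0. E z = 0"
    using eventually_near_0 by eventually_elim (simp add: E regular_ball)
  thus ?thesis using E region_regular[OF assms(1)] by (auto intro: tendsto_eventually)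
qed

lemma scaled_limit:
  assumes "regular z"
  shows "(\<lambda>n. if z = 0 then w n 0 else inverse z ^ n *\<^sub>m u n z) \<longlonglongrightarrow> mat 1"
proof -
  have "(if z = 0 then w n 0 else inverse z ^ n *\<^sub>m u n z) = w n z" for n
    by (simp add: jost_sol_def flip: power_mult_distrib)
  thus ?thesis using w_tendsto[OF assms] by simp
qed

lemma jost_shift_1:
  assumes "cmod z < 1" "invertible (jost J z)" "z \<noteq> 0"
  shows "jost (jshift 1 J) z = inverse z *\<^sub>m (jost J z ** M_fun J z ** Apar J 1)"
  using assms w_mult_A[of 1 z] by (simp add: M_fun_eq(2) jost_sol_def)

lemma jost_shift_1_limit:
  assumes "cmod z < 1"
  shows "((\<lambda>\<zeta>. inverse \<zeta> *\<^sub>m (jost J \<zeta> ** M_fun J \<zeta> ** Apar J 1)) \<longlongrightarrow> jost (jshift 1 J) z) (at z)"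
proof (rule Lim_transform_eventually[OF jost_tendsto_ball[OF assms]])
  show "\<forall>\<^sub>F \<zeta> in at z. jost (jshift 1 J) \<zeta> = inverse \<zeta> *\<^sub>m (jost J \<zeta> ** M_fun J \<zeta> ** Apar J 1)"
    using eventually_punctured_disk[OF assms] by eventually_elim (rule jost_shift_1; simp)
qed

lemma zero_mat_interior:
  assumes S: "appropriate_region J S" and z: "cmod z < 1"
  shows "zero_mat S (jost J) z \<longleftrightarrow> \<not> invertible (jost J z)"
    and "zero_mat S (jost J) z \<Longrightarrow> simple_zero_mat S (jost J) z"
proof -
  have inv: "\<not> zero_mat S (jost J) z" if "invertible (jost J z)"
    using that S z ball_subset_region[OF S]
    by (intro not_zero_mat_invertible at_within_region_nonbot jost_tendsto) auto
  have sing: "simple_zero_mat S (jost J) z" if s: "\<not> invertible (jost J z)"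
  proof -
    obtain k where "simple_zero (jost J) (ball 0 1) z k" using simple_zero_interior[OF z s] by blast
    hence "pole_of_order (ball 0 1) (\<lambda>z. matrix_inv (jost J z)) z 1"
      using simple_zero.pole_of_order_1 s by blast
    moreover have "at z within ball 0 1 = at z" by (rule at_within_open) (use z in auto)
    ultimately show ?thesis
      by (simp add: simple_zero_mat_def pole_of_order_def pole_limit_def at_within_region[OF S z])
  qed
  show "zero_mat S (jost J) z \<longleftrightarrow> \<not> invertible (jost J z)"
    using inv sing unfolding zero_mat_def simple_zero_mat_def by blast
  thus "zero_mat S (jost J) z \<Longrightarrow> simple_zero_mat S (jost J) z" using sing by simp
qed

text \<open>L annihilates the range of u(z0), and u + i u_1 is invertible at z0. Hence every value
  of L is already a value of L ** u 1 z0, so M and the inverse of u have residues with the same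
  range.\<close>

lemma singular_point:
  assumes z0: "cmod z0 < 1" and sing: "\<not> invertible (jost J z0)"
  obtains L where "((\<lambda>z. (z - z0) *\<^sub>m matrix_inv (jost J z)) \<longlongrightarrow> L) (at z0)"
    "ran_mat L = ker_mat (jost J z0)" "ker_mat L = ran_mat (jost J z0)"
    "((\<lambda>z. (z - z0) *\<^sub>m M_fun J z) \<longlongrightarrow> L ** u 1 z0) (at z0)" "w_tilde J z0 = - (L ** u 1 z0)"
    "ran_mat (L ** u 1 z0) = ker_mat (jost J z0)"
proof -
  obtain k where "simple_zero (jost J) (ball 0 1) z0 k" using simple_zero_interior[OF assms] by blast
  then interpret simple_zero "jost J" "ball 0 1" z0 k .
  obtain L where "((\<lambda>z. (z - z0) *\<^sub>m matrix_inv (jost J z)) \<longlongrightarrow> L) (at z0 within ball 0 1)"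
    and ran: "ran_mat L = ker_mat (jost J z0)" and ker: "ker_mat L = ran_mat (jost J z0)"
    by (rule inverse_limit)
  moreover have "at z0 within ball 0 1 = at z0" by (rule at_within_open) (use z0 in auto)
  ultimately have L: "((\<lambda>z. (z - z0) *\<^sub>m matrix_inv (jost J z)) \<longlongrightarrow> L) (at z0)" by simp
  have cu: "(u 1 \<longlongrightarrow> u 1 z0) (at z0)"
    unfolding jost_sol_def jost_sol_scaled_def by (intro tendsto_intros jost_tendsto_ball z0)
  have M_lim: "((\<lambda>z. (z - z0) *\<^sub>m M_fun J z) \<longlongrightarrow> L ** u 1 z0) (at z0)"
  proof (rule Lim_transform_eventually)
    show "((\<lambda>z. ((z - z0) *\<^sub>m matrix_inv (jost J z)) ** u 1 z) \<longlongrightarrow> L ** u 1 z0) (at z0)"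
      by (intro tendsto_intros L cu)
    show "\<forall>\<^sub>F z in at z0. ((z - z0) *\<^sub>m matrix_inv (jost J z)) ** u 1 z = (z - z0) *\<^sub>m M_fun J z"
      using eventually_punctured_disk[OF z0] by eventually_elim (simp add: M_fun_eq(1))
  qed
  hence wt: "w_tilde J z0 = - (L ** u 1 z0)"
    unfolding w_tilde_def by (simp add: tendsto_Lim)
  have "ran_mat (L ** u 1 z0) = ran_mat L"
  proof
    show "ran_mat (L ** u 1 z0) \<subseteq> ran_mat L"
      by (auto simp: ran_mat_def simp flip: matrix_vector_mul_assoc)
    show "ran_mat L \<subseteq> ran_mat (L ** u 1 z0)"
    proof
      fix y assume "y \<in> ran_mat L"
      then obtain x where x: "y = L *v x" by (auto simp: ran_mat_def)
      let ?T = "jost J z0 + \<i> *\<^sub>m u 1 z0"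
      have r: "regular z0" "z0 \<noteq> 0" "z0 \<in> \<real>" "cmod z0 \<le> 1"
        using z0 singular_imp_real[OF z0 sing] regular_ball by auto
      define t where "t = matrix_inv ?T *v x"
      have "x = ?T *v t" unfolding t_def using real_kernel_vector(1)[OF r] by simp
      hence x': "x = jost J z0 *v t + u 1 z0 *v (\<i> *s t)" by (simp add: matrix_vector_mult_add_rdistrib)
      have "jost J z0 *v t \<in> ker_mat L" unfolding ker by (auto simp: ran_mat_def)
      hence "y = (L ** u 1 z0) *v (\<i> *s t)"
        unfolding x x' by (simp add: ker_mat_def matrix_vector_right_distrib matrix_vector_mul_assoc)
      thus "y \<in> ran_mat (L ** u 1 z0)" unfolding ran_mat_def by (rule range_eqI)
    qed
  qed
  thus ?thesis using that[OF L ran ker M_lim wt] ran by simp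
qed

lemma eigen_point_facts:
  assumes sp: "is_spectral_measure J \<mu>" and z: "z \<in> eigen_points J"
  shows "zorder (\<lambda>w. det (jost J w)) z = int (eigen_multiplicity J (z + inverse z))"
    "ker_mat (jost J z) = ran_mat (\<mu> {Re (z + inverse z)})"
    "ker_mat (jost J z) = ran_mat (w_tilde J z)"
proof -
  have z1: "cmod z < 1" and sing: "\<not> invertible (jost J z)" using z eigen_points_eq by auto
  note real = singular_imp_real[OF z1 sing]
  obtain k where "simple_zero (jost J) (ball 0 1) z k" using simple_zero_interior[OF z1 sing] by blast
  thus "zorder (\<lambda>w. det (jost J w)) z = int (eigen_multiplicity J (z + inverse z))"
    using simple_zero.zorder_det[of "jost J" "ball 0 1" z k] jost_holo_ball z1 eigenspace_dim(1)[OF z1 real(2)]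
    by simp
  obtain L where L: "((\<lambda>z'. (z' - z) *\<^sub>m M_fun J z') \<longlongrightarrow> L ** u 1 z) (at z)" "w_tilde J z = - (L ** u 1 z)"
    "ran_mat (L ** u 1 z) = ker_mat (jost J z)"
    by (rule singular_point[OF z1 sing])
  have "w_tilde J z = (-1) *\<^sub>m (L ** u 1 z)" using L(2) by (simp add: smult_mat_minus_left)
  thus "ker_mat (jost J z) = ran_mat (w_tilde J z)" using L(3) ran_mat_smult[of "-1" "L ** u 1 z"] by simp
  \<comment> \<open>The point mass is this nonzero multiple of the limit that defines
    \<open>w_tilde\<close>, up to sign, so the ranges agree.\<close>
  have "1 - inverse (z * z) \<noteq> 0"
    using square_neq_1_in_disk[OF z1] real(2) by (simp add: field_simps)
  thus "ker_mat (jost J z) = ran_mat (\<mu> {Re (z + inverse z)})"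
    unfolding point_mass_residue[OF sp real z1 L(1)] using L(3) by (simp add: ran_mat_smult)
qed

text \<open>An edge point in S brings a moment or decay condition and hence the Green argument. If
  it is missing from S, only summability is at hand and the Herglotz bound limits the pole
  order.\<close>

lemma zero_mat_circle:
  assumes S: "appropriate_region J S" and sp: "is_spectral_measure J \<mu>" and z: "cmod z = 1"
    and zero: "zero_mat S (jost J) z \<or> (z \<in> S \<and> \<not> invertible (jost J z))"
  shows "(z = 1 \<or> z = -1) \<and> simple_zero_mat S (jost J) z"
proof -
  have inv: "\<not> invertible (jost J z)" if "z \<in> S"
    using zero that not_zero_mat_invertible[OF at_within_region_nonbot[OF S] jost_tendsto[OF S]] z by auto
  have edge: "z = 1 \<or> z = -1"
  proof (rule ccontr)
    assume "\<not> (z = 1 \<or> z = -1)"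
    hence "z \<noteq> 1" "z \<noteq> -1" by auto
    moreover from this have "z \<in> S" using region_contains[OF S] z by auto
    ultimately show False using inv circle_invertible(1)[OF z] by blast
  qed
  show ?thesis
  proof (cases "z \<in> S")
    case True
    then obtain R where "cond_A2 J \<and> S = cball 0 1 \<or> cond_A3 J R \<and> S = ball 0 R"
      using S edge unfolding appropriate_region_def by auto
    thus ?thesis using simple_zero_mat_edge[OF edge] inv[OF True] edge by blast
  next
    case False
    hence S_eq: "S = cball 0 1 - {1, -1}"
      using S z unfolding appropriate_region_def cond_A3_def by auto
    obtain k where k: "pole_of_order S (\<lambda>z. matrix_inv (jost J z)) z k"
      using zero False unfolding zero_mat_def by auto
    then obtain L where L: "L \<noteq> 0" "k > 0"
      "((\<lambda>z'. (z' - z) ^ k *\<^sub>m matrix_inv (jost J z')) \<longlongrightarrow> L) (at z within cball 0 1 - {1, -1})"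
      unfolding pole_of_order_def pole_limit_def S_eq by auto
    have "k = 1" using edge_pole_order_le_1[OF sp edge L(1,3)] L(2) by simp
    thus ?thesis using k edge by (simp add: simple_zero_mat_def)
  qed
qed

lemma Mx_boundary:
  "continuous_on (M_dom J \<union> (sphere 0 1 - {1, -1})) Mx"
  "z \<in> M_dom J \<Longrightarrow> Mx z = M_fun J z"
  "z \<in> sphere 0 1 - {1, -1} \<Longrightarrow> invertible (Mx z)"
proof -
  show "continuous_on (M_dom J \<union> (sphere 0 1 - {1, -1})) Mx"
    using Mx_continuous by (rule continuous_on_subset) (auto simp: M_dom_iff circle_invertible(1))
  show "z \<in> M_dom J \<Longrightarrow> Mx z = M_fun J z" by (simp add: M_dom_iff M_fun_eq(1) Mx_def)
  show "z \<in> sphere 0 1 - {1, -1} \<Longrightarrow> invertible (Mx z)"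
    using circle_invertible[of z] by (simp add: Mx_def invertible_mat_mult_iff invertible_matrix_inv)
qed

lemma jost_shift_2:
  assumes "regular z" "z \<noteq> 0"
  shows "jost (jshift 2 J) z =
    inverse z *\<^sub>m (jost (jshift 1 J) z ** matrix_inv (Apar J 1)
      ** ((z + inverse z) *\<^sub>m mat 1 - Bpar J 1) ** matrix_inv (adj (Apar J 1)) ** Apar J 2)
    - inverse (z\<^sup>2) *\<^sub>m (jost J z ** matrix_inv (adj (Apar J 1)) ** Apar J 2)"
proof -
  define K where "K = z *\<^sub>m ((z + inverse z) *\<^sub>m mat 1 - Bpar J 1)"
  have K: "(1 + z\<^sup>2) *\<^sub>m mat 1 - z *\<^sub>m Bpar J 1 = K"
    unfolding K_def using assms(2) by (simp add: smult_mat_diff_right power2_eq_square algebra_simps)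
  have K': "(z + inverse z) *\<^sub>m mat 1 - Bpar J 1 = inverse z *\<^sub>m K"
    unfolding K_def using assms(2) by simp
  have w1: "jost (jshift 1 J) z ** matrix_inv (Apar J 1) = w 1 z" by (simp add: jost_sol_scaled_def)
  have A2: "w 2 z ** Apar J 2 = jost (jshift 2 J) z" by (rule w_mult_A)
  have rec: "jost J z = w 1 z ** K - z\<^sup>2 *\<^sub>m (w 2 z ** adj (Apar J 1))"
    using w_recurrence[OF assms(1), of 0] K by (simp add: Apar_0 w_0 flip: numeral_2_eq_2)
  have inv: "invertible (adj (Apar J 1))" by simp
  have "jost J z ** matrix_inv (adj (Apar J 1)) ** Apar J 2
      = w 1 z ** K ** matrix_inv (adj (Apar J 1)) ** Apar J 2 - z\<^sup>2 *\<^sub>m jost (jshift 2 J) z"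
    unfolding rec using A2 matrix_inv_cancel(1)[OF inv] by (simp add: matrix_diff_rdistrib)
  moreover have "inverse (z\<^sup>2) * z\<^sup>2 = 1" using assms(2) by simp
  ultimately show ?thesis
    unfolding w1 K' by (simp add: smult_mat_diff_right power2_eq_square)
qed

lemma region_A3: "cond_A3 J R \<Longrightarrow> appropriate_region J (ball 0 R)"
  by (auto simp: appropriate_region_def)

lemma jost_holo_A3: "cond_A3 J R \<Longrightarrow> mat_holo (jost (jshift k J)) (ball 0 R)"
  using region_holo[OF region_A3] by simp

lemma jost_holo_A3_0: "cond_A3 J R \<Longrightarrow> mat_holo (jost J) (ball 0 R)"
  using jost_holo_A3[of R 0] by (simp add: jshift_0[OF jacobi])

lemma eventually_invertible_A3:
  assumes "cond_A3 J R" "cmod z < R"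
  shows "\<forall>\<^sub>F \<zeta> in at z. invertible (jost J \<zeta>)"
  using eventually_invertible_jost[of "ball 0 R" z] jost_holo_A3_0[OF assms(1)] assms
  by (simp add: cond_A3_def)

lemma Mx_meromorphic:
  assumes "cond_A3 J R"
  shows "(\<lambda>z. Mx z $ i $ j) meromorphic_on ball 0 R"
proof -
  have "mat_holo (\<lambda>z. u 1 z) (ball 0 R)"
    unfolding jost_sol_def jost_sol_scaled_def
    by (intro mat_holo_intros holomorphic_intros jost_holo_A3 assms)
  hence "(\<lambda>z. u 1 z $ k $ j) meromorphic_on ball 0 R" for k
    by (intro analytic_on_imp_meromorphic_on) (simp add: mat_holo_def analytic_on_open)
  moreover have "(\<lambda>z. matrix_inv (jost J z) $ i $ k) meromorphic_on ball 0 R" for k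
    using jost_holo_A3_0[OF assms] eventually_invertible_A3[OF assms]
    by (intro meromorphic_on_matrix_inv_nth) auto
  ultimately show ?thesis
    unfolding Mx_def matrix_matrix_mult_def by (simp add: meromorphic_on_sum meromorphic_on_mult)
qed

lemma annulus:
  assumes R: "cond_A3 J R" and z: "inverse R < cmod z" "cmod z < R"
  shows "z \<noteq> 0" "cmod (inverse (cnj z)) < R" "regular z" "regular (inverse (cnj z))"
proof -
  have R1: "R > 1" using R by (simp add: cond_A3_def)
  show z0: "z \<noteq> 0" using z(1) R1 by auto
  have "inverse (cmod z) < inverse (inverse R)"
    using z(1) R1 by (intro less_imp_inverse_less) auto
  thus r: "cmod (inverse (cnj z)) < R" by (simp add: norm_inverse)
  show "regular z" "regular (inverse (cnj z))"
    using region_regular[OF region_A3[OF R]] z(2) r by auto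
qed

lemma Mx_sharp:
  assumes R: "cond_A3 J R" and z: "inverse R < cmod z" "cmod z < R"
    and inv: "invertible (sharp (jost J) z ** jost J z)"
  shows "Mx z = sharp Mx z + (z - inverse z) *\<^sub>m matrix_inv (sharp (jost J) z ** jost J z)"
  using Mx_reflected[of z] annulus[OF R z] inv
  by (simp add: sharp_def invertible_mat_mult_iff)

lemma eventually_annulus:
  assumes "inverse R < cmod z" "cmod z < R"
  shows "\<forall>\<^sub>F \<zeta> in at z. inverse R < cmod \<zeta> \<and> cmod \<zeta> < R"
proof -
  have "((\<lambda>\<zeta>. cmod \<zeta>) \<longlongrightarrow> cmod z) (at z)" by (intro tendsto_intros)
  thus ?thesis using assms by (auto simp: eventually_conj_iff intro: order_tendstoD)
qed

text \<open>Zeros of det u are isolated both at z and at its reflection, so the identity holds on a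
  punctured neighbourhood even where a pole sits at z.\<close>

lemma eventually_Mx_sharp:
  assumes R: "cond_A3 J R" and z: "inverse R < cmod z" "cmod z < R"
  shows "\<forall>\<^sub>F \<zeta> in at z. invertible (sharp (jost J) \<zeta> ** jost J \<zeta>) \<and>
    Mx \<zeta> = sharp Mx \<zeta> + (\<zeta> - inverse \<zeta>) *\<^sub>m matrix_inv (sharp (jost J) \<zeta> ** jost J \<zeta>)"
proof -
  note a = annulus[OF R z]
  have "\<forall>\<^sub>F \<zeta> in at z. invertible (jost J (inverse (cnj \<zeta>)))"
    using filterlim_reflection[OF a(1)] eventually_invertible_A3[OF R a(2)]
    by (auto simp: filterlim_iff)
  with eventually_invertible_A3[OF R z(2)] eventually_annulus[OF z] show ?thesis
  proof eventually_elim
    case (elim \<zeta>)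
    hence i: "invertible (sharp (jost J) \<zeta> ** jost J \<zeta>)" by (simp add: sharp_def invertible_mat_mult_iff)
    with Mx_sharp[OF R _ _ i] elim show ?case by blast
  qed
qed

text \<open>Multiply the reflected Wronskian by (\<zeta> - z) times the inverse of u and let \<zeta>
  tend to z. The term with u_1 at the reflected point is regular and drops out; the limit L of
  (\<zeta> - z) times the inverse is the residue, as the pole is simple.\<close>

lemma residue_identities:
  assumes R: "cond_A3 J R" and z: "z \<in> eigen_points J" "inverse R < cmod z"
  defines "P \<equiv> residue_mat (\<lambda>w. matrix_inv (jost J w)) z"
  shows "w_tilde J z ** adj (jost J (inverse (cnj z))) = - (z - inverse z) *\<^sub>m P"
    "ker_mat (adj (jost J (inverse (cnj z)))) \<subseteq> ker_mat P"
    "ker_mat P = ran_mat (jost J z)"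
proof -
  have z1: "cmod z < 1" and sing: "\<not> invertible (jost J z)" using z eigen_points_eq by auto
  note real = singular_imp_real[OF z1 sing]
  have zR: "cmod z < R" using z1 R by (simp add: cond_A3_def)
  note a = annulus[OF R z(2) zR]
  let ?r = "inverse (cnj z)"
  obtain L where L: "((\<lambda>z'. (z' - z) *\<^sub>m matrix_inv (jost J z')) \<longlongrightarrow> L) (at z)"
    "ran_mat L = ker_mat (jost J z)" "ker_mat L = ran_mat (jost J z)"
    "((\<lambda>z'. (z' - z) *\<^sub>m M_fun J z') \<longlongrightarrow> L ** u 1 z) (at z)" "w_tilde J z = - (L ** u 1 z)"
    by (rule singular_point[OF z1 sing])
  obtain e where e: "e > 0" "\<And>x. x \<noteq> z \<Longrightarrow> dist x z < e \<Longrightarrow> invertible (jost J x) \<and> cmod x < 1"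
    using eventually_invertible_jost_ball[OF z1] unfolding eventually_at by auto
  have "mat_holo (\<lambda>x. matrix_inv (jost J x)) (ball z e - {z})"
  proof (rule mat_holo_matrix_inv)
    show "mat_holo (jost J) (ball z e - {z})"
      using e z1 by (intro mat_holo_subset[OF jost_holo_ball]) (force simp: dist_commute)
  qed (use e in \<open>auto simp: dist_commute\<close>)
  hence holo: "(\<lambda>x. matrix_inv (jost J x) $ i $ j) holomorphic_on ball z e - {z}" for i j
    by (simp add: mat_holo_def)
  have "residue (\<lambda>x. matrix_inv (jost J x) $ i $ j) z = L $ i $ j" for i j
    using e(1) mat_tendstoD[OF L(1), of i j]
    by (intro residue_simple'[OF open_ball _ holo]) (auto simp: mult.commute)
  hence P: "P = L" unfolding P_def residue_mat_def by (simp add: vec_eq_iff)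
  show "ker_mat P = ran_mat (jost J z)" using L(3) P by simp
  have cont: "isCont (jost (jshift k J)) ?r" for k
    using region_continuous[OF region_A3[OF R], of k] a(2)
    by (simp add: continuous_on_eq_continuous_at)
  have cj: "((\<lambda>\<zeta>. jost (jshift k J) (inverse (cnj \<zeta>))) \<longlongrightarrow> jost (jshift k J) ?r) (at z)" for k
    by (rule isCont_tendsto_compose[OF cont tendsto_reflection[OF a(1)]])
  have cu: "((\<lambda>\<zeta>. u 1 (inverse (cnj \<zeta>))) \<longlongrightarrow> u 1 ?r) (at z)"
    unfolding jost_sol_def jost_sol_scaled_def
    by (intro tendsto_intros cj tendsto_reflection a(1))
  have cj0: "((\<lambda>\<zeta>. jost J (inverse (cnj \<zeta>))) \<longlongrightarrow> jost J ?r) (at z)"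
    using cj[of 0] by (simp add: jshift_0[OF jacobi])
  have lhs: "((\<lambda>\<zeta>. (\<zeta> - z) *\<^sub>m adj (u 1 (inverse (cnj \<zeta>)))
      - ((\<zeta> - z) *\<^sub>m M_fun J \<zeta>) ** adj (jost J (inverse (cnj \<zeta>)))) \<longlongrightarrow>
      (z - z) *\<^sub>m adj (u 1 ?r) - (L ** u 1 z) ** adj (jost J ?r)) (at z)"
    by (intro tendsto_intros cu L(4) cj0)
  have rhs: "((\<lambda>\<zeta>. (inverse \<zeta> - \<zeta>) *\<^sub>m ((\<zeta> - z) *\<^sub>m matrix_inv (jost J \<zeta>))) \<longlongrightarrow>
      (inverse z - z) *\<^sub>m L) (at z)"
    by (intro tendsto_intros L(1) a(1))
  have "\<forall>\<^sub>F \<zeta> in at z. (\<zeta> - z) *\<^sub>m adj (u 1 (inverse (cnj \<zeta>)))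
      - ((\<zeta> - z) *\<^sub>m M_fun J \<zeta>) ** adj (jost J (inverse (cnj \<zeta>)))
      = (inverse \<zeta> - \<zeta>) *\<^sub>m ((\<zeta> - z) *\<^sub>m matrix_inv (jost J \<zeta>))"
    using eventually_punctured_disk[OF z1] eventually_annulus[OF z(2) zR]
  proof eventually_elim
    case (elim \<zeta>)
    note b = annulus[OF R, of \<zeta>]
    let ?i = "matrix_inv (jost J \<zeta>)" and ?s = "inverse (cnj \<zeta>)"
    have "?i ** (jost J \<zeta> ** adj (u 1 ?s) - u 1 \<zeta> ** adj (jost J ?s)) = ?i ** ((inverse \<zeta> - \<zeta>) *\<^sub>m mat 1)"
      using wronskian_reflected[of \<zeta>] b elim by simp
    hence "adj (u 1 ?s) - M_fun J \<zeta> ** adj (jost J ?s) = (inverse \<zeta> - \<zeta>) *\<^sub>m ?i"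
      using elim by (simp add: matrix_diff_ldistrib matrix_mul_assoc matrix_inv_mult M_fun_eq(1))
    hence "(\<zeta> - z) *\<^sub>m (adj (u 1 ?s) - M_fun J \<zeta> ** adj (jost J ?s)) = (\<zeta> - z) *\<^sub>m ((inverse \<zeta> - \<zeta>) *\<^sub>m ?i)"
      by simp
    thus ?case by (simp add: smult_mat_diff_right mult.commute)
  qed
  hence "(z - z) *\<^sub>m adj (u 1 ?r) - (L ** u 1 z) ** adj (jost J ?r) = (inverse z - z) *\<^sub>m L"
    using tendsto_unique[OF _ Lim_transform_eventually[OF lhs] rhs] by simp
  thus eq: "w_tilde J z ** adj (jost J ?r) = - (z - inverse z) *\<^sub>m P"
    by (simp add: L(5) P)
  have nz: "- (z - inverse z) \<noteq> 0"
    using square_neq_1_in_disk[OF z1] real(2) by (simp add: field_simps)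
  show "ker_mat (adj (jost J ?r)) \<subseteq> ker_mat P"
  proof
    fix v assume "v \<in> ker_mat (adj (jost J ?r))"
    hence "(w_tilde J z ** adj (jost J ?r)) *v v = 0"
      by (simp add: ker_mat_def flip: matrix_vector_mul_assoc)
    hence "- (z - inverse z) *s (P *v v) = 0" unfolding eq smult_mat_vec .
    thus "v \<in> ker_mat P" using nz unfolding ker_mat_def vector_mul_eq_0 by blast
  qed
qed

end

theorem theorem4p6:
  fixes J :: "'l::finite block_jacobi"
    and \<mu> :: "real set \<Rightarrow> complex^'l^'l"
    and S :: "complex set"
  assumes "is_block_jacobi J"
    and "asymptotic_to_type1 J"
    and "is_spectral_measure J \<mu>"
    and "appropriate_region J S"
  shows
    \<comment> \<open>(i)\<close>
    "(\<forall>n\<ge>1.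
        (\<forall>z\<in>S - {0}.
           jost_sol J (n + 1) z ** adj (Apar J n)
           + jost_sol J n z ** (Bpar J n - (z + inverse z) *\<^sub>m mat 1)
           + jost_sol J (n - 1) z ** Apar J (n - 1) = 0) \<and>
        ((\<lambda>z. jost_sol J (n + 1) z ** adj (Apar J n)
           + jost_sol J n z ** (Bpar J n - (z + inverse z) *\<^sub>m mat 1)
           + jost_sol J (n - 1) z ** Apar J (n - 1)) \<longlongrightarrow> 0) (at 0))
     \<and>
     \<comment> \<open>(ii)\<close>
     (\<forall>z\<in>S. (\<lambda>n. if z = 0 then jost_sol_scaled J n 0 else inverse z ^ n *\<^sub>m jost_sol J n z)
        \<longlonglongrightarrow> mat 1)
     \<and>
     \<comment> \<open>(iii)\<close>
     ((\<forall>z\<in>M_dom J - {0}.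
         jost (jshift 1 J) z = inverse z *\<^sub>m (jost J z ** M_fun J z ** Apar J 1)) \<and>
      (\<forall>z\<in>ball 0 1.
         ((\<lambda>w. inverse w *\<^sub>m (jost J w ** M_fun J w ** Apar J 1)) \<longlongrightarrow> jost (jshift 1 J) z) (at z)))
     \<and>
     \<comment> \<open>(iv)\<close>
     ((\<forall>z\<in>ball 0 1. zero_mat S (jost J) z \<longleftrightarrow> z \<in> eigen_points J) \<and>
      (\<forall>z\<in>ball 0 1. zero_mat S (jost J) z \<longrightarrow> simple_zero_mat S (jost J) z) \<and>
      (\<forall>z\<in>eigen_points J.
         zorder (\<lambda>w. det (jost J w)) z = int (eigen_multiplicity J (z + inverse z)) \<and>
         ker_mat (jost J z) = ran_mat (\<mu> {Re (z + inverse z)}) \<and>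
         ker_mat (jost J z) = ran_mat (w_tilde J z)))
     \<and>
     \<comment> \<open>(v)\<close>
     (\<forall>z\<in>sphere 0 1.
        zero_mat S (jost J) z \<or> (z \<in> S \<and> \<not> invertible (jost J z)) \<longrightarrow>
        (z = 1 \<or> z = -1) \<and> simple_zero_mat S (jost J) z)
     \<and>
     \<comment> \<open>(vi)\<close>
     (\<exists>Mc :: complex \<Rightarrow> complex^'l^'l.
        (\<forall>z\<in>M_dom J. Mc z = M_fun J z) \<and>
        continuous_on (M_dom J \<union> (sphere 0 1 - {1, -1})) Mc \<and>
        (\<forall>z\<in>sphere 0 1 - {1, -1}. invertible (Mc z)) \<and>
        (\<forall>\<theta>::real. cis \<theta> \<noteq> 1 \<and> cis \<theta> \<noteq> -1 \<longrightarrow>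
           invertible (adj (jost J (cis \<theta>)) ** jost J (cis \<theta>)) \<and>
           Im_mat (Mc (cis \<theta>)) =
             complex_of_real (sin \<theta>) *\<^sub>m matrix_inv (adj (jost J (cis \<theta>)) ** jost J (cis \<theta>))))
     \<and>
     \<comment> \<open>(vii)\<close>
     ((\<forall>z\<in>S - {0}.
         jost (jshift 2 J) z =
           inverse z *\<^sub>m (jost (jshift 1 J) z ** matrix_inv (Apar J 1)
             ** ((z + inverse z) *\<^sub>m mat 1 - Bpar J 1)
             ** matrix_inv (adj (Apar J 1)) ** Apar J 2)
           - inverse (z\<^sup>2) *\<^sub>m (jost J z ** matrix_inv (adj (Apar J 1)) ** Apar J 2)) \<and>
      ((\<lambda>z. inverse z *\<^sub>m (jost (jshift 1 J) z ** matrix_inv (Apar J 1)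
             ** ((z + inverse z) *\<^sub>m mat 1 - Bpar J 1)
             ** matrix_inv (adj (Apar J 1)) ** Apar J 2)
           - inverse (z\<^sup>2) *\<^sub>m (jost J z ** matrix_inv (adj (Apar J 1)) ** Apar J 2))
         \<longlongrightarrow> jost (jshift 2 J) 0) (at 0))
     \<and>
     (\<forall>R. cond_A3 J R \<longrightarrow>
        \<comment> \<open>(viii)\<close>
        (\<exists>Mx :: complex \<Rightarrow> complex^'l^'l.
           (\<forall>i j. (\<lambda>z. Mx z $ i $ j) meromorphic_on ball 0 R) \<and>
           (\<forall>z\<in>M_dom J. Mx z = M_fun J z) \<and>
           (\<forall>z. inverse R < norm z \<and> norm z < R \<longrightarrow>
              (invertible (sharp (jost J) z ** jost J z) \<longrightarrow>
                 Mx z = sharp Mx z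
                   + (z - inverse z) *\<^sub>m matrix_inv (sharp (jost J) z ** jost J z)) \<and>
              (\<forall>\<^sub>F w in at z. invertible (sharp (jost J) w ** jost J w) \<and>
                 Mx w = sharp Mx w
                   + (w - inverse w) *\<^sub>m matrix_inv (sharp (jost J) w ** jost J w)))) \<and>
        \<comment> \<open>(ix)\<close>
        (\<forall>z\<in>eigen_points J. inverse R < norm z \<longrightarrow>
           w_tilde J z ** adj (jost J (inverse (cnj z)))
             = - (z - inverse z) *\<^sub>m residue_mat (\<lambda>w. matrix_inv (jost J w)) z \<and>
           ker_mat (adj (jost J (inverse (cnj z))))
             \<subseteq> ker_mat (residue_mat (\<lambda>w. matrix_inv (jost J w)) z) \<and>
           ker_mat (residue_mat (\<lambda>w. matrix_inv (jost J w)) z) = ran_mat (jost J z)))"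
proof -
  \<comment> \<open>Each of the three conditions implies summability, so a single locale covers all
    regions.\<close>
  have "cond_A1 J"
    using assms(4) cond_A2_imp_A1 cond_A3_imp_A2 unfolding appropriate_region_def by blast
  then interpret jacobi_asymptotic J using assms(1,2) by unfold_locales
  note S = assms(4) and sp = assms(3)
  note ball = ball_subset_region[OF S]
  show ?thesis
  proof (intro conjI)
    show "\<forall>n\<ge>1.
        (\<forall>z\<in>S - {0}.
           jost_sol J (n + 1) z ** adj (Apar J n)
           + jost_sol J n z ** (Bpar J n - (z + inverse z) *\<^sub>m mat 1)
           + jost_sol J (n - 1) z ** Apar J (n - 1) = 0) \<and>
        ((\<lambda>z. jost_sol J (n + 1) z ** adj (Apar J n)
           + jost_sol J n z ** (Bpar J n - (z + inverse z) *\<^sub>m mat 1)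
           + jost_sol J (n - 1) z ** Apar J (n - 1)) \<longlongrightarrow> 0) (at 0)"
      using recurrence_limit[OF S] by blast
    show "\<forall>z\<in>S. (\<lambda>n. if z = 0 then jost_sol_scaled J n 0 else inverse z ^ n *\<^sub>m jost_sol J n z)
        \<longlonglongrightarrow> mat 1"
      using scaled_limit region_regular[OF S] by blast
    show "\<forall>z\<in>M_dom J - {0}.
         jost (jshift 1 J) z = inverse z *\<^sub>m (jost J z ** M_fun J z ** Apar J 1)"
      using jost_shift_1 by (simp add: M_dom_iff)
    show "\<forall>z\<in>ball 0 1.
         ((\<lambda>w. inverse w *\<^sub>m (jost J w ** M_fun J w ** Apar J 1)) \<longlongrightarrow> jost (jshift 1 J) z) (at z)"
      using jost_shift_1_limit by simp
    show "\<forall>z\<in>ball 0 1. zero_mat S (jost J) z \<longleftrightarrow> z \<in> eigen_points J"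
      using zero_mat_interior(1)[OF S] by (simp add: eigen_points_eq)
    show "\<forall>z\<in>ball 0 1. zero_mat S (jost J) z \<longrightarrow> simple_zero_mat S (jost J) z"
      using zero_mat_interior(2)[OF S] by simp
    show "\<forall>z\<in>eigen_points J.
         zorder (\<lambda>w. det (jost J w)) z = int (eigen_multiplicity J (z + inverse z)) \<and>
         ker_mat (jost J z) = ran_mat (\<mu> {Re (z + inverse z)}) \<and>
         ker_mat (jost J z) = ran_mat (w_tilde J z)"
      using eigen_point_facts[OF sp] by blast
    show "\<forall>z\<in>sphere 0 1.
        zero_mat S (jost J) z \<or> (z \<in> S \<and> \<not> invertible (jost J z)) \<longrightarrow>
        (z = 1 \<or> z = -1) \<and> simple_zero_mat S (jost J) z"
      using zero_mat_circle[OF S sp] by simp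
    show "\<exists>Mc :: complex \<Rightarrow> complex^'l^'l.
        (\<forall>z\<in>M_dom J. Mc z = M_fun J z) \<and>
        continuous_on (M_dom J \<union> (sphere 0 1 - {1, -1})) Mc \<and>
        (\<forall>z\<in>sphere 0 1 - {1, -1}. invertible (Mc z)) \<and>
        (\<forall>\<theta>::real. cis \<theta> \<noteq> 1 \<and> cis \<theta> \<noteq> -1 \<longrightarrow>
           invertible (adj (jost J (cis \<theta>)) ** jost J (cis \<theta>)) \<and>
           Im_mat (Mc (cis \<theta>)) =
             complex_of_real (sin \<theta>) *\<^sub>m matrix_inv (adj (jost J (cis \<theta>)) ** jost J (cis \<theta>)))"
    proof (intro exI[of _ Mx] conjI ballI allI impI)
      fix \<theta> :: real
      assume "cis \<theta> \<noteq> 1 \<and> cis \<theta> \<noteq> -1"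
      thus "invertible (adj (jost J (cis \<theta>)) ** jost J (cis \<theta>))"
        "Im_mat (Mx (cis \<theta>)) =
          complex_of_real (sin \<theta>) *\<^sub>m matrix_inv (adj (jost J (cis \<theta>)) ** jost J (cis \<theta>))"
        using circle_invertible(1)[of "cis \<theta>"] circle_Im[of "cis \<theta>"]
        by (simp_all add: invertible_mat_mult_iff)
    qed (use Mx_boundary in auto)
    have shift_2: "jost (jshift 2 J) z =
        inverse z *\<^sub>m (jost (jshift 1 J) z ** matrix_inv (Apar J 1)
          ** ((z + inverse z) *\<^sub>m mat 1 - Bpar J 1) ** matrix_inv (adj (Apar J 1)) ** Apar J 2)
        - inverse (z\<^sup>2) *\<^sub>m (jost J z ** matrix_inv (adj (Apar J 1)) ** Apar J 2)"
      if "z \<in> S - {0}" for z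
      using jost_shift_2 region_regular[OF S] that by blast
    thus "\<forall>z\<in>S - {0}.
         jost (jshift 2 J) z =
           inverse z *\<^sub>m (jost (jshift 1 J) z ** matrix_inv (Apar J 1)
             ** ((z + inverse z) *\<^sub>m mat 1 - Bpar J 1)
             ** matrix_inv (adj (Apar J 1)) ** Apar J 2)
           - inverse (z\<^sup>2) *\<^sub>m (jost J z ** matrix_inv (adj (Apar J 1)) ** Apar J 2)"
      by blast
    show "((\<lambda>z. inverse z *\<^sub>m (jost (jshift 1 J) z ** matrix_inv (Apar J 1)
             ** ((z + inverse z) *\<^sub>m mat 1 - Bpar J 1)
             ** matrix_inv (adj (Apar J 1)) ** Apar J 2)
           - inverse (z\<^sup>2) *\<^sub>m (jost J z ** matrix_inv (adj (Apar J 1)) ** Apar J 2))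
         \<longlongrightarrow> jost (jshift 2 J) 0) (at 0)"
    proof (rule Lim_transform_eventually[OF jost_tendsto_ball])
      show "\<forall>\<^sub>F z in at 0. jost (jshift 2 J) z =
          inverse z *\<^sub>m (jost (jshift 1 J) z ** matrix_inv (Apar J 1)
            ** ((z + inverse z) *\<^sub>m mat 1 - Bpar J 1) ** matrix_inv (adj (Apar J 1)) ** Apar J 2)
          - inverse (z\<^sup>2) *\<^sub>m (jost J z ** matrix_inv (adj (Apar J 1)) ** Apar J 2)"
        \<comment> \<open>The relation holds on a punctured disk, so continuity of the left side
          gives the removable value at 0.\<close>
        using eventually_near_0 by eventually_elim (rule shift_2, use ball in auto)
    qed simp
    show "\<forall>R. cond_A3 J R \<longrightarrow>
        (\<exists>Mx :: complex \<Rightarrow> complex^'l^'l.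
           (\<forall>i j. (\<lambda>z. Mx z $ i $ j) meromorphic_on ball 0 R) \<and>
           (\<forall>z\<in>M_dom J. Mx z = M_fun J z) \<and>
           (\<forall>z. inverse R < norm z \<and> norm z < R \<longrightarrow>
              (invertible (sharp (jost J) z ** jost J z) \<longrightarrow>
                 Mx z = sharp Mx z
                   + (z - inverse z) *\<^sub>m matrix_inv (sharp (jost J) z ** jost J z)) \<and>
              (\<forall>\<^sub>F w in at z. invertible (sharp (jost J) w ** jost J w) \<and>
                 Mx w = sharp Mx w
                   + (w - inverse w) *\<^sub>m matrix_inv (sharp (jost J) w ** jost J w)))) \<and>
        (\<forall>z\<in>eigen_points J. inverse R < norm z \<longrightarrow>
           w_tilde J z ** adj (jost J (inverse (cnj z)))
             = - (z - inverse z) *\<^sub>m residue_mat (\<lambda>w. matrix_inv (jost J w)) z \<and>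
           ker_mat (adj (jost J (inverse (cnj z))))
             \<subseteq> ker_mat (residue_mat (\<lambda>w. matrix_inv (jost J w)) z) \<and>
           ker_mat (residue_mat (\<lambda>w. matrix_inv (jost J w)) z) = ran_mat (jost J z))"
      using Mx_meromorphic Mx_boundary(2) Mx_sharp eventually_Mx_sharp residue_identities
      by (intro allI impI conjI exI[of _ Mx] ballI) blast+
  qed
qed

end
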